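(* Assume $\mathfrak{b}=\omega_1$. Let $X$ be a stratifiable $k$-space with a compact-countable $k$-network. If $A_3(X)$ is a $k_R$-space, then $A_3(X)$ is a $k$-space.
   Context: All spaces are assumed to be Tychonoff. For a non-empty Tychonoff space $X$, $A(X)$ is the free Abelian topological group over $X$: an Abelian topological group with a continuous map $i:X\to A(X)$ such that $i(X)$ algebraically generates $A(X)$ and every continuous map $f:X\to G$ to an Abelian topological group $G$ has the form $f=\overline{f}\circ i$ for some continuous homomorphism $\overline{f}:A(X)\to G$; $X$ is identified with $i(X)$, and is a free algebraic basis of $A(X)$. Each non-zero $g\in A(X)$ is uniquely $r_1x_1+\cdots+r_kx_k$ with $x_i\in X$ distinct and $r_i\in\mathbb{Z}\setminus\{0\}$; its reduced length is $\sum|r_i|$, and $0$ has reduced length $0$. $A_n(X)$ is the subspace of $A(X)$ of all elements of reduced length at most $n$. A space $X$ is a $k$-space if a subset $C\subseteq X$ is closed whenever $C\cap K$ is closed in $K$ for every compact $K\subseteq X$. $X$ is a $k_R$-space if $X$ is Tychonoff and every $f:X\to\mathbb{R}$ whose restriction to each compact subset is continuous is continuous. $X$ is stratifiable if to each open $U\subseteq X$ one can assign a sequence $\{U_n\}_{n=1}^\infty$ of open subsets of $X$ such that (a) $\overline{U_n}\subseteq U$; (b) $\bigcup_{n}U_n=U$; (c) $U_n\subseteq V_n$ for all $n$ whenever $U\subseteq V$. A family $\mathscr{P}$ of subsets of $X$ is a $k$-network if for every compact $K$ and every open $U\supseteq K$ there is a finite $\mathscr{P}'\subseteq\mathscr{P}$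 with $K\subseteq\bigcup\mathscr{P}'\subseteq U$. It is compact-countable if each compact subset of $X$ meets at most countably many of its members. $\mathfrak{b}$ is the smallest cardinality of a family $\mathscr{H}\subseteq{}^\omega\omega$ that is unbounded, i.e. such that there is no $g\in{}^\omega\omega$ with, for every $f\in\mathscr{H}$, $f(n)\le g(n)$ for all but finitely many $n$. *)

theory Defs
  imports "HOL-Analysis.Analysis" "HOL-Algebra.Free_Abelian_Groups"
begin

section \<open>Topological spaces\<close>

definition tychonoff_space :: "'a topology \<Rightarrow> bool" where
  "tychonoff_space X \<longleftrightarrow> completely_regular_space X \<and> Hausdorff_space X"

definition kR_space :: "'a topology \<Rightarrow> bool" where
  "kR_space X \<longleftrightarrow> tychonoff_space X \<and>
     (\<forall>f::'a \<Rightarrow> real.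
        (\<forall>K. compactin X K \<longrightarrow> continuous_map (subtopology X K) euclideanreal f)
        \<longrightarrow> continuous_map X euclideanreal f)"

text \<open>The sequence assigned to an open set \<open>U\<close> is indexed from \<open>0\<close> instead of \<open>1\<close>.\<close>

definition stratifiable_space :: "'a topology \<Rightarrow> bool" where
  "stratifiable_space X \<longleftrightarrow>
     (\<exists>S :: 'a set \<Rightarrow> nat \<Rightarrow> 'a set.
        (\<forall>U n. openin X U \<longrightarrow> openin X (S U n) \<and> X closure_of (S U n) \<subseteq> U) \<and>
        (\<forall>U. openin X U \<longrightarrow> (\<Union>n. S U n) = U) \<and>
        (\<forall>U V n. openin X U \<longrightarrow> openin X V \<longrightarrow> U \<subseteq> V \<longrightarrow> S U n \<subseteq> S V n))"

definition k_network :: "'a topology \<Rightarrow> 'a set set \<Rightarrow> bool" where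
  "k_network X \<P> \<longleftrightarrow> \<P> \<subseteq> Pow (topspace X) \<and>
     (\<forall>K U. compactin X K \<longrightarrow> openin X U \<longrightarrow> K \<subseteq> U
        \<longrightarrow> (\<exists>\<F>. finite \<F> \<and> \<F> \<subseteq> \<P> \<and> K \<subseteq> \<Union>\<F> \<and> \<Union>\<F> \<subseteq> U))"

definition compact_countable :: "'a topology \<Rightarrow> 'a set set \<Rightarrow> bool" where
  "compact_countable X \<P> \<longleftrightarrow> (\<forall>K. compactin X K \<longrightarrow> countable {P \<in> \<P>. P \<inter> K \<noteq> {}})"


section \<open>The cardinal \<open>\<bb>\<close>\<close>

unbundle cardinal_syntax

definition unbounded_family :: "(nat \<Rightarrow> nat) set \<Rightarrow> bool" where
  "unbounded_family H \<longleftrightarrow> (\<nexists>g. \<forall>f\<in>H. \<forall>\<^sub>\<infinity>n. f n \<le> g n)"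

definition bounding_number :: "(nat \<Rightarrow> nat) rel" where
  "bounding_number =
     card_of (SOME H. unbounded_family H \<and> (\<forall>H'. unbounded_family H' \<longrightarrow> |H| \<le>o |H'| ))"

lemma bounding_number_attained:
  "\<exists>H. unbounded_family H \<and> bounding_number = |H| \<and> (\<forall>H'. unbounded_family H' \<longrightarrow> |H| \<le>o |H'| )"
proof -
  have "\<not> (\<forall>\<^sub>\<infinity>n. Suc (g n) \<le> g n)" for g :: "nat \<Rightarrow> nat"
    by simp
  then have "unbounded_family UNIV"
    unfolding unbounded_family_def by (metis UNIV_I)
  then have ne: "{|H| |H. unbounded_family H} \<noteq> {}"
    by blast
  have wo: "\<forall>r\<in>{|H| |H. unbounded_family H}. Well_order r"
    using card_of_Well_order by blast
  obtain r where r: "r \<in> {|H| |H. unbounded_family H}"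
      "\<forall>r'\<in>{|H| |H. unbounded_family H}. r \<le>o r'"
    using exists_minim_Well_order[OF ne wo] by blast
  then have "\<exists>H. unbounded_family H \<and> (\<forall>H'. unbounded_family H' \<longrightarrow> |H| \<le>o |H'| )"
    by blast
  from someI_ex[OF this] show ?thesis
    unfolding bounding_number_def by blast
qed


section \<open>Free Abelian topological groups\<close>

text \<open>Following the convention that all spaces are Tychonoff, topological groups are Tychonoff.
  The group operation is written multiplicatively, as in the group library.\<close>

definition abelian_topological_group :: "'g monoid \<Rightarrow> 'g topology \<Rightarrow> bool" where
  "abelian_topological_group G T \<longleftrightarrow>
     comm_group G \<and> topspace T = carrier G \<and> tychonoff_space T \<and>
     continuous_map (prod_topology T T) T (\<lambda>(x, y). x \<otimes>\<^bsub>G\<^esub> y) \<and>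
     continuous_map T T (\<lambda>x. inv\<^bsub>G\<^esub> x)"

text \<open>A definition cannot quantify over the type of the test group \<open>H\<close>. The universal property is
  therefore stated for groups whose elements have type \<open>'a \<Rightarrow>\<^sub>0 int\<close>. This loses nothing: only
  the subgroup of \<open>H\<close> generated by the image of \<open>X\<close> matters, and that subgroup is a quotient of the
  algebraic free Abelian group on \<open>X\<close>. The lemma \<open>free_abelian_universal\<close> below gives the
  universal property for groups over arbitrary types.\<close>

definition free_abelian_topological_group ::
    "'a topology \<Rightarrow> 'g monoid \<Rightarrow> 'g topology \<Rightarrow> ('a \<Rightarrow> 'g) \<Rightarrow> bool" where
  "free_abelian_topological_group X A T i \<longleftrightarrow>
     abelian_topological_group A T \<and>
     continuous_map X T i \<and>
     generate A (i ` topspace X) = carrier A \<and>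
     (\<forall>(H :: ('a \<Rightarrow>\<^sub>0 int) monoid) T' f.
        abelian_topological_group H T' \<longrightarrow> continuous_map X T' f \<longrightarrow>
        (\<exists>h \<in> hom A H. continuous_map T T' h \<and> (\<forall>x\<in>topspace X. f x = h (i x))))"

text \<open>The element \<open>r\<^sub>1 x\<^sub>1 + \<dots> + r\<^sub>k x\<^sub>k\<close> of \<open>A(X)\<close> is \<open>free_abelian_eval A i c\<close>, where \<open>c\<close> is the
  finitely supported function with \<open>c x\<^sub>j = r\<^sub>j\<close>. The identification of \<open>X\<close> with its image \<open>i(X)\<close>
  is made explicit.\<close>

definition free_abelian_eval :: "'g monoid \<Rightarrow> ('a \<Rightarrow> 'g) \<Rightarrow> ('a \<Rightarrow>\<^sub>0 int) \<Rightarrow> 'g" where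
  "free_abelian_eval A i c =
     finprod A (\<lambda>x. i x [^]\<^bsub>A\<^esub> Poly_Mapping.lookup c x) (Poly_Mapping.keys c)"

text \<open>The description is proper by the lemma \<open>free_abelian_eval_unique\<close> below.\<close>

definition reduced_length :: "'a topology \<Rightarrow> 'g monoid \<Rightarrow> ('a \<Rightarrow> 'g) \<Rightarrow> 'g \<Rightarrow> nat" where
  "reduced_length X A i g =
     (THE n. \<exists>c. Poly_Mapping.keys c \<subseteq> topspace X \<and> g = free_abelian_eval A i c \<and>
                 n = (\<Sum>x\<in>Poly_Mapping.keys c. nat \<bar>Poly_Mapping.lookup c x\<bar>))"

definition free_abelian_level ::
    "nat \<Rightarrow> 'a topology \<Rightarrow> 'g monoid \<Rightarrow> 'g topology \<Rightarrow> ('a \<Rightarrow> 'g) \<Rightarrow> 'g topology" where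
  "free_abelian_level n X A T i = subtopology T {g \<in> carrier A. reduced_length X A i g \<le> n}"


subsection \<open>Justification of the encoding\<close>

lemma tychonoff_pullback:
  assumes Y: "tychonoff_space Y" and inj: "inj_on h D" and hD: "h ` D \<subseteq> topspace Y"
  shows "tychonoff_space (pullback_topology D h Y)"
proof -
  let ?P = "pullback_topology D h Y"
  have top: "topspace ?P = D"
    using hD by (auto simp: topspace_pullback_topology)
  have ch: "continuous_map ?P Y h"
    using continuous_map_pullback[OF continuous_map_id, of D h Y] by simp
  have "continuous_map (subtopology Y (h ` D)) ?P (inv_into D h)"
  proof (rule continuous_map_pullback')
    show "continuous_map (subtopology Y (h ` D)) Y (h \<circ> inv_into D h)"
      by (rule continuous_map_eq[OF continuous_map_from_subtopology[OF continuous_map_id]])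
        (auto simp: f_inv_into_f)
    show "topspace (subtopology Y (h ` D)) \<subseteq> inv_into D h -` D"
      by (auto simp: inv_into_into)
  qed
  then have "homeomorphic_maps ?P (subtopology Y (h ` D)) h (inv_into D h)"
    using ch inj hD top
    by (auto simp: homeomorphic_maps_def continuous_map_in_subtopology f_inv_into_f)
  then have hs: "?P homeomorphic_space subtopology Y (h ` D)"
    unfolding homeomorphic_space_def by blast
  then show ?thesis
    using Y homeomorphic_completely_regular_space[OF hs] homeomorphic_Hausdorff_space[OF hs]
    by (simp add: tychonoff_space_def completely_regular_space_subtopology Hausdorff_space_subtopology)
qed

lemma free_abelian_universal:
  fixes X :: "'a topology" and A :: "'g monoid" and H :: "'h monoid"
  assumes free: "free_abelian_topological_group X A T i"
    and H: "abelian_topological_group H T'" and f: "continuous_map X T' f"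
  shows "\<exists>h \<in> hom A H. continuous_map T T' h \<and> (\<forall>x\<in>topspace X. f x = h (i x))"
proof -
  interpret H: comm_group H
    using H by (simp add: abelian_topological_group_def)
  have topH: "topspace T' = carrier H"
    using H by (simp add: abelian_topological_group_def)
  have fim: "f ` topspace X \<subseteq> carrier H"
    using f topH by (auto simp: continuous_map_def)
  define F where "F = free_Abelian_group (topspace X)"
  obtain p where p: "p \<in> hom F H" and pf: "\<And>x. x \<in> topspace X \<Longrightarrow> p (frag_of x) = f x"
    using H.free_Abelian_group_universal[OF fim] unfolding F_def by blast
  interpret F: comm_group F
    unfolding F_def by (rule abelian_free_Abelian_group)
  interpret p: group_hom F H p
    using p by unfold_locales
  define K where "K = p ` carrier F"
  have K: "subgroup K H"
    unfolding K_def by (rule p.img_is_subgroup)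
  have KH: "K \<subseteq> carrier H"
    using K by (rule subgroup.subset)
  define j where "j = inv_into (carrier F) p"
  have pj: "p (j k) = k" if "k \<in> K" for k
    using that unfolding K_def j_def by (rule f_inv_into_f)
  define D where "D = j ` K"
  have pD: "p d \<in> K" and jp: "j (p d) = d" if "d \<in> D" for d
    using that pj by (auto simp: D_def)
  have inj: "inj_on p D"
    by (metis inj_onI jp)
  have jD: "j k \<in> D" if "k \<in> K" for k
    using that by (simp add: D_def)
  define H' where "H' = \<lparr>carrier = D, monoid.mult = (\<lambda>u v. j (p u \<otimes>\<^bsub>H\<^esub> p v)), one = j \<one>\<^bsub>H\<^esub>\<rparr>"
  define S where "S = pullback_topology D p T'"
  have cl: "\<And>u v. u \<in> K \<Longrightarrow> v \<in> K \<Longrightarrow> u \<otimes>\<^bsub>H\<^esub> v \<in> K" "\<one>\<^bsub>H\<^esub> \<in> K"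
      "\<And>u. u \<in> K \<Longrightarrow> inv\<^bsub>H\<^esub> u \<in> K"
    using K by (auto simp: subgroup.m_closed subgroup.one_closed subgroup.m_inv_closed)
  have pK: "p d \<in> carrier H" if "d \<in> D" for d
    using that pD KH by blast
  have H'grp: "comm_group H'"
  proof (rule comm_groupI)
    fix x assume "x \<in> carrier H'"
    then have "j (inv\<^bsub>H\<^esub> p x) \<in> carrier H'" "j (inv\<^bsub>H\<^esub> p x) \<otimes>\<^bsub>H'\<^esub> x = \<one>\<^bsub>H'\<^esub>"
      using pD pK by (auto simp: H'_def jD cl pj)
    then show "\<exists>y\<in>carrier H'. y \<otimes>\<^bsub>H'\<^esub> x = \<one>\<^bsub>H'\<^esub>"
      by blast
  next
    fix x y z assume "x \<in> carrier H'" "y \<in> carrier H'" "z \<in> carrier H'"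
    then show "x \<otimes>\<^bsub>H'\<^esub> y \<otimes>\<^bsub>H'\<^esub> z = x \<otimes>\<^bsub>H'\<^esub> (y \<otimes>\<^bsub>H'\<^esub> z)"
      using pD pK by (simp add: H'_def cl pj H.m_assoc)
  next
    fix x y assume "x \<in> carrier H'" "y \<in> carrier H'"
    then show "x \<otimes>\<^bsub>H'\<^esub> y = y \<otimes>\<^bsub>H'\<^esub> x"
      using pK by (simp add: H'_def H.m_comm)
  qed (use pD pK jp in \<open>auto simp: H'_def jD cl pj\<close>)
  interpret H': comm_group H' by fact
  have invH': "inv\<^bsub>H'\<^esub> x = j (inv\<^bsub>H\<^esub> p x)" if "x \<in> D" for x
    by (rule H'.inv_equality) (use that pD pK in \<open>auto simp: H'_def jD cl pj\<close>)
  have topS: "topspace S = D"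
    using pK by (auto simp: S_def topspace_pullback_topology topH)
  have cp: "continuous_map S T' p"
    using continuous_map_pullback[OF continuous_map_id, of D p T'] by (simp add: S_def)
  have "abelian_topological_group H' S"
    unfolding abelian_topological_group_def
  proof (intro conjI)
    show "topspace S = carrier H'"
      by (simp add: topS H'_def)
    show "tychonoff_space S"
      unfolding S_def using H pK topH
      by (intro tychonoff_pullback inj) (auto simp: abelian_topological_group_def)
    have "continuous_map (prod_topology S S) T' ((\<lambda>(x, y). x \<otimes>\<^bsub>H\<^esub> y) \<circ> (\<lambda>(x, y). (p x, p y)))"
      by (rule continuous_map_compose[where X' = "prod_topology T' T'"])
        (use H cp in \<open>auto simp: abelian_topological_group_def continuous_map_prod_top\<close>)
    then have "continuous_map (prod_topology S S) T' (p \<circ> (\<lambda>(x, y). x \<otimes>\<^bsub>H'\<^esub> y))"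
      by (rule continuous_map_eq) (auto simp: topS H'_def pj cl pD)
    then show "continuous_map (prod_topology S S) S (\<lambda>(x, y). x \<otimes>\<^bsub>H'\<^esub> y)"
      unfolding S_def
      by (rule continuous_map_pullback')
        (use jD cl pD in \<open>auto simp: S_def[symmetric] topS H'_def\<close>)
    have "continuous_map S T' ((\<lambda>x. inv\<^bsub>H\<^esub> x) \<circ> p)"
      by (rule continuous_map_compose[OF cp])
        (use H in \<open>auto simp: abelian_topological_group_def\<close>)
    then have "continuous_map S T' (p \<circ> (\<lambda>x. inv\<^bsub>H'\<^esub> x))"
      by (rule continuous_map_eq) (auto simp: topS invH' pj cl pD)
    then show "continuous_map S S (\<lambda>x. inv\<^bsub>H'\<^esub> x)"
      unfolding S_def
      by (rule continuous_map_pullback')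
        (use jD cl pD in \<open>auto simp: S_def[symmetric] topS invH'\<close>)
  qed fact
  moreover
  have fK: "f x \<in> K" if "x \<in> topspace X" for x
  proof -
    have "frag_of x \<in> carrier F"
      using that by (simp add: F_def)
    then show ?thesis
      using pf[OF that] unfolding K_def by force
  qed
  have "continuous_map X S (j \<circ> f)"
    unfolding S_def
  proof (rule continuous_map_pullback')
    show "continuous_map X T' (p \<circ> (j \<circ> f))"
      by (rule continuous_map_eq[OF f]) (simp add: pj fK)
    show "topspace X \<subseteq> (j \<circ> f) -` D"
      by (auto simp: jD fK)
  qed
  ultimately obtain h where h: "h \<in> hom A H'" and ch: "continuous_map T S h"
      and hi: "\<forall>x\<in>topspace X. (j \<circ> f) x = h (i x)"
    using free unfolding free_abelian_topological_group_def by blast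
  show ?thesis
  proof (intro bexI conjI)
    show "continuous_map T T' (p \<circ> h)"
      using ch cp by (rule continuous_map_compose)
    show "\<forall>x\<in>topspace X. f x = (p \<circ> h) (i x)"
      using hi fK pj by (metis comp_apply)
    have hD: "h x \<in> D" if "x \<in> carrier A" for x
      using h that by (auto simp: hom_def H'_def)
    show "p \<circ> h \<in> hom A H"
    proof (rule homI)
      fix x y assume xy: "x \<in> carrier A" "y \<in> carrier A"
      show "(p \<circ> h) x \<in> carrier H"
        using hD pK xy by simp
      have "h (x \<otimes>\<^bsub>A\<^esub> y) = j (p (h x) \<otimes>\<^bsub>H\<^esub> p (h y))"
        using h xy by (simp add: hom_mult H'_def)
      then show "(p \<circ> h) (x \<otimes>\<^bsub>A\<^esub> y) = (p \<circ> h) x \<otimes>\<^bsub>H\<^esub> (p \<circ> h) y"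
        using hD pD cl pj xy by simp
    qed
  qed
qed

lemma hom_free_abelian_eval:
  assumes A: "comm_group A" and B: "comm_group B" and h: "h \<in> hom A B"
    and i: "\<And>x. x \<in> Poly_Mapping.keys c \<Longrightarrow> i x \<in> carrier A"
  shows "h (free_abelian_eval A i c) = free_abelian_eval B (h \<circ> i) c"
proof -
  interpret A: comm_group A by fact
  interpret B: comm_group B by fact
  interpret h: group_hom A B h using h by unfold_locales
  have "h (finprod A (\<lambda>x. i x [^]\<^bsub>A\<^esub> r x) S) = finprod B (\<lambda>x. h (i x) [^]\<^bsub>B\<^esub> r x) S"
    if "finite S" "\<forall>x\<in>S. i x \<in> carrier A" for S and r :: "'c \<Rightarrow> int"
    using that
  proof (induction S rule: finite_induct)
    case empty
    then show ?case by simp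
  next
    case (insert x S)
    then show ?case
      by (subst A.finprod_insert B.finprod_insert; auto simp: Pi_def h.hom_int_pow)+
  qed
  then show ?thesis
    using i by (simp add: free_abelian_eval_def)
qed

lemma free_abelian_eval_frag_of:
  assumes "Poly_Mapping.keys c \<subseteq> S"
  shows "free_abelian_eval (free_Abelian_group S) frag_of c = c"
proof -
  interpret F: comm_group "free_Abelian_group S" by (rule abelian_free_Abelian_group)
  have "finprod (free_Abelian_group S) (\<lambda>x. frag_of x [^]\<^bsub>free_Abelian_group S\<^esub> r x) Q
      = (\<Sum>x\<in>Q. frag_cmul (r x) (frag_of x))"
    if "finite Q" "Q \<subseteq> S" for Q and r :: "'a \<Rightarrow> int"
    using that
  proof (induction Q rule: finite_induct)
    case empty
    then show ?case by simp
  next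
    case (insert x Q)
    have "(\<lambda>x. frag_of x [^]\<^bsub>free_Abelian_group S\<^esub> r x) \<in> Q \<rightarrow> carrier (free_Abelian_group S)"
      using insert.prems by (auto intro!: F.int_pow_closed)
    moreover have "frag_of x [^]\<^bsub>free_Abelian_group S\<^esub> r x \<in> carrier (free_Abelian_group S)"
      using insert.prems by (auto intro!: F.int_pow_closed)
    ultimately show ?case
      using insert by (subst F.finprod_insert) auto
  qed
  from this[OF finite_keys assms] show ?thesis
    unfolding free_abelian_eval_def by (simp flip: frag_expansion frag_extend_def)
qed

definition real_additive_group :: "real monoid" where
  "real_additive_group = \<lparr>carrier = UNIV, monoid.mult = (+), one = 0\<rparr>"

lemma comm_group_real: "comm_group real_additive_group"
  by (rule comm_groupI)
    (auto simp: real_additive_group_def intro: exI[where x = "- x" for x :: real])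

lemma abelian_topological_group_real:
  "abelian_topological_group real_additive_group euclideanreal"
proof -
  interpret comm_group real_additive_group by (rule comm_group_real)
  have inv: "inv\<^bsub>real_additive_group\<^esub> x = - x" for x
    by (rule inv_equality) (auto simp: real_additive_group_def)
  have "completely_regular_space euclideanreal"
    by (intro metrizable_imp_completely_regular_space metrizable_space_euclidean)
  then show ?thesis
    unfolding abelian_topological_group_def tychonoff_space_def inv
    using comm_group_real
    by (auto simp: real_additive_group_def case_prod_unfold Hausdorff_space_euclidean
        intro!: continuous_on_add continuous_on_fst continuous_on_snd continuous_on_id)
qed

lemma free_abelian_eval_real:
  "free_abelian_eval real_additive_group f c =
    (\<Sum>x\<in>Poly_Mapping.keys c. of_int (Poly_Mapping.lookup c x) * f x)"
proof -
  interpret R: comm_group real_additive_group by (rule comm_group_real)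
  have inv: "inv\<^bsub>real_additive_group\<^esub> x = - x" for x
    by (rule R.inv_equality) (auto simp: real_additive_group_def)
  have np: "y [^]\<^bsub>real_additive_group\<^esub> n = of_nat n * y" for y :: real and n :: nat
    by (induction n) (auto simp: real_additive_group_def nat_pow_def algebra_simps)
  have ip: "y [^]\<^bsub>real_additive_group\<^esub> k = of_int k * y" for y :: real and k :: int
    by (auto simp: int_pow_def2 np inv)
  have "finprod real_additive_group g Q = (\<Sum>x\<in>Q. g x)" if "finite Q"
    for Q and g :: "'a \<Rightarrow> real"
    using that
    by (induction Q rule: finite_induct)
      (auto simp: real_additive_group_def R.finprod_insert[unfolded real_additive_group_def]
        R.finprod_empty[unfolded real_additive_group_def])
  then show ?thesis
    by (simp add: free_abelian_eval_def ip)
qed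

lemma free_abelian_eval_unique:
  fixes X :: "'a topology" and A :: "'g monoid"
  assumes X: "tychonoff_space X" and free: "free_abelian_topological_group X A T i"
    and g: "g \<in> carrier A"
  shows "\<exists>!c. Poly_Mapping.keys c \<subseteq> topspace X \<and> g = free_abelian_eval A i c"
proof -
  have "comm_group A" and iX: "i ` topspace X \<subseteq> carrier A"
    and gen: "generate A (i ` topspace X) = carrier A"
    using free by (auto simp: free_abelian_topological_group_def abelian_topological_group_def
        continuous_map_def)
  interpret A: comm_group A by fact
  define F where "F = free_Abelian_group (topspace X)"
  obtain p where p: "p \<in> hom F A" and pf: "\<And>x. x \<in> topspace X \<Longrightarrow> p (frag_of x) = i x"
    using A.free_Abelian_group_universal[OF iX] unfolding F_def by blast
  interpret F: comm_group F
    unfolding F_def by (rule abelian_free_Abelian_group)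
  interpret p: group_hom F A p
    using p by unfold_locales
  have cF: "c \<in> carrier F \<longleftrightarrow> Poly_Mapping.keys c \<subseteq> topspace X" for c
    by (simp add: F_def)
  have pe: "p c = free_abelian_eval A i c" if "c \<in> carrier F" for c
  proof -
    have sub: "Poly_Mapping.keys c \<subseteq> topspace X"
      using that cF by blast
    have "p c = p (free_abelian_eval F frag_of c)"
      using free_abelian_eval_frag_of[OF sub] by (simp add: F_def)
    also have "\<dots> = free_abelian_eval A (p \<circ> frag_of) c"
      by (rule hom_free_abelian_eval[OF F.comm_group_axioms A.comm_group_axioms p])
        (use sub in \<open>auto simp: F_def\<close>)
    also have "\<dots> = free_abelian_eval A i c"
      unfolding free_abelian_eval_def
      using sub pf iX by (intro A.finprod_cong') (auto intro!: A.int_pow_closed)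
    finally show ?thesis .
  qed
  have "i ` topspace X \<subseteq> p ` carrier F"
  proof (rule image_subsetI)
    fix x assume x: "x \<in> topspace X"
    then have "frag_of x \<in> carrier F"
      by (simp add: F_def)
    then show "i x \<in> p ` carrier F"
      by (metis x pf image_eqI)
  qed
  then have "carrier A \<subseteq> p ` carrier F"
    using A.generate_subgroup_incl[OF _ p.img_is_subgroup] gen by metis
  then have ex: "\<exists>c\<in>carrier F. g = p c"
    using g by blast
  have zero: "c = 0" if c: "c \<in> carrier F" and pc: "p c = \<one>\<^bsub>A\<^esub>" for c
  proof (rule ccontr)
    assume "c \<noteq> 0"
    then obtain x0 where x0: "x0 \<in> Poly_Mapping.keys c"
      by (metis keys_eq_empty ex_in_conv)
    have sub: "Poly_Mapping.keys c \<subseteq> topspace X"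
      using c cF by blast
    define Q where "Q = Poly_Mapping.keys c - {x0}"
    have "closedin X Q"
      using X sub unfolding Q_def
      by (intro closedin_Hausdorff_finite) (auto simp: tychonoff_space_def)
    moreover have "x0 \<in> topspace X - Q"
      using x0 sub by (auto simp: Q_def)
    moreover have "completely_regular_space X"
      using X by (simp add: tychonoff_space_def)
    ultimately obtain f where "continuous_map X (top_of_set {0..1::real}) f" and f0: "f x0 = 0"
        and f1: "f ` Q \<subseteq> {1}"
      unfolding completely_regular_space_def by meson
    then have "continuous_map X euclideanreal (\<lambda>x. 1 - f x)"
      by (intro continuous_intros) (auto simp: continuous_map_in_subtopology)
    from free_abelian_universal[OF free abelian_topological_group_real this]
    obtain h where h: "h \<in> hom A real_additive_group"
      and hi: "\<And>x. x \<in> topspace X \<Longrightarrow> 1 - f x = h (i x)"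
      by auto
    have "0 = h (free_abelian_eval A i c)"
      using hom_one[OF h] pc pe[OF c] comm_group.axioms(2)[OF comm_group_real] A.group_axioms
      by (simp add: real_additive_group_def)
    also have "\<dots> = free_abelian_eval real_additive_group (h \<circ> i) c"
      using iX sub by (intro hom_free_abelian_eval[OF A.comm_group_axioms comm_group_real h]) auto
    also have "\<dots> = (\<Sum>x\<in>Poly_Mapping.keys c. of_int (Poly_Mapping.lookup c x) * (1 - f x))"
      unfolding free_abelian_eval_real using hi sub by (intro sum.cong) auto
    also have "\<dots> = (\<Sum>x\<in>{x0}. of_int (Poly_Mapping.lookup c x) * (1 - f x))"
      using x0 f1 by (intro sum.mono_neutral_right) (auto simp: Q_def)
    also have "\<dots> = of_int (Poly_Mapping.lookup c x0)"
      using f0 by simp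
    finally show False
      using x0 by (simp add: in_keys_iff)
  qed
  have inj: "c = d" if cd: "c \<in> carrier F" "d \<in> carrier F" "p c = p d" for c d
  proof -
    have "inv\<^bsub>F\<^esub> d = - d"
      using cd cF by (simp add: F_def)
    then have "c - d = c \<otimes>\<^bsub>F\<^esub> inv\<^bsub>F\<^esub> d"
      by (simp add: F_def)
    moreover have "p (c \<otimes>\<^bsub>F\<^esub> inv\<^bsub>F\<^esub> d) = \<one>\<^bsub>A\<^esub>" "c \<otimes>\<^bsub>F\<^esub> inv\<^bsub>F\<^esub> d \<in> carrier F"
      using cd by auto
    ultimately have "c - d = 0"
      using zero by metis
    then show ?thesis by simp
  qed
  show ?thesis
    using ex inj pe cF by metis
qed

lemma reduced_length_eq:
  fixes X :: "'a topology" and A :: "'g monoid"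
  assumes X: "tychonoff_space X" and free: "free_abelian_topological_group X A T i"
    and c: "Poly_Mapping.keys c \<subseteq> topspace X"
  shows "reduced_length X A i (free_abelian_eval A i c) =
    (\<Sum>x\<in>Poly_Mapping.keys c. nat \<bar>Poly_Mapping.lookup c x\<bar>)"
proof -
  have A: "comm_group A" and iX: "i ` topspace X \<subseteq> carrier A"
    using free by (auto simp: free_abelian_topological_group_def abelian_topological_group_def
        continuous_map_def)
  interpret A: comm_group A by fact
  have "free_abelian_eval A i c \<in> carrier A"
    unfolding free_abelian_eval_def using iX c by (intro A.finprod_closed) (auto intro!: A.int_pow_closed)
  from free_abelian_eval_unique[OF X free this] c
  have "\<And>d. Poly_Mapping.keys d \<subseteq> topspace X \<Longrightarrow> free_abelian_eval A i c = free_abelian_eval A i d \<Longrightarrow> d = c"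
    by blast
  then show ?thesis
    unfolding reduced_length_def using c by (intro the_equality) auto
qed

end

(*
  For a stratifiable k-space X, A_3(X) is a k-space as soon as X^3 is one and every open set
  containing {x} x Diag contains V x {(y, y') | q y > 0, q y' > 0 for some q in Q}, for a
  neighbourhood V of x and a compact-finite family Q of continuous functions to [0, 1] whose
  maxima are everywhere 1: words of length 2 and 3 are handled by disjoint neighbourhoods of
  their letters, words w + y - z near the shorter word w by the map y |-> (q y), which extends to
  a continuous homomorphism from A(X) to a space of bounded functions.

  On the other hand A_3(X) is not a k_R-space if it contains a fan: words that cluster at a point,
  each having two letters with prescribed neighbourhoods that form a family of pairs such that a
  compact set meets both members of only finitely many of them. For each of the words, functions
  on X supported in the two neighbourhoods extend to A(X), and the sum of the minima of their
  absolute values separates the words from the cluster point and is continuous on compact sets.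

  If some compact set is not covered by finitely many relatively compact members of the
  k-network, fans force the set of non-isolated points to be compact and then to have a countable
  outer base, so that X is first countable and the criterion applies. Otherwise fans built on
  almost disjoint families show that X is a sum of open k_omega-subspaces, and a fan built on an
  unbounded family of omega_1 functions shows that X is locally compact or all but countably many
  of the summands are discrete; both cases satisfy the criterion.
*)
theory Submission
  imports Defs "HOL-Probability.Discrete_Topology"
begin

section \<open>Stratifiable k-spaces\<close>

text \<open>Length 3 leaves room for one letter and one difference. Words of \<open>A_3\<close> near
  a word \<open>w\<close> consist of letters near those of \<open>w\<close> and a remainder of
  degree 0, which is 0 or some \<open>y - z\<close>. The second case forces \<open>w\<close> to have
  length at most 1, so only 0 and single letters are delicate, and the tube condition is about
  these. For the same reason a fan at a letter \<open>x\<close> may consist of words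
  \<open>a + s - y\<close> in which only \<open>a\<close> approaches \<open>x\<close>, while
  \<open>s\<close> and \<open>y\<close> need not cluster anywhere in \<open>X\<close>: it suffices
  that \<open>s - y\<close> approaches 0. Fans are found as points and sequences, but the functions
  on \<open>X\<close> that detect their words need open supports. Hence compact-finite families have
  to be expanded to open sets that are still compact-finite, which is what the stratification
  provides. Compact-finiteness replaces local finiteness because in a k-space it suffices for closed
  unions and continuous sums. The value of the bounding number is used once: uncountably many
  non-discrete summands are then enough to index an unbounded family of functions.\<close>

lemma compactin_finite_subcover:
  assumes "compactin X L" "\<And>i. i \<in> I \<Longrightarrow> openin X (U i)" "L \<subseteq> (\<Union>i\<in>I. U i)"
  shows "\<exists>J\<subseteq>I. finite J \<and> L \<subseteq> (\<Union>i\<in>J. U i)"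
proof -
  have "(\<forall>V\<in>U ` I. openin X V) \<and> L \<subseteq> \<Union>(U ` I)"
    using assms by blast
  then have "\<exists>\<F>. finite \<F> \<and> \<F> \<subseteq> U ` I \<and> L \<subseteq> \<Union>\<F>"
    using assms(1) by (simp add: compactin_def)
  then show ?thesis
    by (metis finite_subset_image)
qed

text \<open>The finite set \<open>S\<close> will mostly be the set of letters of a word: the
  homomorphism that extends \<open>f\<close> then returns the coefficient of \<open>x\<close> in
  this word, and in other words it sees only letters in \<open>U\<close>.\<close>

lemma tychonoff_separating_function:
  assumes tychonoff: "tychonoff_space X" and x: "x \<in> topspace X" "openin X U" "x \<in> U" "finite S"
  shows "\<exists>f. continuous_map X euclideanreal f \<and> f x = 1 \<and> (\<forall>y\<in>topspace X. 0 \<le> f y \<and> f y \<le> 1)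
    \<and> (\<forall>y\<in>topspace X. y \<notin> U \<or> y \<in> S - {x} \<longrightarrow> f y = 0)"
proof -
  let ?C = "(topspace X - U) \<union> (S - {x}) \<inter> topspace X"
  have "closedin X ((S - {x}) \<inter> topspace X)"
    using tychonoff x(4) by (intro closedin_Hausdorff_finite) (auto simp: tychonoff_space_def)
  then have "closedin X ?C"
    using x(2) by (intro closedin_Un) auto
  moreover have "x \<in> topspace X - ?C"
    using x by blast
  ultimately obtain f where f: "continuous_map X (top_of_set {0..1::real}) f" "f x = 0" "f ` ?C \<subseteq> {1}"
    using tychonoff unfolding tychonoff_space_def completely_regular_space_def by meson
  then have c: "continuous_map X euclideanreal f" and r: "f ` topspace X \<subseteq> {0..1}"
    by (auto simp: continuous_map_in_subtopology)
  show ?thesis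
    using f(2,3) r by (intro exI[of _ "\<lambda>y. 1 - f y"]) (auto intro!: continuous_intros c)
qed

text \<open>Families are indexed, so repetitions count: for points \<open>d m\<close> the condition
  says that \<open>d\<close> is finite-to-one and, in a Hausdorff k-space, that its values form a
  closed discrete set.\<close>

definition compact_finite :: "'a topology \<Rightarrow> 'i set \<Rightarrow> ('i \<Rightarrow> 'a set) \<Rightarrow> bool" where
  "compact_finite X I A \<longleftrightarrow> (\<forall>L. compactin X L \<longrightarrow> finite {i \<in> I. A i \<inter> L \<noteq> {}})"

lemma compact_finiteD: "compact_finite X I A \<Longrightarrow> compactin X L \<Longrightarrow> finite {i \<in> I. A i \<inter> L \<noteq> {}}"
  by (simp add: compact_finite_def)

lemma compact_finite_subset:
  assumes "compact_finite X I A" "J \<subseteq> I" "\<And>i. i \<in> J \<Longrightarrow> B i \<subseteq> A i"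
  shows "compact_finite X J B"
  unfolding compact_finite_def
proof (intro strip)
  fix L assume "compactin X L"
  then have "finite {i \<in> I. A i \<inter> L \<noteq> {}}"
    using assms(1) by (simp add: compact_finite_def)
  then show "finite {i \<in> J. B i \<inter> L \<noteq> {}}"
    by (rule finite_subset[rotated]) (use assms in blast)
qed

text \<open>\<open>G n F\<close> is the complement of the closure of the \<open>n\<close>-th set assigned to the complement of \<open>F\<close>.\<close>

locale stratified_k_space =
  fixes X :: "'a topology" and G :: "nat \<Rightarrow> 'a set \<Rightarrow> 'a set"
  assumes Hausdorff: "Hausdorff_space X"
    and k_space_X: "k_space X"
    and openin_G: "closedin X F \<Longrightarrow> openin X (G n F)"
    and subset_G: "closedin X F \<Longrightarrow> F \<subseteq> G n F"
    and G_mono: "closedin X F \<Longrightarrow> closedin X F' \<Longrightarrow> F \<subseteq> F' \<Longrightarrow> G n F \<subseteq> G n F'"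
    and G_decreasing: "closedin X F \<Longrightarrow> m \<le> n \<Longrightarrow> G n F \<subseteq> G m F"
    and notin_closure_G: "closedin X F \<Longrightarrow> x \<in> topspace X \<Longrightarrow> x \<notin> F \<Longrightarrow> \<exists>n. x \<notin> X closure_of G n F"
begin

lemma closedin_sing: "x \<in> topspace X \<Longrightarrow> closedin X {x}"
  by (simp add: Hausdorff closedin_Hausdorff_sing_eq)

lemma closedin_compact: "compactin X L \<Longrightarrow> closedin X L"
  by (simp add: Hausdorff compactin_imp_closedin)

section \<open>Compact sets and convergent sequences\<close>

lemma k_closedI:
  assumes "S \<subseteq> topspace X" "\<And>L. compactin X L \<Longrightarrow> closedin X (L \<inter> S)"
  shows "closedin X S"
  using assms k_space_X unfolding k_space by (meson closedin_subset_topspace inf_le1)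

lemma closedin_compact_finite_Union:
  assumes "compact_finite X I F" "\<And>i. i \<in> I \<Longrightarrow> closedin X (F i)"
  shows "closedin X (\<Union>i\<in>I. F i)"
proof (rule k_closedI)
  show "(\<Union>i\<in>I. F i) \<subseteq> topspace X"
    using assms(2) closedin_subset by blast
  fix L assume L: "compactin X L"
  have "L \<inter> (\<Union>i\<in>I. F i) = (\<Union>i\<in>{i\<in>I. F i \<inter> L \<noteq> {}}. L \<inter> F i)"
    by blast
  moreover have "closedin X \<dots>"
    using compact_finiteD[OF assms(1) L] assms(2) closedin_compact[OF L]
    by (intro closedin_Union) auto
  ultimately show "closedin X (L \<inter> (\<Union>i\<in>I. F i))"
    by simp
qed

text \<open>The closures of the sets \<open>G n {x}\<close> decrease to \<open>{x}\<close>. Their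
  complements therefore cover the compact set \<open>L - U\<close> and, being increasing, one of
  them does so alone. Within a compact set \<open>x\<close> thus behaves as if it had a countable
  base.\<close>

lemma closure_G_limit:
  assumes L: "compactin X L" "x \<in> topspace X" and U: "openin X U" "x \<in> U"
  shows "\<exists>n. X closure_of G n {x} \<inter> L \<subseteq> U"
proof -
  have cx: "closedin X {x}"
    using L(2) by (rule closedin_sing)
  have LU: "compactin X (L - U)"
  proof -
    have "L - U = (topspace X - U) \<inter> L"
      using compactin_subset_topspace[OF L(1)] by blast
    then show ?thesis
      using U(1) L(1) by (auto intro!: closed_Int_compactin)
  qed
  let ?V = "\<lambda>n. topspace X - X closure_of G n {x}"
  have "\<exists>n. y \<in> ?V n" if "y \<in> L - U" for y
  proof -
    have "y \<in> topspace X" "y \<notin> {x}"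
      using that U compactin_subset_topspace[OF L(1)] by auto
    then show ?thesis
      using notin_closure_G[OF cx] by blast
  qed
  then have "L - U \<subseteq> (\<Union>n\<in>UNIV. ?V n)"
    by blast
  then have "\<exists>N\<subseteq>UNIV. finite N \<and> L - U \<subseteq> (\<Union>n\<in>N. ?V n)"
    by (intro compactin_finite_subcover[OF LU]) auto
  then obtain N where N: "finite N" "L - U \<subseteq> (\<Union>n\<in>N. ?V n)"
    by blast
  obtain n where n: "\<forall>m\<in>N. m \<le> n"
    using N(1) unfolding finite_nat_set_iff_bounded_le ..
  have "?V m \<subseteq> ?V n" if "m \<in> N" for m
    using closure_of_mono[OF G_decreasing[OF cx, of m n], of X] that n by blast
  then have "L - U \<subseteq> ?V n"
    using N by blast
  then show ?thesis
    by blast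
qed

text \<open>By compactness some \<open>z\<close> has infinitely many terms in each neighbourhood;
  picking the \<open>k\<close>-th term of the subsequence in \<open>G k {z}\<close> forces
  convergence by \<open>closure_G_limit\<close>.\<close>

lemma sequentially_compact:
  assumes L: "compactin X L" and l: "\<And>n::nat. l n \<in> L"
  shows "\<exists>z\<in>L. \<exists>r. strict_mono r \<and> limitin X (l \<circ> r) z sequentially"
proof -
  have "\<exists>z\<in>L. \<forall>U. openin X U \<longrightarrow> z \<in> U \<longrightarrow> infinite {n. l n \<in> U}"
  proof (rule ccontr)
    assume "\<not> ?thesis"
    then obtain U where U: "\<And>z. z \<in> L \<Longrightarrow> openin X (U z) \<and> z \<in> U z \<and> finite {n. l n \<in> U z}"
      by metis
    then have "\<exists>J\<subseteq>L. finite J \<and> L \<subseteq> (\<Union>z\<in>J. U z)"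
      by (intro compactin_finite_subcover[OF L]) auto
    then obtain J where J: "J \<subseteq> L" "finite J" "L \<subseteq> (\<Union>z\<in>J. U z)"
      by blast
    have "(UNIV::nat set) \<subseteq> (\<Union>z\<in>J. {n. l n \<in> U z})"
      using l J(3) by blast
    moreover have "finite (\<Union>z\<in>J. {n. l n \<in> U z})"
      using J U by auto
    ultimately show False
      using finite_subset infinite_UNIV_nat by blast
  qed
  then obtain z where z: "z \<in> L" and inf: "\<And>U. openin X U \<Longrightarrow> z \<in> U \<Longrightarrow> infinite {n. l n \<in> U}"
    by blast
  have zX: "z \<in> topspace X"
    using z L compactin_subset_topspace by blast
  have *: "\<exists>m>n. l m \<in> G k {z}" for n k
  proof -
    have "z \<in> G k {z}"
      using subset_G[OF closedin_sing[OF zX]] by blast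
    then have "infinite {n. l n \<in> G k {z}}"
      by (intro inf openin_G closedin_sing zX)
    then show ?thesis
      unfolding infinite_nat_iff_unbounded by blast
  qed
  obtain r where r: "\<And>k. l (r k) \<in> G k {z}" "\<And>k::nat. r k < r (Suc k)"
    using dependent_nat_choice[of "\<lambda>k n. l n \<in> G k {z}" "\<lambda>k n m. n < m"] * by metis
  have "limitin X (l \<circ> r) z sequentially"
    unfolding limitin_sequentially
  proof (intro conjI strip)
    fix U assume U: "openin X U \<and> z \<in> U"
    then obtain n where n: "X closure_of G n {z} \<inter> L \<subseteq> U"
      using closure_G_limit[OF L zX] by blast
    have "(l \<circ> r) k \<in> U" if "n \<le> k" for k
    proof -
      have "G k {z} \<subseteq> X closure_of G n {z}"
        by (meson G_decreasing closedin_sing closure_of_subset openin_G openin_subset subset_trans that zX)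
      then show ?thesis
        using r(1)[of k] l n by auto
    qed
    then show "\<exists>N. \<forall>n\<ge>N. (l \<circ> r) n \<in> U"
      by blast
  qed (rule zX)
  then show ?thesis
    using z r(2) by (auto simp: strict_mono_Suc_iff)
qed

lemma closure_sequence:
  assumes L: "compactin X L" and A: "A \<subseteq> L" and z: "z \<in> X closure_of A"
  shows "\<exists>a. (\<forall>n::nat. a n \<in> A) \<and> limitin X a z sequentially"
proof -
  have "z \<in> L"
    using closure_of_minimal[OF A closedin_compact[OF L]] z by blast
  then have zX: "z \<in> topspace X"
    using compactin_subset_topspace[OF L] by blast
  have "\<exists>a. a \<in> A \<and> a \<in> G n {z}" for n
    using z openin_G[OF closedin_sing[OF zX]] subset_G[OF closedin_sing[OF zX]]
    unfolding in_closure_of by (metis insert_subset)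
  then obtain a where a: "\<And>n. a n \<in> A" "\<And>n. a n \<in> G n {z}"
    by metis
  have "limitin X a z sequentially"
    unfolding limitin_sequentially
  proof (intro conjI strip)
    fix U assume U: "openin X U \<and> z \<in> U"
    then obtain n where n: "X closure_of G n {z} \<inter> L \<subseteq> U"
      using closure_G_limit[OF L zX] by blast
    have "a k \<in> U" if "n \<le> k" for k
    proof -
      have "G k {z} \<subseteq> X closure_of G n {z}"
        by (meson G_decreasing closedin_sing closure_of_subset openin_G openin_subset subset_trans that zX)
      then show ?thesis
        using a(1)[of k] a(2)[of k] n A by blast
    qed
    then show "\<exists>N. \<forall>n\<ge>N. a n \<in> U"
      by blast
  qed (rule zX)
  then show ?thesis
    using a by blast
qed

lemma sequential:
  assumes A: "A \<subseteq> topspace X" "\<not> closedin X A"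
  shows "\<exists>a z. (\<forall>n::nat. a n \<in> A) \<and> z \<notin> A \<and> limitin X a z sequentially"
proof -
  obtain L where L: "compactin X L" "\<not> closedin X (L \<inter> A)"
    using k_closedI A by blast
  then obtain z where z: "z \<in> X closure_of (L \<inter> A)" "z \<notin> L \<inter> A"
    by (metis A(1) closure_of_subset_eq inf.coboundedI2 subsetI)
  have zL: "z \<in> L"
    by (metis L(1) closedin_compact closure_of_minimal inf_le1 subsetD z(1))
  obtain a where "\<forall>n::nat. a n \<in> L \<inter> A" "limitin X a z sequentially"
    using closure_sequence[OF L(1) _ z(1)] by auto
  then show ?thesis
    using z zL by blast
qed

text \<open>The union \<open>B\<close> of the closures of all countable subsets of \<open>A\<close>
  contains the limits of its sequences, since countably many countable sets have a countable union.
  So \<open>B\<close> is closed by \<open>sequential\<close>.\<close>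

lemma countable_tightness:
  assumes A: "A \<subseteq> topspace X" and x: "x \<in> X closure_of A"
  shows "\<exists>C\<subseteq>A. countable C \<and> x \<in> X closure_of C"
proof -
  define B where "B = (\<Union>C\<in>{C. C \<subseteq> A \<and> countable C}. X closure_of C)"
  have "closedin X B"
  proof (rule ccontr)
    assume "\<not> closedin X B"
    moreover have "B \<subseteq> topspace X"
      unfolding B_def using closure_of_subset_topspace by fastforce
    ultimately obtain a z where a: "\<And>n::nat. a n \<in> B" "z \<notin> B" "limitin X a z sequentially"
      using sequential by meson
    have "\<exists>C. C \<subseteq> A \<and> countable C \<and> a n \<in> X closure_of C" for n
      using a(1)[of n] unfolding B_def by blast
    then obtain C where C: "\<And>n. C n \<subseteq> A" "\<And>n. countable (C n)" "\<And>n. a n \<in> X closure_of C n"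
      by metis
    have "a n \<in> X closure_of (\<Union>n. C n)" for n
      using C(3)[of n] closure_of_mono[of "C n" "\<Union>n. C n" X] by blast
    then have "z \<in> X closure_of (\<Union>n. C n)"
      using a(3) limitin_closedin[OF a(3) closedin_closure_of] by simp
    moreover have "(\<Union>n. C n) \<subseteq> A" "countable (\<Union>n. C n)"
      using C by auto
    ultimately show False
      using a(2) unfolding B_def by blast
  qed
  moreover have "A \<subseteq> B"
  proof
    fix a assume "a \<in> A"
    then have "a \<in> X closure_of {a}" "{a} \<subseteq> A" "countable {a}"
      using A closure_of_subset[of "{a}" X] by auto
    then show "a \<in> B"
      unfolding B_def by blast
  qed
  ultimately have "x \<in> B"
    using x closure_of_minimal by blast
  then show ?thesis
    unfolding B_def by blast
qed

text \<open>If infinitely many \<open>s i\<close> avoided a neighbourhood \<open>U\<close> of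
  \<open>z\<close>, their closure \<open>F\<close> would miss \<open>z\<close>, and so would the
  closure of some \<open>G n F\<close>. But monotonicity puts the corresponding late terms
  \<open>l i\<close> into \<open>G n F\<close>. This replaces the metric argument that sequences of
  vanishing distance have the same limit.\<close>

lemma G_limit:
  assumes l: "limitin X l z sequentially" and k: "\<And>i. i \<le> k i"
    and lG: "\<And>i. l i \<in> G (k i) {s i}" and s: "\<And>i. s i \<in> topspace X"
  shows "limitin X s z sequentially"
proof (rule ccontr)
  assume "\<not> ?thesis"
  then obtain U where U: "openin X U" "z \<in> U" and nev: "\<not> (\<exists>N. \<forall>i\<ge>N. s i \<in> U)"
    using limitin_topspace[OF l] unfolding limitin_sequentially by blast
  define F where "F = X closure_of {s i |i. s i \<notin> U}"
  have FU: "F \<subseteq> topspace X - U"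
    unfolding F_def by (rule closure_of_minimal) (use s U in auto)
  have sF: "s i \<in> F" if "s i \<notin> U" for i
    unfolding F_def using closure_of_subset[of "{s i |i. s i \<notin> U}" X] s that by auto
  have cF: "closedin X F"
    by (simp add: F_def)
  obtain n where n: "z \<notin> X closure_of G n F"
    using notin_closure_G[OF cF limitin_topspace[OF l]] U FU by blast
  then obtain N where N: "\<And>i. i \<ge> N \<Longrightarrow> l i \<in> topspace X - X closure_of G n F"
    using l limitin_topspace[OF l] unfolding limitin_sequentially
    by (metis Diff_iff closedin_closure_of openin_diff openin_topspace)
  obtain i where i: "i \<ge> max N n" "s i \<notin> U"
    using nev by blast
  have "G (k i) {s i} \<subseteq> G n {s i}"
    using G_decreasing[OF closedin_sing[OF s]] k[of i] i by auto
  also have "\<dots> \<subseteq> G n F"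
    using G_mono closedin_sing s cF sF i by simp
  also have "\<dots> \<subseteq> X closure_of G n F"
    by (simp add: cF closure_of_subset openin_G openin_subset)
  finally show False
    using lG[of i] N[of i] i by auto
qed

section \<open>Compact-finite open expansions\<close>

lemma closed_discrete:
  assumes D: "compact_finite X D (\<lambda>d. {d})" "D \<subseteq> topspace X"
  shows "closedin X D"
proof -
  have "closedin X {d}" if "d \<in> D" for d
    using that D(2) closedin_sing by blast
  then have "closedin X (\<Union>d\<in>D. {d})"
    by (rule closedin_compact_finite_Union[OF D(1)])
  then show ?thesis
    by simp
qed

text \<open>The sets \<open>G n {d} - X closure_of G n (D - {d})\<close>, united over \<open>n\<close>, witness monotone normality.\<close>

lemma compact_finite_expansion_points:
  assumes D: "compact_finite X D (\<lambda>d. {d})" "D \<subseteq> topspace X"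
  shows "\<exists>W. (\<forall>d\<in>D. openin X (W d) \<and> d \<in> W d) \<and> compact_finite X D W"
proof -
  have sub: "closedin X E" if "E \<subseteq> D" for E
    by (rule closed_discrete[OF compact_finite_subset[OF D(1) that]]) (use that D in auto)
  define M where "M = (\<lambda>E F. \<Union>n. G n E - X closure_of G n F)"
  have openM: "openin X (M E F)" if "closedin X E" for E F
    unfolding M_def using that by (auto intro!: openin_Union openin_diff openin_G)
  have subM: "E \<subseteq> M E F" if E: "closedin X E" "closedin X F" "E \<inter> F = {}" for E F
  proof
    fix x assume x: "x \<in> E"
    then obtain n where "x \<notin> X closure_of G n F"
      using notin_closure_G[OF E(2)] E(3) closedin_subset[OF E(1)] by blast
    then show "x \<in> M E F"
      unfolding M_def using subset_G[OF E(1)] x by blast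
  qed
  have disj: "M E F \<inter> M E' F' = {}"
    if "closedin X E" "closedin X F" "closedin X E'" "closedin X F'" "E \<subseteq> F'" "E' \<subseteq> F"
    for E F E' F'
  proof (rule ccontr)
    assume "\<not> ?thesis"
    then obtain p m n where p: "p \<in> G m E" "p \<notin> X closure_of G m F" "p \<in> G n E'" "p \<notin> X closure_of G n F'"
      unfolding M_def by blast
    have cl: "G i H \<subseteq> X closure_of G i H" if "closedin X H" for i H
      using that by (simp add: closure_of_subset openin_G openin_subset)
    show False
    proof (cases "m \<le> n")
      case True
      then have "p \<in> G m F"
        using p(3) G_decreasing[OF that(3) True] G_mono[OF that(3) that(2) that(6)] by blast
      then show False
        using p(2) cl[OF that(2)] by blast
    next
      case False
      then have "p \<in> G n F'"
        using p(1) G_decreasing[OF that(1), of n m] G_mono[OF that(1) that(4) that(5)] by auto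
      then show False
        using p(4) cl[OF that(4)] by blast
    qed
  qed
  define H where "H = (\<lambda>d. M {d} (D - {d}))"
  have openH: "openin X (H d)" and dH: "d \<in> H d" if "d \<in> D" for d
    using openM[OF sub[of "{d}"]] subM[OF sub[of "{d}"] sub[of "D - {d}"]] that unfolding H_def by auto
  have disjH: "H d \<inter> H e = {}" if "d \<in> D" "e \<in> D" "d \<noteq> e" for d e
    unfolding H_def by (rule disj) (use that sub in auto)
  \<comment> \<open>The pairwise disjoint sets \<open>H d\<close> may still accumulate at
    \<open>C\<close>. Intersecting them with \<open>M D C\<close>, whose closure misses
    \<open>C\<close>, repairs this: a compact set meets that closure in a compact set, which
    finitely many of the disjoint \<open>H d\<close> cover.\<close>
  define C where "C = topspace X - (\<Union>d\<in>D. H d)"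
  have cC: "closedin X C"
    unfolding C_def using openH by (intro closedin_diff openin_Union) auto
  have cD: "closedin X D"
    by (rule sub) simp
  have DC: "D \<inter> C = {}"
    using dH unfolding C_def by blast
  have clN: "X closure_of (M D C) \<subseteq> (\<Union>d\<in>D. H d)"
  proof -
    have "X closure_of (M D C) \<inter> M C D = {}"
      using openM[OF cC] disj[OF cD cC cC cD] by (simp add: Int_commute openin_Int_closure_of_eq_empty)
    then have "X closure_of (M D C) \<inter> C = {}"
      using subM[OF cC cD] DC by blast
    then show ?thesis
      using closure_of_subset_topspace[of X "M D C"] unfolding C_def by blast
  qed
  show ?thesis
  proof (intro exI[of _ "\<lambda>d. H d \<inter> M D C"] conjI ballI)
    fix d assume d: "d \<in> D"
    show "openin X (H d \<inter> M D C)" "d \<in> H d \<inter> M D C"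
      using d openH[OF d] dH[OF d] openM[OF cD] subM[OF cD cC DC] by auto
  next
    show "compact_finite X D (\<lambda>d. H d \<inter> M D C)"
      unfolding compact_finite_def
    proof (intro strip)
      fix L assume L: "compactin X L"
      have "compactin X (X closure_of (M D C) \<inter> L)"
        using L closed_Int_compactin closedin_closure_of by blast
      moreover have "X closure_of (M D C) \<inter> L \<subseteq> \<Union>(H ` D)"
        using clN by auto
      ultimately obtain D0 where D0: "D0 \<subseteq> D" "finite D0" "X closure_of (M D C) \<inter> L \<subseteq> \<Union>(H ` D0)"
        using compactin_finite_subcover[of X _ D H] openH by metis
      have MC: "M D C \<subseteq> X closure_of (M D C)"
        by (simp add: cD closure_of_subset openM openin_subset)
      have "{d \<in> D. H d \<inter> M D C \<inter> L \<noteq> {}} \<subseteq> D0"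
      proof
        fix d assume "d \<in> {d \<in> D. H d \<inter> M D C \<inter> L \<noteq> {}}"
        then obtain p where p: "d \<in> D" "p \<in> H d" "p \<in> M D C" "p \<in> L"
          by blast
        then have "p \<in> \<Union>(H ` D0)"
          using D0(3) MC by blast
        then obtain e where e: "e \<in> D0" "p \<in> H e"
          by blast
        then have "d = e"
          using disjH[of d e] p D0(1) by blast
        then show "d \<in> D0"
          using e by simp
      qed
      then show "finite {d \<in> D. H d \<inter> M D C \<inter> L \<noteq> {}}"
        using D0 finite_subset by blast
    qed
  qed
qed

text \<open>The \<open>n\<close>-th points are expanded for each \<open>n\<close> separately and
  then shrunk by \<open>G n\<close>. A compact set that meets infinitely many of the unions must do
  so at levels \<open>n\<close> tending to infinity; by \<open>G_limit\<close> a subsequence of the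
  points \<open>s i n\<close> involved converges, and together with its limit it is a compact set
  that contradicts \<open>cf\<close>.\<close>

lemma compact_finite_expansion:
  fixes s :: "'i \<Rightarrow> nat \<Rightarrow> 'a"
  assumes cf: "compact_finite X I (\<lambda>i. range (s i))" and s: "\<And>i n. i \<in> I \<Longrightarrow> s i n \<in> topspace X"
  shows "\<exists>W. (\<forall>i\<in>I. \<forall>n. openin X (W i n) \<and> s i n \<in> W i n) \<and> compact_finite X I (\<lambda>i. \<Union>n. W i n)"
proof -
  have "\<exists>V. (\<forall>d\<in>(\<lambda>i. s i n) ` I. openin X (V d) \<and> d \<in> V d) \<and> compact_finite X ((\<lambda>i. s i n) ` I) V" for n
  proof (rule compact_finite_expansion_points)
    show "compact_finite X ((\<lambda>i. s i n) ` I) (\<lambda>d. {d})"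
      unfolding compact_finite_def
    proof (intro strip)
      fix L assume "compactin X L"
      then have "finite {i \<in> I. range (s i) \<inter> L \<noteq> {}}"
        using cf compact_finiteD by blast
      then show "finite {d \<in> (\<lambda>i. s i n) ` I. {d} \<inter> L \<noteq> {}}"
        by (rule finite_surj[where f = "\<lambda>i. s i n"]) auto
    qed
  qed (use s in auto)
  then obtain V where V: "\<And>n i. i \<in> I \<Longrightarrow> openin X (V n (s i n)) \<and> s i n \<in> V n (s i n)"
    and Vcf: "\<And>n. compact_finite X ((\<lambda>i. s i n) ` I) (V n)"
    by (metis image_eqI)
  \<comment> \<open>Different \<open>i\<close> may share the point \<open>s i n\<close>, but only
    finitely many do, as a single point is compact.\<close>
  have Vcf': "finite {i \<in> I. V n (s i n) \<inter> L \<noteq> {}}" if L: "compactin X L" for n L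
  proof -
    let ?D = "{d \<in> (\<lambda>i. s i n) ` I. V n d \<inter> L \<noteq> {}}"
    have "finite ?D"
      using Vcf L compact_finiteD by blast
    moreover have "finite {i \<in> I. s i n = d}" if "d \<in> ?D" for d
    proof -
      have "compactin X {d}"
        using that s by auto
      from compact_finiteD[OF cf this] show ?thesis
        by (rule finite_subset[rotated]) auto
    qed
    ultimately have "finite (\<Union>d\<in>?D. {i \<in> I. s i n = d})"
      by blast
    then show ?thesis
      by (rule finite_subset[rotated]) blast
  qed
  define W where "W = (\<lambda>i n. V n (s i n) \<inter> G n {s i n})"
  have "compact_finite X I (\<lambda>i. \<Union>n. W i n)"
    unfolding compact_finite_def
  proof (intro strip, rule ccontr)
    fix L assume L: "compactin X L" and "infinite {i \<in> I. (\<Union>n. W i n) \<inter> L \<noteq> {}}"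
    moreover define J where "J = {i \<in> I. (\<Union>n. W i n) \<inter> L \<noteq> {}}"
    ultimately have J: "infinite J" "J \<subseteq> I"
      by auto
    have meet: "\<exists>n. W i n \<inter> L \<noteq> {}" if "i \<in> J" for i
      using that unfolding J_def by blast
    obtain n where n: "\<And>i. i \<in> J \<Longrightarrow> W i (n i) \<inter> L \<noteq> {}"
      using meet by metis
    have fin: "finite {i \<in> J. n i \<le> m}" for m
    proof -
      have "finite (\<Union>k\<in>{..m}. {i \<in> I. V k (s i k) \<inter> L \<noteq> {}})"
        using Vcf'[OF L] by blast
      then show ?thesis
      proof (rule finite_subset[rotated], intro subsetI)
        fix i assume "i \<in> {i \<in> J. n i \<le> m}"
        then have "n i \<in> {..m}" "i \<in> {i \<in> I. V (n i) (s i (n i)) \<inter> L \<noteq> {}}"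
          using n[of i] J by (auto simp: W_def)
        then show "i \<in> (\<Union>k\<in>{..m}. {i \<in> I. V k (s i k) \<inter> L \<noteq> {}})"
          by blast
      qed
    qed
    have step: "\<exists>i\<in>J. n i > m \<and> i \<notin> F" if "finite F" for m F
    proof -
      have "infinite (J - ({i \<in> J. n i \<le> m} \<union> F))"
        using fin J that by (simp add: Diff_infinite_finite)
      then obtain i where "i \<in> J - ({i \<in> J. n i \<le> m} \<union> F)"
        by (metis ex_in_conv finite.emptyI)
      then show ?thesis
        by (intro bexI[of _ i]) auto
    qed
    obtain j where j: "\<And>m. j m \<in> J" "\<And>m::nat. n (j m) < n (j (Suc m))"
      using dependent_nat_choice[of "\<lambda>m i. i \<in> J" "\<lambda>m i i'. n i < n i'"] step
      by (metis finite.emptyI)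
    have sm: "strict_mono (\<lambda>m. n (j m))"
      using j(2) strict_mono_Suc_iff by blast
    have "\<exists>l. l \<in> W (j m) (n (j m)) \<and> l \<in> L" for m
      using n[OF j(1)] by blast
    then obtain l where l: "\<And>m. l m \<in> W (j m) (n (j m))" "\<And>m. l m \<in> L"
      by metis
    obtain z r where z: "strict_mono r" "limitin X (l \<circ> r) z sequentially"
      using sequentially_compact[of L l, OF L l(2)] by blast
    have sX: "s (j m) (n (j m)) \<in> topspace X" for m
      using s j J by blast
    have lim: "limitin X (\<lambda>i. s (j (r i)) (n (j (r i)))) z sequentially"
    proof (rule G_limit[OF z(2)])
      show "i \<le> n (j (r i))" for i
        using strict_mono_imp_increasing[OF sm] strict_mono_imp_increasing[OF z(1)] le_trans by blast
      show "(l \<circ> r) i \<in> G (n (j (r i))) {s (j (r i)) (n (j (r i)))}" for i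
        using l(1)[of "r i"] by (simp add: W_def)
    qed (rule sX)
    let ?S = "range (\<lambda>i. s (j (r i)) (n (j (r i))))"
    have "compactin X (insert z ?S)"
      by (rule compactin_sequence_with_limit[OF lim]) (use sX in auto)
    then have "finite {i \<in> I. range (s i) \<inter> insert z ?S \<noteq> {}}"
      using cf compact_finiteD by blast
    moreover have "range (\<lambda>m. j (r m)) \<subseteq> {i \<in> I. range (s i) \<inter> insert z ?S \<noteq> {}}"
      using j J by blast
    ultimately have "finite (range (\<lambda>m. j (r m)))"
      by (rule rev_finite_subset)
    then have "finite (n ` range (\<lambda>m. j (r m)))"
      by blast
    moreover have "inj (\<lambda>m. n (j (r m)))"
      using strict_mono_imp_inj_on[OF strict_mono_o[OF sm z(1)]] by (simp add: o_def)
    ultimately show False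
      using range_inj_infinite[of "\<lambda>m. n (j (r m))"] by (simp add: image_image)
  qed
  moreover have "openin X (W i n)" "s i n \<in> W i n" if "i \<in> I" for i n
    using V[OF that, of n] openin_G[OF closedin_sing[OF s[OF that]], of n n]
      subset_G[OF closedin_sing[OF s[OF that]], of n n]
    unfolding W_def by auto
  ultimately show ?thesis
    by blast
qed

end

section \<open>Compactness tested by compact-finite sequences\<close>

context stratified_k_space
begin

text \<open>The sets \<open>E n U\<close> below refine the cover to a \<open>\<sigma>\<close>-discrete closed cover.\<close>

lemma compactin_if_no_compact_finite_sequence:
  assumes C: "closedin X C"
    and no: "\<And>d::nat \<Rightarrow> 'a. range d \<subseteq> C \<Longrightarrow> \<not> compact_finite X UNIV (\<lambda>m. {d m})"
  shows "compactin X C"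
  unfolding compactin_def
proof (intro conjI strip)
  show "C \<subseteq> topspace X"
    using C closedin_subset by blast
  fix \<U> assume U: "Ball \<U> (openin X) \<and> C \<subseteq> \<Union> \<U>"
  \<comment> \<open>A well-order on the cover charges each point to the first member that contains
    it: \<open>E n U\<close> is the part of \<open>upto U\<close> that avoids the
    \<open>n\<close>-th neighbourhood of its complement and all members before
    \<open>U\<close>.\<close>
  obtain r where r: "well_order_on \<U> r"
    using well_order_on by blast
  then have lin: "linear_order_on \<U> r" and wf: "wf (r - Id)"
    by (auto simp: well_order_on_def)
  have total: "(V, W) \<in> r \<or> (W, V) \<in> r" if "V \<in> \<U>" "W \<in> \<U>" for V W
    using lin that unfolding linear_order_on_def partial_order_on_def preorder_on_def total_on_def refl_on_def
    by metis
  have field: "V \<in> \<U>" "W \<in> \<U>" if "(V, W) \<in> r" for V W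
    using lin that unfolding linear_order_on_def partial_order_on_def preorder_on_def by blast+
  have trans: "(V, Z) \<in> r" if "(V, W) \<in> r" "(W, Z) \<in> r" for V W Z
    using lin that unfolding linear_order_on_def partial_order_on_def preorder_on_def trans_def by blast
  have antisym: "V = W" if "(V, W) \<in> r" "(W, V) \<in> r" for V W
    using lin that unfolding linear_order_on_def partial_order_on_def antisym_def by blast
  define upto where "upto = (\<lambda>U. \<Union>{V. (V, U) \<in> r})"
  define below where "below = (\<lambda>U. \<Union>{V. (V, U) \<in> r \<and> V \<noteq> U})"
  have open_upto: "openin X (upto V)" and open_below: "openin X (below V)" for V
    unfolding upto_def below_def using U field by (auto intro!: openin_Union)
  have upto: "V \<subseteq> upto V" if "V \<in> \<U>" for V
    unfolding upto_def using total[OF that that] by blast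
  have upto_eq: "upto V \<subseteq> V \<union> below V" for V
    unfolding upto_def below_def by blast
  have upto_below: "upto V \<subseteq> below W" if "(V, W) \<in> r" "V \<noteq> W" for V W
    unfolding upto_def below_def using that trans antisym by blast
  have closedG: "closedin X (topspace X - G n (topspace X - Q))" if "openin X Q" for n Q
    using that by (intro closedin_diff openin_G) auto
  define E where "E = (\<lambda>n U. topspace X - G n (topspace X - upto U) - below U)"
  have closed_E: "closedin X (E n U)" for n U
    unfolding E_def by (intro closedin_diff closedG open_upto open_below)
  have E_upto: "E n U \<subseteq> upto U" for n U
    unfolding E_def using subset_G[of "topspace X - upto U" n] open_upto[of U] by blast
  have E_sub: "E n U \<subseteq> U" for n U
    using E_upto[of n U] upto_eq[of U] unfolding E_def by blast
  have least: "\<exists>V\<in>\<U>. x \<in> V \<and> x \<notin> below V" if x: "x \<in> C" for x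
  proof -
    obtain V0 where "V0 \<in> {V \<in> \<U>. x \<in> V}"
      using U x by blast
    then obtain V where V: "V \<in> {V \<in> \<U>. x \<in> V}" "\<And>W. (W, V) \<in> r - Id \<Longrightarrow> W \<notin> {V \<in> \<U>. x \<in> V}"
      by (rule wfE_min[OF wf]) blast
    then show ?thesis
      unfolding below_def using field by auto
  qed
  have cover: "\<exists>n V. V \<in> \<U> \<and> x \<in> E n V" if x: "x \<in> C" for x
  proof -
    obtain V where V: "V \<in> \<U>" "x \<in> V" "x \<notin> below V"
      using least[OF x] by blast
    have xX: "x \<in> topspace X"
      using x C closedin_subset by blast
    have cl: "closedin X (topspace X - upto V)"
      using open_upto by blast
    obtain n where "x \<notin> X closure_of G n (topspace X - upto V)"
      using notin_closure_G[OF cl xX] upto[OF V(1)] V(2) by blast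
    moreover have "G n (topspace X - upto V) \<subseteq> X closure_of G n (topspace X - upto V)"
      by (intro closure_of_subset openin_subset openin_G cl)
    ultimately have "x \<in> E n V"
      unfolding E_def using V xX by blast
    then show ?thesis
      using V by blast
  qed
  have disc: "compact_finite X \<U> (\<lambda>V. E n V \<inter> C)" for n
    unfolding compact_finite_def
  proof (intro strip)
    fix L assume L: "compactin X L"
    have "\<exists>N V. openin X N \<and> x \<in> N \<and> (\<forall>W\<in>\<U>. E n W \<inter> N \<noteq> {} \<longrightarrow> W = V)" if x: "x \<in> C \<inter> L" for x
    proof -
      obtain V where V: "V \<in> \<U>" "x \<in> V" "x \<notin> below V"
        using least x by blast
      \<comment> \<open>This neighbourhood of \<open>x\<close> meets no \<open>E n W\<close> except
        possibly that of \<open>V\<close>: for \<open>W\<close> after \<open>V\<close> because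
        \<open>E n W\<close> avoids \<open>below W\<close>, which contains \<open>V\<close>; for
        \<open>W\<close> before \<open>V\<close> because \<open>G n\<close> is monotone and
        \<open>upto W \<subseteq> below V\<close>.\<close>
      let ?N = "V - (topspace X - G n (topspace X - below V))"
      have c: "closedin X (topspace X - below V)"
        using open_below by blast
      have "x \<in> G n (topspace X - below V)"
        using subset_G[OF c, of n] x V C closedin_subset by blast
      moreover have "openin X ?N"
        using U V by (intro openin_diff closedG open_below) auto
      moreover have "W = V" if W: "W \<in> \<U>" "E n W \<inter> ?N \<noteq> {}" for W
      proof (rule ccontr)
        assume "W \<noteq> V"
        then consider "(V, W) \<in> r" | "(W, V) \<in> r"
          using total W V by blast
        then show False
        proof cases
          case 1
          then have "V \<subseteq> below W"
            unfolding below_def using \<open>W \<noteq> V\<close> by blast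
          then show False
            using W unfolding E_def by blast
        next
          case 2
          then have "upto W \<subseteq> below V"
            using upto_below \<open>W \<noteq> V\<close> by blast
          then have "G n (topspace X - below V) \<subseteq> G n (topspace X - upto W)"
            by (intro G_mono) (use open_upto open_below in auto)
          then show False
            using W unfolding E_def by blast
        qed
      qed
      ultimately show ?thesis
        using V by (intro exI[of _ ?N] exI[of _ V]) auto
    qed
    then obtain N V where NV: "\<And>x. x \<in> C \<inter> L \<Longrightarrow> openin X (N x) \<and> x \<in> N x"
      and un: "\<And>x W. x \<in> C \<inter> L \<Longrightarrow> W \<in> \<U> \<Longrightarrow> E n W \<inter> N x \<noteq> {} \<Longrightarrow> W = V x"
      by metis
    have "\<exists>J\<subseteq>C \<inter> L. finite J \<and> C \<inter> L \<subseteq> (\<Union>x\<in>J. N x)"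
      by (rule compactin_finite_subcover[OF closed_Int_compactin[OF C L]]) (use NV in auto)
    then obtain J where J: "J \<subseteq> C \<inter> L" "finite J" "C \<inter> L \<subseteq> (\<Union>x\<in>J. N x)"
      by blast
    have "{W \<in> \<U>. E n W \<inter> C \<inter> L \<noteq> {}} \<subseteq> V ` J"
    proof
      fix W assume "W \<in> {W \<in> \<U>. E n W \<inter> C \<inter> L \<noteq> {}}"
      then obtain y where y: "W \<in> \<U>" "y \<in> E n W" "y \<in> C \<inter> L"
        by blast
      then obtain x where "x \<in> J" "y \<in> N x"
        using J by blast
      then show "W \<in> V ` J"
        using un[of x W] y J by blast
    qed
    then show "finite {W \<in> \<U>. E n W \<inter> C \<inter> L \<noteq> {}}"
      using J finite_subset by blast
  qed
  \<comment> \<open>One point from each of infinitely many sets \<open>E n V\<close> would give a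
    compact-finite sequence in \<open>C\<close>; hence the cover has a countable subcover.\<close>
  have fin: "finite {V \<in> \<U>. E n V \<inter> C \<noteq> {}}" for n
  proof (rule ccontr)
    assume "infinite {V \<in> \<U>. E n V \<inter> C \<noteq> {}}"
    then obtain f :: "nat \<Rightarrow> 'a set" where f: "inj f" "range f \<subseteq> {V \<in> \<U>. E n V \<inter> C \<noteq> {}}"
      using infinite_countable_subset by blast
    then have "\<exists>y. y \<in> E n (f m) \<inter> C" for m
      by blast
    then obtain d where d: "\<And>m. d m \<in> E n (f m) \<inter> C"
      by metis
    have "compact_finite X UNIV (\<lambda>m. {d m})"
      unfolding compact_finite_def
    proof (intro strip)
      fix L assume "compactin X L"
      then have "finite {V \<in> \<U>. E n V \<inter> C \<inter> L \<noteq> {}}"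
        using disc compact_finiteD by blast
      then have "finite (f -` {V \<in> \<U>. E n V \<inter> C \<inter> L \<noteq> {}})"
        using f(1) by (rule finite_vimageI)
      then show "finite {m \<in> UNIV. {d m} \<inter> L \<noteq> {}}"
        by (rule finite_subset[rotated]) (use d f(2) in blast)
    qed
    then show False
      using no[of d] d by blast
  qed
  define \<V> where "\<V> = (\<Union>n. {V \<in> \<U>. E n V \<inter> C \<noteq> {}})"
  have "countable \<V>"
    unfolding \<V>_def by (rule countable_UN) (auto intro: countable_finite fin)
  moreover have "\<V> \<subseteq> \<U>"
    unfolding \<V>_def by blast
  moreover have "C \<subseteq> \<Union>\<V>"
  proof
    fix x assume "x \<in> C"
    moreover then obtain n V where "V \<in> \<U>" "x \<in> E n V"
      using cover by blast
    ultimately have "V \<in> \<V>" "x \<in> V"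
      unfolding \<V>_def using E_sub[of n V] by auto
    then show "x \<in> \<Union>\<V>"
      by blast
  qed
  ultimately have V: "countable \<V>" "\<V> \<subseteq> \<U>" "C \<subseteq> \<Union>\<V>"
    by auto
  show "\<exists>\<F>. finite \<F> \<and> \<F> \<subseteq> \<U> \<and> C \<subseteq> \<Union> \<F>"
  proof (rule ccontr)
    assume neg: "\<not> ?thesis"
    have ne: "\<V> \<noteq> {}"
    proof
      assume "\<V> = {}"
      then have "finite {} \<and> {} \<subseteq> \<U> \<and> C \<subseteq> \<Union>{}"
        using V(3) by simp
      then show False
        using neg by blast
    qed
    define v where "v = from_nat_into \<V>"
    have rv: "range v = \<V>"
      unfolding v_def using ne V(1) by (rule range_from_nat_into)
    \<comment> \<open>Points outside longer and longer initial parts of the countable subcover again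
      form a compact-finite sequence.\<close>
    have "\<exists>y. y \<in> C \<and> y \<notin> (\<Union>i\<in>{..k}. v i)" for k
    proof -
      have "finite (v ` {..k})" "v ` {..k} \<subseteq> \<U>"
        using rv V by auto
      then show ?thesis
        using neg by blast
    qed
    then obtain d where d: "\<And>k. d k \<in> C" "\<And>k i. i \<le> k \<Longrightarrow> d k \<notin> v i"
      by (metis UN_I atMost_iff)
    have "compact_finite X UNIV (\<lambda>m. {d m})"
      unfolding compact_finite_def
    proof (intro strip)
      fix L assume L: "compactin X L"
      have "\<exists>J\<subseteq>UNIV. finite J \<and> C \<inter> L \<subseteq> (\<Union>x\<in>J. v x)"
        by (rule compactin_finite_subcover[OF closed_Int_compactin[OF C L]]) (use rv V U in auto)
      then obtain J :: "nat set" where J: "finite J" "C \<inter> L \<subseteq> (\<Union>x\<in>J. v x)"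
        by blast
      obtain N where "\<forall>j\<in>J. j \<le> N"
        using J(1) unfolding finite_nat_set_iff_bounded_le ..
      then have "{m \<in> UNIV. {d m} \<inter> L \<noteq> {}} \<subseteq> {..<N}"
        using J(2) d by (auto simp: subset_iff) (metis IntI UN_E leI le_trans)
      then show "finite {m \<in> UNIV. {d m} \<inter> L \<noteq> {}}"
        using finite_subset by blast
    qed
    then show False
      using no[of d] d by blast
  qed
qed

lemma non_isolated_limit:
  assumes "x \<in> topspace X" "\<not> openin X {x}"
  shows "\<exists>a. (\<forall>n::nat. a n \<in> topspace X \<and> a n \<noteq> x) \<and> limitin X a x sequentially"
proof -
  have "\<not> closedin X (topspace X - {x})"
    using assms by (simp add: openin_closedin_eq)
  then obtain a z where "\<And>n::nat. a n \<in> topspace X - {x}" "z \<notin> topspace X - {x}" "limitin X a z sequentially"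
    using sequential[of "topspace X - {x}"] by blast
  then show ?thesis
    using limitin_topspace by fastforce
qed

lemma continuous_map_k:
  assumes "\<And>L. compactin X L \<Longrightarrow> continuous_map (subtopology X L) Y f"
  shows "continuous_map X Y f"
  unfolding continuous_map_closedin
proof (intro conjI strip)
  show "f \<in> topspace X \<rightarrow> topspace Y"
  proof
    fix x assume "x \<in> topspace X"
    then have "f \<in> topspace (subtopology X {x}) \<rightarrow> topspace Y" "x \<in> topspace (subtopology X {x})"
      using assms[of "{x}"] by (auto simp: continuous_map_def)
    then show "f x \<in> topspace Y"
      by (rule funcset_mem)
  qed
  fix C assume C: "closedin Y C"
  show "closedin X {x \<in> topspace X. f x \<in> C}"
  proof (rule k_closedI)
    fix L assume L: "compactin X L"
    have "closedin (subtopology X L) {x \<in> topspace (subtopology X L). f x \<in> C}"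
      using closedin_continuous_map_preimage[OF assms[OF L] C] .
    moreover have "{x \<in> topspace (subtopology X L). f x \<in> C} = L \<inter> {x \<in> topspace X. f x \<in> C}"
      by auto
    ultimately show "closedin X (L \<inter> {x \<in> topspace X. f x \<in> C})"
      using closedin_closed_subtopology[OF closedin_compact[OF L]] by auto
  qed auto
qed

end

lemma stratified_k_space_if_stratifiable:
  assumes "tychonoff_space X" "stratifiable_space X" "k_space X"
  shows "\<exists>G. stratified_k_space X G"
proof -
  from assms(2)[unfolded stratifiable_space_def]
  obtain S :: "'a set \<Rightarrow> nat \<Rightarrow> 'a set" where
    "\<forall>U n. openin X U \<longrightarrow> openin X (S U n) \<and> X closure_of S U n \<subseteq> U"
    "\<forall>U. openin X U \<longrightarrow> (\<Union>n. S U n) = U"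
    "\<forall>U V n. openin X U \<longrightarrow> openin X V \<longrightarrow> U \<subseteq> V \<longrightarrow> S U n \<subseteq> S V n"
    by (elim exE conjE)
  then have S: "\<And>U n. openin X U \<Longrightarrow> openin X (S U n)" "\<And>U n. openin X U \<Longrightarrow> X closure_of S U n \<subseteq> U"
       "\<And>U. openin X U \<Longrightarrow> (\<Union>n. S U n) = U"
       "\<And>U V n. openin X U \<Longrightarrow> openin X V \<Longrightarrow> U \<subseteq> V \<Longrightarrow> S U n \<subseteq> S V n"
    by simp_all
  \<comment> \<open>The sets assigned to an open set need not increase with \<open>n\<close>;
    uniting the first \<open>n + 1\<close> of them makes \<open>G\<close> decrease in
    \<open>n\<close>.\<close>
  define G where "G = (\<lambda>n F. topspace X - X closure_of (\<Union>m\<in>{..n}. S (topspace X - F) m))"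
  have cl: "X closure_of (\<Union>m\<in>{..n}. S U m) = (\<Union>m\<in>{..n}. X closure_of S U m)" for U n
    using closure_of_Union[of "(S U) ` {..n}" X] by simp
  have "stratified_k_space X G"
  proof
    show "Hausdorff_space X" "k_space X"
      using assms by (auto simp: tychonoff_space_def)
    fix F n assume F: "closedin X F"
    then have o: "openin X (topspace X - F)"
      by blast
    show "openin X (G n F)"
      unfolding G_def by (intro openin_diff openin_topspace closedin_closure_of)
    show "F \<subseteq> G n F"
      unfolding G_def cl using S(2)[OF o] closedin_subset[OF F] by blast
    show "G n F \<subseteq> G n F'" if "closedin X F'" "F \<subseteq> F'" for F'
    proof -
      have "S (topspace X - F') m \<subseteq> S (topspace X - F) m" for m
        using S(4)[OF _ o, of "topspace X - F'" m] that by blast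
      then show ?thesis
        unfolding G_def by (intro Diff_mono closure_of_mono UN_mono subset_refl)
    qed
    show "G n F \<subseteq> G m F" if "m \<le> n" for m
      unfolding G_def cl using that by (intro Diff_mono subset_refl UN_mono) auto
    show "\<exists>n. x \<notin> X closure_of G n F" if x: "x \<in> topspace X" "x \<notin> F" for x
    proof -
      obtain n where n: "x \<in> S (topspace X - F) n"
        using S(3)[OF o] x by blast
      have "S (topspace X - F) n \<inter> G n F = {}"
        unfolding G_def cl using closure_of_subset[OF openin_subset[OF S(1)[OF o, of n]]] by blast
      then have "S (topspace X - F) n \<inter> X closure_of G n F = {}"
        using S(1)[OF o] by (simp add: openin_Int_closure_of_eq_empty)
      then show ?thesis
        using n by blast
    qed
  qed
  then show ?thesis
    by blast
qed

section \<open>Free Abelian topological groups\<close>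

definition frag_length :: "('a \<Rightarrow>\<^sub>0 int) \<Rightarrow> nat" where
  "frag_length c = (\<Sum>x\<in>Poly_Mapping.keys c. nat \<bar>Poly_Mapping.lookup c x\<bar>)"

text \<open>The target groups by which neighbourhoods in \<open>A(X)\<close> are described: the
  reals single out letters, and a space of bounded functions keeps two letters close to each
  other.\<close>

definition normed_additive_group :: "'v::real_normed_vector monoid" where
  "normed_additive_group = \<lparr>carrier = UNIV, monoid.mult = (+), one = 0\<rparr>"

lemma comm_group_normed: "comm_group (normed_additive_group :: 'v::real_normed_vector monoid)"
  by (rule comm_groupI)
    (auto simp: normed_additive_group_def intro: exI[where x = "- x" for x :: 'v])

lemma inv_normed: "inv\<^bsub>normed_additive_group\<^esub> x = - (x :: 'v::real_normed_vector)"
  by (rule group.inv_equality[OF comm_group.axioms(2)[OF comm_group_normed]])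
    (auto simp: normed_additive_group_def)

lemma abelian_topological_group_normed:
  "abelian_topological_group (normed_additive_group :: 'v::real_normed_vector monoid) euclidean"
proof -
  have "completely_regular_space (euclidean :: 'v topology)"
    by (intro metrizable_imp_completely_regular_space metrizable_space_euclidean)
  then show ?thesis
    unfolding abelian_topological_group_def tychonoff_space_def inv_normed
    using comm_group_normed
    by (auto simp: normed_additive_group_def case_prod_unfold Hausdorff_space_euclidean
        intro!: continuous_on_add continuous_on_fst continuous_on_snd continuous_on_id)
qed

lemma free_abelian_eval_normed:
  fixes f :: "'a \<Rightarrow> 'v::real_normed_vector"
  shows "free_abelian_eval normed_additive_group f c =
    (\<Sum>x\<in>Poly_Mapping.keys c. of_int (Poly_Mapping.lookup c x) *\<^sub>R f x)"
proof -
  interpret R: comm_group "normed_additive_group :: 'v monoid" by (rule comm_group_normed)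
  have np: "y [^]\<^bsub>normed_additive_group\<^esub> n = of_nat n *\<^sub>R y" for y :: 'v and n :: nat
    by (induction n) (auto simp: normed_additive_group_def nat_pow_def algebra_simps)
  have ip: "y [^]\<^bsub>normed_additive_group\<^esub> k = of_int k *\<^sub>R y" for y :: 'v and k :: int
    by (auto simp: int_pow_def2 np inv_normed)
  have "finprod normed_additive_group g Q = (\<Sum>x\<in>Q. g x)" if "finite Q"
    for Q and g :: "'a \<Rightarrow> 'v"
    using that
    by (induction Q rule: finite_induct)
      (auto simp: normed_additive_group_def R.finprod_insert[unfolded normed_additive_group_def]
        R.finprod_empty[unfolded normed_additive_group_def])
  then show ?thesis
    by (simp add: free_abelian_eval_def ip)
qed

text \<open>Only the indices with \<open>y \<in> A i\<close> are summed, so the sum is finite at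
  each point even when the whole family is infinite. On \<open>L\<close> it agrees with a sum over
  the fixed finite set of indices whose sets meet \<open>L\<close>.\<close>

lemma continuous_map_compact_finite_sum:
  fixes f :: "'i \<Rightarrow> 'b \<Rightarrow> real"
  assumes cf: "compact_finite Y I A" and f: "\<And>i. i \<in> I \<Longrightarrow> continuous_map Y euclideanreal (f i)"
    and zero: "\<And>i y. i \<in> I \<Longrightarrow> y \<in> topspace Y \<Longrightarrow> y \<notin> A i \<Longrightarrow> f i y = 0"
    and L: "compactin Y L"
  shows "continuous_map (subtopology Y L) euclideanreal (\<lambda>y. \<Sum>i\<in>{i \<in> I. y \<in> A i}. f i y)"
proof -
  let ?J = "{i \<in> I. A i \<inter> L \<noteq> {}}"
  have fin: "finite ?J"
    using cf L compact_finiteD by blast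
  have "continuous_map (subtopology Y L) euclideanreal (\<lambda>y. \<Sum>i\<in>?J. f i y)"
    by (intro continuous_map_sum fin continuous_map_from_subtopology f) auto
  then show ?thesis
  proof (rule continuous_map_eq)
    fix y assume "y \<in> topspace (subtopology Y L)"
    then have y: "y \<in> L" "y \<in> topspace Y"
      by auto
    show "(\<Sum>i\<in>?J. f i y) = (\<Sum>i\<in>{i \<in> I. y \<in> A i}. f i y)"
      by (rule sum.mono_neutral_right[OF fin]) (use y zero in auto)
  qed
qed

text \<open>The weights of a gliding hump: \<open>M j k\<close> measures the effect of the
  \<open>j\<close>-th function on the \<open>k\<close>-th word, and the \<open>k\<close>-th
  amplitude exceeds the total effect of the earlier functions by \<open>k\<close>.\<close>

fun amplitude :: "(nat \<Rightarrow> nat \<Rightarrow> real) \<Rightarrow> nat \<Rightarrow> real" where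
  "amplitude M k = real k + (\<Sum>j<k. amplitude M j * M j k)"

declare amplitude.simps [simp del]

lemma amplitude_nonneg:
  assumes "\<And>j k. M j k \<ge> 0"
  shows "amplitude M k \<ge> 0"
proof (induction k rule: less_induct)
  case (less k)
  then show ?case
    by (subst amplitude.simps) (auto intro!: add_nonneg_nonneg sum_nonneg mult_nonneg_nonneg assms)
qed

locale free_abelian =
  fixes X :: "'a topology" and A :: "'g monoid" and T :: "'g topology" and i :: "'a \<Rightarrow> 'g"
  assumes tychonoff: "tychonoff_space X" and free: "free_abelian_topological_group X A T i"
begin

abbreviation ev :: "('a \<Rightarrow>\<^sub>0 int) \<Rightarrow> 'g" where
  "ev \<equiv> free_abelian_eval A i"

sublocale A: comm_group A
  using free by (simp add: free_abelian_topological_group_def abelian_topological_group_def)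

lemma topspace_T: "topspace T = carrier A"
  and continuous_mult: "continuous_map (prod_topology T T) T (\<lambda>(x, y). x \<otimes>\<^bsub>A\<^esub> y)"
  and continuous_inv: "continuous_map T T (\<lambda>x. inv\<^bsub>A\<^esub> x)"
  and Hausdorff_T: "Hausdorff_space T"
  and continuous_i: "continuous_map X T i"
  using free by (auto simp: free_abelian_topological_group_def abelian_topological_group_def tychonoff_space_def)

lemma i_closed: "x \<in> topspace X \<Longrightarrow> i x \<in> carrier A"
  using continuous_i topspace_T by (auto simp: continuous_map_def)

lemma ev_hom: "ev \<in> hom (free_Abelian_group (topspace X)) A"
proof -
  have iX: "i ` topspace X \<subseteq> carrier A"
    using i_closed by blast
  obtain p where p: "p \<in> hom (free_Abelian_group (topspace X)) A"
    and pf: "\<And>x. x \<in> topspace X \<Longrightarrow> p (frag_of x) = i x"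
    using A.free_Abelian_group_universal[OF iX] by blast
  have eq: "p c = ev c" if "c \<in> carrier (free_Abelian_group (topspace X))" for c
  proof -
    have sub: "Poly_Mapping.keys c \<subseteq> topspace X"
      using that by simp
    have "p c = p (free_abelian_eval (free_Abelian_group (topspace X)) frag_of c)"
      using free_abelian_eval_frag_of[OF sub] by simp
    also have "\<dots> = free_abelian_eval A (p \<circ> frag_of) c"
      by (rule hom_free_abelian_eval[OF abelian_free_Abelian_group A.comm_group_axioms p]) (use sub in auto)
    also have "\<dots> = ev c"
      unfolding free_abelian_eval_def
      using sub pf iX by (intro A.finprod_cong') (auto intro!: A.int_pow_closed)
    finally show ?thesis .
  qed
  interpret F: comm_group "free_Abelian_group (topspace X)"
    by (rule abelian_free_Abelian_group)
  show ?thesis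
  proof (rule homI)
    fix c d assume cd: "c \<in> carrier (free_Abelian_group (topspace X))" "d \<in> carrier (free_Abelian_group (topspace X))"
    show "ev c \<in> carrier A"
      using hom_in_carrier[OF p cd(1)] eq[OF cd(1)] by simp
    show "ev (c \<otimes>\<^bsub>free_Abelian_group (topspace X)\<^esub> d) = ev c \<otimes>\<^bsub>A\<^esub> ev d"
      using hom_mult[OF p cd] eq[OF cd(1)] eq[OF cd(2)] eq[OF F.m_closed[OF cd]] by simp
  qed
qed

lemma ev_closed: "Poly_Mapping.keys c \<subseteq> topspace X \<Longrightarrow> ev c \<in> carrier A"
  using ev_hom by (auto simp: hom_def)

lemma ev_add:
  "Poly_Mapping.keys c \<subseteq> topspace X \<Longrightarrow> Poly_Mapping.keys d \<subseteq> topspace X \<Longrightarrow> ev (c + d) = ev c \<otimes>\<^bsub>A\<^esub> ev d"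
  using ev_hom by (auto simp: hom_def)

lemma ev_zero: "ev 0 = \<one>\<^bsub>A\<^esub>"
  by (simp add: free_abelian_eval_def)

lemma ev_minus:
  assumes "Poly_Mapping.keys c \<subseteq> topspace X"
  shows "ev (- c) = inv\<^bsub>A\<^esub> ev c"
proof -
  have "ev (- c) \<otimes>\<^bsub>A\<^esub> ev c = \<one>\<^bsub>A\<^esub>"
    using ev_add[of "- c" c] assms ev_zero by simp
  then show ?thesis
    using A.inv_equality ev_closed assms by (metis keys_minus)
qed

lemma ev_frag_of: "x \<in> topspace X \<Longrightarrow> ev (frag_of x) = i x"
  by (simp add: free_abelian_eval_def i_closed)

lemma ev_inj:
  assumes "Poly_Mapping.keys c \<subseteq> topspace X" "Poly_Mapping.keys d \<subseteq> topspace X" "ev c = ev d"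
  shows "c = d"
  using free_abelian_eval_unique[OF tychonoff free ev_closed[OF assms(1)]] assms by blast

lemma ev_surj: "g \<in> carrier A \<Longrightarrow> \<exists>c. Poly_Mapping.keys c \<subseteq> topspace X \<and> g = ev c"
  using free_abelian_eval_unique[OF tychonoff free] by blast

lemma level_eq:
  "free_abelian_level n X A T i =
    subtopology T (ev ` {c. Poly_Mapping.keys c \<subseteq> topspace X \<and> frag_length c \<le> n})"
proof -
  have "{g \<in> carrier A. reduced_length X A i g \<le> n} = ev ` {c. Poly_Mapping.keys c \<subseteq> topspace X \<and> frag_length c \<le> n}"
    (is "?L = ?R")
  proof (intro equalityI subsetI)
    fix g assume g: "g \<in> ?L"
    then obtain c where c: "Poly_Mapping.keys c \<subseteq> topspace X" "g = ev c"
      using ev_surj by blast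
    then have "frag_length c \<le> n"
      using g reduced_length_eq[OF tychonoff free c(1)] by (simp add: frag_length_def)
    then show "g \<in> ?R"
      using c by blast
  next
    fix g assume "g \<in> ?R"
    then obtain c where "Poly_Mapping.keys c \<subseteq> topspace X" "frag_length c \<le> n" "g = ev c"
      by blast
    then show "g \<in> ?L"
      using ev_closed reduced_length_eq[OF tychonoff free, of c] by (simp add: frag_length_def)
  qed
  then show ?thesis
    by (simp add: free_abelian_level_def)
qed

lemma ev_in_level:
  "Poly_Mapping.keys c \<subseteq> topspace X \<Longrightarrow> frag_length c \<le> n \<Longrightarrow> ev c \<in> topspace (free_abelian_level n X A T i)"
  unfolding level_eq using ev_closed topspace_T by auto

lemma extend_normed:
  fixes f :: "'a \<Rightarrow> 'v::real_normed_vector"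
  assumes "continuous_map X euclidean f"
  shows "\<exists>h. continuous_map T euclidean h \<and>
    (\<forall>c. Poly_Mapping.keys c \<subseteq> topspace X \<longrightarrow>
       h (ev c) = (\<Sum>x\<in>Poly_Mapping.keys c. of_int (Poly_Mapping.lookup c x) *\<^sub>R f x))"
proof -
  obtain h where h: "h \<in> hom A normed_additive_group" "continuous_map T euclidean h"
    "\<And>x. x \<in> topspace X \<Longrightarrow> f x = h (i x)"
    using free_abelian_universal[OF free abelian_topological_group_normed assms] by blast
  have "h (ev c) = (\<Sum>x\<in>Poly_Mapping.keys c. of_int (Poly_Mapping.lookup c x) *\<^sub>R f x)"
    if c: "Poly_Mapping.keys c \<subseteq> topspace X" for c
  proof -
    have "h (ev c) = free_abelian_eval normed_additive_group (h \<circ> i) c"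
      by (rule hom_free_abelian_eval[OF A.comm_group_axioms comm_group_normed h(1)]) (use c i_closed in blast)
    also have "\<dots> = (\<Sum>x\<in>Poly_Mapping.keys c. of_int (Poly_Mapping.lookup c x) *\<^sub>R f x)"
      unfolding free_abelian_eval_normed using h(3) c by (intro sum.cong) auto
    finally show ?thesis .
  qed
  then show ?thesis
    using h(2) by blast
qed

lemma extend_real:
  fixes f :: "'a \<Rightarrow> real"
  assumes "continuous_map X euclideanreal f"
  shows "\<exists>h. continuous_map T euclideanreal h \<and>
    (\<forall>c. Poly_Mapping.keys c \<subseteq> topspace X \<longrightarrow>
       h (ev c) = (\<Sum>x\<in>Poly_Mapping.keys c. of_int (Poly_Mapping.lookup c x) * f x))"
  using extend_normed[OF assms] by simp

lemmas separating_function = tychonoff_separating_function[OF tychonoff]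

end

section \<open>Compact sets of words, and fans\<close>

locale free_stratified = free_abelian X A T i + stratified_k_space X G
  for X :: "'a topology" and A :: "'g monoid" and T i G
begin

text \<open>If the supports were unbounded, a suitable locally finite sum of functions on \<open>X\<close> would extend
  to a homomorphism that is unbounded on \<open>L\<close>.\<close>

lemma compact_support:
  assumes L: "compactin T L"
  shows "\<exists>B. compactin X B \<and> (\<forall>c. Poly_Mapping.keys c \<subseteq> topspace X \<longrightarrow> ev c \<in> L \<longrightarrow> Poly_Mapping.keys c \<subseteq> B)"
proof -
  define S where "S = \<Union>{Poly_Mapping.keys c |c. Poly_Mapping.keys c \<subseteq> topspace X \<and> ev c \<in> L}"
  have SX: "S \<subseteq> topspace X"
    unfolding S_def by blast
  have "compactin X (X closure_of S)"
  proof (rule compactin_if_no_compact_finite_sequence[OF closedin_closure_of], rule notI)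
    fix d :: "nat \<Rightarrow> 'a"
    assume d: "range d \<subseteq> X closure_of S" and cf: "compact_finite X UNIV (\<lambda>m. {d m})"
    have dX: "d m \<in> topspace X" for m
      using d closure_of_subset_topspace[of X S] by blast
    have "compact_finite X UNIV (\<lambda>m. range (\<lambda>n::nat. d m))"
      using cf by simp
    then have "\<exists>W. (\<forall>m\<in>UNIV. \<forall>n. openin X (W m n) \<and> d m \<in> W m n) \<and> compact_finite X UNIV (\<lambda>m. \<Union>n::nat. W m n)"
      by (rule compact_finite_expansion) (rule dX)
    then obtain W :: "nat \<Rightarrow> nat \<Rightarrow> 'a set" where W: "\<And>m n. openin X (W m n) \<and> d m \<in> W m n"
      and Wcf: "compact_finite X UNIV (\<lambda>m. \<Union>n. W m n)"
      by auto
    define V where "V = (\<lambda>m. W m (0::nat))"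
    have V: "openin X (V m)" "d m \<in> V m" for m
      unfolding V_def using W by auto
    have Vcf: "compact_finite X UNIV V"
      by (rule compact_finite_subset[OF Wcf]) (auto simp: V_def)
    have "\<exists>c u. Poly_Mapping.keys c \<subseteq> topspace X \<and> ev c \<in> L \<and> u \<in> Poly_Mapping.keys c \<and> u \<in> V m" for m
    proof -
      have "d m \<in> X closure_of S"
        using d by blast
      then obtain u where "u \<in> S" "u \<in> V m"
        using V[of m] unfolding in_closure_of by blast
      then show ?thesis
        unfolding S_def by blast
    qed
    then obtain c u where c: "\<And>m. Poly_Mapping.keys (c m) \<subseteq> topspace X" "\<And>m. ev (c m) \<in> L"
      and u: "\<And>m. u m \<in> Poly_Mapping.keys (c m)" "\<And>m. u m \<in> V m"
      by metis
    have "\<exists>b. \<forall>m'\<ge>b. V m' \<inter> Poly_Mapping.keys (c m) = {}" for m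
    proof -
      have "finite {m'\<in>UNIV. V m' \<inter> Poly_Mapping.keys (c m) \<noteq> {}}"
        by (rule compact_finiteD[OF Vcf]) (simp add: c finite_imp_compactin)
      then obtain b where "\<forall>m'\<in>{m'\<in>UNIV. V m' \<inter> Poly_Mapping.keys (c m) \<noteq> {}}. m' < b"
        using finite_nat_set_iff_bounded by blast
      then show ?thesis
        by (intro exI[of _ b]) (auto simp: not_le[symmetric])
    qed
    then obtain b where b: "\<And>m m'. m' \<ge> b m \<Longrightarrow> V m' \<inter> Poly_Mapping.keys (c m) = {}"
      by metis
    \<comment> \<open>The subsequence is sparse enough for the functions to act triangularly:
      \<open>V (r k)\<close> misses the letters of all earlier words, so the \<open>k\<close>-th
      function does not change the value at an earlier word.\<close>
    obtain r where r: "\<And>k. r k < r (Suc k) \<and> b (r k) \<le> r (Suc k)"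
      using dependent_nat_choice[of "\<lambda>_ _. True" "\<lambda>_ m m'. m < m' \<and> b m \<le> m'"]
      by (metis max.strict_coboundedI1 max.cobounded2 lessI)
    have mono_r: "strict_mono r"
      using r strict_mono_Suc_iff by blast
    have avoid: "V (r k) \<inter> Poly_Mapping.keys (c (r j)) = {}" if "j < k" for j k
    proof -
      have "r (Suc j) \<le> r k"
        using that mono_r by (simp add: strict_mono_less_eq)
      then show ?thesis
        using b r[of j] le_trans by blast
    qed
    have "\<exists>f. continuous_map X euclideanreal f \<and> f (u m) = 1 \<and> (\<forall>y\<in>topspace X. 0 \<le> f y \<and> f y \<le> 1)
      \<and> (\<forall>y\<in>topspace X. y \<notin> V m \<or> y \<in> Poly_Mapping.keys (c m) - {u m} \<longrightarrow> f y = 0)" for m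
      by (rule separating_function) (use u c V in auto)
    then obtain f where f: "\<And>m. continuous_map X euclideanreal (f m)" "\<And>m. f m (u m) = 1"
      "\<And>m y. y \<in> topspace X \<Longrightarrow> y \<notin> V m \<or> y \<in> Poly_Mapping.keys (c m) - {u m} \<Longrightarrow> f m y = 0"
      by metis
    \<comment> \<open>\<open>\<beta> j k\<close> is the value at the \<open>k\<close>-th word of the
      homomorphism that extends \<open>f (r j)\<close>. It vanishes for \<open>j > k\<close>, and
      \<open>\<beta> k k\<close> is the coefficient of \<open>u (r k)\<close>, a non-zero integer.
      The amplitudes make the \<open>k\<close>-th term outweigh the earlier ones by
      \<open>k\<close>.\<close>
    define \<beta> where "\<beta> = (\<lambda>j k. \<Sum>x\<in>Poly_Mapping.keys (c (r k)). of_int (Poly_Mapping.lookup (c (r k)) x) * f (r j) x)"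
    define t where "t = amplitude (\<lambda>j k. \<bar>\<beta> j k\<bar>)"
    have t: "t k = real k + (\<Sum>j<k. t j * \<bar>\<beta> j k\<bar>)" for k
      unfolding t_def by (subst amplitude.simps) simp
    have t0: "t k \<ge> 0" for k
      unfolding t_def by (rule amplitude_nonneg) simp
    define F where "F = (\<lambda>y. \<Sum>k\<in>{k\<in>UNIV. y \<in> V (r k)}. t k * f (r k) y)"
    have Vrcf: "compact_finite X UNIV (\<lambda>k. V (r k))"
      unfolding compact_finite_def
    proof (intro strip)
      fix L assume "compactin X L"
      then have "finite {m \<in> UNIV. V m \<inter> L \<noteq> {}}"
        using Vcf compact_finiteD by blast
      then have "finite (r -` {m \<in> UNIV. V m \<inter> L \<noteq> {}})"
        using strict_mono_imp_inj_on[OF mono_r] finite_vimageI by blast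
      then show "finite {k \<in> UNIV. V (r k) \<inter> L \<noteq> {}}"
        by (simp add: vimage_def)
    qed
    have "continuous_map X euclideanreal F"
      unfolding F_def
      by (rule continuous_map_k, rule continuous_map_compact_finite_sum[OF Vrcf])
        (auto intro!: continuous_intros f)
    then obtain h where h: "continuous_map T euclideanreal h"
      and hev: "\<And>c. Poly_Mapping.keys c \<subseteq> topspace X \<Longrightarrow>
       h (ev c) = (\<Sum>x\<in>Poly_Mapping.keys c. of_int (Poly_Mapping.lookup c x) * F x)"
      using extend_real by blast
    have large: "\<bar>h (ev (c (r k)))\<bar> \<ge> real k" for k
    proof -
      let ?c = "c (r k)"
      have Fx: "F x = (\<Sum>j\<le>k. t j * f (r j) x)" if x: "x \<in> Poly_Mapping.keys ?c" for x
      proof -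
        have "{j \<in> UNIV. x \<in> V (r j)} \<subseteq> {..k}"
          using avoid[of k] x by (auto simp: not_le[symmetric])
        moreover have "f (r j) x = 0" if "x \<notin> V (r j)" for j
          using f(3)[of x "r j"] that x c(1)[of "r k"] by blast
        ultimately show ?thesis
          unfolding F_def by (intro sum.mono_neutral_left) auto
      qed
      have "h (ev ?c) = (\<Sum>x\<in>Poly_Mapping.keys ?c. \<Sum>j\<le>k. t j * (of_int (Poly_Mapping.lookup ?c x) * f (r j) x))"
        unfolding hev[OF c(1)] by (intro sum.cong) (auto simp: Fx sum_distrib_left algebra_simps)
      also have "\<dots> = (\<Sum>j\<le>k. t j * \<beta> j k)"
        unfolding \<beta>_def sum_distrib_left by (rule sum.swap)
      also have "\<dots> = t k * \<beta> k k + (\<Sum>j<k. t j * \<beta> j k)"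
        by (simp add: lessThan_Suc_atMost[symmetric])
      finally have *: "h (ev ?c) = t k * \<beta> k k + (\<Sum>j<k. t j * \<beta> j k)" .
      have "\<beta> k k = (\<Sum>x\<in>{u (r k)}. of_int (Poly_Mapping.lookup ?c x) * f (r k) x)"
        unfolding \<beta>_def
      proof (rule sum.mono_neutral_right)
        show "\<forall>x\<in>Poly_Mapping.keys ?c - {u (r k)}. of_int (Poly_Mapping.lookup ?c x) * f (r k) x = 0"
          using f(3)[of _ "r k"] c(1)[of "r k"] by auto
      qed (use u in auto)
      then have "\<bar>\<beta> k k\<bar> \<ge> 1"
        using u(1)[of "r k"] f(2) by (simp add: in_keys_iff)
      then have "t k \<le> \<bar>t k * \<beta> k k\<bar>"
        using t0[of k] mult_left_mono[of 1 "\<bar>\<beta> k k\<bar>" "t k"] by (simp add: abs_mult)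
      moreover have "\<bar>\<Sum>j<k. t j * \<beta> j k\<bar> \<le> (\<Sum>j<k. t j * \<bar>\<beta> j k\<bar>)"
        by (rule order_trans[OF sum_abs]) (simp add: abs_mult t0)
      ultimately show ?thesis
        using t[of k] unfolding * by linarith
    qed
    have "compactin euclideanreal (h ` L)"
      using image_compactin[OF L h] .
    then have "bounded (h ` L)"
      by (simp add: compact_imp_bounded)
    then obtain K where K: "\<And>g. g \<in> L \<Longrightarrow> \<bar>h g\<bar> \<le> K"
      by (auto simp: bounded_iff)
    obtain k where "real k > K"
      using reals_Archimedean2 by blast
    then show False
      using large[of k] K[OF c(2)[of "r k"]] by linarith
  qed
  moreover have "Poly_Mapping.keys c \<subseteq> X closure_of S" if "Poly_Mapping.keys c \<subseteq> topspace X" "ev c \<in> L" for c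
  proof -
    have "Poly_Mapping.keys c \<subseteq> S"
      unfolding S_def using that by blast
    then show ?thesis
      using closure_of_subset[OF SX] by blast
  qed
  ultimately show ?thesis
    by blast
qed

text \<open>The minimum of two detecting functions is non-zero only at words with letters in both
  \<open>U l\<close> and \<open>V l\<close>. The words of a compact set have their letters in a
  compact set by \<open>compact_support\<close>, so by \<open>fin\<close> only finitely many minima
  are non-zero somewhere on it. Two neighbourhoods are used because in the fans below neither family
  of them need be compact-finite.\<close>

lemma not_kR_space_if_fan:
  fixes c :: "'l \<Rightarrow> ('a \<Rightarrow>\<^sub>0 int)"
  assumes c: "\<And>l. l \<in> I \<Longrightarrow> Poly_Mapping.keys (c l) \<subseteq> topspace X" "\<And>l. l \<in> I \<Longrightarrow> frag_length (c l) \<le> n"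
    and u: "\<And>l. l \<in> I \<Longrightarrow> u l \<in> Poly_Mapping.keys (c l)" "\<And>l. l \<in> I \<Longrightarrow> openin X (U l)" "\<And>l. l \<in> I \<Longrightarrow> u l \<in> U l"
    and v: "\<And>l. l \<in> I \<Longrightarrow> v l \<in> Poly_Mapping.keys (c l)" "\<And>l. l \<in> I \<Longrightarrow> openin X (V l)" "\<And>l. l \<in> I \<Longrightarrow> v l \<in> V l"
    and fin: "\<And>L. compactin X L \<Longrightarrow> finite {l \<in> I. U l \<inter> L \<noteq> {} \<and> V l \<inter> L \<noteq> {}}"
    and p: "Poly_Mapping.keys p \<subseteq> topspace X" "frag_length p \<le> n" "\<And>l. l \<in> I \<Longrightarrow> c l \<noteq> p"
    and cluster: "\<And>N. openin T N \<Longrightarrow> ev p \<in> N \<Longrightarrow> \<exists>l\<in>I. ev (c l) \<in> N"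
  shows "\<not> kR_space (free_abelian_level n X A T i)"
proof
  let ?Y = "free_abelian_level n X A T i"
  assume kR: "kR_space ?Y"
  \<comment> \<open>\<open>f\<close> is 1 at \<open>w\<close> and 0 at the other letters of
    \<open>c l\<close>, so \<open>h (ev (c l))\<close> is the coefficient of \<open>w\<close>, a
    non-zero integer; hence the bound 1.\<close>
  have detect: "\<exists>h. continuous_map T euclideanreal h \<and> \<bar>h (ev (c l))\<bar> \<ge> 1 \<and>
      (\<forall>d. Poly_Mapping.keys d \<subseteq> topspace X \<longrightarrow> h (ev d) \<noteq> 0 \<longrightarrow> Poly_Mapping.keys d \<inter> O' \<noteq> {})"
    if l: "l \<in> I" and w: "w \<in> Poly_Mapping.keys (c l)" "openin X O'" "w \<in> O'" for l w O'
  proof -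
    obtain f where f: "continuous_map X euclideanreal f" "f w = 1"
      "\<And>y. y \<in> topspace X \<Longrightarrow> y \<notin> O' \<or> y \<in> Poly_Mapping.keys (c l) - {w} \<Longrightarrow> f y = 0"
    proof -
      have "w \<in> topspace X"
        using w(1) c(1)[OF l] by blast
      from separating_function[OF this w(2,3) finite_keys[of "c l"]] show ?thesis
        using that by blast
    qed
    obtain h where h: "continuous_map T euclideanreal h"
      and hev: "\<And>c. Poly_Mapping.keys c \<subseteq> topspace X \<Longrightarrow>
       h (ev c) = (\<Sum>x\<in>Poly_Mapping.keys c. of_int (Poly_Mapping.lookup c x) * f x)"
      using extend_real[OF f(1)] by blast
    have "h (ev (c l)) = (\<Sum>x\<in>{w}. of_int (Poly_Mapping.lookup (c l) x) * f x)"
      unfolding hev[OF c(1)[OF l]] 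
    proof (rule sum.mono_neutral_right)
      show "\<forall>x\<in>Poly_Mapping.keys (c l) - {w}. of_int (Poly_Mapping.lookup (c l) x) * f x = 0"
        using f(3) c(1)[OF l] by auto
    qed (use w in auto)
    then have "\<bar>h (ev (c l))\<bar> \<ge> 1"
      using w(1) f(2) by (simp add: in_keys_iff)
    moreover have "Poly_Mapping.keys d \<inter> O' \<noteq> {}" if d: "Poly_Mapping.keys d \<subseteq> topspace X" "h (ev d) \<noteq> 0" for d
    proof
      assume "Poly_Mapping.keys d \<inter> O' = {}"
      then have "h (ev d) = 0"
        unfolding hev[OF d(1)] by (intro sum.neutral ballI) (use d(1) f(3) in \<open>simp add: disjoint_iff subset_iff\<close>)
      then show False
        using d by blast
    qed
    ultimately show ?thesis
      using h by blast
  qed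
  have "\<exists>h. continuous_map T euclideanreal h \<and> \<bar>h (ev (c l))\<bar> \<ge> 1 \<and>
      (\<forall>d. Poly_Mapping.keys d \<subseteq> topspace X \<longrightarrow> h (ev d) \<noteq> 0 \<longrightarrow> Poly_Mapping.keys d \<inter> U l \<noteq> {})" if "l \<in> I" for l
    using detect[OF that u(1)[OF that] u(2)[OF that] u(3)[OF that]] .
  then obtain h where h: "\<And>l. l \<in> I \<Longrightarrow> continuous_map T euclideanreal (h l)" "\<And>l. l \<in> I \<Longrightarrow> \<bar>h l (ev (c l))\<bar> \<ge> 1"
    "\<And>l d. l \<in> I \<Longrightarrow> Poly_Mapping.keys d \<subseteq> topspace X \<Longrightarrow> h l (ev d) \<noteq> 0 \<Longrightarrow> Poly_Mapping.keys d \<inter> U l \<noteq> {}"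
    by metis
  have "\<exists>h. continuous_map T euclideanreal h \<and> \<bar>h (ev (c l))\<bar> \<ge> 1 \<and>
      (\<forall>d. Poly_Mapping.keys d \<subseteq> topspace X \<longrightarrow> h (ev d) \<noteq> 0 \<longrightarrow> Poly_Mapping.keys d \<inter> V l \<noteq> {})" if "l \<in> I" for l
    using detect[OF that v(1)[OF that] v(2)[OF that] v(3)[OF that]] .
  then obtain k where k: "\<And>l. l \<in> I \<Longrightarrow> continuous_map T euclideanreal (k l)" "\<And>l. l \<in> I \<Longrightarrow> \<bar>k l (ev (c l))\<bar> \<ge> 1"
    "\<And>l d. l \<in> I \<Longrightarrow> Poly_Mapping.keys d \<subseteq> topspace X \<Longrightarrow> k l (ev d) \<noteq> 0 \<Longrightarrow> Poly_Mapping.keys d \<inter> V l \<noteq> {}"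
    by metis
  define Z where "Z = (\<lambda>l. {g \<in> carrier A. h l g \<noteq> 0 \<and> k l g \<noteq> 0})"
  define f where "f = (\<lambda>l g. min \<bar>h l g\<bar> \<bar>k l g\<bar>)"
  have cf: "compact_finite ?Y I Z"
    unfolding compact_finite_def
  proof (intro strip)
    fix L assume "compactin ?Y L"
    then have L: "compactin T L"
      by (simp add: level_eq compactin_subtopology)
    obtain B where B: "compactin X B"
      "\<And>d. Poly_Mapping.keys d \<subseteq> topspace X \<Longrightarrow> ev d \<in> L \<Longrightarrow> Poly_Mapping.keys d \<subseteq> B"
      using compact_support[OF L] by blast
    have "{l \<in> I. Z l \<inter> L \<noteq> {}} \<subseteq> {l \<in> I. U l \<inter> B \<noteq> {} \<and> V l \<inter> B \<noteq> {}}"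
    proof
      fix l assume "l \<in> {l \<in> I. Z l \<inter> L \<noteq> {}}"
      then obtain g where g: "l \<in> I" "g \<in> L" "g \<in> carrier A" "h l g \<noteq> 0" "k l g \<noteq> 0"
        unfolding Z_def by blast
      then obtain d where d: "Poly_Mapping.keys d \<subseteq> topspace X" "g = ev d"
        using ev_surj by blast
      then show "l \<in> {l \<in> I. U l \<inter> B \<noteq> {} \<and> V l \<inter> B \<noteq> {}}"
        using h(3)[of l d] k(3)[of l d] g B(2)[of d] by blast
    qed
    then show "finite {l \<in> I. Z l \<inter> L \<noteq> {}}"
      using fin[OF B(1)] finite_subset by blast
  qed
  have evp: "ev p \<in> topspace ?Y"
    using ev_in_level p by blast
  \<comment> \<open>\<open>\<phi>\<close> must vanish at \<open>ev p\<close>, so the finitely many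
    terms that do not are dropped. Their words are then excluded by removing a finite set from the
    neighbourhood of \<open>ev p\<close>.\<close>
  define F where "F = {l \<in> I. Z l \<inter> {ev p} \<noteq> {}}"
  have finF: "finite F"
    unfolding F_def by (rule compact_finiteD[OF cf]) (use evp in auto)
  define \<phi> where "\<phi> = (\<lambda>g. \<Sum>l\<in>{l \<in> I - F. g \<in> Z l}. f l g)"
  have cf': "compact_finite ?Y (I - F) Z"
    by (rule compact_finite_subset[OF cf]) auto
  have cont_f: "continuous_map ?Y euclideanreal (f l)" if "l \<in> I" for l
    unfolding f_def level_eq
    by (intro continuous_intros continuous_map_from_subtopology h k that)
  have "continuous_map ?Y euclideanreal \<phi>"
  proof -
    have "continuous_map (subtopology ?Y L) euclideanreal \<phi>" if "compactin ?Y L" for L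
      unfolding \<phi>_def
    proof (rule continuous_map_compact_finite_sum[OF cf' _ _ that])
      fix l g assume "l \<in> I - F" "g \<in> topspace ?Y" "g \<notin> Z l"
      then show "f l g = 0"
        unfolding f_def Z_def using topspace_T by (auto simp: level_eq)
    qed (use cont_f in auto)
    then show ?thesis
      using kR unfolding kR_space_def by blast
  qed
  then have open1: "openin ?Y {g \<in> topspace ?Y. \<phi> g \<in> {..<1}}"
    by (rule openin_continuous_map_preimage) auto
  have "closedin T (ev ` c ` F)"
    using Hausdorff_T finF c ev_closed topspace_T unfolding F_def
    by (intro closedin_Hausdorff_finite) auto
  then have open2: "openin T (topspace T - ev ` c ` F)"
    by blast
  obtain N where N: "openin T N" "{g \<in> topspace ?Y. \<phi> g \<in> {..<1}} = N \<inter> topspace ?Y"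
    using open1 unfolding level_eq openin_subtopology topspace_subtopology
    by (metis (no_types, lifting) Int_assoc inf.absorb2 openin_subset inf_commute)
  have "\<phi> (ev p) = 0"
    unfolding \<phi>_def F_def by (rule sum.neutral) auto
  then have "ev p \<in> {g \<in> topspace ?Y. \<phi> g \<in> {..<1}}"
    using evp by simp
  then have "ev p \<in> N"
    unfolding N(2) by (rule IntD1)
  moreover have "ev p \<notin> ev ` c ` F"
  proof
    assume "ev p \<in> ev ` c ` F"
    then obtain l where "l \<in> I" "ev (c l) = ev p"
      unfolding F_def by auto
    then show False
      using ev_inj[OF c(1)[of l] p(1)] p(3)[of l] by simp
  qed
  moreover have "ev p \<in> topspace T"
    using ev_closed[OF p(1)] topspace_T by simp
  ultimately have "ev p \<in> N \<inter> (topspace T - ev ` c ` F)"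
    by simp
  then have "\<exists>l\<in>I. ev (c l) \<in> N \<inter> (topspace T - ev ` c ` F)"
    by (intro cluster openin_Int N(1) open2)
  then obtain l where l: "l \<in> I" "ev (c l) \<in> N \<inter> (topspace T - ev ` c ` F)"
    by (elim bexE)
  then have lF: "l \<notin> F"
    by auto
  have evl: "ev (c l) \<in> topspace ?Y"
    using ev_in_level c l by blast
  then have "ev (c l) \<in> {g \<in> topspace ?Y. \<phi> g \<in> {..<1}}"
    unfolding N(2) using l(2) by simp
  then have "\<phi> (ev (c l)) < 1"
    by simp
  moreover have "\<phi> (ev (c l)) \<ge> 1"
  proof -
    have fin': "finite {l' \<in> I - F. ev (c l) \<in> Z l'}"
      using compact_finiteD[OF cf', of "{ev (c l)}"] evl by auto
    have "ev (c l) \<in> Z l"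
      unfolding Z_def using h(2)[OF l(1)] k(2)[OF l(1)] ev_closed[OF c(1)[OF l(1)]] by auto
    then have "f l (ev (c l)) \<le> \<phi> (ev (c l))"
      unfolding \<phi>_def using l lF fin' by (intro member_le_sum) (auto simp: f_def)
    then show ?thesis
      using h(2)[OF l(1)] k(2)[OF l(1)] unfolding f_def by linarith
  qed
  ultimately show False
    by linarith
qed

end

section \<open>A sufficient condition for \<open>A\<^sub>3(X)\<close> to be a k-space\<close>

text \<open>The homomorphism that sends every letter to 1. It is continuous and integer-valued, so
  it is constant near each word.\<close>

definition frag_degree :: "('a \<Rightarrow>\<^sub>0 int) \<Rightarrow> int" where
  "frag_degree c = (\<Sum>x\<in>Poly_Mapping.keys c. Poly_Mapping.lookup c x)"

text \<open>The coefficient 0 is used as well, so that words of length less than 3 are also sums of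
  three letters.\<close>

abbreviation letter :: "int \<Rightarrow> 'a \<Rightarrow> ('a \<Rightarrow>\<^sub>0 int)" where
  "letter e x \<equiv> frag_cmul e (frag_of x)"

section \<open>Length and degree of words\<close>

lemma frag_length_superset:
  "finite K \<Longrightarrow> Poly_Mapping.keys c \<subseteq> K \<Longrightarrow> frag_length c = (\<Sum>x\<in>K. nat \<bar>Poly_Mapping.lookup c x\<bar>)"
  unfolding frag_length_def by (rule sum.mono_neutral_left) (auto simp: in_keys_iff)

lemma frag_sum_superset:
  fixes f :: "'a \<Rightarrow> 'v::real_normed_vector"
  shows "finite K \<Longrightarrow> Poly_Mapping.keys c \<subseteq> K \<Longrightarrow>
    (\<Sum>x\<in>Poly_Mapping.keys c. of_int (Poly_Mapping.lookup c x) *\<^sub>R f x) =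
    (\<Sum>x\<in>K. of_int (Poly_Mapping.lookup c x) *\<^sub>R f x)"
  by (rule sum.mono_neutral_left) (auto simp: in_keys_iff)

lemma frag_sum_add:
  fixes f :: "'a \<Rightarrow> 'v::real_normed_vector"
  shows "(\<Sum>x\<in>Poly_Mapping.keys (c + d). of_int (Poly_Mapping.lookup (c + d) x) *\<^sub>R f x) =
    (\<Sum>x\<in>Poly_Mapping.keys c. of_int (Poly_Mapping.lookup c x) *\<^sub>R f x) +
    (\<Sum>x\<in>Poly_Mapping.keys d. of_int (Poly_Mapping.lookup d x) *\<^sub>R f x)"
proof -
  let ?K = "Poly_Mapping.keys c \<union> Poly_Mapping.keys d"
  have "finite ?K" "Poly_Mapping.keys (c + d) \<subseteq> ?K"
    using keys_add[of c d] by auto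
  from frag_sum_superset[OF this, of f] frag_sum_superset[of ?K c f] frag_sum_superset[of ?K d f]
  show ?thesis
    by (simp add: lookup_add algebra_simps sum.distrib)
qed

lemma frag_sum_letter:
  fixes f :: "'a \<Rightarrow> 'v::real_normed_vector"
  shows "(\<Sum>x\<in>Poly_Mapping.keys (letter e w). of_int (Poly_Mapping.lookup (letter e w) x) *\<^sub>R f x) = of_int e *\<^sub>R f w"
proof -
  have "finite {w}" "Poly_Mapping.keys (letter e w) \<subseteq> {w}"
    using keys_cmul[of e "frag_of w"] by auto
  from frag_sum_superset[OF this, of f] show ?thesis
    by simp
qed

lemma frag_degree_eq: "real_of_int (frag_degree c) = (\<Sum>x\<in>Poly_Mapping.keys c. of_int (Poly_Mapping.lookup c x) *\<^sub>R 1)"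
  by (simp add: frag_degree_def)

lemma frag_degree_add: "frag_degree (c + d) = frag_degree c + frag_degree d"
proof -
  have "real_of_int (frag_degree (c + d)) = real_of_int (frag_degree c + frag_degree d)"
    unfolding of_int_add frag_degree_eq by (rule frag_sum_add)
  then show ?thesis
    by linarith
qed

lemma frag_degree_letter: "frag_degree (letter e x) = e"
proof -
  have "real_of_int (frag_degree (letter e x)) = real_of_int e *\<^sub>R 1"
    unfolding frag_degree_eq by (rule frag_sum_letter)
  then show ?thesis
    by simp
qed

lemma frag_length_add: "frag_length (c + d) \<le> frag_length c + frag_length d"
proof -
  let ?K = "Poly_Mapping.keys c \<union> Poly_Mapping.keys d"
  have "finite ?K" "Poly_Mapping.keys (c + d) \<subseteq> ?K"
    using keys_add[of c d] by auto
  then have "frag_length (c + d) = (\<Sum>x\<in>?K. nat \<bar>Poly_Mapping.lookup (c + d) x\<bar>)"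
    by (rule frag_length_superset)
  also have "\<dots> \<le> (\<Sum>x\<in>?K. nat \<bar>Poly_Mapping.lookup c x\<bar> + nat \<bar>Poly_Mapping.lookup d x\<bar>)"
    by (rule sum_mono) (auto simp: lookup_add)
  also have "\<dots> = frag_length c + frag_length d"
    using frag_length_superset[of ?K c] frag_length_superset[of ?K d] by (simp add: sum.distrib)
  finally show ?thesis .
qed

lemma frag_length_letter: "frag_length (letter e x) = nat \<bar>e\<bar>"
proof -
  have "finite {x}" "Poly_Mapping.keys (letter e x) \<subseteq> {x}"
    using keys_cmul[of e "frag_of x"] by auto
  from frag_length_superset[OF this] show ?thesis
    by simp
qed

lemma frag_length_eq_0_iff: "frag_length c = 0 \<longleftrightarrow> c = 0"
proof
  assume "frag_length c = 0"
  then have "\<forall>x\<in>Poly_Mapping.keys c. Poly_Mapping.lookup c x = 0"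
    by (auto simp: frag_length_def)
  then show "c = 0"
    by (intro poly_mapping_eqI) (auto simp: in_keys_iff)
qed (simp add: frag_length_def)

lemma remove_letter:
  assumes e: "e \<in> {1, -1}" and w: "e * Poly_Mapping.lookup c w \<ge> 1"
  shows "frag_length c = Suc (frag_length (c - letter e w))"
    and "Poly_Mapping.keys (c - letter e w) \<subseteq> Poly_Mapping.keys c"
proof -
  have wk: "w \<in> Poly_Mapping.keys c"
    using w by (auto simp: in_keys_iff)
  have lookup: "Poly_Mapping.lookup (c - letter e w) x = (if x = w then Poly_Mapping.lookup c w - e else Poly_Mapping.lookup c x)" for x
    by (simp add: lookup_minus)
  show sub: "Poly_Mapping.keys (c - letter e w) \<subseteq> Poly_Mapping.keys c"
    using wk by (auto simp: in_keys_iff[of _ "c - letter e w"] lookup in_keys_iff[of _ c] split: if_splits)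
  have eq: "(\<Sum>x\<in>Poly_Mapping.keys c - {w}. nat \<bar>Poly_Mapping.lookup (c - letter e w) x\<bar>)
    = (\<Sum>x\<in>Poly_Mapping.keys c - {w}. nat \<bar>Poly_Mapping.lookup c x\<bar>)"
    by (rule sum.cong) (auto simp: lookup)
  have one: "nat \<bar>Poly_Mapping.lookup c w\<bar> = Suc (nat \<bar>Poly_Mapping.lookup c w - e\<bar>)"
    using e w by auto
  show "frag_length c = Suc (frag_length (c - letter e w))"
    unfolding frag_length_superset[OF finite_keys sub] frag_length_superset[OF finite_keys subset_refl, of c]
      sum.remove[OF finite_keys wk] eq lookup one by simp
qed

text \<open>A non-zero word of degree 0 has a letter of each sign. Removing one of each lowers the
  length by 2 and leaves a word of degree 0 and length at most 1, which must be 0, as otherwise its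
  length could be lowered by 2 again.\<close>

lemma frag_degree_0_cases:
  assumes "frag_degree c = 0" "frag_length c \<le> 3"
  shows "c = 0 \<or> (frag_length c \<ge> 2 \<and> (\<exists>y\<in>Poly_Mapping.keys c. \<exists>z\<in>Poly_Mapping.keys c. c = letter 1 y + letter (-1) z))"
proof -
  have step: "\<exists>y\<in>Poly_Mapping.keys d. \<exists>z\<in>Poly_Mapping.keys d. frag_length d = frag_length (d - letter 1 y - letter (-1) z) + 2"
    if d: "d \<noteq> 0" "frag_degree d = 0" for d :: "'a \<Rightarrow>\<^sub>0 int"
  proof -
    have ex: "\<exists>y\<in>Poly_Mapping.keys d. e * Poly_Mapping.lookup d y \<ge> 1" if "e \<in> {1, -1}" for e
    proof (rule ccontr)
      assume neg: "\<not> ?thesis"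
      have "(\<Sum>x\<in>Poly_Mapping.keys d. e * Poly_Mapping.lookup d x) = 0"
        using d(2) by (simp add: frag_degree_def sum_distrib_left[symmetric])
      moreover have "e * Poly_Mapping.lookup d x < 0" if "x \<in> Poly_Mapping.keys d" for x
      proof -
        have "\<not> e * Poly_Mapping.lookup d x \<ge> 1" "e * Poly_Mapping.lookup d x \<noteq> 0"
          using neg that \<open>e \<in> {1, -1}\<close> by (auto simp: in_keys_iff)
        then show ?thesis
          by linarith
      qed
      moreover have "Poly_Mapping.keys d \<noteq> {}"
        using d(1) by simp
      ultimately show False
        using sum_strict_mono[OF finite_keys, of d "\<lambda>x. e * Poly_Mapping.lookup d x" "\<lambda>x. 0"] by simp
    qed
    obtain y where y: "y \<in> Poly_Mapping.keys d" "1 * Poly_Mapping.lookup d y \<ge> 1"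
      using ex[of 1] by auto
    obtain z where z: "z \<in> Poly_Mapping.keys d" "(-1) * Poly_Mapping.lookup d z \<ge> 1"
      using ex[of "-1"] by auto
    have "y \<noteq> z"
      using y z by auto
    then have "(-1) * Poly_Mapping.lookup (d - letter 1 y) z \<ge> 1"
      using z by (simp add: lookup_minus)
    from remove_letter(1)[OF _ this] remove_letter(1)[OF _ y(2)]
    have "frag_length d = frag_length (d - letter 1 y - letter (-1) z) + 2"
      by simp
    then show ?thesis
      using y z by blast
  qed
  show ?thesis
  proof (cases "c = 0")
    case False
    then obtain y z where yz: "y \<in> Poly_Mapping.keys c" "z \<in> Poly_Mapping.keys c"
      "frag_length c = frag_length (c - letter 1 y - letter (-1) z) + 2"
      using step assms by blast
    let ?d = "c - letter 1 y - letter (-1) z"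
    have "frag_degree c = frag_degree (?d + (letter 1 y + letter (-1) z))"
      by simp
    then have "frag_degree ?d = 0"
      using assms(1) unfolding frag_degree_add frag_degree_letter by simp
    then have "?d = 0"
      using step[of ?d] yz(3) assms(2) by fastforce
    then have "c = letter 1 y + letter (-1) z"
      by (simp add: algebra_simps)
    then show ?thesis
      using yz by auto
  qed simp
qed

section \<open>Spelling words with signed letters\<close>

fun signed_word :: "int list \<Rightarrow> 'a list \<Rightarrow> ('a \<Rightarrow>\<^sub>0 int)" where
  "signed_word (e # es) (x # xs) = letter e x + signed_word es xs"
| "signed_word _ _ = 0"

lemma frag_degree_signed_word: "length es = length xs \<Longrightarrow> frag_degree (signed_word es xs) = sum_list es"
  by (induction es xs rule: list_induct2) (auto simp: frag_degree_add frag_degree_letter, simp add: frag_degree_def)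

text \<open>The letters are taken off one at a time. Since the sets \<open>V x\<close> are disjoint,
  taking off a letter in \<open>V x\<close> changes no other sum and lowers its own by 1, just as
  the count of \<open>x\<close> in the list drops by 1. The fixed set \<open>K\<close> keeps the
  range of summation unchanged while \<open>c\<close> loses letters.\<close>

lemma extract_word:
  assumes "finite K" and disj: "\<And>x y. x \<in> set xs \<Longrightarrow> y \<in> set xs \<Longrightarrow> x \<noteq> y \<Longrightarrow> V x \<inter> V y = {}"
    and s: "\<And>x. x \<in> set xs \<Longrightarrow> s x \<in> {1, -1}"
    and "Poly_Mapping.keys c \<subseteq> K"
    and "\<And>x. x \<in> set xs \<Longrightarrow> int (count_list xs x) \<le> (\<Sum>w\<in>K \<inter> V x. max 0 (s x * Poly_Mapping.lookup c w))"
  shows "\<exists>ws r. list_all2 (\<lambda>x w. w \<in> V x \<and> w \<in> Poly_Mapping.keys c) xs ws \<and> c = signed_word (map s xs) ws + r \<and>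
    frag_length c = length xs + frag_length r \<and> Poly_Mapping.keys r \<subseteq> Poly_Mapping.keys c"
  using assms
proof (induction xs arbitrary: c)
  case Nil
  then show ?case
    by auto
next
  case (Cons x xs)
  have "1 \<le> (\<Sum>w\<in>K \<inter> V x. max 0 (s x * Poly_Mapping.lookup c w))"
    using Cons.prems(5)[of x] by simp
  then have "\<exists>w\<in>K \<inter> V x. max 0 (s x * Poly_Mapping.lookup c w) > 0"
    using sum_nonpos[of "K \<inter> V x" "\<lambda>w. max 0 (s x * Poly_Mapping.lookup c w)"]
    by (meson leD less_le_trans not_le zero_less_one)
  then obtain w where w: "w \<in> K" "w \<in> V x" "s x * Poly_Mapping.lookup c w \<ge> 1"
    by (auto simp: max_def split: if_splits)
  have sx: "s x \<in> {1, -1}"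
    using Cons.prems(3) by simp
  have wk: "w \<in> Poly_Mapping.keys c"
    using w by (auto simp: in_keys_iff)
  let ?d = "c - letter (s x) w"
  have lookup: "Poly_Mapping.lookup ?d v = (if v = w then Poly_Mapping.lookup c w - s x else Poly_Mapping.lookup c v)" for v
    by (simp add: lookup_minus)
  note rl = remove_letter[OF sx w(3)]
  have "int (count_list xs y) \<le> (\<Sum>v\<in>K \<inter> V y. max 0 (s y * Poly_Mapping.lookup ?d v))" if y: "y \<in> set xs" for y
  proof (cases "y = x")
    case False
    then have "w \<notin> V y"
      using Cons.prems(2)[of x y] y w by auto
    then have "(\<Sum>v\<in>K \<inter> V y. max 0 (s y * Poly_Mapping.lookup ?d v)) = (\<Sum>v\<in>K \<inter> V y. max 0 (s y * Poly_Mapping.lookup c v))"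
      by (intro sum.cong) (auto simp: lookup)
    then show ?thesis
      using Cons.prems(5)[of y] False y by simp
  next
    case True
    have fin: "finite (K \<inter> V x)" "w \<in> K \<inter> V x"
      using Cons.prems(1) w by auto
    have "(\<Sum>v\<in>K \<inter> V x - {w}. max 0 (s x * Poly_Mapping.lookup ?d v)) = (\<Sum>v\<in>K \<inter> V x - {w}. max 0 (s x * Poly_Mapping.lookup c v))"
      by (intro sum.cong) (auto simp: lookup)
    moreover have "max 0 (s x * Poly_Mapping.lookup ?d w) = max 0 (s x * Poly_Mapping.lookup c w) - 1"
      using w(3) sx unfolding lookup by auto
    ultimately have "(\<Sum>v\<in>K \<inter> V x. max 0 (s x * Poly_Mapping.lookup ?d v)) = (\<Sum>v\<in>K \<inter> V x. max 0 (s x * Poly_Mapping.lookup c v)) - 1"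
      by (simp add: sum.remove[OF fin])
    then show ?thesis
      using Cons.prems(5)[of x] True by simp
  qed
  then have "\<exists>ws r. list_all2 (\<lambda>x w. w \<in> V x \<and> w \<in> Poly_Mapping.keys ?d) xs ws \<and> ?d = signed_word (map s xs) ws + r \<and>
    frag_length ?d = length xs + frag_length r \<and> Poly_Mapping.keys r \<subseteq> Poly_Mapping.keys ?d"
    using rl(2) Cons.prems(1-4) by (intro Cons.IH) auto
  then obtain ws r where r: "list_all2 (\<lambda>x w. w \<in> V x \<and> w \<in> Poly_Mapping.keys ?d) xs ws" "?d = signed_word (map s xs) ws + r"
    "frag_length ?d = length xs + frag_length r" "Poly_Mapping.keys r \<subseteq> Poly_Mapping.keys ?d"
    by blast
  have "list_all2 (\<lambda>x w. w \<in> V x \<and> w \<in> Poly_Mapping.keys c) xs ws"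
    by (rule list_all2_mono[OF r(1)]) (use rl(2) in blast)
  moreover have "c = letter (s x) w + signed_word (map s xs) ws + r"
    using r(2) by (simp add: algebra_simps)
  ultimately show ?case
    using r(3,4) rl w(2) wk by (intro exI[of _ "w # ws"] exI[of _ r]) auto
qed

text \<open>This is \<open>extract_word\<close> for \<open>c\<close> itself with
  \<open>V x = {x}\<close>: the letters taken off already have the full length of \<open>c\<close>,
  so nothing remains.\<close>

lemma spelling:
  obtains xs where "set xs = Poly_Mapping.keys c" "\<And>x. int (count_list xs x) = \<bar>Poly_Mapping.lookup c x\<bar>"
    "length xs = frag_length c" "c = signed_word (map (\<lambda>x. sgn (Poly_Mapping.lookup c x)) xs) xs"
proof -
  have "\<exists>xs. \<forall>x. count_list xs x = (if x \<in> K then nat \<bar>Poly_Mapping.lookup c x\<bar> else 0)" if "finite K" for K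
    using that
  proof (induction K rule: finite_induct)
    case empty
    then show ?case
      by (intro exI[of _ "[]"]) simp
  next
    case (insert a K)
    then obtain xs where xs: "\<And>x. count_list xs x = (if x \<in> K then nat \<bar>Poly_Mapping.lookup c x\<bar> else 0)"
      by blast
    have "count_list (replicate n a) x = (if x = a then n else 0)" for n x
      by (induction n) auto
    then show ?case
      using insert.hyps(2)
      by (intro exI[of _ "replicate (nat \<bar>Poly_Mapping.lookup c a\<bar>) a @ xs"]) (auto simp: xs)
  qed
  from this[OF finite_keys[of c]] obtain xs where "\<And>x. count_list xs x = (if x \<in> Poly_Mapping.keys c then nat \<bar>Poly_Mapping.lookup c x\<bar> else 0)"
    by blast
  then have count: "count_list xs x = nat \<bar>Poly_Mapping.lookup c x\<bar>" for x
    by (simp add: in_keys_iff)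
  have set: "set xs = Poly_Mapping.keys c"
    using count count_list_0_iff[of xs] by (auto simp: in_keys_iff)
  have len: "length xs = frag_length c"
    using sum_count_set[of xs "Poly_Mapping.keys c"] set by (simp add: frag_length_def count)
  let ?s = "\<lambda>x. sgn (Poly_Mapping.lookup c x)"
  have "\<exists>ws r. list_all2 (\<lambda>x w. w \<in> {x} \<and> w \<in> Poly_Mapping.keys c) xs ws \<and> c = signed_word (map ?s xs) ws + r \<and>
    frag_length c = length xs + frag_length r \<and> Poly_Mapping.keys r \<subseteq> Poly_Mapping.keys c"
  proof (rule extract_word[OF finite_keys])
    fix x assume "x \<in> set xs"
    then have x: "x \<in> Poly_Mapping.keys c"
      by (simp add: set)
    then show "?s x \<in> {1, -1}"
      by (auto simp: in_keys_iff sgn_if)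
    have "Poly_Mapping.keys c \<inter> {x} = {x}"
      using x by blast
    then show "int (count_list xs x) \<le> (\<Sum>w\<in>Poly_Mapping.keys c \<inter> {x}. max 0 (?s x * Poly_Mapping.lookup c w))"
      by (simp add: count abs_sgn mult.commute)
  qed auto
  then obtain ws r where ws: "list_all2 (\<lambda>x w. w \<in> {x} \<and> w \<in> Poly_Mapping.keys c) xs ws" "c = signed_word (map ?s xs) ws + r"
    "frag_length c = length xs + frag_length r"
    by blast
  have "list_all2 (=) xs ws"
    by (rule list_all2_mono[OF ws(1)]) auto
  then have "ws = xs"
    by (simp add: list_all2_eq[symmetric] list.rel_eq)
  moreover have "r = 0"
    using ws(3) len frag_length_eq_0_iff[of r] by simp
  ultimately have "c = signed_word (map ?s xs) xs"
    using ws(2) by simp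
  then show thesis
    using that set len count by simp
qed

text \<open>Some member attains the value 1 at each point, instead of the sum being 1. Hence if the
  values at \<open>y\<close> and \<open>z\<close> differ by less than 1 for every member, a member
  that is 1 at \<open>y\<close> is non-zero at \<open>z\<close>.\<close>

definition partition_family :: "'a topology \<Rightarrow> ('a \<Rightarrow> real) set \<Rightarrow> bool" where
  "partition_family X Q \<longleftrightarrow>
    (\<forall>q\<in>Q. continuous_map X euclideanreal q \<and> (\<forall>y\<in>topspace X. 0 \<le> q y \<and> q y \<le> 1)) \<and>
    (\<forall>y\<in>topspace X. \<exists>q\<in>Q. q y = 1) \<and>
    compact_finite X Q (\<lambda>q. {y \<in> topspace X. q y \<noteq> 0})"

text \<open>The diagonal condition is imposed over a whole neighbourhood \<open>V\<close> because it
  will come from words \<open>v + y - y\<close>, which do not depend on \<open>y\<close>.\<close>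

definition tube_property :: "'a topology \<Rightarrow> bool" where
  "tube_property X \<longleftrightarrow>
    (\<forall>x V W. openin X V \<longrightarrow> x \<in> V \<longrightarrow> openin (prod_topology X (prod_topology X X)) W \<longrightarrow>
      (\<forall>v\<in>V. \<forall>y\<in>topspace X. (v, y, y) \<in> W) \<longrightarrow>
      (\<exists>V' Q. openin X V' \<and> x \<in> V' \<and> partition_family X Q \<and>
        (\<forall>v\<in>V'. \<forall>q\<in>Q. \<forall>y\<in>topspace X. \<forall>z\<in>topspace X. q y \<noteq> 0 \<longrightarrow> q z \<noteq> 0 \<longrightarrow> (v, y, z) \<in> W)))"

text \<open>\<open>F y\<close> is the family of the values \<open>q y\<close>. On the type
  \<open>discrete\<close> all functions are continuous, so \<open>\<Rightarrow>\<^sub>C\<close>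
  yields the space of all bounded functions with the supremum norm; coordinates outside
  \<open>Q\<close> are 0. On a compact set only finitely many coordinates are non-zero, which gives
  continuity.\<close>

lemma (in stratified_k_space) partition_embedding:
  assumes Q: "partition_family X Q"
  shows "\<exists>F :: 'a \<Rightarrow> ('a \<Rightarrow> real) discrete \<Rightarrow>\<^sub>C real. continuous_map X euclidean F \<and>
    (\<forall>y\<in>topspace X. \<forall>z\<in>topspace X. dist (F y) (F z) < 1 \<longrightarrow> (\<exists>q\<in>Q. q y \<noteq> 0 \<and> q z \<noteq> 0))"
proof -
  have q: "\<And>q. q \<in> Q \<Longrightarrow> continuous_map X euclideanreal q" "\<And>q y. q \<in> Q \<Longrightarrow> y \<in> topspace X \<Longrightarrow> 0 \<le> q y \<and> q y \<le> 1"
    and one: "\<And>y. y \<in> topspace X \<Longrightarrow> \<exists>q\<in>Q. q y = 1"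
    and cf: "compact_finite X Q (\<lambda>q. {y \<in> topspace X. q y \<noteq> 0})"
    using Q by (auto simp: partition_family_def)
  define f where "f = (\<lambda>y p. if y \<in> topspace X \<and> of_discrete p \<in> Q then of_discrete p y else 0)"
  have "f y \<in> bcontfun" for y
  proof (rule bcontfun_normI[where b = 1])
    show "continuous_on UNIV (f y)"
      by (rule continuous_on_open_vimage[THEN iffD2]) (auto simp: open_discrete)
    show "norm (f y p) \<le> 1" for p
      using q(2)[of "of_discrete p" y] by (simp add: f_def)
  qed
  define F where "F = (\<lambda>y. Bcontfun (f y))"
  have F: "apply_bcontfun (F y) = f y" for y
    using \<open>f y \<in> bcontfun\<close> by (simp add: F_def Bcontfun_inverse)
  have "continuous_map (subtopology X L) euclidean F" if L: "compactin X L" for L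
  proof -
    let ?J = "{q \<in> Q. {y \<in> topspace X. q y \<noteq> 0} \<inter> L \<noteq> {}}"
    have fin: "finite ?J"
      using cf L compact_finiteD by blast
    have "\<exists>U. openin (subtopology X L) U \<and> y \<in> U \<and> (\<forall>z\<in>U. F z \<in> Met_TC.mball (F y) \<epsilon>)"
      if y: "y \<in> topspace (subtopology X L)" and e: "\<epsilon> > 0" for y \<epsilon>
    proof -
      let ?U = "{z \<in> topspace (subtopology X L). (\<Sum>q\<in>?J. \<bar>q z - q y\<bar>) \<in> {..<\<epsilon>/2}}"
      have "openin (subtopology X L) ?U"
      proof (rule openin_continuous_map_preimage[of _ euclideanreal])
        show "continuous_map (subtopology X L) euclideanreal (\<lambda>z. \<Sum>q\<in>?J. \<bar>q z - q y\<bar>)"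
          using fin q(1)
          by (intro continuous_map_sum continuous_map_real_abs continuous_map_diff continuous_map_from_subtopology) auto
      qed auto
      moreover have "y \<in> ?U"
        using y e by simp
      moreover have "F z \<in> Met_TC.mball (F y) \<epsilon>" if z: "z \<in> ?U" for z
      proof -
        have "dist (F y) (F z) \<le> \<epsilon>/2"
        proof (rule dist_bound)
          fix p
          show "dist (F y p) (F z p) \<le> \<epsilon>/2"
          proof (cases "of_discrete p \<in> ?J")
            case True
            then have "\<bar>of_discrete p z - of_discrete p y\<bar> \<le> (\<Sum>q\<in>?J. \<bar>q z - q y\<bar>)"
              using fin by (intro member_le_sum) auto
            then show ?thesis
              using z y True by (auto simp: F f_def dist_real_def abs_minus_commute)
          next
            case False
            then have "f y p = 0" "f z p = 0"
              using z y by (auto simp: f_def)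
            then show ?thesis
              using e by (simp add: F)
          qed
        qed
        then show ?thesis
          using e by simp
      qed
      ultimately show ?thesis
        by blast
    qed
    then have "continuous_map (subtopology X L) Met_TC.mtopology F"
      unfolding Met_TC.continuous_map_to_metric by blast
    then show ?thesis
      by simp
  qed
  then have "continuous_map X euclidean F"
    by (rule continuous_map_k)
  moreover have "\<exists>q\<in>Q. q y \<noteq> 0 \<and> q z \<noteq> 0" if yz: "y \<in> topspace X" "z \<in> topspace X" "dist (F y) (F z) < 1" for y z
  proof -
    obtain q where q: "q \<in> Q" "q y = 1"
      using one yz by blast
    have "dist (F y (discrete q)) (F z (discrete q)) < 1"
      using dist_bounded[of "F y" "discrete q" "F z"] yz(3) by linarith
    then have "dist (q y) (q z) < 1"
      using yz q by (simp add: F f_def discrete_inverse)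
    then have "q z \<noteq> 0"
      using q by (auto simp: dist_real_def)
    then show ?thesis
      using q by (intro bexI[of _ q]) auto
  qed
  ultimately show ?thesis
    by blast
qed

text \<open>Images of compact sets are compact, so a set with closed traces on compact sets has a
  preimage with closed traces. This moves the question from \<open>A_3(X)\<close>, which is not yet
  known to be a k-space, to the cube of \<open>X\<close>.\<close>

lemma k_space_closedin_preimage:
  assumes Z: "k_space Z" and g: "continuous_map Z Y g"
    and C: "\<And>K. compactin Y K \<Longrightarrow> closedin (subtopology Y K) (K \<inter> C)"
  shows "closedin Z {z \<in> topspace Z. g z \<in> C}"
proof -
  have "closedin (subtopology Z K) (K \<inter> {z \<in> topspace Z. g z \<in> C})" if K: "compactin Z K" for K
  proof -
    have "continuous_map (subtopology Z K) (subtopology Y (g ` K)) g"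
      using g by (auto simp: continuous_map_in_subtopology intro: continuous_map_from_subtopology)
    then have "closedin (subtopology Z K) {z \<in> topspace (subtopology Z K). g z \<in> g ` K \<inter> C}"
      using C[OF image_compactin[OF K g]] by (rule closedin_continuous_map_preimage)
    moreover have "{z \<in> topspace (subtopology Z K). g z \<in> g ` K \<inter> C} = K \<inter> {z \<in> topspace Z. g z \<in> C}"
      by auto
    ultimately show ?thesis
      by simp
  qed
  then show ?thesis
    by (intro Z[unfolded k_space, rule_format] conjI allI impI) auto
qed

section \<open>Neighbourhoods of a word\<close>

context free_abelian
begin

lemma continuous_letter:
  assumes "e \<in> {-1, 0, 1}"
  shows "continuous_map X T (\<lambda>x. ev (letter e x))"
proof -
  consider "e = 0" | "e = 1" | "e = -1"
    using assms by blast
  then show ?thesis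
  proof cases
    case 1
    then show ?thesis
      by (simp add: ev_zero topspace_T)
  next
    case 2
    have "continuous_map X T (\<lambda>x. ev (frag_of x))"
      by (rule continuous_map_eq[OF continuous_i]) (simp add: ev_frag_of)
    then show ?thesis
      using 2 by simp
  next
    case 3
    have "continuous_map X T ((\<lambda>x. inv\<^bsub>A\<^esub> x) \<circ> i)"
      using continuous_i continuous_inv by (rule continuous_map_compose)
    then have "continuous_map X T (\<lambda>x. ev (- frag_of x))"
      by (rule continuous_map_eq) (simp add: ev_minus ev_frag_of)
    then show ?thesis
      using 3 by simp
  qed
qed

lemma keys_letter: "x \<in> topspace X \<Longrightarrow> Poly_Mapping.keys (letter e x) \<subseteq> topspace X"
  using keys_cmul[of e "frag_of x"] by auto

lemma keys_add_subset:
  "Poly_Mapping.keys c \<subseteq> S \<Longrightarrow> Poly_Mapping.keys d \<subseteq> S \<Longrightarrow> Poly_Mapping.keys (c + d) \<subseteq> S"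
  using keys_add[of c d] by blast

lemma continuous_ev_add:
  assumes "continuous_map Z T (\<lambda>z. ev (c z))" "continuous_map Z T (\<lambda>z. ev (d z))"
    and "\<And>z. z \<in> topspace Z \<Longrightarrow> Poly_Mapping.keys (c z) \<subseteq> topspace X"
    and "\<And>z. z \<in> topspace Z \<Longrightarrow> Poly_Mapping.keys (d z) \<subseteq> topspace X"
  shows "continuous_map Z T (\<lambda>z. ev (c z + d z))"
proof -
  have "continuous_map Z T ((\<lambda>(x, y). x \<otimes>\<^bsub>A\<^esub> y) \<circ> (\<lambda>z. (ev (c z), ev (d z))))"
    by (rule continuous_map_compose[OF _ continuous_mult]) (simp add: continuous_map_pairedI assms(1,2))
  then show ?thesis
    by (rule continuous_map_eq) (simp add: ev_add assms(3,4))
qed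

lemma continuous_three_letters:
  assumes "e1 \<in> {-1, 0, 1}" "e2 \<in> {-1, 0, 1}" "e3 \<in> {-1, 0, 1}"
  shows "continuous_map (prod_topology X (prod_topology X X)) T
    (\<lambda>(x, y, z). ev (letter e1 x + letter e2 y + letter e3 z))"
proof -
  have "continuous_map (prod_topology X (prod_topology X X)) T (\<lambda>w. ev (letter e1 (fst w)))"
    using continuous_map_compose[OF continuous_map_fst continuous_letter[OF assms(1)]] by (simp add: o_def)
  moreover have "continuous_map (prod_topology X (prod_topology X X)) T (\<lambda>w. ev (letter e2 (fst (snd w))))"
    using continuous_map_compose[OF continuous_map_compose[OF continuous_map_snd continuous_map_fst] continuous_letter[OF assms(2)]]
    by (simp add: o_def)
  moreover have "continuous_map (prod_topology X (prod_topology X X)) T (\<lambda>w. ev (letter e3 (snd (snd w))))"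
    using continuous_map_compose[OF continuous_map_compose[OF continuous_map_snd continuous_map_snd] continuous_letter[OF assms(3)]]
    by (simp add: o_def)
  ultimately have "continuous_map (prod_topology X (prod_topology X X)) T
      (\<lambda>w. ev (letter e1 (fst w) + letter e2 (fst (snd w)) + letter e3 (snd (snd w))))"
    by (intro continuous_ev_add keys_add_subset keys_letter) auto
  then show ?thesis
    by (simp add: case_prod_unfold)
qed

lemma keys_three_letters:
  "x \<in> topspace X \<Longrightarrow> y \<in> topspace X \<Longrightarrow> z \<in> topspace X \<Longrightarrow>
    Poly_Mapping.keys (letter e1 x + letter e2 y + letter e3 z) \<subseteq> topspace X"
  by (intro keys_add_subset keys_letter)

text \<open>The homomorphism \<open>k\<close> that extends a function \<open>f\<close> supported in
  \<open>V x\<close> takes at \<open>c0\<close> the coefficient of \<open>x\<close> as its value. At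
  \<open>c\<close> its value, with the right sign, is at most the sum of the positive parts, because
  \<open>0 \<le> f \<le> 1\<close>. A neighbourhood of radius 1 makes that sum greater than the
  absolute coefficient minus 1, and integrality does the rest.\<close>

lemma near_word:
  assumes c0: "Poly_Mapping.keys c0 \<subseteq> topspace X"
    and V: "\<And>x. x \<in> Poly_Mapping.keys c0 \<Longrightarrow> openin X (V x) \<and> x \<in> V x"
  shows "\<exists>N. openin T N \<and> ev c0 \<in> N \<and> (\<forall>c. Poly_Mapping.keys c \<subseteq> topspace X \<longrightarrow> ev c \<in> N \<longrightarrow>
    frag_degree c = frag_degree c0 \<and>
    (\<forall>x\<in>Poly_Mapping.keys c0. \<bar>Poly_Mapping.lookup c0 x\<bar> \<le>
      (\<Sum>w\<in>Poly_Mapping.keys c \<inter> V x. max 0 (sgn (Poly_Mapping.lookup c0 x) * Poly_Mapping.lookup c w))))"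
proof -
  have near: "openin T {g \<in> topspace T. h g \<in> {r - 1<..<r + 1}}" if "continuous_map T euclideanreal h" for h r
    using that by (rule openin_continuous_map_preimage) auto
  have "continuous_map X euclideanreal (\<lambda>x. 1)"
    by simp
  from extend_real[OF this] obtain h where h: "continuous_map T euclideanreal h"
    and hev: "\<And>c. Poly_Mapping.keys c \<subseteq> topspace X \<Longrightarrow> h (ev c) = of_int (frag_degree c)"
    by (auto simp: frag_degree_def)
  let ?N = "{g \<in> topspace T. h g \<in> {of_int (frag_degree c0) - 1<..<of_int (frag_degree c0) + 1}}"
  have "\<exists>N. openin T N \<and> ev c0 \<in> N \<and> (\<forall>c. Poly_Mapping.keys c \<subseteq> topspace X \<longrightarrow> ev c \<in> N \<longrightarrow>
    \<bar>Poly_Mapping.lookup c0 x\<bar> \<le>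
      (\<Sum>w\<in>Poly_Mapping.keys c \<inter> V x. max 0 (sgn (Poly_Mapping.lookup c0 x) * Poly_Mapping.lookup c w)))"
    if x: "x \<in> Poly_Mapping.keys c0" for x
  proof -
    have "\<exists>f. continuous_map X euclideanreal f \<and> f x = 1 \<and> (\<forall>y\<in>topspace X. 0 \<le> f y \<and> f y \<le> 1)
      \<and> (\<forall>y\<in>topspace X. y \<notin> V x \<or> y \<in> Poly_Mapping.keys c0 - {x} \<longrightarrow> f y = 0)"
      by (rule separating_function) (use x c0 V[OF x] in auto)
    then obtain f where f: "continuous_map X euclideanreal f" "f x = 1"
      "\<And>y. y \<in> topspace X \<Longrightarrow> 0 \<le> f y \<and> f y \<le> 1"
      "\<And>y. y \<in> topspace X \<Longrightarrow> y \<notin> V x \<or> y \<in> Poly_Mapping.keys c0 - {x} \<Longrightarrow> f y = 0"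
      by blast
    obtain k where k: "continuous_map T euclideanreal k"
      and kev: "\<And>c. Poly_Mapping.keys c \<subseteq> topspace X \<Longrightarrow>
        k (ev c) = (\<Sum>x\<in>Poly_Mapping.keys c. of_int (Poly_Mapping.lookup c x) * f x)"
      using extend_real[OF f(1)] by blast
    let ?r = "Poly_Mapping.lookup c0 x"
    have "k (ev c0) = (\<Sum>y\<in>{x}. of_int (Poly_Mapping.lookup c0 y) * f y)"
      unfolding kev[OF c0]
    proof (rule sum.mono_neutral_right)
      show "\<forall>y\<in>Poly_Mapping.keys c0 - {x}. of_int (Poly_Mapping.lookup c0 y) * f y = 0"
        using f(4) c0 by auto
    qed (use x in auto)
    then have k0: "k (ev c0) = of_int ?r"
      using f(2) by simp
    let ?M = "{g \<in> topspace T. k g \<in> {of_int ?r - 1<..<of_int ?r + 1}}"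
    have "\<bar>?r\<bar> \<le> (\<Sum>w\<in>Poly_Mapping.keys c \<inter> V x. max 0 (sgn ?r * Poly_Mapping.lookup c w))"
      if c: "Poly_Mapping.keys c \<subseteq> topspace X" "ev c \<in> ?M" for c
    proof -
      have r0: "?r \<noteq> 0"
        using x by (simp add: in_keys_iff)
      have "of_int (sgn ?r) * k (ev c) = (\<Sum>w\<in>Poly_Mapping.keys c. of_int (sgn ?r * Poly_Mapping.lookup c w) * f w)"
        unfolding kev[OF c(1)] by (simp add: sum_distrib_left mult.assoc)
      also have "\<dots> = (\<Sum>w\<in>Poly_Mapping.keys c \<inter> V x. of_int (sgn ?r * Poly_Mapping.lookup c w) * f w)"
      proof (rule sum.mono_neutral_right)
        show "\<forall>w\<in>Poly_Mapping.keys c - Poly_Mapping.keys c \<inter> V x. of_int (sgn ?r * Poly_Mapping.lookup c w) * f w = 0"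
          using f(4) c(1) by auto
      qed auto
      also have "\<dots> \<le> (\<Sum>w\<in>Poly_Mapping.keys c \<inter> V x. of_int (max 0 (sgn ?r * Poly_Mapping.lookup c w)))"
      proof (rule sum_mono)
        fix w assume "w \<in> Poly_Mapping.keys c \<inter> V x"
        then have fw: "0 \<le> f w" "f w \<le> 1"
          using f(3) c(1) by auto
        let ?a = "real_of_int (sgn ?r * Poly_Mapping.lookup c w)"
        have "?a * f w \<le> max 0 ?a * f w"
          using fw by (intro mult_right_mono) auto
        also have "\<dots> \<le> max 0 ?a * 1"
          using fw by (intro mult_left_mono) auto
        also have "\<dots> = of_int (max 0 (sgn ?r * Poly_Mapping.lookup c w))"
          unfolding of_int_max by simp
        finally show "?a * f w \<le> of_int (max 0 (sgn ?r * Poly_Mapping.lookup c w))" .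
      qed
      finally have le: "of_int (sgn ?r) * k (ev c) \<le> of_int (\<Sum>w\<in>Poly_Mapping.keys c \<inter> V x. max 0 (sgn ?r * Poly_Mapping.lookup c w))"
        by simp
      have "of_int (sgn ?r) * k (ev c) > of_int \<bar>?r\<bar> - 1"
        using c(2) r0 by (cases "?r > 0") (auto simp: sgn_if)
      then have "real_of_int (\<bar>?r\<bar> - 1) < of_int (\<Sum>w\<in>Poly_Mapping.keys c \<inter> V x. max 0 (sgn ?r * Poly_Mapping.lookup c w))"
        using le by linarith
      then show ?thesis
        unfolding of_int_less_iff by linarith
    qed
    moreover have "ev c0 \<in> ?M"
      using k0 ev_closed[OF c0] topspace_T by auto
    ultimately show ?thesis
      using near[OF k, of "of_int ?r"] by blast
  qed
  then obtain M where M: "\<And>x. x \<in> Poly_Mapping.keys c0 \<Longrightarrow> openin T (M x)" "\<And>x. x \<in> Poly_Mapping.keys c0 \<Longrightarrow> ev c0 \<in> M x"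
    "\<And>x c. x \<in> Poly_Mapping.keys c0 \<Longrightarrow> Poly_Mapping.keys c \<subseteq> topspace X \<Longrightarrow> ev c \<in> M x \<Longrightarrow>
    \<bar>Poly_Mapping.lookup c0 x\<bar> \<le>
      (\<Sum>w\<in>Poly_Mapping.keys c \<inter> V x. max 0 (sgn (Poly_Mapping.lookup c0 x) * Poly_Mapping.lookup c w))"
    by metis
  have open_M: "openin T (?N \<inter> \<Inter>(insert (topspace T) (M ` Poly_Mapping.keys c0)))"
    by (intro openin_Int near h openin_Inter) (use M(1) in auto)
  have deg: "frag_degree c = frag_degree c0" if "Poly_Mapping.keys c \<subseteq> topspace X" "ev c \<in> ?N" for c
  proof -
    have "real_of_int (frag_degree c) \<in> {of_int (frag_degree c0) - 1<..<of_int (frag_degree c0) + 1}"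
      using that hev by simp
    then show ?thesis
      by simp
  qed
  let ?N' = "?N \<inter> \<Inter>(insert (topspace T) (M ` Poly_Mapping.keys c0))"
  have "ev c0 \<in> ?N'"
    using M(2) hev[OF c0] ev_closed[OF c0] topspace_T by auto
  moreover have "frag_degree c = frag_degree c0 \<and>
    (\<forall>x\<in>Poly_Mapping.keys c0. \<bar>Poly_Mapping.lookup c0 x\<bar> \<le>
      (\<Sum>w\<in>Poly_Mapping.keys c \<inter> V x. max 0 (sgn (Poly_Mapping.lookup c0 x) * Poly_Mapping.lookup c w)))"
    if c: "Poly_Mapping.keys c \<subseteq> topspace X" "ev c \<in> ?N'" for c
  proof (intro conjI ballI)
    show "frag_degree c = frag_degree c0"
      by (rule deg[OF c(1) IntD1[OF c(2)]])
    fix x assume x: "x \<in> Poly_Mapping.keys c0"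
    then have "ev c \<in> M x"
      using IntD2[OF c(2)] by simp
    then show "\<bar>Poly_Mapping.lookup c0 x\<bar> \<le>
      (\<Sum>w\<in>Poly_Mapping.keys c \<inter> V x. max 0 (sgn (Poly_Mapping.lookup c0 x) * Poly_Mapping.lookup c w))"
      by (rule M(3)[OF x c(1)])
  qed
  ultimately show ?thesis
    using open_M by (intro exI[of _ ?N']) simp
qed

text \<open>For disjoint neighbourhoods of the letters, \<open>near_word\<close> provides what
  \<open>extract_word\<close> needs. The extracted letters already have the degree of
  \<open>c0\<close>, which is that of \<open>c\<close>, so the remainder has degree 0.\<close>

lemma near_signed_word:
  assumes c0: "Poly_Mapping.keys c0 \<subseteq> topspace X"
    and V: "\<And>x. x \<in> Poly_Mapping.keys c0 \<Longrightarrow> openin X (V x) \<and> x \<in> V x"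
    and xs: "set xs = Poly_Mapping.keys c0" "\<And>x. int (count_list xs x) = \<bar>Poly_Mapping.lookup c0 x\<bar>"
      "c0 = signed_word (map (\<lambda>x. sgn (Poly_Mapping.lookup c0 x)) xs) xs"
  shows "\<exists>N. openin T N \<and> ev c0 \<in> N \<and> (\<forall>c. Poly_Mapping.keys c \<subseteq> topspace X \<longrightarrow> ev c \<in> N \<longrightarrow>
    (\<exists>ws r. list_all2 (\<lambda>x w. w \<in> V x \<and> w \<in> topspace X) xs ws \<and>
      c = signed_word (map (\<lambda>x. sgn (Poly_Mapping.lookup c0 x)) xs) ws + r \<and>
      frag_length c = length xs + frag_length r \<and> Poly_Mapping.keys r \<subseteq> topspace X \<and> frag_degree r = 0))"
proof -
  have "Hausdorff_space X"
    using tychonoff by (simp add: tychonoff_space_def)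
  have "\<exists>U. \<forall>x\<in>Poly_Mapping.keys c0. (openin X (U x) \<and> x \<in> U x) \<and> (\<forall>y\<in>Poly_Mapping.keys c0. x \<noteq> y \<longrightarrow> U x \<inter> U y = {})"
  proof -
    have "\<exists>P. openin X (fst P) \<and> openin X (snd P) \<and> x \<in> fst P \<and> y \<in> snd P \<and> fst P \<inter> snd P = {}"
      if "x \<in> Poly_Mapping.keys c0" "y \<in> Poly_Mapping.keys c0" "x \<noteq> y" for x y
      using \<open>Hausdorff_space X\<close> that c0 unfolding Hausdorff_space_def disjnt_def
      by (metis fst_conv snd_conv subsetD)
    then obtain P where P: "\<And>x y. x \<in> Poly_Mapping.keys c0 \<Longrightarrow> y \<in> Poly_Mapping.keys c0 \<Longrightarrow> x \<noteq> y \<Longrightarrow>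
      openin X (fst (P x y)) \<and> openin X (snd (P x y)) \<and> x \<in> fst (P x y) \<and> y \<in> snd (P x y) \<and> fst (P x y) \<inter> snd (P x y) = {}"
      by metis
    define U where "U = (\<lambda>x. topspace X \<inter> (\<Inter>y\<in>Poly_Mapping.keys c0 - {x}. fst (P x y) \<inter> snd (P y x)))"
    have "openin X (U x) \<and> x \<in> U x" if x: "x \<in> Poly_Mapping.keys c0" for x
    proof
      have "openin X (\<Inter>(insert (topspace X) ((\<lambda>y. fst (P x y) \<inter> snd (P y x)) ` (Poly_Mapping.keys c0 - {x}))))"
        by (intro openin_Inter) (use P x in auto)
      then show "openin X (U x)"
        by (simp add: U_def)
      show "x \<in> U x"
        unfolding U_def using P x c0 by auto
    qed
    moreover have "U x \<inter> U y = {}" if "x \<in> Poly_Mapping.keys c0" "y \<in> Poly_Mapping.keys c0" "x \<noteq> y" for x y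
      using P[OF that] that unfolding U_def by fastforce
    ultimately show ?thesis
      by (intro exI[of _ U]) auto
  qed
  then obtain U where U: "\<And>x. x \<in> Poly_Mapping.keys c0 \<Longrightarrow> openin X (U x) \<and> x \<in> U x"
    "\<And>x y. x \<in> Poly_Mapping.keys c0 \<Longrightarrow> y \<in> Poly_Mapping.keys c0 \<Longrightarrow> x \<noteq> y \<Longrightarrow> U x \<inter> U y = {}"
    by metis
  have UV: "openin X (U x \<inter> V x) \<and> x \<in> U x \<inter> V x" if "x \<in> Poly_Mapping.keys c0" for x
    using U(1)[OF that] V[OF that] by auto
  obtain N where N: "openin T N" "ev c0 \<in> N" and NN: "\<And>c. Poly_Mapping.keys c \<subseteq> topspace X \<Longrightarrow> ev c \<in> N \<Longrightarrow>
    frag_degree c = frag_degree c0 \<and>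
    (\<forall>x\<in>Poly_Mapping.keys c0. \<bar>Poly_Mapping.lookup c0 x\<bar> \<le>
      (\<Sum>w\<in>Poly_Mapping.keys c \<inter> (U x \<inter> V x). max 0 (sgn (Poly_Mapping.lookup c0 x) * Poly_Mapping.lookup c w)))"
    using near_word[OF c0, of "\<lambda>x. U x \<inter> V x"] UV by blast
  have "\<exists>ws r. list_all2 (\<lambda>x w. w \<in> V x \<and> w \<in> topspace X) xs ws \<and>
      c = signed_word (map (\<lambda>x. sgn (Poly_Mapping.lookup c0 x)) xs) ws + r \<and>
      frag_length c = length xs + frag_length r \<and> Poly_Mapping.keys r \<subseteq> topspace X \<and> frag_degree r = 0"
    if c: "Poly_Mapping.keys c \<subseteq> topspace X" "ev c \<in> N" for c
  proof -
    let ?s = "\<lambda>x. sgn (Poly_Mapping.lookup c0 x)"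
    have "\<exists>ws r. list_all2 (\<lambda>x w. w \<in> U x \<inter> V x \<and> w \<in> Poly_Mapping.keys c) xs ws \<and> c = signed_word (map ?s xs) ws + r \<and>
      frag_length c = length xs + frag_length r \<and> Poly_Mapping.keys r \<subseteq> Poly_Mapping.keys c"
    proof (rule extract_word[OF finite_keys])
      show "(U x \<inter> V x) \<inter> (U y \<inter> V y) = {}" if "x \<in> set xs" "y \<in> set xs" "x \<noteq> y" for x y
        using U(2)[of x y] that xs(1) by blast
      show "?s x \<in> {1, -1}" if "x \<in> set xs" for x
        using that xs(1) by (auto simp: in_keys_iff sgn_if)
      show "int (count_list xs x) \<le> (\<Sum>w\<in>Poly_Mapping.keys c \<inter> (U x \<inter> V x). max 0 (?s x * Poly_Mapping.lookup c w))"
        if "x \<in> set xs" for x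
        using NN[OF c] that unfolding xs(1) xs(2) by blast
    qed simp
    then obtain ws r where r: "list_all2 (\<lambda>x w. w \<in> U x \<inter> V x \<and> w \<in> Poly_Mapping.keys c) xs ws"
      "c = signed_word (map ?s xs) ws + r" "frag_length c = length xs + frag_length r" "Poly_Mapping.keys r \<subseteq> Poly_Mapping.keys c"
      by blast
    have "length ws = length xs"
      using list_all2_lengthD[OF r(1)] by simp
    then have "frag_degree c = sum_list (map ?s xs) + frag_degree r"
      using frag_degree_signed_word[of "map ?s xs" ws] r(2) by (simp add: frag_degree_add)
    moreover have "frag_degree c0 = sum_list (map ?s xs)"
      using frag_degree_signed_word[of "map ?s xs" xs] xs(3) by simp
    ultimately have "frag_degree r = 0"
      using NN[OF c] by simp
    moreover have "list_all2 (\<lambda>x w. w \<in> V x \<and> w \<in> topspace X) xs ws"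
      by (rule list_all2_mono[OF r(1)]) (use c(1) in auto)
    ultimately show ?thesis
      using r c(1) by blast
  qed
  then show ?thesis
    using N by blast
qed

end

section \<open>The criterion for words of length at most 3\<close>

lemma openin_triple_box:
  assumes "openin (prod_topology X (prod_topology Y Z)) W" "(x, y, z) \<in> W"
  shows "\<exists>U1 U2 U3. openin X U1 \<and> openin Y U2 \<and> openin Z U3 \<and> x \<in> U1 \<and> y \<in> U2 \<and> z \<in> U3 \<and>
    (\<forall>a\<in>U1. \<forall>b\<in>U2. \<forall>c\<in>U3. (a, b, c) \<in> W)"
proof -
  have "\<exists>U V. openin X U \<and> openin (prod_topology Y Z) V \<and> x \<in> U \<and> (y, z) \<in> V \<and> U \<times> V \<subseteq> W"
    using openin_prod_topology_alt[THEN iffD1, rule_format, OF assms(1) assms(2)] .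
  then obtain U1 V where 1: "openin X U1" "openin (prod_topology Y Z) V" "x \<in> U1" "(y, z) \<in> V" "U1 \<times> V \<subseteq> W"
    by (elim exE conjE)
  have "\<exists>U2 U3. openin Y U2 \<and> openin Z U3 \<and> y \<in> U2 \<and> z \<in> U3 \<and> U2 \<times> U3 \<subseteq> V"
    using openin_prod_topology_alt[THEN iffD1, rule_format, OF 1(2) 1(4)] .
  then obtain U2 U3 where "openin Y U2" "openin Z U3" "y \<in> U2" "z \<in> U3" "U2 \<times> U3 \<subseteq> V"
    by (elim exE conjE)
  then show ?thesis
    using 1 by (intro exI[of _ U1] exI[of _ U2] exI[of _ U3]) auto
qed

context free_stratified
begin

theorem k_space_level_3:
  assumes k3: "k_space (prod_topology X (prod_topology X X))"
    and tube: "tube_property X" and ne: "topspace X \<noteq> {}"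
  shows "k_space (free_abelian_level 3 X A T i)"
proof -
  let ?Y = "free_abelian_level 3 X A T i"
  let ?X3 = "prod_topology X (prod_topology X X)"
  have "closedin ?Y C" if CY: "C \<subseteq> topspace ?Y"
    and C: "\<And>K. compactin ?Y K \<Longrightarrow> closedin (subtopology ?Y K) (K \<inter> C)" for C
  proof -
    \<comment> \<open>Every word of \<open>A_3\<close> is a value of \<open>q e\<close> for some
      signs \<open>e\<close>. Each \<open>q e\<close> is continuous on the k-space
      \<open>?X3\<close>, so the set \<open>W e\<close> of triples whose word lies outside
      \<open>C\<close> is open.\<close>
    define q where "q = (\<lambda>(e1, e2, e3) (x, y, z). ev (letter e1 x + letter e2 y + letter e3 z))"
    define W where "W = (\<lambda>e. {w \<in> topspace ?X3. q e w \<notin> C})"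
    have in_W: "(x, y, z) \<in> W (e1, e2, e3) \<longleftrightarrow> x \<in> topspace X \<and> y \<in> topspace X \<and> z \<in> topspace X \<and>
      ev (letter e1 x + letter e2 y + letter e3 z) \<notin> C" for x y z e1 e2 e3
      by (auto simp: W_def q_def)
    have openW: "openin ?X3 (W (e1, e2, e3))"
      if e: "e1 \<in> {-1, 0, 1}" "e2 \<in> {-1, 0, 1}" "e3 \<in> {-1, 0, 1}" for e1 e2 e3
    proof -
      have "continuous_map ?X3 T (q (e1, e2, e3))"
        unfolding q_def using continuous_three_letters[OF e] by simp
      moreover have "q (e1, e2, e3) w \<in> ev ` {c. Poly_Mapping.keys c \<subseteq> topspace X \<and> frag_length c \<le> 3}"
        if "w \<in> topspace ?X3" for w
      proof -
        obtain x y z where w: "w = (x, y, z)"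
          by (cases w)
        have "frag_length (letter e1 x + letter e2 y + letter e3 z) \<le> nat \<bar>e1\<bar> + nat \<bar>e2\<bar> + nat \<bar>e3\<bar>"
          using frag_length_add[of "letter e1 x + letter e2 y" "letter e3 z"] frag_length_add[of "letter e1 x" "letter e2 y"]
          by (simp add: frag_length_letter)
        also have "\<dots> \<le> 3"
          using e by auto
        finally show ?thesis
          using that keys_three_letters unfolding q_def w by auto
      qed
      ultimately have "continuous_map ?X3 ?Y (q (e1, e2, e3))"
        unfolding level_eq continuous_map_in_subtopology by blast
      from k_space_closedin_preimage[OF k3 this C]
      have "openin ?X3 (topspace ?X3 - {w \<in> topspace ?X3. q (e1, e2, e3) w \<in> C})"
        by blast
      moreover have "topspace ?X3 - {w \<in> topspace ?X3. q (e1, e2, e3) w \<in> C} = W (e1, e2, e3)"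
        unfolding W_def by blast
      ultimately show ?thesis
        by simp
    qed
    have "\<exists>N. openin T N \<and> g \<in> N \<and> N \<inter> topspace ?Y \<inter> C = {}" if g: "g \<in> topspace ?Y - C" for g
    proof -
      obtain c0 where c0: "Poly_Mapping.keys c0 \<subseteq> topspace X" "frag_length c0 \<le> 3" "g = ev c0"
        using g by (auto simp: level_eq)
      have evc0: "ev c0 \<notin> C"
        using g c0 by blast
      obtain xs where xs: "set xs = Poly_Mapping.keys c0" "\<And>x. int (count_list xs x) = \<bar>Poly_Mapping.lookup c0 x\<bar>"
        "length xs = frag_length c0" "c0 = signed_word (map (\<lambda>x. sgn (Poly_Mapping.lookup c0 x)) xs) xs"
        by (rule spelling[of c0]) blast
      let ?s = "\<lambda>x. sgn (Poly_Mapping.lookup c0 x)"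
      have s: "?s x \<in> {-1, 0, 1}" for x
        by (auto simp: sgn_if)
      have xsX: "set xs \<subseteq> topspace X"
        using xs(1) c0(1) by simp
      have len: "length xs \<le> 3"
        using xs(3) c0(2) by simp
      \<comment> \<open>Near \<open>g\<close> every word is spelled by letters in the sets
        \<open>V x\<close> and a remainder \<open>r\<close> of degree 0, without cancellation; only
        such words have to be kept outside \<open>C\<close>. The neighbourhood \<open>M\<close>
        allows a further restriction on \<open>r\<close>.\<close>
      have reduce: "\<exists>N. openin T N \<and> g \<in> N \<and> N \<inter> topspace ?Y \<inter> C = {}"
        if V: "\<And>x. x \<in> set xs \<Longrightarrow> openin X (V x) \<and> x \<in> V x" and M: "openin T M" "g \<in> M"
          and *: "\<And>ws r. list_all2 (\<lambda>x w. w \<in> V x \<and> w \<in> topspace X) xs ws \<Longrightarrow> frag_length r + length xs \<le> 3 \<Longrightarrow>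
            Poly_Mapping.keys r \<subseteq> topspace X \<Longrightarrow> frag_degree r = 0 \<Longrightarrow>
            ev (signed_word (map ?s xs) ws + r) \<in> M \<Longrightarrow> ev (signed_word (map ?s xs) ws + r) \<notin> C" for V M
      proof -
        obtain N where N: "openin T N" "ev c0 \<in> N" and NN: "\<And>c. Poly_Mapping.keys c \<subseteq> topspace X \<Longrightarrow> ev c \<in> N \<Longrightarrow>
          (\<exists>ws r. list_all2 (\<lambda>x w. w \<in> V x \<and> w \<in> topspace X) xs ws \<and> c = signed_word (map ?s xs) ws + r \<and>
            frag_length c = length xs + frag_length r \<and> Poly_Mapping.keys r \<subseteq> topspace X \<and> frag_degree r = 0)"
          using near_signed_word[OF c0(1) _ xs(1,2,4), of V] V xs(1) by blast
        have "h \<notin> C" if h: "h \<in> N" "h \<in> M" "h \<in> topspace ?Y" for h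
        proof -
          obtain c where c: "Poly_Mapping.keys c \<subseteq> topspace X" "frag_length c \<le> 3" "h = ev c"
            using h(3) by (auto simp: level_eq)
          then obtain ws r where ws: "list_all2 (\<lambda>x w. w \<in> V x \<and> w \<in> topspace X) xs ws" "c = signed_word (map ?s xs) ws + r"
            "frag_length c = length xs + frag_length r" "Poly_Mapping.keys r \<subseteq> topspace X" "frag_degree r = 0"
            using NN h(1) by blast
          show ?thesis
            using *[OF ws(1) _ ws(4,5)] ws(2,3) c(2,3) h(2) by simp
        qed
        then show ?thesis
          using N M c0(3) by (intro exI[of _ "N \<inter> M"]) auto
      qed
      have "g \<in> topspace T"
        using c0 ev_closed topspace_T by auto
      then have gT: "openin T (topspace T)" "g \<in> topspace T"
        by auto
      consider (long) "length xs \<ge> 2" | (short) "length xs \<le> 1"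
        by linarith
      then show ?thesis
      proof cases
        case long
        then obtain a b ys where ab: "xs = a # b # ys"
          by (metis (no_types, opaque_lifting) One_nat_def Suc_1 Suc_le_length_iff)
        \<comment> \<open>A word of length 2 gets \<open>a\<close> as a dummy third letter, with
          sign 0.\<close>
        define d where "d = (if ys = [] then a else hd ys)"
        define e where "e = (if ys = [] then 0 else ?s d)"
        have ys: "ys = [] \<or> ys = [d]"
          using len unfolding ab d_def by (cases ys) auto
        have word: "signed_word (map ?s xs) ws = letter (?s a) (ws ! 0) + letter (?s b) (ws ! 1) + letter e (if ys = [] then ws ! 0 else ws ! 2)"
          if "length ws = length xs" for ws
        proof (cases "ys = []")
          case True
          then show ?thesis
            using that by (auto simp: ab e_def length_Suc_conv)
        next
          case False
          then have "ys = [d]" "e = ?s d"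
            using ys by (auto simp: e_def)
          then show ?thesis
            using that by (auto simp: ab length_Suc_conv)
        qed
        have dX: "d \<in> topspace X" "a \<in> topspace X" "b \<in> topspace X" "d \<in> set xs"
          using xsX ys by (auto simp: ab d_def)
        have nth: "xs ! 0 = a" "xs ! 1 = b"
          by (auto simp: ab)
        have nth': "(if ys = [] then a else xs ! 2) = d"
        proof (cases "ys = []")
          case False
          then have "ys = [d]"
            using ys by simp
          then show ?thesis
            by (simp add: ab)
        qed (simp add: d_def)
        have c0': "c0 = letter (?s a) a + letter (?s b) b + letter e d"
          using trans[OF xs(4) word[OF refl]] unfolding nth nth' .
        then have "(a, b, d) \<in> W (?s a, ?s b, e)"
          unfolding in_W using evc0 dX c0' by metis
        then obtain U1 U2 U3 where U: "openin X U1" "openin X U2" "openin X U3" "a \<in> U1" "b \<in> U2" "d \<in> U3"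
          "\<And>x y z. x \<in> U1 \<Longrightarrow> y \<in> U2 \<Longrightarrow> z \<in> U3 \<Longrightarrow> (x, y, z) \<in> W (?s a, ?s b, e)"
          using openin_triple_box[OF openW[OF s[of a] s[of b], of e]] s unfolding e_def by (metis insertCI)
        \<comment> \<open>Letters may coincide, so each letter gets the intersection over the
          positions that it occupies.\<close>
        define V where "V = (\<lambda>x. topspace X \<inter> (if x = a then U1 else topspace X) \<inter> (if x = b then U2 else topspace X) \<inter> (if x = d then U3 else topspace X))"
        show ?thesis
        proof (rule reduce[OF _ gT])
          fix x assume "x \<in> set xs"
          then show "openin X (V x) \<and> x \<in> V x"
            using U xsX unfolding V_def by auto
        next
          fix ws and r :: "'a \<Rightarrow>\<^sub>0 int"
          assume ws: "list_all2 (\<lambda>x w. w \<in> V x \<and> w \<in> topspace X) xs ws" and r: "frag_length r + length xs \<le> 3"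
            "frag_degree r = 0"
          have "frag_length r \<le> 1"
            using r(1) long by linarith
          then have r0: "r = 0"
            using frag_degree_0_cases[OF r(2)] by auto
          have lw: "length ws = length xs"
            using list_all2_lengthD[OF ws] by simp
          have nth: "ws ! k \<in> V (xs ! k)" if "k < length xs" for k
            using list_all2_nthD[OF ws that] by blast
          have "ws ! 0 \<in> U1" "ws ! 1 \<in> U2"
            using nth[of 0] nth[of 1] unfolding ab V_def by auto
          moreover have "(if ys = [] then ws ! 0 else ws ! 2) \<in> U3"
          proof (cases "ys = []")
            case True
            then have "ws ! 0 \<in> V d"
              using nth[of 0] by (simp add: ab d_def)
            then show ?thesis
              using True by (simp add: V_def)
          next
            case False
            then have "xs ! 2 = d" "2 < length xs"
              using ys by (auto simp: ab)
            then have "ws ! 2 \<in> V d"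
              using nth[of 2] by simp
            then show ?thesis
              using False by (simp add: V_def)
          qed
          ultimately have "(ws ! 0, ws ! 1, if ys = [] then ws ! 0 else ws ! 2) \<in> W (?s a, ?s b, e)"
            by (rule U(7))
          then show "ev (signed_word (map ?s xs) ws + r) \<notin> C"
            unfolding in_W word[OF lw] r0 by simp
        qed
      next
        case short
        \<comment> \<open>The word 0 is treated like a single letter: \<open>a\<close> is then an
          arbitrary point and has sign 0.\<close>
        define a where "a = (if xs = [] then (SOME x. x \<in> topspace X) else hd xs)"
        define e where "e = (if xs = [] then 0 else ?s a)"
        have xs': "xs = [] \<or> xs = [a]"
          using short unfolding a_def by (cases xs) auto
        have aX: "a \<in> topspace X"
          using xsX ne unfolding a_def by (auto simp: some_in_eq)
        have e: "e \<in> {-1, 0, 1}"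
          using s unfolding e_def by simp
        have word: "signed_word (map ?s xs) ws = letter e (if xs = [] then a else ws ! 0)" if "length ws = length xs" for ws
          using that xs' by (auto simp: e_def length_Suc_conv)
        have c0a: "c0 = letter e a"
          using trans[OF xs(4) word[OF refl]] xs' by auto
        \<comment> \<open>As the last two letters cancel when they are equal,
          \<open>(v, y, y)\<close> belongs to \<open>W (e, 1, -1)\<close> for all \<open>y\<close>
          as soon as \<open>(v, v, v)\<close> does.\<close>
        define V where "V = {x \<in> topspace X. (x, x, x) \<in> W (e, 1, -1)}"
        have "continuous_map X ?X3 (\<lambda>x. (x, x, x))"
          by (intro continuous_map_pairedI continuous_map_id[unfolded id_def])
        then have openV: "openin X V"
          unfolding V_def by (rule openin_continuous_map_preimage) (rule openW, use e in auto)
        have cancel: "letter e v + letter 1 y + letter (-1) y = letter e v" for v y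
          by simp
        have aV: "a \<in> V"
          unfolding V_def using aX in_W[of a a a e 1 "-1"] c0a evc0 cancel by simp
        have diag: "(v, y, y) \<in> W (e, 1, -1)" if "v \<in> V" "y \<in> topspace X" for v y
          using that in_W[of v v v e 1 "-1"] in_W[of v y y e 1 "-1"] unfolding V_def cancel by blast
        have openW': "openin ?X3 (W (e, 1, -1))"
          by (rule openW) (use e in auto)
        have "\<exists>V' Q. openin X V' \<and> a \<in> V' \<and> partition_family X Q \<and>
        (\<forall>v\<in>V'. \<forall>q\<in>Q. \<forall>y\<in>topspace X. \<forall>z\<in>topspace X. q y \<noteq> 0 \<longrightarrow> q z \<noteq> 0 \<longrightarrow> (v, y, z) \<in> W (e, 1, -1))"
          using tube[unfolded tube_property_def, rule_format, OF openV aV openW'] diag by blast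
        then obtain V' Q where V': "openin X V'" "a \<in> V'" and Q: "partition_family X Q"
          and VQ: "\<And>v q y z. v \<in> V' \<Longrightarrow> q \<in> Q \<Longrightarrow> y \<in> topspace X \<Longrightarrow> z \<in> topspace X \<Longrightarrow> q y \<noteq> 0 \<Longrightarrow> q z \<noteq> 0 \<Longrightarrow> (v, y, z) \<in> W (e, 1, -1)"
          by blast
        obtain F :: "'a \<Rightarrow> ('a \<Rightarrow> real) discrete \<Rightarrow>\<^sub>C real" where F: "continuous_map X euclidean F"
          and FQ: "\<And>y z. y \<in> topspace X \<Longrightarrow> z \<in> topspace X \<Longrightarrow> dist (F y) (F z) < 1 \<Longrightarrow> \<exists>q\<in>Q. q y \<noteq> 0 \<and> q z \<noteq> 0"
          using partition_embedding[OF Q] by blast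
        obtain h where h: "continuous_map T euclidean h" and hev: "\<And>c. Poly_Mapping.keys c \<subseteq> topspace X \<Longrightarrow>
          h (ev c) = (\<Sum>x\<in>Poly_Mapping.keys c. of_int (Poly_Mapping.lookup c x) *\<^sub>R F x)"
          using extend_normed[OF F] by blast
        have h3: "h (ev (letter e1 x + letter e2 y + letter e3 z)) = of_int e1 *\<^sub>R F x + of_int e2 *\<^sub>R F y + of_int e3 *\<^sub>R F z"
          if "x \<in> topspace X" "y \<in> topspace X" "z \<in> topspace X" for x y z e1 e2 e3
          unfolding hev[OF keys_three_letters[OF that]] frag_sum_add frag_sum_letter ..
        have hg: "h g = of_int e *\<^sub>R F a"
          using h3[OF aX aX aX, of e 1 "-1"] unfolding cancel c0(3) c0a by simp
        \<comment> \<open>Replacing \<open>a\<close> by \<open>w\<close>, and \<open>g\<close> by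
          the nearby word, each costs less than 1/2 in the norm. The difference of these two errors
          is \<open>F y - F z\<close>, which therefore has norm less than 1, so that some
          \<open>q\<close> is non-zero at both \<open>y\<close> and \<open>z\<close>.\<close>
        define V1 where "V1 = V' \<inter> {w \<in> topspace X. F w \<in> ball (F a) (1/2)}"
        define M where "M = {g' \<in> topspace T. h g' \<in> ball (h g) (1/2)}"
        have "openin X V1"
          unfolding V1_def by (intro openin_Int V' openin_continuous_map_preimage[OF F]) auto
        moreover have "a \<in> V1"
          unfolding V1_def using V' aX by simp
        moreover have openM: "openin T M" "g \<in> M"
        proof -
          show "openin T M"
            unfolding M_def by (rule openin_continuous_map_preimage[OF h]) simp
          show "g \<in> M"
            unfolding M_def using gT by simp
        qed
        ultimately show ?thesis
        proof (intro reduce[of "\<lambda>_. V1" M])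
          fix x assume "openin X V1" "a \<in> V1" "x \<in> set xs"
          then show "openin X V1 \<and> x \<in> V1"
            using xs' by auto
        next
          fix ws r assume V1: "openin X V1" "a \<in> V1" and ws: "list_all2 (\<lambda>x w. w \<in> V1 \<and> w \<in> topspace X) xs ws"
            and r: "frag_length r + length xs \<le> 3" "Poly_Mapping.keys r \<subseteq> topspace X" "frag_degree r = 0"
            and inM: "ev (signed_word (map ?s xs) ws + r) \<in> M"
          define w where "w = (if xs = [] then a else ws ! 0)"
          have lw: "length ws = length xs"
            using list_all2_lengthD[OF ws] by simp
          have w: "w \<in> V1"
            using list_all2_nthD[OF ws, of 0] xs' V1 unfolding w_def by auto
          then have wX: "w \<in> topspace X" "w \<in> V'" "dist (F a) (F w) < 1/2"
            unfolding V1_def by auto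
          obtain y z where yz: "y \<in> topspace X" "z \<in> topspace X" "r = letter 1 y + letter (-1) z"
          proof (cases "r = 0")
            case True
            then have "r = letter 1 a + letter (-1) a"
              by simp
            then show ?thesis
              using that aX by blast
          next
            case False
            then show ?thesis
              using that frag_degree_0_cases[OF r(3)] r(1,2) by fastforce
          qed
          have eq: "signed_word (map ?s xs) ws + r = letter e w + letter 1 y + letter (-1) z"
            unfolding word[OF lw] yz(3) w_def by (simp add: algebra_simps)
          have "h (ev (letter e w + letter 1 y + letter (-1) z)) = of_int e *\<^sub>R F w + F y - F z"
            using h3[OF wX(1) yz(1,2), of e 1 "-1"] by simp
          then have "norm (of_int e *\<^sub>R F a - (of_int e *\<^sub>R F w + F y - F z)) < 1/2"
            using inM unfolding eq M_def hg by (simp add: dist_norm)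
          moreover have "norm (of_int e *\<^sub>R F a - of_int e *\<^sub>R F w) < 1/2"
          proof -
            have "norm (of_int e *\<^sub>R F a - of_int e *\<^sub>R F w) = \<bar>of_int e\<bar> * norm (F a - F w)"
              unfolding scaleR_diff_right[symmetric] by simp
            also have "\<dots> \<le> 1 * norm (F a - F w)"
              using e by (intro mult_right_mono) auto
            finally show ?thesis
              using wX(3) by (simp add: dist_norm)
          qed
          moreover have "norm (p' - q') < 1" if "norm q' < 1/2" "norm p' < 1/2" for p' q' :: "('a \<Rightarrow> real) discrete \<Rightarrow>\<^sub>C real"
            using norm_triangle_ineq4[of p' q'] that by linarith
          ultimately have "norm ((of_int e *\<^sub>R F a - of_int e *\<^sub>R F w) - (of_int e *\<^sub>R F a - (of_int e *\<^sub>R F w + F y - F z))) < 1"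
            by blast
          then have "norm (F y - F z) < 1"
            by simp
          then have "(w, y, z) \<in> W (e, 1, -1)"
            using FQ[OF yz(1,2)] VQ[OF wX(2) _ yz(1,2)] by (auto simp: dist_norm)
          then show "ev (signed_word (map ?s xs) ws + r) \<notin> C"
            unfolding in_W eq by blast
        qed
      qed
    qed
    then obtain N where N: "\<And>g. g \<in> topspace ?Y - C \<Longrightarrow> openin T (N g) \<and> g \<in> N g \<and> N g \<inter> topspace ?Y \<inter> C = {}"
      by metis
    have Yeq: "?Y = subtopology T (topspace ?Y)"
      unfolding level_eq by (metis subtopology_restrict topspace_subtopology)
    have "openin ?Y (topspace ?Y \<inter> (\<Union>g\<in>topspace ?Y - C. N g))"
      by (subst Yeq, subst openin_subtopology_Int2) (use N in auto)
    moreover have "topspace ?Y \<inter> (\<Union>g\<in>topspace ?Y - C. N g) = topspace ?Y - C"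
      using N by blast
    ultimately show ?thesis
      using CY by (simp add: closedin_def)
  qed
  then show ?thesis
    unfolding k_space by blast
qed

end

section \<open>Products of \<open>k\<^sub>\<omega>\<close>-spaces\<close>

text \<open>An open subspace with the direct limit topology of increasing compact sets
  \<open>K n\<close>. It is a notion for subsets because \<open>X\<close> will be a sum of possibly
  uncountably many such subspaces.\<close>

definition k_omega_set :: "'a topology \<Rightarrow> 'a set \<Rightarrow> (nat \<Rightarrow> 'a set) \<Rightarrow> bool" where
  "k_omega_set X P K \<longleftrightarrow> openin X P \<and> (\<forall>n. compactin X (K n)) \<and> incseq K \<and> P = (\<Union>n. K n) \<and>
    (\<forall>U\<subseteq>P. (\<forall>n. openin (subtopology X (K n)) (U \<inter> K n)) \<longrightarrow> openin X U)"

lemma k_omega_setD: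
  assumes "k_omega_set X P K"
  shows "openin X P" "compactin X (K n)" "incseq K" "P = (\<Union>n. K n)"
  using assms by (auto simp: k_omega_set_def)

lemma k_omega_set_openI:
  "k_omega_set X P K \<Longrightarrow> U \<subseteq> P \<Longrightarrow> (\<And>n. openin (subtopology X (K n)) (U \<inter> K n)) \<Longrightarrow> openin X U"
  by (simp add: k_omega_set_def)

lemma compactin_nbhd_closure:
  assumes "regular_space X" "compactin X A" "openin X U" "A \<subseteq> U"
  shows "\<exists>V. openin X V \<and> A \<subseteq> V \<and> X closure_of V \<subseteq> U"
proof -
  have "closedin X (topspace X - U)" "disjnt A (topspace X - U)"
    using assms by (auto simp: disjnt_def)
  then have "\<exists>V W. openin X V \<and> openin X W \<and> A \<subseteq> V \<and> topspace X - U \<subseteq> W \<and> disjnt V W"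
    using regular_space_compact_closed_separation[OF assms(1,2)] by simp
  then obtain V W where V: "openin X V" "openin X W" "A \<subseteq> V" "topspace X - U \<subseteq> W" "disjnt V W"
    by (elim exE conjE)
  have "W \<inter> X closure_of V = {}"
    using V(2,5) by (simp add: openin_Int_closure_of_eq_empty disjnt_def Int_commute)
  then have "X closure_of V \<subseteq> U"
    using V(4) closure_of_subset_topspace[of X V] by blast
  then show ?thesis
    using V by blast
qed

text \<open>A point of the union lies in some \<open>A n\<close> with \<open>n \<ge> m\<close>, and
  there the open set \<open>Q\<close> of stage \<open>n\<close> works, because
  \<open>K m \<subseteq> K (Suc n)\<close>.\<close>

lemma openin_incseq_Union:
  assumes K: "incseq K" and A: "\<And>n. \<exists>Q. openin X Q \<and> A n \<subseteq> Q \<and> Q \<inter> K (Suc n) \<subseteq> A (Suc n)" and AK: "\<And>n. A n \<subseteq> K n"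
  shows "openin (subtopology X (K m)) ((\<Union>n. A n) \<inter> K m)"
proof -
  have "A n \<subseteq> A (Suc n)" for n
    using A[of n] AK[of n] incseq_SucD[OF K, of n] by blast
  then have Ainc: "incseq A"
    by (rule incseq_SucI)
  have "\<exists>U. openin (subtopology X (K m)) U \<and> v \<in> U \<and> U \<subseteq> (\<Union>n. A n) \<inter> K m" if v: "v \<in> (\<Union>n. A n) \<inter> K m" for v
  proof -
    obtain n where n: "v \<in> A n" "n \<ge> m"
      using v incseqD[OF Ainc] by (metis IntD1 UN_E max.cobounded1 max.cobounded2 subsetD)
    obtain Q where Q: "openin X Q" "A n \<subseteq> Q" "Q \<inter> K (Suc n) \<subseteq> A (Suc n)"
      using A[of n] by blast
    have "K m \<subseteq> K (Suc n)"
      using incseqD[OF K, of m "Suc n"] n by simp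
    then have "Q \<inter> K m \<subseteq> (\<Union>n. A n) \<inter> K m"
      using Q(3) by blast
    moreover have "openin (subtopology X (K m)) (Q \<inter> K m)"
      using Q(1) by (auto simp: openin_subtopology)
    ultimately show ?thesis
      using n Q v by blast
  qed
  then show ?thesis
    by (subst openin_subopen) blast
qed

text \<open>The neighbourhoods \<open>V'\<close> and \<open>E\<close> are built along the compact sets, the compact box at each stage being
  enlarged inside the next product \<open>K n \<times> L n\<close> by means of Wallace's theorem.\<close>

lemma k_omega_tube:
  assumes regX: "regular_space X" and regZ: "regular_space Z"
    and K: "\<And>n. compactin X (K n)" "incseq K" and L: "\<And>n. compactin Z (L n)" "incseq L"
    and S: "\<And>n. openin (subtopology (prod_topology X Z) (K n \<times> L n)) (S \<inter> (K n \<times> L n))"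
    and V: "openin X V" "x \<in> V" "x \<in> K 0" and D: "closedin Z D" and VD: "(V \<inter> (\<Union>n. K n)) \<times> (D \<inter> (\<Union>n. L n)) \<subseteq> S"
  shows "\<exists>V' E. x \<in> V' \<and> V' \<subseteq> V \<inter> (\<Union>n. K n) \<and> D \<inter> (\<Union>n. L n) \<subseteq> E \<and> E \<subseteq> (\<Union>n. L n) \<and> V' \<times> E \<subseteq> S \<and>
    (\<forall>n. openin (subtopology X (K n)) (V' \<inter> K n)) \<and> (\<forall>n. openin (subtopology Z (L n)) (E \<inter> L n))"
proof -
  \<comment> \<open>The invariant of stage \<open>n\<close>: a compact box inside \<open>S\<close>
    whose sides contain \<open>x\<close> and the part of \<open>D\<close> reached so far.
    \<open>R\<close> says that the sides of the next box are neighbourhoods of the present ones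
    relative to the next compact sets.\<close>
  define P where "P = (\<lambda>n (A, B). compactin X A \<and> A \<subseteq> K n \<inter> V \<and> compactin Z B \<and> B \<subseteq> L n \<and> D \<inter> L n \<subseteq> B \<and> A \<times> B \<subseteq> S \<and> x \<in> A)"
  define R where "R = (\<lambda>n (A, B) (A', B'). (\<exists>Q. openin X Q \<and> A \<subseteq> Q \<and> Q \<inter> K (Suc n) \<subseteq> A') \<and>
      (\<exists>Q. openin Z Q \<and> B \<subseteq> Q \<and> Q \<inter> L (Suc n) \<subseteq> B'))"
  have xX: "x \<in> topspace X"
    using V openin_subset by blast
  have "P 0 ({x}, D \<inter> L 0)"
    unfolding P_def using V VD xX closed_Int_compactin[OF D L(1)] by auto
  then have start: "\<exists>AB. P 0 AB"
    by blast
  have step: "\<exists>AB'. P (Suc n) AB' \<and> R n AB AB'" if "P n AB" for n AB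
  proof -
    obtain A B where AB: "AB = (A, B)"
      by (cases AB)
    have A: "compactin X A" "A \<subseteq> K n" "A \<subseteq> V" "x \<in> A" and B: "compactin Z B" "B \<subseteq> L n" "D \<inter> L n \<subseteq> B" and ABS: "A \<times> B \<subseteq> S"
      using that unfolding AB P_def by auto
    have AK: "A \<subseteq> K (Suc n)" and BL: "B \<subseteq> L (Suc n)"
      using A(2) B(2) incseq_SucD[OF K(2), of n] incseq_SucD[OF L(2), of n] by blast+
    \<comment> \<open>The new part of \<open>D\<close> is added before the box is enlarged; this
      stays inside \<open>S\<close> by \<open>VD\<close>, since
      \<open>A \<subseteq> V\<close>.\<close>
    let ?B = "B \<union> (D \<inter> L (Suc n))"
    have cB: "compactin Z ?B"
      using B(1) closed_Int_compactin[OF D L(1)] by (rule compactin_Un)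
    have "A \<times> ?B \<subseteq> S \<inter> (K (Suc n) \<times> L (Suc n))"
      using ABS AK BL VD A(3) by blast
    moreover obtain W where W: "openin (prod_topology X Z) W" "S \<inter> (K (Suc n) \<times> L (Suc n)) = W \<inter> (K (Suc n) \<times> L (Suc n))"
      using S[of "Suc n"] unfolding openin_subtopology by blast
    ultimately have "A \<times> ?B \<subseteq> W"
      by blast
    then obtain U1 U2 where U: "openin X U1" "openin Z U2" "A \<subseteq> U1" "?B \<subseteq> U2" "U1 \<times> U2 \<subseteq> W"
      by (rule Wallace_theorem_prod_topology[OF A(1) cB W(1)])
    obtain Q1 where Q1: "openin X Q1" "A \<subseteq> Q1" "X closure_of Q1 \<subseteq> U1 \<inter> V"
      using compactin_nbhd_closure[OF regX A(1) openin_Int[OF U(1) V(1)]] U(3) A(3) by auto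
    obtain Q2 where Q2: "openin Z Q2" "?B \<subseteq> Q2" "Z closure_of Q2 \<subseteq> U2"
      using compactin_nbhd_closure[OF regZ cB U(2,4)] by auto
    have cl: "Q1 \<subseteq> X closure_of Q1" "Q2 \<subseteq> Z closure_of Q2"
      using Q1(1) Q2(1) by (auto intro!: closure_of_subset openin_subset)
    let ?A' = "X closure_of Q1 \<inter> K (Suc n)" and ?B' = "Z closure_of Q2 \<inter> L (Suc n)"
    have "?A' \<times> ?B' \<subseteq> S"
      using Q1(3) Q2(3) U(5) W(2) by blast
    moreover have "compactin X ?A'" "compactin Z ?B'"
      by (intro closed_Int_compactin closedin_closure_of K L)+
    moreover have "D \<inter> L (Suc n) \<subseteq> ?B'" "x \<in> ?A'"
      using Q1(2) Q2(2) cl AK A(4) by blast+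
    ultimately have "P (Suc n) (?A', ?B')"
      unfolding P_def using Q1(3) by auto
    moreover have "R n AB (?A', ?B')"
      unfolding R_def AB using Q1(1,2) Q2(1,2) cl by blast
    ultimately show ?thesis
      by blast
  qed
  obtain f where f: "\<And>n. P n (f n)" "\<And>n. R n (f n) (f (Suc n))"
    using dependent_nat_choice[of P R, OF start step] by blast
  define A where "A = (\<lambda>n. fst (f n))"
  define B where "B = (\<lambda>n. snd (f n))"
  have PA: "A n \<subseteq> K n \<inter> V" "B n \<subseteq> L n" "D \<inter> L n \<subseteq> B n" "A n \<times> B n \<subseteq> S" "x \<in> A n" for n
    using f(1)[of n] unfolding P_def A_def B_def by (auto simp: case_prod_unfold)
  have RA: "\<exists>Q. openin X Q \<and> A n \<subseteq> Q \<and> Q \<inter> K (Suc n) \<subseteq> A (Suc n)" "\<exists>Q. openin Z Q \<and> B n \<subseteq> Q \<and> Q \<inter> L (Suc n) \<subseteq> B (Suc n)" for n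
    using f(2)[of n] unfolding R_def A_def B_def by (auto simp: case_prod_unfold)
  have inc: "incseq A" "incseq B"
  proof -
    have "A n \<subseteq> A (Suc n)" for n
      using RA(1)[of n] PA(1)[of n] incseq_SucD[OF K(2), of n] by blast
    then show "incseq A"
      by (rule incseq_SucI)
    have "B n \<subseteq> B (Suc n)" for n
      using RA(2)[of n] PA(2)[of n] incseq_SucD[OF L(2), of n] by blast
    then show "incseq B"
      by (rule incseq_SucI)
  qed
  have "(\<Union>n. A n) \<times> (\<Union>n. B n) \<subseteq> S"
  proof clarify
    fix a b m n assume "a \<in> A m" "b \<in> B n"
    then have "a \<in> A (max m n)" "b \<in> B (max m n)"
      using incseqD[OF inc(1), of m "max m n"] incseqD[OF inc(2), of n "max m n"] by auto
    then show "(a, b) \<in> S"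
      using PA(4) by blast
  qed
  moreover have "openin (subtopology X (K m)) ((\<Union>n. A n) \<inter> K m)" for m
    by (rule openin_incseq_Union[OF K(2) RA(1)]) (use PA(1) in blast)
  moreover have "openin (subtopology Z (L m)) ((\<Union>n. B n) \<inter> L m)" for m
    by (rule openin_incseq_Union[OF L(2) RA(2) PA(2)])
  moreover have "x \<in> (\<Union>n. A n)"
    using PA(5)[of 0] by (rule UN_I[OF UNIV_I])
  moreover have "(\<Union>n. A n) \<subseteq> V \<inter> (\<Union>n. K n)"
    by (rule UN_least) (use PA(1) in blast)
  moreover have "D \<inter> (\<Union>n. L n) \<subseteq> (\<Union>n. B n)"
    unfolding Int_UN_distrib by (rule UN_mono[OF subset_refl PA(3)])
  moreover have "(\<Union>n. B n) \<subseteq> (\<Union>n. L n)"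
    by (rule UN_mono[OF subset_refl PA(2)])
  ultimately show ?thesis
    by (intro exI[of _ "\<Union>n. A n"] exI[of _ "\<Union>n. B n"]) simp
qed

lemma k_omega_set_shift:
  assumes "k_omega_set X P K"
  shows "k_omega_set X P (\<lambda>n. K (n + m))"
  unfolding k_omega_set_def
proof (intro conjI allI impI)
  have inc: "incseq K"
    using assms by (simp add: k_omega_set_def)
  have KK: "K n \<subseteq> K (n + m)" for n
    using incseqD[OF inc] by simp
  show "openin X P" "compactin X (K (n + m))" for n
    using assms by (auto simp: k_omega_set_def)
  show "incseq (\<lambda>n. K (n + m))"
    using inc by (simp add: incseq_def)
  show "P = (\<Union>n. K (n + m))"
    unfolding k_omega_setD(4)[OF assms] using KK by blast
  fix U assume U: "U \<subseteq> P" "\<forall>n. openin (subtopology X (K (n + m))) (U \<inter> K (n + m))"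
  have "openin (subtopology X (K n)) (U \<inter> K n)" for n
  proof -
    obtain Q where "openin X Q" "U \<inter> K (n + m) = Q \<inter> K (n + m)"
      using U(2) unfolding openin_subtopology by blast
    then have "openin X Q" "U \<inter> K n = Q \<inter> K n"
      using KK[of n] by blast+
    then show ?thesis
      unfolding openin_subtopology by blast
  qed
  then show "openin X U"
    by (rule k_omega_set_openI[OF assms U(1)])
qed

text \<open>Starting the exhaustions late enough puts \<open>x\<close> into the first compact set;
  the sets that \<open>k_omega_tube\<close> then yields are open because the topologies are direct
  limits.\<close>

lemma k_omega_set_tube:
  assumes regX: "regular_space X" and regZ: "regular_space Z"
    and K: "k_omega_set X P K" and L: "k_omega_set Z Q L"
    and S: "\<And>n. openin (subtopology (prod_topology X Z) (K n \<times> L n)) (S \<inter> (K n \<times> L n))"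
    and V: "openin X V" "x \<in> V" "x \<in> P" and D: "closedin Z D" and VD: "(V \<inter> P) \<times> (D \<inter> Q) \<subseteq> S"
  shows "\<exists>V' E. openin X V' \<and> openin Z E \<and> x \<in> V' \<and> V' \<subseteq> V \<inter> P \<and> D \<inter> Q \<subseteq> E \<and> E \<subseteq> Q \<and> V' \<times> E \<subseteq> S"
proof -
  obtain m where m: "x \<in> K m"
    using V(3) k_omega_setD(4)[OF K] by blast
  have K': "k_omega_set X P (\<lambda>n. K (n + m))" and L': "k_omega_set Z Q (\<lambda>n. L (n + m))"
    using K L by (auto intro: k_omega_set_shift)
  have "\<exists>V' E. x \<in> V' \<and> V' \<subseteq> V \<inter> (\<Union>n. K (n + m)) \<and> D \<inter> (\<Union>n. L (n + m)) \<subseteq> E \<and> E \<subseteq> (\<Union>n. L (n + m)) \<and> V' \<times> E \<subseteq> S \<and>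
    (\<forall>n. openin (subtopology X (K (n + m))) (V' \<inter> K (n + m))) \<and> (\<forall>n. openin (subtopology Z (L (n + m))) (E \<inter> L (n + m)))"
  proof (rule k_omega_tube[OF regX regZ _ _ _ _ S V(1,2) _ D])
    show "(V \<inter> (\<Union>n. K (n + m))) \<times> (D \<inter> (\<Union>n. L (n + m))) \<subseteq> S"
      using VD K' L' by (simp add: k_omega_set_def)
  qed (use K' L' m in \<open>auto simp: k_omega_set_def\<close>)
  then obtain V' E where VE: "x \<in> V'" "V' \<subseteq> V \<inter> P" "D \<inter> Q \<subseteq> E" "E \<subseteq> Q" "V' \<times> E \<subseteq> S"
    "\<forall>n. openin (subtopology X (K (n + m))) (V' \<inter> K (n + m))" "\<forall>n. openin (subtopology Z (L (n + m))) (E \<inter> L (n + m))"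
    using K' L' by (auto simp: k_omega_set_def)
  have "openin X V'"
    by (rule k_omega_set_openI[OF K']) (use VE in auto)
  moreover have "openin Z E"
    by (rule k_omega_set_openI[OF L']) (use VE in auto)
  moreover note VE(1-5)
  ultimately show ?thesis
    by (intro exI[of _ V'] exI[of _ E]) simp
qed

text \<open>At a point \<open>(x, z)\<close> of \<open>S\<close> the tube lemma is applied to the
  closed set \<open>{z}\<close>, with the slice of \<open>S\<close> at height \<open>z\<close> as
  \<open>V\<close>. That slice is open because its traces on the sets \<open>K n\<close>
  are.\<close>

lemma k_omega_set_prod:
  assumes regX: "regular_space X" and regZ: "regular_space Z" and hausZ: "Hausdorff_space Z"
    and K: "k_omega_set X P K" and L: "k_omega_set Z Q L"
  shows "k_omega_set (prod_topology X Z) (P \<times> Q) (\<lambda>n. K n \<times> L n)"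
  unfolding k_omega_set_def
proof (intro conjI allI impI)
  note K' = k_omega_setD[OF K] and L' = k_omega_setD[OF L]
  show "openin (prod_topology X Z) (P \<times> Q)"
    using K' L' by (simp add: openin_prod_Times_iff)
  show "compactin (prod_topology X Z) (K n \<times> L n)" for n
    using K' L' by (simp add: compactin_Times)
  show "incseq (\<lambda>n. K n \<times> L n)"
    using incseq_SucD[OF K'(3)] incseq_SucD[OF L'(3)] by (intro incseq_SucI Sigma_mono) auto
  show "P \<times> Q = (\<Union>n. K n \<times> L n)"
  proof
    show "P \<times> Q \<subseteq> (\<Union>n. K n \<times> L n)"
    proof clarify
      fix a b assume "a \<in> P" "b \<in> Q"
      then obtain m n where "a \<in> K m" "b \<in> L n"
        using K'(4) L'(4) by blast
      then have "a \<in> K (max m n)" "b \<in> L (max m n)"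
        using incseqD[OF K'(3), of m "max m n"] incseqD[OF L'(3), of n "max m n"] by auto
      then show "(a, b) \<in> (\<Union>n. K n \<times> L n)"
        by blast
    qed
  qed (use K'(4) L'(4) in blast)
  fix S assume S: "S \<subseteq> P \<times> Q" "\<forall>n. openin (subtopology (prod_topology X Z) (K n \<times> L n)) (S \<inter> (K n \<times> L n))"
  have "\<exists>U. openin (prod_topology X Z) U \<and> w \<in> U \<and> U \<subseteq> S" if "w \<in> S" for w
  proof -
    obtain x z where w: "w = (x, z)"
      by (cases w)
    have xz: "x \<in> P" "z \<in> Q" "(x, z) \<in> S"
      using that S(1) w by auto
    obtain m where m: "z \<in> L m"
      using xz L'(4) by blast
    have zZ: "z \<in> topspace Z"
      using compactin_subset_topspace[OF L'(2)] m by blast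
    let ?V = "{v \<in> P. (v, z) \<in> S}"
    have "openin X ?V"
    proof (rule k_omega_set_openI[OF k_omega_set_shift[OF K, of m]])
      fix n
      obtain W where W: "openin (prod_topology X Z) W" "S \<inter> (K (n + m) \<times> L (n + m)) = W \<inter> (K (n + m) \<times> L (n + m))"
        using S(2) unfolding openin_subtopology by blast
      have "z \<in> L (n + m)"
        using m incseqD[OF L'(3), of m "n + m"] by auto
      moreover have "K (n + m) \<subseteq> P" "K (n + m) \<subseteq> topspace X"
        using K'(4) compactin_subset_topspace[OF K'(2)] by auto
      ultimately have "?V \<inter> K (n + m) = {v \<in> topspace X. (v, z) \<in> W} \<inter> K (n + m)"
        using W(2) by blast
      moreover have "continuous_map X (prod_topology X Z) (\<lambda>v. (v, z))"
        using zZ by (intro continuous_map_pairedI) auto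
      then have "openin X {v \<in> topspace X. (v, z) \<in> W}"
        using W(1) by (rule openin_continuous_map_preimage)
      ultimately show "openin (subtopology X (K (n + m))) (?V \<inter> K (n + m))"
        unfolding openin_subtopology by blast
    qed auto
    moreover have "closedin Z {z}"
      using zZ hausZ by (simp add: closedin_Hausdorff_sing_eq)
    ultimately have "\<exists>V' E. openin X V' \<and> openin Z E \<and> x \<in> V' \<and> V' \<subseteq> ?V \<inter> P \<and> {z} \<inter> Q \<subseteq> E \<and> E \<subseteq> Q \<and> V' \<times> E \<subseteq> S"
      using S(2) xz by (intro k_omega_set_tube[OF regX regZ K L]) auto
    then obtain V' E where "openin X V'" "openin Z E" "x \<in> V'" "z \<in> E" "V' \<times> E \<subseteq> S"
      using xz by blast
    then show ?thesis
      unfolding w by (intro exI[of _ "V' \<times> E"]) (auto simp: openin_prod_Times_iff)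
  qed
  then show "openin (prod_topology X Z) S"
    by (subst openin_subopen) blast
qed

lemma openin_k_omega_set:
  assumes K: "k_omega_set X P K" and S: "\<And>L. compactin X L \<Longrightarrow> openin (subtopology X L) (L \<inter> S)"
  shows "openin X (S \<inter> P)"
proof -
  have "(S \<inter> P) \<inter> K n = K n \<inter> S" for n
    using k_omega_setD(4)[OF K] by blast
  then have "openin (subtopology X (K n)) ((S \<inter> P) \<inter> K n)" for n
    using S[OF k_omega_setD(2)[OF K, of n]] by simp
  then show ?thesis
    by (intro k_omega_set_openI[OF K]) auto
qed

lemma k_space_if_k_omega_sets:
  assumes "\<And>x. x \<in> topspace X \<Longrightarrow> \<exists>P K. x \<in> P \<and> k_omega_set X P K"
  shows "k_space X"
  unfolding k_space_open
proof (intro allI impI)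
  fix S assume S: "S \<subseteq> topspace X \<and> (\<forall>K. compactin X K \<longrightarrow> openin (subtopology X K) (K \<inter> S))"
  have "\<exists>U. openin X U \<and> x \<in> U \<and> U \<subseteq> S" if "x \<in> S" for x
  proof -
    obtain P K where P: "x \<in> P" "k_omega_set X P K"
      using assms S \<open>x \<in> S\<close> by blast
    have "openin X (S \<inter> P)"
      by (rule openin_k_omega_set[OF P(2)]) (use S in blast)
    then show ?thesis
      using P that by blast
  qed
  then show "openin X S"
    by (subst openin_subopen) blast
qed

section \<open>Partitions subordinate to open covers\<close>

definition refinable :: "'a topology \<Rightarrow> bool" where
  "refinable X \<longleftrightarrow> (\<forall>\<U>. (\<forall>U\<in>\<U>. openin X U) \<longrightarrow> topspace X \<subseteq> \<Union>\<U> \<longrightarrow>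
    (\<exists>Q. partition_family X Q \<and> (\<forall>q\<in>Q. \<exists>U\<in>\<U>. \<forall>y\<in>topspace X. q y \<noteq> 0 \<longrightarrow> y \<in> U)))"

text \<open>Mather's trick: the product vanishes as soon as an earlier function exceeds \<open>3/4\<close>.\<close>

lemma threshold_functions:
  fixes f :: "nat \<Rightarrow> 'a \<Rightarrow> real"
  assumes f: "\<And>n. continuous_map X euclideanreal (f n)" "\<And>n. \<forall>y\<in>topspace X. 0 \<le> f n y \<and> f n y \<le> 1"
  shows "\<exists>q. (\<forall>n. continuous_map X euclideanreal (q n)) \<and>
    (\<forall>n. \<forall>y\<in>topspace X. 0 \<le> q n y \<and> q n y \<le> 1) \<and>
    (\<forall>n. \<forall>y\<in>topspace X. f n y = 0 \<longrightarrow> q n y = 0) \<and>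
    (\<forall>n. \<forall>y\<in>topspace X. f n y > 3/4 \<longrightarrow> (\<exists>k. q k y = 1)) \<and>
    (\<forall>k n. \<forall>y\<in>topspace X. k < n \<longrightarrow> f k y > 3/4 \<longrightarrow> q n y = 0)"
proof -
  \<comment> \<open>The factors are 1 where \<open>f k \<le> 1/2\<close> and 0 where
    \<open>f k \<ge> 3/4\<close>. So at the first index \<open>k\<close> with
    \<open>f k y \<ge> 1/2\<close> both factors of \<open>q k y\<close> are 1.\<close>
  define r where "r = (\<lambda>n y. \<Prod>k<n. max 0 (min 1 (3 - 4 * f k y)))"
  define q where "q = (\<lambda>n y. min 1 (2 * f n y) * r n y)"
  have r: "0 \<le> r n y" "r n y \<le> 1" for n y
    unfolding r_def by (auto intro!: prod_nonneg prod_le_1)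
  have "continuous_map X euclideanreal (q n)" for n
    unfolding q_def r_def by (intro continuous_intros f) auto
  moreover have "0 \<le> q n y \<and> q n y \<le> 1" if "y \<in> topspace X" for n y
    unfolding q_def using bspec[OF f(2)[of n] that] r[of n y] by (auto intro!: mult_le_one)
  moreover have "q n y = 0" if "y \<in> topspace X" "f n y = 0" for n y
    using that by (simp add: q_def)
  moreover have "\<exists>k. q k y = 1" if "y \<in> topspace X" "f n y > 3/4" for n y
  proof -
    define k where "k = (LEAST k. f k y \<ge> 1/2)"
    have k: "f k y \<ge> 1/2"
      unfolding k_def by (rule LeastI[of _ n]) (use that in simp)
    have "f j y < 1/2" if "j < k" for j
      using not_less_Least[of j "\<lambda>k. f k y \<ge> 1/2"] that unfolding k_def by (simp add: not_le)
    then have "max 0 (min 1 (3 - 4 * f j y)) = 1" if "j < k" for j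
      using that by (smt (verit, best) field_sum_of_halves)
    then have "r k y = 1"
      unfolding r_def by (intro prod.neutral) auto
    then show ?thesis
      using k by (intro exI[of _ k]) (simp add: q_def)
  qed
  moreover have "q n y = 0" if "y \<in> topspace X" "k < n" "f k y > 3/4" for k n y
  proof -
    have "r n y = 0"
      unfolding r_def by (rule prod_zero[OF _ bexI[of _ k]]) (use that in auto)
    then show ?thesis
      by (simp add: q_def)
  qed
  ultimately show ?thesis
    by (intro exI[of _ q]) simp
qed

text \<open>Each summand is Lindeloef, so countably many functions subordinate to the cover suffice
  there, and \<open>threshold_functions\<close> makes them locally finite. Different summands are
  open and disjoint and contain the respective supports, so the union of the families is still
  compact-finite.\<close>

lemma refinable_if_sum_of_sigma_compact:
  assumes X: "tychonoff_space X" and Z: "\<And>j. j \<in> I \<Longrightarrow> openin X (Z j)" "topspace X = (\<Union>j\<in>I. Z j)"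
    and disj: "\<And>j k. j \<in> I \<Longrightarrow> k \<in> I \<Longrightarrow> j \<noteq> k \<Longrightarrow> Z j \<inter> Z k = {}"
    and K: "\<And>j n. j \<in> I \<Longrightarrow> compactin X (K j (n::nat))" "\<And>j. j \<in> I \<Longrightarrow> Z j \<subseteq> (\<Union>n. K j n)"
  shows "refinable X"
  unfolding refinable_def
proof (intro allI impI)
  fix \<U> assume U: "\<forall>U\<in>\<U>. openin X U" "topspace X \<subseteq> \<Union>\<U>"
  define I' where "I' = {j \<in> I. Z j \<noteq> {}}"
  define good where "good = (\<lambda>j (q :: nat \<Rightarrow> 'a \<Rightarrow> real). (\<forall>n. continuous_map X euclideanreal (q n)) \<and>
      (\<forall>n. \<forall>y\<in>topspace X. 0 \<le> q n y \<and> q n y \<le> 1) \<and>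
      (\<forall>n. \<exists>U\<in>\<U>. \<forall>y\<in>topspace X. q n y \<noteq> 0 \<longrightarrow> y \<in> U \<inter> Z j) \<and>
      (\<forall>y\<in>Z j. \<exists>n. q n y = 1) \<and> (\<forall>y\<in>Z j. \<exists>N m. openin X N \<and> y \<in> N \<and> (\<forall>z\<in>N. \<forall>n>m. q n z = 0)))"
  have "\<exists>q. good j q" if j: "j \<in> I'" for j
  proof -
    have jI: "j \<in> I" and ne: "Z j \<noteq> {}"
      using j by (auto simp: I'_def)
    have ZX: "Z j \<subseteq> topspace X"
      using Z jI by blast
    have "topspace X - Z j = (\<Union>k\<in>I - {j}. Z k)"
      unfolding Z(2) using disj jI by blast
    moreover have "openin X (\<Union>k\<in>I - {j}. Z k)"
      by (rule openin_Union) (use Z in auto)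
    ultimately have cZ: "closedin X (Z j)"
      using ZX by (simp add: closedin_def)
    have "\<exists>U. U \<in> \<U> \<and> y \<in> U" if "y \<in> Z j" for y
      using that U(2) ZX by blast
    then obtain u where u: "\<And>y. y \<in> Z j \<Longrightarrow> u y \<in> \<U> \<and> y \<in> u y"
      by metis
    have "\<exists>f. continuous_map X euclideanreal f \<and> f y = 1 \<and> (\<forall>z\<in>topspace X. 0 \<le> f z \<and> f z \<le> 1)
      \<and> (\<forall>z\<in>topspace X. z \<notin> u y \<inter> Z j \<or> z \<in> {} - {y} \<longrightarrow> f z = 0)" if "y \<in> Z j" for y
      using u[OF that] that ZX U(1) Z(1)[OF jI] by (intro tychonoff_separating_function[OF X]) auto
    then obtain f where f: "\<And>y. y \<in> Z j \<Longrightarrow> continuous_map X euclideanreal (f y)" "\<And>y. y \<in> Z j \<Longrightarrow> f y y = (1::real)"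
      "\<And>y z. y \<in> Z j \<Longrightarrow> z \<in> topspace X \<Longrightarrow> 0 \<le> f y z \<and> f y z \<le> 1"
      "\<And>y z. y \<in> Z j \<Longrightarrow> z \<in> topspace X \<Longrightarrow> z \<notin> u y \<inter> Z j \<Longrightarrow> f y z = 0"
      by metis
    have of: "openin X {z \<in> topspace X. f y z \<in> {3/4<..}}" if "y \<in> Z j" for y
      by (rule openin_continuous_map_preimage[OF f(1)[OF that]]) simp
    have "\<exists>J\<subseteq>Z j. finite J \<and> Z j \<inter> K j n \<subseteq> (\<Union>y\<in>J. {z \<in> topspace X. f y z \<in> {3/4<..}})" for n
      by (rule compactin_finite_subcover[OF closed_Int_compactin[OF cZ K(1)[OF jI]] of]) (use f(2) ZX in auto)
    then have "\<forall>n. \<exists>J. J \<subseteq> Z j \<and> finite J \<and> Z j \<inter> K j n \<subseteq> (\<Union>y\<in>J. {z \<in> topspace X. f y z \<in> {3/4<..}})"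
      by simp
    from choice[OF this] obtain J where
      "\<forall>n. J n \<subseteq> Z j \<and> finite (J n) \<and> Z j \<inter> K j n \<subseteq> (\<Union>y\<in>J n. {z \<in> topspace X. f y z \<in> {3/4<..}})" ..
    then have J: "\<And>n. J n \<subseteq> Z j" "\<And>n. finite (J n)"
      "\<And>n. Z j \<inter> K j n \<subseteq> (\<Union>y\<in>J n. {z \<in> topspace X. f y z \<in> {3/4<..}})"
      by simp_all
    obtain z0 where z0: "z0 \<in> Z j"
      using ne by blast
    define Y where "Y = insert z0 (\<Union>n. J n)"
    have "countable (\<Union>n. J n)"
      by (rule countable_UN) (auto intro: countable_finite J(2))
    then have Y: "countable Y" "Y \<subseteq> Z j" "Y \<noteq> {}"
      unfolding Y_def using J(1) z0 by auto
    define g where "g = from_nat_into Y"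
    have g: "range g = Y"
      unfolding g_def by (rule range_from_nat_into[OF Y(3,1)])
    have gZ: "g n \<in> Z j" for n
      using g Y(2) by blast
    have fg: "continuous_map X euclideanreal (f (g n))" "\<forall>y\<in>topspace X. 0 \<le> f (g n) y \<and> f (g n) y \<le> 1" for n
      using f(1)[OF gZ] f(3)[OF gZ] by auto
    from threshold_functions[of X "\<lambda>n. f (g n)", OF fg]
    obtain q where q': "\<forall>n. continuous_map X euclideanreal (q n)"
      "\<forall>n. \<forall>y\<in>topspace X. 0 \<le> q n y \<and> q n y \<le> 1"
      "\<forall>n. \<forall>y\<in>topspace X. f (g n) y = 0 \<longrightarrow> q n y = 0"
      "\<forall>n. \<forall>y\<in>topspace X. f (g n) y > 3/4 \<longrightarrow> (\<exists>k. q k y = 1)"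
      "\<forall>k n. \<forall>y\<in>topspace X. k < n \<longrightarrow> f (g k) y > 3/4 \<longrightarrow> q n y = 0"
      by (elim exE conjE)
    note q = q'[rule_format]
    have big: "\<exists>n. f (g n) y > 3/4" if y: "y \<in> Z j" for y
    proof -
      obtain n where "y \<in> K j n"
        using y K(2)[OF jI] by blast
      then obtain w where "w \<in> J n" "f w y > 3/4"
        using J(3)[of n] y by auto
      moreover then have "w \<in> range g"
        unfolding g Y_def by blast
      ultimately show ?thesis
        by blast
    qed
    have "\<exists>U\<in>\<U>. \<forall>y\<in>topspace X. q n y \<noteq> 0 \<longrightarrow> y \<in> U \<inter> Z j" for n
      using q(3) f(4)[OF gZ] u[OF gZ] by blast
    moreover have "\<exists>n. q n y = 1" if y: "y \<in> Z j" for y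
      using big[OF y] q(4) y ZX by blast
    moreover have "\<exists>N m. openin X N \<and> y \<in> N \<and> (\<forall>z\<in>N. \<forall>n>m. q n z = 0)" if y: "y \<in> Z j" for y
    proof -
      obtain m where "f (g m) y > 3/4"
        using big[OF y] by blast
      then show ?thesis
        using of[OF gZ[of m]] q(5) y ZX by (intro exI[of _ "{z \<in> topspace X. f (g m) z \<in> {3/4<..}}"] exI[of _ m]) auto
    qed
    ultimately show ?thesis
      unfolding good_def using q(1,2) by (intro exI[of _ q] conjI allI ballI) auto
  qed
  then obtain q where "\<And>j. j \<in> I' \<Longrightarrow> good j (q j)"
    by metis
  then have q: "\<And>j n. j \<in> I' \<Longrightarrow> continuous_map X euclideanreal (q j n)"
      "\<And>j n y. j \<in> I' \<Longrightarrow> y \<in> topspace X \<Longrightarrow> 0 \<le> q j n y \<and> q j n y \<le> 1"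
      "\<And>j n. j \<in> I' \<Longrightarrow> \<exists>U\<in>\<U>. \<forall>y\<in>topspace X. q j n y \<noteq> 0 \<longrightarrow> y \<in> U \<inter> Z j"
      "\<And>j y. j \<in> I' \<Longrightarrow> y \<in> Z j \<Longrightarrow> \<exists>n. q j n y = 1"
      "\<And>j y. j \<in> I' \<Longrightarrow> y \<in> Z j \<Longrightarrow> \<exists>N m. openin X N \<and> y \<in> N \<and> (\<forall>z\<in>N. \<forall>n>m. q j n z = 0)"
    unfolding good_def by simp_all
  have cover: "\<exists>j\<in>I'. y \<in> Z j" if "y \<in> topspace X" for y
    using that Z(2) by (auto simp: I'_def)
  let ?Q = "(\<lambda>(j, n). q j n) ` (I' \<times> UNIV)"
  have "compact_finite X ?Q (\<lambda>p. {y \<in> topspace X. p y \<noteq> 0})"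
    unfolding compact_finite_def
  proof (intro strip)
    fix L assume L: "compactin X L"
    define loc where "loc = (\<lambda>y N F. openin X N \<and> y \<in> N \<and> finite F \<and> (\<forall>p\<in>?Q. \<forall>z\<in>N. p z \<noteq> 0 \<longrightarrow> p \<in> F))"
    have "\<exists>N F. loc y N F" if y: "y \<in> L" for y
    proof -
      have "y \<in> topspace X"
        using y L compactin_subset_topspace by blast
      then obtain j where j: "j \<in> I'" "y \<in> Z j"
        using cover by blast
      then obtain N m where N: "openin X N" "y \<in> N" "\<forall>z\<in>N. \<forall>n>m. q j n z = 0"
        using q(5)[OF j] by blast
      have jI: "j \<in> I"
        using j by (simp add: I'_def)
      have "p \<in> q j ` {..m}" if p: "p \<in> ?Q" and z: "z \<in> N \<inter> Z j" "p z \<noteq> 0" for p z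
      proof -
        obtain k n where k: "k \<in> I'" "p = q k n"
          using p by auto
        have "z \<in> topspace X"
          using z N(1) openin_subset by blast
        then have "z \<in> Z k"
          using q(3)[OF k(1), of n] z(2) k(2) by blast
        then have "k = j"
          using disj[of k j] k(1) jI z(1) by (auto simp: I'_def)
        moreover then have "n \<le> m"
          using N(3) z k(2) by (auto simp: not_less[symmetric])
        ultimately show ?thesis
          using k by blast
      qed
      then show ?thesis
        unfolding loc_def using N(1,2) j(2) Z(1)[OF jI]
        by (intro exI[of _ "N \<inter> Z j"] exI[of _ "q j ` {..m}"] conjI ballI impI) auto
    qed
    then obtain N F where loc: "\<And>y. y \<in> L \<Longrightarrow> loc y (N y) (F y)"
      by metis
    then have N: "\<And>y. y \<in> L \<Longrightarrow> openin X (N y)" "\<And>y. y \<in> L \<Longrightarrow> y \<in> N y" and F: "\<And>y. y \<in> L \<Longrightarrow> finite (F y)"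
      unfolding loc_def by simp_all
    have NF: "p \<in> F y" if "y \<in> L" "p \<in> ?Q" "z \<in> N y" "p z \<noteq> 0" for y p z
      using loc[OF that(1)] that(2-4) unfolding loc_def by blast
    have "\<exists>J\<subseteq>L. finite J \<and> L \<subseteq> (\<Union>y\<in>J. N y)"
      by (rule compactin_finite_subcover[OF L N(1)]) (use N(2) in auto)
    then obtain J where J: "J \<subseteq> L" "finite J" "L \<subseteq> (\<Union>y\<in>J. N y)"
      by blast
    have "{p \<in> ?Q. {y \<in> topspace X. p y \<noteq> 0} \<inter> L \<noteq> {}} \<subseteq> (\<Union>y\<in>J. F y)"
    proof
      fix p assume "p \<in> {p \<in> ?Q. {y \<in> topspace X. p y \<noteq> 0} \<inter> L \<noteq> {}}"
      then obtain z where z: "p \<in> ?Q" "z \<in> L" "p z \<noteq> 0"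
        by blast
      then obtain y where "y \<in> J" "z \<in> N y"
        using J(3) by blast
      then show "p \<in> (\<Union>y\<in>J. F y)"
        using NF[of y p z] z J(1) by blast
    qed
    moreover have "finite (\<Union>y\<in>J. F y)"
      using J F by blast
    ultimately show "finite {p \<in> ?Q. {y \<in> topspace X. p y \<noteq> 0} \<inter> L \<noteq> {}}"
      by (rule finite_subset)
  qed
  moreover have "\<exists>p\<in>?Q. p y = 1" if "y \<in> topspace X" for y
    using cover[OF that] q(4) by fastforce
  ultimately have "partition_family X ?Q"
    unfolding partition_family_def using q(1,2) by auto
  moreover have "\<exists>U\<in>\<U>. \<forall>y\<in>topspace X. p y \<noteq> 0 \<longrightarrow> y \<in> U" if "p \<in> ?Q" for p
    using that q(3) by fastforce
  ultimately show "\<exists>Q. partition_family X Q \<and> (\<forall>q\<in>Q. \<exists>U\<in>\<U>. \<forall>y\<in>topspace X. q y \<noteq> 0 \<longrightarrow> y \<in> U)"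
    by blast
qed

text \<open>Finitely many functions handle a neighbourhood \<open>N\<close> of \<open>K\<close>. The
  points outside \<open>N\<close> are isolated and form a closed set, so a compact set contains only
  finitely many of them, and their characteristic functions complete the family.\<close>

lemma refinable_if_compact_derived:
  assumes X: "tychonoff_space X" and K: "compactin X K" and iso: "\<And>x. x \<in> topspace X - K \<Longrightarrow> openin X {x}"
  shows "refinable X"
  unfolding refinable_def
proof (intro allI impI)
  fix \<U> assume U: "\<forall>U\<in>\<U>. openin X U" "topspace X \<subseteq> \<Union>\<U>"
  have KX: "K \<subseteq> topspace X"
    using K compactin_subset_topspace by blast
  have "\<exists>U. U \<in> \<U> \<and> y \<in> U" if "y \<in> K" for y
    using that U(2) KX by blast
  then obtain u where u: "\<And>y. y \<in> K \<Longrightarrow> u y \<in> \<U> \<and> y \<in> u y"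
    by metis
  have "\<exists>f. continuous_map X euclideanreal f \<and> f y = 1 \<and> (\<forall>z\<in>topspace X. 0 \<le> f z \<and> f z \<le> 1)
    \<and> (\<forall>z\<in>topspace X. z \<notin> u y \<or> z \<in> {} - {y} \<longrightarrow> f z = 0)" if "y \<in> K" for y
    using u[OF that] that KX U(1) by (intro tychonoff_separating_function[OF X]) auto
  then obtain f where f: "\<And>y. y \<in> K \<Longrightarrow> continuous_map X euclideanreal (f y)" "\<And>y. y \<in> K \<Longrightarrow> f y y = (1::real)"
    "\<And>y z. y \<in> K \<Longrightarrow> z \<in> topspace X \<Longrightarrow> 0 \<le> f y z \<and> f y z \<le> 1"
    "\<And>y z. y \<in> K \<Longrightarrow> z \<in> topspace X \<Longrightarrow> z \<notin> u y \<Longrightarrow> f y z = 0"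
    by metis
  have of: "openin X {z \<in> topspace X. f y z \<in> {3/4<..}}" if "y \<in> K" for y
    by (rule openin_continuous_map_preimage[OF f(1)[OF that]]) simp
  have "\<exists>J\<subseteq>K. finite J \<and> K \<subseteq> (\<Union>y\<in>J. {z \<in> topspace X. f y z \<in> {3/4<..}})"
    by (rule compactin_finite_subcover[OF K of]) (use f(2) KX in auto)
  then obtain J where J: "J \<subseteq> K" "finite J" "K \<subseteq> (\<Union>y\<in>J. {z \<in> topspace X. f y z \<in> {3/4<..}})"
    by blast
  obtain g and m :: nat where g: "J = g ` {i. i < m}"
    using finite_imp_nat_seg_image_inj_on[OF J(2)] by metis
  have gK: "g n \<in> K" if "n < m" for n
    using that g J(1) by blast
  \<comment> \<open>Padding with zeros from \<open>m\<close> on makes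
    \<open>threshold_functions\<close> applicable; the functions \<open>q n\<close> with
    \<open>n \<ge> m\<close> then vanish.\<close>
  define f' where "f' = (\<lambda>n. if n < m then f (g n) else (\<lambda>y. 0))"
  have fg: "continuous_map X euclideanreal (f' n)" "\<forall>y\<in>topspace X. 0 \<le> f' n y \<and> f' n y \<le> 1" for n
    using f(1)[OF gK] f(3)[OF gK] by (auto simp: f'_def)
  from threshold_functions[of X f', OF fg]
  obtain q where q': "\<forall>n. continuous_map X euclideanreal (q n)"
    "\<forall>n. \<forall>y\<in>topspace X. 0 \<le> q n y \<and> q n y \<le> 1"
    "\<forall>n. \<forall>y\<in>topspace X. f' n y = 0 \<longrightarrow> q n y = 0"
    "\<forall>n. \<forall>y\<in>topspace X. f' n y > 3/4 \<longrightarrow> (\<exists>k. q k y = 1)"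
    "\<forall>k n. \<forall>y\<in>topspace X. k < n \<longrightarrow> f' k y > 3/4 \<longrightarrow> q n y = 0"
    by (elim exE conjE)
  note q = q'[rule_format]
  define N where "N = (\<Union>y\<in>J. {z \<in> topspace X. f y z \<in> {3/4<..}})"
  have openN: "openin X N"
    unfolding N_def by (rule openin_Union) (use of J(1) in auto)
  define e :: "'a \<Rightarrow> 'a \<Rightarrow> real" where "e = (\<lambda>x y. if y = x then 1 else 0)"
  have isoN: "openin X {x}" if "x \<in> topspace X - N" for x
    using iso J(3) that unfolding N_def by blast
  have conte: "continuous_map X euclideanreal (e x)" if x: "x \<in> topspace X - N" for x
    unfolding continuous_map_def
  proof (intro conjI strip)
    fix V :: "real set" assume "openin euclideanreal V"
    have "openin X (topspace X - {x})"
      using X x closedin_Hausdorff_sing_eq[of X x] by (auto simp: tychonoff_space_def)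
    moreover have eq: "{y \<in> topspace X. e x y \<in> V} = (if 1 \<in> V then {x} else {}) \<union> (if 0 \<in> V then topspace X - {x} else {})"
      using x by (auto simp: e_def)
    ultimately show "openin X {y \<in> topspace X. e x y \<in> V}"
      unfolding eq using isoN[OF x] by (intro openin_Un) auto
  qed simp
  let ?Q = "q ` {..<m} \<union> e ` (topspace X - N)"
  have "compact_finite X ?Q (\<lambda>p. {y \<in> topspace X. p y \<noteq> 0})"
    unfolding compact_finite_def
  proof (intro strip)
    fix L assume L: "compactin X L"
    have "compactin X ((topspace X - N) \<inter> L)"
      using L openN by (intro closed_Int_compactin) auto
    then have "\<exists>F\<subseteq>(topspace X - N) \<inter> L. finite F \<and> (topspace X - N) \<inter> L \<subseteq> (\<Union>x\<in>F. {x})"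
      by (rule compactin_finite_subcover) (use isoN in auto)
    then have fin: "finite ((topspace X - N) \<inter> L)"
      by (metis UN_singleton finite_subset)
    have "{p \<in> ?Q. {y \<in> topspace X. p y \<noteq> 0} \<inter> L \<noteq> {}} \<subseteq> q ` {..<m} \<union> e ` ((topspace X - N) \<inter> L)"
      by (auto simp: e_def split: if_splits)
    then show "finite {p \<in> ?Q. {y \<in> topspace X. p y \<noteq> 0} \<inter> L \<noteq> {}}"
      by (rule finite_subset) (use fin in simp)
  qed
  moreover have "\<exists>p\<in>?Q. p y = 1" if y: "y \<in> topspace X" for y
  proof (cases "y \<in> N")
    case True
    then obtain n where "n < m" "f (g n) y > 3/4"
      unfolding N_def g by auto
    then have "\<exists>k. q k y = 1"
      using q(4)[of y n] y by (simp add: f'_def)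
    then obtain k where k: "q k y = 1"
      by blast
    then have "k < m"
      using q(3)[of y k] y by (cases "k < m") (auto simp: f'_def)
    then show ?thesis
      using k by blast
  next
    case False
    then have "e y \<in> ?Q" "e y y = 1"
      using y by (auto simp: e_def)
    then show ?thesis
      by blast
  qed
  moreover have "continuous_map X euclideanreal p \<and> (\<forall>y\<in>topspace X. 0 \<le> p y \<and> p y \<le> 1)" if "p \<in> ?Q" for p
    using that
  proof
    assume "p \<in> q ` {..<m}"
    then show ?thesis
      using q(1,2) by auto
  next
    assume "p \<in> e ` (topspace X - N)"
    then obtain x where x: "x \<in> topspace X - N" "p = e x"
      by blast
    then show ?thesis
      using conte[OF x(1)] by (auto simp: e_def)
  qed
  ultimately have "partition_family X ?Q"
    unfolding partition_family_def by blast
  moreover have "\<exists>U\<in>\<U>. \<forall>y\<in>topspace X. p y \<noteq> 0 \<longrightarrow> y \<in> U" if "p \<in> ?Q" for p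
    using that
  proof
    assume "p \<in> q ` {..<m}"
    then obtain n where n: "n < m" "p = q n"
      by blast
    have "\<forall>y\<in>topspace X. p y \<noteq> 0 \<longrightarrow> y \<in> u (g n)"
      using q(3)[of _ n] f(4)[OF gK[OF n(1)]] n by (auto simp: f'_def)
    then show ?thesis
      using u[OF gK[OF n(1)]] by blast
  next
    assume "p \<in> e ` (topspace X - N)"
    then obtain x where x: "x \<in> topspace X" "p = e x"
      by blast
    then obtain U where "U \<in> \<U>" "x \<in> U"
      using U(2) by blast
    then show ?thesis
      using x(2) by (intro bexI[of _ U]) (auto simp: e_def split: if_splits)
  qed
  ultimately show "\<exists>Q. partition_family X Q \<and> (\<forall>q\<in>Q. \<exists>U\<in>\<U>. \<forall>y\<in>topspace X. q y \<noteq> 0 \<longrightarrow> y \<in> U)"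
    by blast
qed

text \<open>The open sets \<open>U\<close> with \<open>V' \<times> U \<times> U\<close> inside
  \<open>W\<close> cover \<open>X\<close>, and \<open>Q\<close> refines this cover. What has to be
  found is a single \<open>V'\<close> that serves all \<open>y\<close>.\<close>

lemma tube_propertyI:
  assumes ref: "refinable X"
    and tube: "\<And>x V W. openin X V \<Longrightarrow> x \<in> V \<Longrightarrow> openin (prod_topology X (prod_topology X X)) W \<Longrightarrow>
      (\<And>v y. v \<in> V \<Longrightarrow> y \<in> topspace X \<Longrightarrow> (v, y, y) \<in> W) \<Longrightarrow>
      \<exists>V'. openin X V' \<and> x \<in> V' \<and> (\<forall>y\<in>topspace X. \<exists>U. openin X U \<and> y \<in> U \<and> (\<forall>v\<in>V'. \<forall>a\<in>U. \<forall>b\<in>U. (v, a, b) \<in> W))"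
  shows "tube_property X"
  unfolding tube_property_def
proof (intro allI impI)
  fix x V W assume "openin X V" "x \<in> V" "openin (prod_topology X (prod_topology X X)) W" "\<forall>v\<in>V. \<forall>y\<in>topspace X. (v, y, y) \<in> W"
  then have "\<exists>V'. openin X V' \<and> x \<in> V' \<and> (\<forall>y\<in>topspace X. \<exists>U. openin X U \<and> y \<in> U \<and> (\<forall>v\<in>V'. \<forall>a\<in>U. \<forall>b\<in>U. (v, a, b) \<in> W))"
    by (intro tube[of V]) auto
  then obtain V' where V': "openin X V'" "x \<in> V'"
    and U: "\<And>y. y \<in> topspace X \<Longrightarrow> \<exists>U. openin X U \<and> y \<in> U \<and> (\<forall>v\<in>V'. \<forall>a\<in>U. \<forall>b\<in>U. (v, a, b) \<in> W)"
    by blast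
  let ?U = "{U. openin X U \<and> (\<forall>v\<in>V'. \<forall>a\<in>U. \<forall>b\<in>U. (v, a, b) \<in> W)}"
  have "topspace X \<subseteq> \<Union>?U"
  proof
    fix y assume "y \<in> topspace X"
    from U[OF this] show "y \<in> \<Union>?U"
      by (elim exE conjE) (rule UnionI, simp_all)
  qed
  then have "\<exists>Q. partition_family X Q \<and> (\<forall>q\<in>Q. \<exists>U\<in>?U. \<forall>y\<in>topspace X. q y \<noteq> 0 \<longrightarrow> y \<in> U)"
    by (intro ref[unfolded refinable_def, rule_format]) auto
  then obtain Q where Q: "partition_family X Q" "\<And>q. q \<in> Q \<Longrightarrow> \<exists>U\<in>?U. \<forall>y\<in>topspace X. q y \<noteq> 0 \<longrightarrow> y \<in> U"
    by blast
  have "(v, y, z) \<in> W" if "v \<in> V'" "q \<in> Q" "y \<in> topspace X" "z \<in> topspace X" "q y \<noteq> 0" "q z \<noteq> 0" for v q y z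
    using Q(2)[OF that(2)] that by blast
  then show "\<exists>V' Q. openin X V' \<and> x \<in> V' \<and> partition_family X Q \<and>
        (\<forall>v\<in>V'. \<forall>q\<in>Q. \<forall>y\<in>topspace X. \<forall>z\<in>topspace X. q y \<noteq> 0 \<longrightarrow> q z \<noteq> 0 \<longrightarrow> (v, y, z) \<in> W)"
    using V' Q(1) by (intro exI[of _ V'] exI[of _ Q]) simp
qed

lemma square_nbhd:
  assumes "openin (prod_topology X X) E" "(y, y) \<in> E"
  shows "\<exists>U. openin X U \<and> y \<in> U \<and> U \<times> U \<subseteq> E"
proof -
  have "\<exists>U1 U2. openin X U1 \<and> openin X U2 \<and> y \<in> U1 \<and> y \<in> U2 \<and> U1 \<times> U2 \<subseteq> E"
    using openin_prod_topology_alt[THEN iffD1, rule_format, OF assms] .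
  then obtain U1 U2 where "openin X U1" "openin X U2" "y \<in> U1" "y \<in> U2" "U1 \<times> U2 \<subseteq> E"
    by (elim exE conjE)
  then show ?thesis
    by (intro exI[of _ "U1 \<inter> U2"]) auto
qed

text \<open>A neighbourhood with compact closure inside \<open>V\<close> serves all
  \<open>y\<close>, since Wallace's theorem applies to this closure and each point
  \<open>(y, y)\<close>.\<close>

lemma tube_property_if_locally_compact:
  assumes ref: "refinable X" and reg: "regular_space X" and lc: "locally_compact_space X"
  shows "tube_property X"
proof (rule tube_propertyI[OF ref])
  fix x V W assume V: "openin X V" "x \<in> V" and W: "openin (prod_topology X (prod_topology X X)) W"
    and VW: "\<And>v y. v \<in> V \<Longrightarrow> y \<in> topspace X \<Longrightarrow> (v, y, y) \<in> W"
  have xX: "x \<in> topspace X"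
    using V openin_subset by blast
  obtain P C where P: "openin X P" "compactin X C" "x \<in> P" "P \<subseteq> C"
    using lc xX unfolding locally_compact_space_def by blast
  obtain V' where V': "openin X V'" "x \<in> V'" "X closure_of V' \<subseteq> V \<inter> P"
    using compactin_nbhd_closure[OF reg, of "{x}" "V \<inter> P"] xX V P by auto
  have "compactin X (X closure_of V' \<inter> C)"
    using P(2) by (intro closed_Int_compactin) auto
  moreover have "X closure_of V' \<inter> C = X closure_of V'"
    using V'(3) P(4) by blast
  ultimately have cc: "compactin X (X closure_of V')"
    by simp
  have "\<exists>U. openin X U \<and> y \<in> U \<and> (\<forall>v\<in>V'. \<forall>a\<in>U. \<forall>b\<in>U. (v, a, b) \<in> W)" if y: "y \<in> topspace X" for y
  proof -
    have "compactin (prod_topology X X) {(y, y)}" "(X closure_of V') \<times> {(y, y)} \<subseteq> W"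
      using y VW V'(3) by auto
    then obtain U1 U2 where U: "openin X U1" "openin (prod_topology X X) U2" "X closure_of V' \<subseteq> U1" "{(y, y)} \<subseteq> U2" "U1 \<times> U2 \<subseteq> W"
      by (rule Wallace_theorem_prod_topology[OF cc _ W])
    obtain U where "openin X U" "y \<in> U" "U \<times> U \<subseteq> U2"
      using square_nbhd[OF U(2), of y] U(4) by auto
    then show ?thesis
      using U(3,5) closure_of_subset[OF openin_subset[OF V'(1)]] by (intro exI[of _ U]) blast
  qed
  then show "\<exists>V'. openin X V' \<and> x \<in> V' \<and> (\<forall>y\<in>topspace X. \<exists>U. openin X U \<and> y \<in> U \<and> (\<forall>v\<in>V'. \<forall>a\<in>U. \<forall>b\<in>U. (v, a, b) \<in> W))"
    using V' by blast
qed

text \<open>Wallace's theorem for \<open>x\<close> and the diagonal of the compact set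
  \<open>K\<close> handles all \<open>y \<in> K\<close> at once; at an isolated \<open>y\<close> the
  set \<open>{y}\<close> will do for every \<open>V' \<subseteq> V\<close>.\<close>

lemma tube_property_if_compact_derived:
  assumes X: "tychonoff_space X" and K: "compactin X K" and iso: "\<And>x. x \<in> topspace X - K \<Longrightarrow> openin X {x}"
  shows "tube_property X"
proof (rule tube_propertyI[OF refinable_if_compact_derived[OF assms]])
  fix x V W assume V: "openin X V" "x \<in> V" and W: "openin (prod_topology X (prod_topology X X)) W"
    and VW: "\<And>v y. v \<in> V \<Longrightarrow> y \<in> topspace X \<Longrightarrow> (v, y, y) \<in> W"
  let ?D = "(\<lambda>y. (y, y)) ` K"
  have cx: "compactin X {x}"
    using V openin_subset by fastforce
  have "continuous_map X (prod_topology X X) (\<lambda>y. (y, y))"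
    by (intro continuous_map_pairedI continuous_map_id[unfolded id_def])
  with K have cD: "compactin (prod_topology X X) ?D"
    by (rule image_compactin)
  have "{x} \<times> ?D \<subseteq> W"
    using VW V(2) compactin_subset_topspace[OF K] by auto
  then obtain U1 U2 where U: "openin X U1" "openin (prod_topology X X) U2" "{x} \<subseteq> U1" "?D \<subseteq> U2" "U1 \<times> U2 \<subseteq> W"
    by (rule Wallace_theorem_prod_topology[OF cx cD W])
  have "\<exists>U. openin X U \<and> y \<in> U \<and> (\<forall>v\<in>U1 \<inter> V. \<forall>a\<in>U. \<forall>b\<in>U. (v, a, b) \<in> W)" if y: "y \<in> topspace X" for y
  proof (cases "y \<in> K")
    case True
    then obtain U where "openin X U" "y \<in> U" "U \<times> U \<subseteq> U2"
      using square_nbhd[OF U(2), of y] U(4) by auto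
    then show ?thesis
      using U(5) by (intro exI[of _ U]) blast
  next
    case False
    then show ?thesis
      using iso[of y] y VW by (intro exI[of _ "{y}"]) simp
  qed
  then show "\<exists>V'. openin X V' \<and> x \<in> V' \<and> (\<forall>y\<in>topspace X. \<exists>U. openin X U \<and> y \<in> U \<and> (\<forall>v\<in>V'. \<forall>a\<in>U. \<forall>b\<in>U. (v, a, b) \<in> W))"
    using U(1,3) V by (intro exI[of _ "U1 \<inter> V"]) auto
qed

text \<open>The diagonal of \<open>P\<close> is not compact in general, so
  \<open>k_omega_set_tube\<close> takes the place of Wallace's theorem. Isolated points are handled
  by singletons, both as \<open>y\<close> and as \<open>x\<close>.\<close>

lemma tube_property_if_k_omega_and_isolated:
  assumes ref: "refinable X" and reg: "regular_space X" and haus: "Hausdorff_space X"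
    and K: "k_omega_set X P K" and iso: "\<And>x. x \<in> topspace X - P \<Longrightarrow> openin X {x}"
  shows "tube_property X"
proof (rule tube_propertyI[OF ref])
  fix x V W assume V: "openin X V" "x \<in> V" and W: "openin (prod_topology X (prod_topology X X)) W"
    and VW: "\<And>v y. v \<in> V \<Longrightarrow> y \<in> topspace X \<Longrightarrow> (v, y, y) \<in> W"
  have xX: "x \<in> topspace X"
    using V openin_subset by blast
  show "\<exists>V'. openin X V' \<and> x \<in> V' \<and> (\<forall>y\<in>topspace X. \<exists>U. openin X U \<and> y \<in> U \<and> (\<forall>v\<in>V'. \<forall>a\<in>U. \<forall>b\<in>U. (v, a, b) \<in> W))"
  proof (cases "x \<in> P")
    case True
    let ?D = "(\<lambda>y. (y, y)) ` topspace X"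
    have reg2: "regular_space (prod_topology X X)"
      using reg by (simp add: regular_space_prod_topology)
    have D: "closedin (prod_topology X X) ?D"
      using haus by (simp add: Hausdorff_space_closedin_diagonal)
    have "\<exists>V' E. openin X V' \<and> openin (prod_topology X X) E \<and> x \<in> V' \<and> V' \<subseteq> V \<inter> P \<and> ?D \<inter> (P \<times> P) \<subseteq> E \<and> E \<subseteq> P \<times> P \<and> V' \<times> E \<subseteq> W"
    proof (rule k_omega_set_tube[OF reg reg2 K k_omega_set_prod[OF reg reg haus K K] _ V True D])
      show "openin (subtopology (prod_topology X (prod_topology X X)) (K n \<times> K n \<times> K n)) (W \<inter> (K n \<times> K n \<times> K n))" for n
        using W by (auto simp: openin_subtopology)
      show "(V \<inter> P) \<times> (?D \<inter> P \<times> P) \<subseteq> W"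
        using VW by auto
    qed
    then obtain V' E where VE: "openin X V'" "openin (prod_topology X X) E" "x \<in> V'" "V' \<subseteq> V \<inter> P" "?D \<inter> (P \<times> P) \<subseteq> E" "E \<subseteq> P \<times> P" "V' \<times> E \<subseteq> W"
      by (elim exE conjE)
    have V': "openin X V'" "x \<in> V'" "V' \<subseteq> V" and E: "openin (prod_topology X X) E" "?D \<inter> (P \<times> P) \<subseteq> E" "V' \<times> E \<subseteq> W"
      using VE by simp_all
    have "\<exists>U. openin X U \<and> y \<in> U \<and> (\<forall>v\<in>V'. \<forall>a\<in>U. \<forall>b\<in>U. (v, a, b) \<in> W)" if y: "y \<in> topspace X" for y
    proof (cases "y \<in> P")
      case True
      then obtain U where "openin X U" "y \<in> U" "U \<times> U \<subseteq> E"
        using square_nbhd[OF E(1), of y] E(2) y by auto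
      then show ?thesis
        using E(3) by (intro exI[of _ U]) blast
    next
      case False
      then show ?thesis
        using iso[of y] y VW V'(3) by (intro exI[of _ "{y}"]) auto
    qed
    then show ?thesis
      using V' by blast
  next
    case False
    have "\<exists>U. openin X U \<and> y \<in> U \<and> (\<forall>v\<in>{x}. \<forall>a\<in>U. \<forall>b\<in>U. (v, a, b) \<in> W)" if y: "y \<in> topspace X" for y
    proof -
      obtain U1 U2 U3 where "openin X U1" "openin X U2" "openin X U3" "x \<in> U1" "y \<in> U2" "y \<in> U3"
        "\<forall>a\<in>U1. \<forall>b\<in>U2. \<forall>c\<in>U3. (a, b, c) \<in> W"
        using openin_triple_box[OF W VW[OF V(2) y]] by (elim exE conjE)
      then show ?thesis
        by (intro exI[of _ "U2 \<inter> U3"]) auto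
    qed
    then show ?thesis
      using iso[of x] False xX by (intro exI[of _ "{x}"]) auto
  qed
qed

definition sequential_base :: "'a topology \<Rightarrow> 'a \<Rightarrow> (nat \<Rightarrow> 'a set) \<Rightarrow> bool" where
  "sequential_base X x B \<longleftrightarrow> (\<forall>n. openin X (B n) \<and> x \<in> B n) \<and> (\<forall>U. openin X U \<longrightarrow> x \<in> U \<longrightarrow> (\<exists>N. \<forall>n\<ge>N. B n \<subseteq> U))"

lemma sequential_base_prod:
  assumes B: "sequential_base X x B" and C: "sequential_base Y y C"
  shows "sequential_base (prod_topology X Y) (x, y) (\<lambda>n. B n \<times> C n)"
  unfolding sequential_base_def
proof (intro conjI allI impI)
  show "openin (prod_topology X Y) (B n \<times> C n)" "(x, y) \<in> B n \<times> C n" for n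
    using B C by (auto simp: sequential_base_def openin_prod_Times_iff)
  fix W assume "openin (prod_topology X Y) W" "(x, y) \<in> W"
  then have "\<exists>U V. openin X U \<and> openin Y V \<and> x \<in> U \<and> y \<in> V \<and> U \<times> V \<subseteq> W"
    by (rule openin_prod_topology_alt[THEN iffD1, rule_format])
  then obtain U V where UV: "openin X U" "openin Y V" "x \<in> U" "y \<in> V" "U \<times> V \<subseteq> W"
    by (elim exE conjE)
  obtain M where M: "\<forall>n\<ge>M. B n \<subseteq> U"
    using B UV(1,3) unfolding sequential_base_def by blast
  obtain N where N: "\<forall>n\<ge>N. C n \<subseteq> V"
    using C UV(2,4) unfolding sequential_base_def by blast
  have "B n \<times> C n \<subseteq> W" if "n \<ge> max M N" for n
    using M N UV(5) that by fastforce
  then show "\<exists>N. \<forall>n\<ge>N. B n \<times> C n \<subseteq> W"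
    by blast
qed

lemma k_space_if_sequential_bases:
  assumes haus: "Hausdorff_space X" and base: "\<And>x. x \<in> topspace X \<Longrightarrow> \<exists>B. sequential_base X x B"
  shows "k_space X"
  unfolding k_space
proof (intro allI impI)
  fix S assume S: "S \<subseteq> topspace X \<and> (\<forall>K. compactin X K \<longrightarrow> closedin (subtopology X K) (K \<inter> S))"
  have "z \<in> S" if z: "z \<in> X closure_of S" for z
  proof -
    have zX: "z \<in> topspace X"
      using z closure_of_subset_topspace[of X S] by blast
    obtain B where B: "sequential_base X z B"
      using base[OF zX] by blast
    have "\<exists>a. a \<in> S \<and> a \<in> B n" for n
      using z B unfolding in_closure_of sequential_base_def by blast
    then obtain a where a: "\<And>n. a n \<in> S" "\<And>n. a n \<in> B n"
      by metis
    have lim: "limitin X a z sequentially"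
      unfolding limitin_sequentially
    proof (intro conjI allI impI)
      fix U assume "openin X U \<and> z \<in> U"
      then obtain N where "\<forall>n\<ge>N. B n \<subseteq> U"
        using B unfolding sequential_base_def by blast
      then show "\<exists>N. \<forall>n\<ge>N. a n \<in> U"
        using a(2) by blast
    qed (rule zX)
    have K: "compactin X (insert z (range a))"
      by (rule compactin_sequence_with_limit[OF lim]) (use a S in auto)
    then have "closedin X (insert z (range a) \<inter> S)"
      using S closedin_closed_subtopology[OF compactin_imp_closedin[OF haus K]] by auto
    then have "z \<in> insert z (range a) \<inter> S"
      by (rule limitin_closedin[OF lim]) (use a in auto)
    then show ?thesis
      by blast
  qed
  then show "closedin X S"
    using S by (metis closedin_closure_of closure_of_subset subsetI subset_antisym)
qed

section \<open>Fans in \<open>A\<^sub>3(X)\<close>\<close>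

lemma countable_enumeration:
  assumes "countable S"
  shows "\<exists>e. S \<subseteq> range (e :: nat \<Rightarrow> 'b)"
proof (cases "S = {}")
  case False
  then show ?thesis
    using range_from_nat_into[OF False assms] by (intro exI[of _ "from_nat_into S"]) simp
qed simp

locale kR_level_3 = free_stratified X A T i G
  for X :: "'a topology" and A :: "'g monoid" and T i G +
  fixes \<P> :: "'a set set"
  assumes k_network: "k_network X \<P>" and compact_countable: "compact_countable X \<P>"
    and kR: "kR_space (free_abelian_level 3 X A T i)"
begin

lemma regular: "regular_space X"
  using tychonoff by (simp add: tychonoff_space_def completely_regular_imp_regular_space)

lemma network_cover:
  assumes "compactin X K" "openin X U" "K \<subseteq> U"
  shows "\<exists>\<F>. finite \<F> \<and> \<F> \<subseteq> \<P> \<and> K \<subseteq> \<Union>\<F> \<and> \<Union>\<F> \<subseteq> U"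
  using k_network assms by (simp add: k_network_def)

lemma countable_meeting: "compactin X K \<Longrightarrow> countable {P \<in> \<P>. P \<inter> K \<noteq> {}}"
  using compact_countable by (simp add: compact_countable_def)

lemma network_subset: "P \<in> \<P> \<Longrightarrow> P \<subseteq> topspace X"
  using k_network by (auto simp: k_network_def)

lemma compact_sequence:
  assumes "limitin X s z sequentially" "\<And>n::nat. s n \<in> topspace X"
  shows "compactin X (insert z (range s))"
  by (rule compactin_sequence_with_limit[OF assms(1)]) (use assms(2) in auto)

lemma small_difference:
  assumes M: "openin T M" "\<one>\<^bsub>A\<^esub> \<in> M" and s: "limitin X s y sequentially"
  shows "\<exists>N. \<forall>n\<ge>N. ev (letter 1 (s n) + letter (-1) y) \<in> M"
proof -
  have y: "y \<in> topspace X"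
    by (rule limitin_topspace[OF s])
  have "continuous_map X T (\<lambda>x. ev (letter 1 x + letter (-1) y))"
  proof (rule continuous_ev_add)
    show "continuous_map X T (\<lambda>x. ev (letter 1 x))"
      by (rule continuous_letter) simp
    have "ev (letter (-1) y) \<in> topspace T"
      unfolding topspace_T by (rule ev_closed[OF keys_letter[OF y]])
    then show "continuous_map X T (\<lambda>x. ev (letter (-1) y))"
      by simp
  qed (rule keys_letter, use y in simp)+
  then have "openin X {x \<in> topspace X. ev (letter 1 x + letter (-1) y) \<in> M}"
    using M(1) by (rule openin_continuous_map_preimage)
  moreover have "y \<in> {x \<in> topspace X. ev (letter 1 x + letter (-1) y) \<in> M}"
    using y M(2) by (simp add: ev_zero)
  ultimately have "\<exists>N. \<forall>n\<ge>N. s n \<in> {x \<in> topspace X. ev (letter 1 x + letter (-1) y) \<in> M}"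
    using s unfolding limitin_sequentially by blast
  then show ?thesis
    by blast
qed

lemma split_neighbourhood:
  assumes N: "openin T N" "ev (letter 1 x) \<in> N" and x: "x \<in> topspace X"
  shows "\<exists>U M. openin X U \<and> x \<in> U \<and> openin T M \<and> \<one>\<^bsub>A\<^esub> \<in> M \<and>
    (\<forall>a\<in>U. \<forall>d. Poly_Mapping.keys d \<subseteq> topspace X \<longrightarrow> ev d \<in> M \<longrightarrow> ev (letter 1 a + d) \<in> N)"
proof -
  let ?W = "{w \<in> topspace (prod_topology T T). (\<lambda>(x, y). x \<otimes>\<^bsub>A\<^esub> y) w \<in> N}"
  have W: "openin (prod_topology T T) ?W"
    using continuous_mult N(1) by (rule openin_continuous_map_preimage)
  have "(ev (letter 1 x), \<one>\<^bsub>A\<^esub>) \<in> ?W"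
    using N(2) ev_closed[OF keys_letter[OF x, of 1]] A.r_one[OF ev_closed[OF keys_letter[OF x, of 1]]]
    by (simp add: topspace_T)
  from openin_prod_topology_alt[THEN iffD1, rule_format, OF W this]
  obtain M1 M where M: "openin T M1" "openin T M" "ev (letter 1 x) \<in> M1" "\<one>\<^bsub>A\<^esub> \<in> M" "M1 \<times> M \<subseteq> ?W"
    by (elim exE conjE)
  let ?U = "{a \<in> topspace X. ev (letter 1 a) \<in> M1}"
  have "openin X ?U"
    by (rule openin_continuous_map_preimage[OF continuous_letter M(1)]) simp
  moreover have "ev (letter 1 a + d) \<in> N" if "a \<in> ?U" "Poly_Mapping.keys d \<subseteq> topspace X" "ev d \<in> M" for a d
  proof -
    have "(ev (letter 1 a), ev d) \<in> ?W"
      using M(5) that by blast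
    then show ?thesis
      using ev_add[OF keys_letter that(2), of a 1] that(1) by simp
  qed
  ultimately show ?thesis
    using M x by (intro exI[of _ ?U] exI[of _ M]) simp
qed

text \<open>Only \<open>a l\<close> has to approach \<open>x\<close>; the points \<open>y l\<close>
  may even be closed and discrete, because it is the difference of \<open>s l\<close> and
  \<open>y l\<close> that approaches 0. The letters used for detection are \<open>a l\<close> and
  \<open>y l\<close>, and \<open>ne\<close> keeps them from cancelling: the coefficient of
  \<open>y l\<close> is exactly -1, which also tells the word from \<open>x\<close>.\<close>

lemma no_difference_fan:
  assumes X: "\<And>l. l \<in> I \<Longrightarrow> a l \<in> topspace X \<and> s l \<in> topspace X \<and> y l \<in> topspace X" "x \<in> topspace X"
    and ne: "\<And>l. l \<in> I \<Longrightarrow> a l \<noteq> y l \<and> s l \<noteq> y l"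
    and U: "\<And>l. l \<in> I \<Longrightarrow> openin X (U l) \<and> a l \<in> U l" and V: "\<And>l. l \<in> I \<Longrightarrow> openin X (V l) \<and> y l \<in> V l"
    and fin: "\<And>L. compactin X L \<Longrightarrow> finite {l \<in> I. U l \<inter> L \<noteq> {} \<and> V l \<inter> L \<noteq> {}}"
    and cluster: "\<And>O' M. openin X O' \<Longrightarrow> x \<in> O' \<Longrightarrow> openin T M \<Longrightarrow> \<one>\<^bsub>A\<^esub> \<in> M \<Longrightarrow>
      \<exists>l\<in>I. a l \<in> O' \<and> ev (letter 1 (s l) + letter (-1) (y l)) \<in> M"
  shows False
proof -
  let ?c = "\<lambda>l. letter 1 (a l) + (letter 1 (s l) + letter (-1) (y l))"
  have keys: "Poly_Mapping.keys (?c l) \<subseteq> topspace X" if "l \<in> I" for l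
    using X(1)[OF that] by (intro keys_add_subset keys_letter) auto
  have lookup: "Poly_Mapping.lookup (?c l) (y l) = -1" "Poly_Mapping.lookup (?c l) (a l) > 0" if "l \<in> I" for l
    using ne[OF that] by (auto simp: lookup_add lookup_minus)
  have "\<not> kR_space (free_abelian_level 3 X A T i)"
  proof (rule not_kR_space_if_fan[of I ?c 3 a U y V "letter 1 x"])
    fix l assume l: "l \<in> I"
    show "Poly_Mapping.keys (?c l) \<subseteq> topspace X"
      by (rule keys[OF l])
    show "frag_length (?c l) \<le> 3"
      using frag_length_add[of "letter 1 (a l)" "letter 1 (s l) + letter (-1) (y l)"]
        frag_length_add[of "letter 1 (s l)" "letter (-1) (y l)"] unfolding frag_length_letter by simp
    show "a l \<in> Poly_Mapping.keys (?c l)" "y l \<in> Poly_Mapping.keys (?c l)"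
      using lookup[OF l] by (auto simp: in_keys_iff)
    show "openin X (U l)" "a l \<in> U l" "openin X (V l)" "y l \<in> V l"
      using U[OF l] V[OF l] by auto
    show "?c l \<noteq> letter 1 x"
    proof
      assume eq: "?c l = letter 1 x"
      have "Poly_Mapping.lookup (letter 1 x) (y l) = -1"
        using lookup(1)[OF l] unfolding eq .
      then show False
        by (simp split: if_splits)
    qed
  next
    show "finite {l \<in> I. U l \<inter> L \<noteq> {} \<and> V l \<inter> L \<noteq> {}}" if "compactin X L" for L
      by (rule fin[OF that])
    show "Poly_Mapping.keys (letter 1 x) \<subseteq> topspace X"
      by (rule keys_letter[OF X(2)])
    show "frag_length (letter 1 x) \<le> 3"
      unfolding frag_length_letter by simp
    fix N assume N: "openin T N" "ev (letter 1 x) \<in> N"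
    from split_neighbourhood[OF this X(2)]
    obtain O' M where O': "openin X O'" "x \<in> O'" "openin T M" "\<one>\<^bsub>A\<^esub> \<in> M"
      "\<forall>a\<in>O'. \<forall>d. Poly_Mapping.keys d \<subseteq> topspace X \<longrightarrow> ev d \<in> M \<longrightarrow> ev (letter 1 a + d) \<in> N"
      by (elim exE conjE)
    obtain l where l: "l \<in> I" "a l \<in> O'" "ev (letter 1 (s l) + letter (-1) (y l)) \<in> M"
      using cluster[OF O'(1-4)] by blast
    have "Poly_Mapping.keys (letter 1 (s l) + letter (-1) (y l)) \<subseteq> topspace X"
      using X(1)[OF l(1)] by (intro keys_add_subset keys_letter) auto
    then show "\<exists>l\<in>I. ev (?c l) \<in> N"
      using O'(5) l by blast
  qed
  then show False
    using kR by contradiction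
qed

text \<open>Fans in the square of \<open>X\<close> at \<open>(x, y)\<close> are carried over by
  addition. The condition \<open>ne\<close> keeps the words different from
  \<open>x + y\<close>.\<close>

lemma no_sum_fan:
  assumes X: "\<And>l. l \<in> I \<Longrightarrow> a l \<in> topspace X \<and> b l \<in> topspace X" "x \<in> topspace X" "y \<in> topspace X"
    and ne: "\<And>l. l \<in> I \<Longrightarrow> b l \<noteq> x \<and> b l \<noteq> y"
    and U: "\<And>l. l \<in> I \<Longrightarrow> openin X (U l) \<and> a l \<in> U l" and V: "\<And>l. l \<in> I \<Longrightarrow> openin X (V l) \<and> b l \<in> V l"
    and fin: "\<And>L. compactin X L \<Longrightarrow> finite {l \<in> I. U l \<inter> L \<noteq> {} \<and> V l \<inter> L \<noteq> {}}"
    and cluster: "\<And>P Q. openin X P \<Longrightarrow> x \<in> P \<Longrightarrow> openin X Q \<Longrightarrow> y \<in> Q \<Longrightarrow> \<exists>l\<in>I. a l \<in> P \<and> b l \<in> Q"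
  shows False
proof -
  let ?c = "\<lambda>a b. letter 1 a + letter 1 b"
  have keys: "Poly_Mapping.keys (?c a b) \<subseteq> topspace X" if "a \<in> topspace X" "b \<in> topspace X" for a b
    using that by (intro keys_add_subset keys_letter)
  have length: "frag_length (?c a b) \<le> 3" for a b :: 'a
    using frag_length_add[of "letter 1 a" "letter 1 b"] unfolding frag_length_letter by simp
  have lookup: "Poly_Mapping.lookup (?c a b) b > 0" "Poly_Mapping.lookup (?c a b) a > 0" for a b :: 'a
    by (auto simp: lookup_add)
  have "\<not> kR_space (free_abelian_level 3 X A T i)"
  proof (rule not_kR_space_if_fan[of I "\<lambda>l. ?c (a l) (b l)" 3 a U b V "?c x y"])
    fix l assume l: "l \<in> I"
    show "Poly_Mapping.keys (?c (a l) (b l)) \<subseteq> topspace X"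
      using X(1)[OF l] keys by blast
    show "frag_length (?c (a l) (b l)) \<le> 3"
      by (rule length)
    show "a l \<in> Poly_Mapping.keys (?c (a l) (b l))" "b l \<in> Poly_Mapping.keys (?c (a l) (b l))"
      using lookup[of "a l" "b l"] by (auto simp: in_keys_iff)
    show "openin X (U l)" "a l \<in> U l" "openin X (V l)" "b l \<in> V l"
      using U[OF l] V[OF l] by auto
    show "?c (a l) (b l) \<noteq> ?c x y"
    proof
      assume eq: "?c (a l) (b l) = ?c x y"
      have "Poly_Mapping.lookup (?c x y) (b l) > 0"
        using lookup(1)[of "a l" "b l"] unfolding eq .
      then show False
        using ne[OF l] by (simp add: lookup_add)
    qed
  next
    show "finite {l \<in> I. U l \<inter> L \<noteq> {} \<and> V l \<inter> L \<noteq> {}}" if "compactin X L" for L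
      by (rule fin[OF that])
    show "Poly_Mapping.keys (?c x y) \<subseteq> topspace X" "frag_length (?c x y) \<le> 3"
      by (rule keys[OF X(2,3)], rule length)
    fix N assume N: "openin T N" "ev (?c x y) \<in> N"
    have "continuous_map (prod_topology X X) T (\<lambda>w. ev (letter 1 (fst w) + letter 1 (snd w)))"
    proof (rule continuous_ev_add)
      show "continuous_map (prod_topology X X) T (\<lambda>w. ev (letter 1 (fst w)))"
        using continuous_map_compose[OF continuous_map_fst continuous_letter[of 1]] by (simp add: o_def)
      show "continuous_map (prod_topology X X) T (\<lambda>w. ev (letter 1 (snd w)))"
        using continuous_map_compose[OF continuous_map_snd continuous_letter[of 1]] by (simp add: o_def)
    qed (rule keys_letter, auto)+
    then have W: "openin (prod_topology X X) {w \<in> topspace (prod_topology X X). ev (?c (fst w) (snd w)) \<in> N}"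
      using N(1) by (rule openin_continuous_map_preimage)
    have "(x, y) \<in> {w \<in> topspace (prod_topology X X). ev (?c (fst w) (snd w)) \<in> N}"
      using X(2,3) N(2) by simp
    from openin_prod_topology_alt[THEN iffD1, rule_format, OF W this]
    obtain P Q where P: "openin X P" "openin X Q" "x \<in> P" "y \<in> Q"
      "P \<times> Q \<subseteq> {w \<in> topspace (prod_topology X X). ev (?c (fst w) (snd w)) \<in> N}"
      by (elim exE conjE)
    obtain l where "l \<in> I" "a l \<in> P" "b l \<in> Q"
      using cluster[OF P(1,3,2,4)] by blast
    moreover then have "(a l, b l) \<in> {w \<in> topspace (prod_topology X X). ev (?c (fst w) (snd w)) \<in> N}"
      using P(5) by blast
    ultimately show "\<exists>l\<in>I. ev (?c (a l) (b l)) \<in> N"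
      by (intro bexI[of _ l]) simp_all
  qed
  then show False
    using kR by contradiction
qed

definition nonisolated :: "'a set" where
  "nonisolated = {x \<in> topspace X. \<not> openin X {x}}"

lemma closedin_nonisolated: "closedin X nonisolated"
proof -
  have "topspace X - nonisolated = \<Union>{{x} |x. openin X {x}}"
  proof
    show "topspace X - nonisolated \<subseteq> \<Union>{{x} |x. openin X {x}}"
      unfolding nonisolated_def by blast
    show "\<Union>{{x} |x. openin X {x}} \<subseteq> topspace X - nonisolated"
      unfolding nonisolated_def using openin_subset[of X "{_}"] by auto
  qed
  moreover have "openin X (\<Union>{{x} |x. openin X {x}})"
    by (rule openin_Union) auto
  ultimately show ?thesis
    by (auto simp: closedin_def nonisolated_def)
qed

text \<open>If some compact set is not covered by finitely many relatively compact members of the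
  \<open>k\<close>-network, then every neighbourhood of some point \<open>x\<close> contains one of countably many given
  infinite closed discrete sets \<open>D j\<close>, as in the metric fan.\<close>

lemma discrete_sets_at_point:
  assumes K: "compactin X K"
    and no: "\<not> (\<exists>\<F>. finite \<F> \<and> \<F> \<subseteq> {P \<in> \<P>. compactin X (X closure_of P)} \<and> K \<subseteq> \<Union>\<F>)"
  shows "\<exists>x D. x \<in> topspace X \<and> (\<forall>j m. D j m \<in> topspace X) \<and>
    (\<forall>j::nat. compact_finite X UNIV (\<lambda>m::nat. {D j m})) \<and> (\<forall>U. openin X U \<longrightarrow> x \<in> U \<longrightarrow> (\<exists>j. range (D j) \<subseteq> U))"
proof -
  let ?C = "{P \<in> \<P>. P \<inter> K \<noteq> {} \<and> compactin X (X closure_of P)}"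
  let ?N = "{P \<in> \<P>. P \<inter> K \<noteq> {} \<and> \<not> compactin X (X closure_of P)}"
  have cC: "countable ?C" and cN: "countable ?N"
    by (rule countable_subset[OF _ countable_meeting[OF K]], blast)+
  obtain e :: "nat \<Rightarrow> 'a set" where e: "?C \<subseteq> range e"
    using countable_enumeration[OF cC] by blast
  \<comment> \<open>These points of \<open>K\<close> avoid more and more of the relatively compact
    members that meet \<open>K\<close>. A convergent subsequence can be covered only with the help
    of members that are not relatively compact, and its limit is the required point
    \<open>x\<close>.\<close>
  have "\<exists>y. y \<in> K \<and> (\<forall>k\<le>n. e k \<in> ?C \<longrightarrow> y \<notin> e k)" for n
  proof (rule ccontr)
    assume neg: "\<not> ?thesis"
    have "K \<subseteq> \<Union>(?C \<inter> e ` {..n})"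
    proof
      fix z assume "z \<in> K"
      then obtain k where "k \<le> n" "e k \<in> ?C" "z \<in> e k"
        using neg by blast
      then show "z \<in> \<Union>(?C \<inter> e ` {..n})"
        by (intro UnionI[of "e k"]) auto
    qed
    moreover have "finite (?C \<inter> e ` {..n})" "?C \<inter> e ` {..n} \<subseteq> {P \<in> \<P>. compactin X (X closure_of P)}"
      by auto
    ultimately have "finite (?C \<inter> e ` {..n}) \<and> ?C \<inter> e ` {..n} \<subseteq> {P \<in> \<P>. compactin X (X closure_of P)} \<and> K \<subseteq> \<Union>(?C \<inter> e ` {..n})"
      by (intro conjI)
    then have "\<exists>\<F>. finite \<F> \<and> \<F> \<subseteq> {P \<in> \<P>. compactin X (X closure_of P)} \<and> K \<subseteq> \<Union>\<F>"
      by (rule exI)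
    then show False
      using no by contradiction
  qed
  then have "\<forall>n. \<exists>y. y \<in> K \<and> (\<forall>k\<le>n. e k \<in> ?C \<longrightarrow> y \<notin> e k)"
    by (rule allI)
  from choice[OF this] obtain y where y': "\<forall>n. y n \<in> K \<and> (\<forall>k\<le>n. e k \<in> ?C \<longrightarrow> y n \<notin> e k)" ..
  have y: "\<And>n. y n \<in> K" "\<And>n k. k \<le> n \<Longrightarrow> e k \<in> ?C \<Longrightarrow> y n \<notin> e k"
    using y' by simp_all
  obtain x r where x: "x \<in> K" "strict_mono r" "limitin X (y \<circ> r) x sequentially"
    using sequentially_compact[of K y, OF K y(1)] by blast
  have KX: "K \<subseteq> topspace X"
    using K compactin_subset_topspace by blast
  have N: "\<exists>P\<in>?N. P \<subseteq> U" if U: "openin X U" "x \<in> U" for U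
  proof -
    obtain t where t: "\<And>k. k \<ge> t \<Longrightarrow> y (r k) \<in> U"
      using x(3) U unfolding limitin_sequentially by auto
    let ?l = "\<lambda>k. y (r (k + t))"
    have "limitin X ?l x sequentially"
      using limitin_sequentially_offset[OF x(3), of t] by (simp add: o_def)
    then have "compactin X (insert x (range ?l))"
      by (rule compact_sequence) (use y KX in auto)
    moreover have "insert x (range ?l) \<subseteq> U"
      using t U(2) by auto
    ultimately have "\<exists>\<F>. finite \<F> \<and> \<F> \<subseteq> \<P> \<and> insert x (range ?l) \<subseteq> \<Union>\<F> \<and> \<Union>\<F> \<subseteq> U"
      by (rule network_cover[OF _ U(1)])
    then obtain \<F> where F: "finite \<F>" "\<F> \<subseteq> \<P>" "insert x (range ?l) \<subseteq> \<Union>\<F>" "\<Union>\<F> \<subseteq> U"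
      by (elim exE conjE)
    have "\<exists>k. \<forall>P\<in>\<F> \<inter> ?C. ?l k \<notin> P"
    proof -
      have "\<forall>P\<in>\<F> \<inter> ?C. \<exists>n. P = e n"
        using e by blast
      from bchoice[OF this] obtain f where "\<forall>P\<in>\<F> \<inter> ?C. P = e (f P)" ..
      then have f: "\<And>P. P \<in> \<F> \<inter> ?C \<Longrightarrow> P = e (f P)"
        by (rule bspec)
      have "finite (f ` (\<F> \<inter> ?C))"
        using F(1) by blast
      then obtain k where k: "\<forall>n\<in>f ` (\<F> \<inter> ?C). n \<le> k"
        unfolding finite_nat_set_iff_bounded_le ..
      have "?l k \<notin> P" if P: "P \<in> \<F> \<inter> ?C" for P
      proof -
        have "f P \<le> k"
          using k P by blast
        also have "k \<le> r (k + t)"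
          using strict_mono_imp_increasing[OF x(2), of "k + t"] by linarith
        finally have "y (r (k + t)) \<notin> e (f P)"
          by (rule y(2)) (use f[OF P] P in auto)
        then show ?thesis
          using f[OF P] by simp
      qed
      then show ?thesis
        by blast
    qed
    then obtain k where k: "\<And>P. P \<in> \<F> \<inter> ?C \<Longrightarrow> ?l k \<notin> P"
      by blast
    obtain P where P: "P \<in> \<F>" "?l k \<in> P"
      using F(3) by blast
    then have "P \<inter> K \<noteq> {}"
      using y(1) by blast
    then have "P \<in> ?N"
      using P F(2) k[of P] by blast
    then show ?thesis
      using P F(4) by blast
  qed
  have "?N \<noteq> {}"
    using N[of "topspace X"] x(1) KX by auto
  define q where "q = from_nat_into ?N"
  have q: "range q = ?N"
    unfolding q_def by (rule range_from_nat_into[OF \<open>?N \<noteq> {}\<close> cN])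
  \<comment> \<open>The closure of \<open>q j\<close> is not compact, so it contains a
    compact-finite sequence. Passing to closures is harmless since \<open>X\<close> is
    regular.\<close>
  have "\<exists>d::nat \<Rightarrow> 'a. range d \<subseteq> X closure_of (q j) \<and> compact_finite X UNIV (\<lambda>m. {d m})" for j
  proof (rule ccontr)
    assume "\<not> ?thesis"
    then have "compactin X (X closure_of (q j))"
      by (intro compactin_if_no_compact_finite_sequence) auto
    then show False
      using q by blast
  qed
  then obtain D :: "nat \<Rightarrow> nat \<Rightarrow> 'a" where D: "\<And>j. range (D j) \<subseteq> X closure_of (q j)" "\<And>j. compact_finite X UNIV (\<lambda>m. {D j m})"
    by metis
  have "\<exists>j. range (D j) \<subseteq> U" if U: "openin X U" "x \<in> U" for U
  proof -
    have "compactin X {x}" "{x} \<subseteq> U"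
      using x(1) KX U by auto
    then have "\<exists>V. openin X V \<and> {x} \<subseteq> V \<and> X closure_of V \<subseteq> U"
      by (intro compactin_nbhd_closure[OF regular _ U(1)])
    then obtain V where V: "openin X V" "{x} \<subseteq> V" "X closure_of V \<subseteq> U"
      by (elim exE conjE)
    have "\<exists>P\<in>?N. P \<subseteq> V"
      by (rule N[OF V(1)]) (use V(2) in simp)
    then obtain P where P: "P \<in> ?N" "P \<subseteq> V"
      by (elim bexE)
    have "P \<in> range q"
      unfolding q by (rule P(1))
    then obtain j where "P = q j"
      by (rule rangeE)
    then have "range (D j) \<subseteq> X closure_of V"
      using D(1)[of j] closure_of_mono[OF P(2), of X] by simp
    then show ?thesis
      using V(3) by blast
  qed
  moreover have "D j m \<in> topspace X" for j m
    using D(1)[of j] closure_of_subset_topspace[of X "q j"] by blast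
  ultimately show ?thesis
    using x(1) KX D(2) by (intro exI[of _ x] exI[of _ D] conjI allI impI) auto
qed

lemma expand_points:
  fixes d :: "nat \<Rightarrow> 'a"
  assumes "compact_finite X UNIV (\<lambda>m. {d m})" "\<And>m. d m \<in> topspace X"
  shows "\<exists>W. (\<forall>m. openin X (W m) \<and> d m \<in> W m) \<and> compact_finite X UNIV W"
proof -
  have "compact_finite X UNIV (\<lambda>m. range (\<lambda>n::nat. d m))"
    using assms(1) by simp
  then have "\<exists>W. (\<forall>m\<in>UNIV. \<forall>n. openin X (W m n) \<and> d m \<in> W m n) \<and> compact_finite X UNIV (\<lambda>m. \<Union>n::nat. W m n)"
    by (rule compact_finite_expansion) (rule assms(2))
  then obtain W :: "nat \<Rightarrow> nat \<Rightarrow> 'a set" where W: "\<forall>m\<in>UNIV. \<forall>n. openin X (W m n) \<and> d m \<in> W m n"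
    and cf: "compact_finite X UNIV (\<lambda>m. \<Union>n. W m n)"
    by (elim exE conjE)
  have "compact_finite X UNIV (\<lambda>m. W m 0)"
    by (rule compact_finite_subset[OF cf]) auto
  then show ?thesis
    using W by (intro exI[of _ "\<lambda>m. W m 0"]) simp
qed

end

section \<open>A point with infinite closed discrete sets in every neighbourhood\<close>

locale kR_discrete_fan = kR_level_3 X A T i G \<P>
  for X :: "'a topology" and A :: "'g monoid" and T i G \<P> +
  fixes x :: 'a and D :: "nat \<Rightarrow> nat \<Rightarrow> 'a"
  assumes x: "x \<in> topspace X" and D: "\<And>j m. D j m \<in> topspace X"
    and D_discrete: "\<And>j. compact_finite X UNIV (\<lambda>m. {D j m})"
    and D_inside: "\<And>U. openin X U \<Longrightarrow> x \<in> U \<Longrightarrow> \<exists>j. range (D j) \<subseteq> U"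
begin

lemma finite_D_eq: "y \<in> topspace X \<Longrightarrow> finite {m. D j m = y}"
  using compact_finiteD[OF D_discrete, of "{y}" j] by (simp add: eq_commute)

lemma D_ne: "y \<in> topspace X \<Longrightarrow> \<exists>m\<ge>N. D j m \<noteq> y"
proof (rule ccontr)
  assume y: "y \<in> topspace X" and neg: "\<not> ?thesis"
  then have "{N..} \<subseteq> {m. D j m = y}"
    by auto
  then show False
    using finite_D_eq[OF y, of j] infinite_Ici[of N] finite_subset by blast
qed

lemma x_nonisolated: "x \<in> nonisolated"
proof -
  have "\<not> openin X {x}"
  proof
    assume "openin X {x}"
    then obtain j where "range (D j) \<subseteq> {x}"
      using D_inside[of "{x}"] by blast
    then show False
      using D_ne[OF x, of 0 j] by blast
  qed
  then show ?thesis
    using x by (simp add: nonisolated_def)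
qed

text \<open>Each of the first \<open>N\<close> sets has a point other than \<open>x\<close>;
  removing these finitely many points from \<open>U\<close> excludes these sets. So the index can
  also be taken late in a given convergent sequence.\<close>

lemma D_inside_late:
  assumes "openin X U" "x \<in> U"
  shows "\<exists>j\<ge>N. range (D j) \<subseteq> U"
proof -
  have "\<exists>m. D j m \<noteq> x" for j
    using D_ne[OF x] by blast
  then obtain m where m: "\<And>j. D j (m j) \<noteq> x"
    by metis
  let ?F = "(\<lambda>j. D j (m j)) ` {..<N}"
  have "closedin X ?F"
    using D by (intro closedin_Hausdorff_finite[OF Hausdorff]) auto
  then have "openin X (U - ?F)"
    using assms(1) by blast
  moreover have "x \<in> U - ?F"
    using assms(2) m by fastforce
  ultimately obtain j where j: "range (D j) \<subseteq> U - ?F"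
    using D_inside by blast
  have "j \<ge> N"
  proof (rule ccontr)
    assume "\<not> j \<ge> N"
    then have "D j (m j) \<in> ?F"
      by simp
    then show False
      using j by blast
  qed
  then show ?thesis
    using j by blast
qed

lemma D_expansion: "\<exists>W. \<forall>j. (\<forall>m. openin X (W j m) \<and> D j m \<in> W j m) \<and> compact_finite X UNIV (W j)"
  by (rule choice) (rule allI, rule expand_points[OF D_discrete D])

lemma finite_pairs:
  assumes "finite {j. R j}" "\<And>j. finite {m::nat. S j m}"
  shows "finite {(j::nat, m). R j \<and> S j m}"
proof -
  have "finite (Sigma {j. R j} (\<lambda>j. {m. S j m}))"
    using assms by blast
  then show ?thesis
    by (rule finite_subset[rotated]) auto
qed

text \<open>Otherwise a compact-finite sequence of non-isolated points \<open>y j\<close>, with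
  \<open>s j\<close> converging to \<open>y j\<close>, gives the fan
  \<open>D j m + s j m - y j\<close> at \<open>x\<close>: a compact set meets only finitely many
  \<open>V j\<close>, and for each of them finitely many \<open>W j m\<close>. A neighbourhood of
  \<open>x\<close> fixes \<open>j\<close>, and a neighbourhood of 0 then asks for a large
  \<open>m\<close>.\<close>

lemma compactin_nonisolated: "compactin X nonisolated"
proof (rule compactin_if_no_compact_finite_sequence[OF closedin_nonisolated], rule notI)
  fix y :: "nat \<Rightarrow> 'a" assume y: "range y \<subseteq> nonisolated" and cf: "compact_finite X UNIV (\<lambda>m. {y m})"
  have yX: "y j \<in> topspace X" and y_ni: "\<not> openin X {y j}" for j
    using y by (auto simp: nonisolated_def)
  have "\<forall>j. \<exists>s. (\<forall>n::nat. s n \<in> topspace X \<and> s n \<noteq> y j) \<and> limitin X s (y j) sequentially"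
    using non_isolated_limit[OF yX y_ni] by (rule allI)
  from choice[OF this] obtain s where
    s': "\<forall>j. (\<forall>n::nat. s j n \<in> topspace X \<and> s j n \<noteq> y j) \<and> limitin X (s j) (y j) sequentially" ..
  have s: "s j n \<in> topspace X" "s j n \<noteq> y j" "limitin X (s j) (y j) sequentially" for j n
    using s' by auto
  obtain V where V: "\<And>j. openin X (V j)" "\<And>j. y j \<in> V j" and Vcf: "compact_finite X UNIV V"
    using expand_points[OF cf yX] by metis
  obtain W where W': "\<forall>j. (\<forall>m. openin X (W j m) \<and> D j m \<in> W j m) \<and> compact_finite X UNIV (W j)"
    using D_expansion ..
  have W: "openin X (W j m)" "D j m \<in> W j m" and Wcf: "compact_finite X UNIV (W j)" for j m
    using W' by auto
  let ?I = "{(j, m). D j m \<noteq> y j}"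
  show False
  proof (rule no_difference_fan[of ?I "\<lambda>(j, m). D j m" "\<lambda>(j, m). s j m" "\<lambda>(j, m). y j" x "\<lambda>(j, m). W j m" "\<lambda>(j, m). V j"])
    fix L assume L: "compactin X L"
    have "finite {j \<in> UNIV. V j \<inter> L \<noteq> {}}" "\<And>j. finite {m \<in> UNIV. W j m \<inter> L \<noteq> {}}"
      using compact_finiteD[OF Vcf L] compact_finiteD[OF Wcf L] by auto
    then have "finite {(j, m). V j \<inter> L \<noteq> {} \<and> W j m \<inter> L \<noteq> {}}"
      by (intro finite_pairs) auto
    then show "finite {l \<in> ?I. (case l of (j, m) \<Rightarrow> W j m) \<inter> L \<noteq> {} \<and> (case l of (j, m) \<Rightarrow> V j) \<inter> L \<noteq> {}}"
      by (rule finite_subset[rotated]) auto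
  next
    fix Q M assume Q: "openin X Q" "x \<in> Q" and M: "openin T M" "\<one>\<^bsub>A\<^esub> \<in> M"
    obtain j where j: "range (D j) \<subseteq> Q"
      using D_inside[OF Q] by blast
    obtain N where N: "\<forall>n\<ge>N. ev (letter 1 (s j n) + letter (-1) (y j)) \<in> M"
      using small_difference[OF M s(3)] by blast
    obtain m where "m \<ge> N" "D j m \<noteq> y j"
      using D_ne[OF yX] by blast
    then show "\<exists>l\<in>?I. (case l of (j, m) \<Rightarrow> D j m) \<in> Q \<and>
      ev (letter 1 (case l of (j, m) \<Rightarrow> s j m) + letter (-1) (case l of (j, m) \<Rightarrow> y j)) \<in> M"
      using j N by (intro bexI[of _ "(j, m)"]) auto
  qed (use x D s yX W V in auto)
qed

text \<open>Without such a compact set, a subsequence of the \<open>y n\<close> with limit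
  \<open>z\<close> would give the fan of the words \<open>D k m + \<sigma> (r k) m\<close> at
  \<open>x + z\<close>. The points \<open>\<sigma> n m\<close> are isolated and serve as their own
  neighbourhoods.\<close>

lemma sequences_meet_compact:
  fixes \<sigma> :: "nat \<Rightarrow> nat \<Rightarrow> 'a"
  assumes y: "\<And>n. y n \<in> nonisolated" and lim: "\<And>n. limitin X (\<sigma> n) (y n) sequentially"
    and iso: "\<And>n m. \<sigma> n m \<in> topspace X - nonisolated"
  shows "\<exists>L. compactin X L \<and> infinite {n. range (\<sigma> n) \<inter> L \<noteq> {}}"
proof (rule ccontr)
  assume neg: "\<not> ?thesis"
  obtain z r where z: "z \<in> nonisolated" "strict_mono r" "limitin X (y \<circ> r) z sequentially"
    using sequentially_compact[of nonisolated y, OF compactin_nonisolated y] by blast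
  have zX: "z \<in> topspace X"
    using z by (simp add: nonisolated_def)
  obtain W where W': "\<forall>j. (\<forall>m. openin X (W j m) \<and> D j m \<in> W j m) \<and> compact_finite X UNIV (W j)"
    using D_expansion ..
  have W: "openin X (W j m)" "D j m \<in> W j m" and Wcf: "compact_finite X UNIV (W j)" for j m
    using W' by auto
  have isolated: "openin X {\<sigma> n m}" "\<sigma> n m \<in> topspace X" "\<sigma> n m \<notin> nonisolated" for n m
    using iso[of n m] by (auto simp: nonisolated_def)
  show False
  proof (rule no_sum_fan[of UNIV "\<lambda>(k, m). D k m" "\<lambda>(k, m). \<sigma> (r k) m" x z "\<lambda>(k, m). W k m" "\<lambda>(k, m). {\<sigma> (r k) m}"])
    fix L assume L: "compactin X L"
    have "finite {n. range (\<sigma> n) \<inter> L \<noteq> {}}"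
      using neg L by blast
    then have "finite (r -` {n. range (\<sigma> n) \<inter> L \<noteq> {}})"
      by (rule finite_vimageI[OF _ strict_mono_imp_inj_on[OF z(2)]])
    moreover have "finite {m \<in> UNIV. W j m \<inter> L \<noteq> {}}" for j
      using compact_finiteD[OF Wcf L] .
    ultimately have "finite {(j, m). range (\<sigma> (r j)) \<inter> L \<noteq> {} \<and> W j m \<inter> L \<noteq> {}}"
      by (intro finite_pairs) (auto simp: vimage_def)
    then show "finite {l \<in> UNIV. (case l of (k, m) \<Rightarrow> W k m) \<inter> L \<noteq> {} \<and> (case l of (k, m) \<Rightarrow> {\<sigma> (r k) m}) \<inter> L \<noteq> {}}"
      by (rule finite_subset[rotated]) auto
  next
    fix P Q assume P: "openin X P" "x \<in> P" and Q: "openin X Q" "z \<in> Q"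
    obtain k0 where k0: "\<And>k. k \<ge> k0 \<Longrightarrow> y (r k) \<in> Q"
      using z(3) Q unfolding limitin_sequentially by auto
    obtain k where k: "k \<ge> k0" "range (D k) \<subseteq> P"
      using D_inside_late[OF P] by blast
    obtain m where "\<sigma> (r k) m \<in> Q"
      using lim[of "r k"] Q(1) k0[OF k(1)] unfolding limitin_sequentially by blast
    then show "\<exists>l\<in>UNIV. (case l of (k, m) \<Rightarrow> D k m) \<in> P \<and> (case l of (k, m) \<Rightarrow> \<sigma> (r k) m) \<in> Q"
      using k(2) by (intro bexI[of _ "(k, m)"]) auto
  next
    fix l :: "nat \<times> nat"
    show "(case l of (k, m) \<Rightarrow> \<sigma> (r k) m) \<noteq> x \<and> (case l of (k, m) \<Rightarrow> \<sigma> (r k) m) \<noteq> z"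
      using isolated(3) x_nonisolated z(1) by (auto split: prod.split)
  qed (use x zX D isolated W in auto)
qed

text \<open>As \<open>N\<close> is not a neighbourhood, its complement is not closed, and a sequence
  in it converges to a point of \<open>N\<close>, which cannot be isolated. A tail of the sequence
  lies in \<open>U\<close>.\<close>

lemma escaping_sequence:
  assumes N: "nonisolated \<subseteq> N" "N \<subseteq> topspace X" and not: "\<not> nonisolated \<subseteq> X interior_of N"
    and U: "openin X U" "nonisolated \<subseteq> U"
  shows "\<exists>\<sigma> y. (\<forall>m::nat. \<sigma> m \<in> U - N) \<and> y \<in> nonisolated \<and> limitin X \<sigma> y sequentially"
proof -
  have "\<not> closedin X (topspace X - N)"
  proof
    assume "closedin X (topspace X - N)"
    then have "openin X N"
      using N(2) by (simp add: openin_closedin_eq)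
    then show False
      using not N(1) interior_of_openin by blast
  qed
  then obtain a z where a: "\<And>n::nat. a n \<in> topspace X - N" "z \<notin> topspace X - N" "limitin X a z sequentially"
    using sequential[of "topspace X - N"] by blast
  have z: "z \<in> nonisolated"
  proof (rule ccontr)
    assume "z \<notin> nonisolated"
    then have "openin X {z}"
      using limitin_topspace[OF a(3)] by (simp add: nonisolated_def)
    then obtain n where "a n \<in> {z}"
      using a(3) unfolding limitin_sequentially by blast
    then show False
      using a(1)[of n] a(2) by simp
  qed
  then obtain t where t: "\<And>n. n \<ge> t \<Longrightarrow> a n \<in> U"
    using a(3) U unfolding limitin_sequentially by blast
  have "limitin X (\<lambda>i. a (i + t)) z sequentially"
    by (rule limitin_sequentially_offset[OF a(3)])
  then show ?thesis
    using a(1) t z by (intro exI[of _ "\<lambda>i. a (i + t)"] exI[of _ z]) simp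
qed

text \<open>The sequences escaping from the finite subfamilies of a suitable countable set \<open>M\<close> of members
  of the \<open>k\<close>-network cannot be met by a compact set infinitely often.\<close>

lemma finite_network_neighbourhood:
  assumes U: "openin X U" "nonisolated \<subseteq> U"
  shows "\<exists>\<F>. finite \<F> \<and> \<F> \<subseteq> \<P> \<and> \<Union>\<F> \<subseteq> U \<and> nonisolated \<subseteq> X interior_of (nonisolated \<union> \<Union>\<F>)"
proof (rule ccontr)
  assume neg: "\<not> ?thesis"
  \<comment> \<open>Finite subfamilies of all of the network are considered, but only their members
    inside \<open>U\<close> are allowed in the desired family; so \<open>\<sigma> \<F>\<close> has
    to escape from these members only.\<close>
  let ?in = "\<lambda>\<F>. {Q \<in> \<F>. Q \<subseteq> U}"
  have "\<exists>\<sigma> y. (\<forall>m::nat. \<sigma> m \<in> U - (nonisolated \<union> \<Union>(?in \<F>))) \<and> y \<in> nonisolated \<and> limitin X \<sigma> y sequentially"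
    if F: "finite \<F>" "\<F> \<subseteq> \<P>" for \<F>
  proof (rule escaping_sequence[OF _ _ _ U])
    show "nonisolated \<union> \<Union>(?in \<F>) \<subseteq> topspace X"
      using network_subset F(2) by (auto simp: nonisolated_def)
    have fin: "finite (?in \<F>)" "?in \<F> \<subseteq> \<P>" "\<Union>(?in \<F>) \<subseteq> U"
      using F by auto
    show "\<not> nonisolated \<subseteq> X interior_of (nonisolated \<union> \<Union>(?in \<F>))"
    proof
      assume "nonisolated \<subseteq> X interior_of (nonisolated \<union> \<Union>(?in \<F>))"
      with fin have "finite (?in \<F>) \<and> ?in \<F> \<subseteq> \<P> \<and> \<Union>(?in \<F>) \<subseteq> U \<and> nonisolated \<subseteq> X interior_of (nonisolated \<union> \<Union>(?in \<F>))"
        by (intro conjI)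
      then have "\<exists>\<F>. finite \<F> \<and> \<F> \<subseteq> \<P> \<and> \<Union>\<F> \<subseteq> U \<and> nonisolated \<subseteq> X interior_of (nonisolated \<union> \<Union>\<F>)"
        by (rule exI)
      then show False
        using neg by contradiction
    qed
  qed simp
  then have "\<forall>\<F>\<in>{\<F>. finite \<F> \<and> \<F> \<subseteq> \<P>}. \<exists>p. (\<forall>m::nat. fst p m \<in> U - (nonisolated \<union> \<Union>(?in \<F>))) \<and>
      snd p \<in> nonisolated \<and> limitin X (fst p) (snd p) sequentially"
    by simp
  from bchoice[OF this] obtain p where p: "\<forall>\<F>\<in>{\<F>. finite \<F> \<and> \<F> \<subseteq> \<P>}. (\<forall>m::nat. fst (p \<F>) m \<in> U - (nonisolated \<union> \<Union>(?in \<F>))) \<and>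
      snd (p \<F>) \<in> nonisolated \<and> limitin X (fst (p \<F>)) (snd (p \<F>)) sequentially" ..
  define \<sigma> where "\<sigma> = (\<lambda>\<F>. fst (p \<F>))"
  have \<sigma>: "\<sigma> \<F> m \<in> U" "\<sigma> \<F> m \<notin> nonisolated" "\<And>Q. Q \<in> \<F> \<Longrightarrow> Q \<subseteq> U \<Longrightarrow> \<sigma> \<F> m \<notin> Q"
    and lim: "snd (p \<F>) \<in> nonisolated" "limitin X (\<sigma> \<F>) (snd (p \<F>)) sequentially"
    if "finite \<F>" "\<F> \<subseteq> \<P>" for \<F> m
    using p that unfolding \<sigma>_def by auto
  have UX: "U \<subseteq> topspace X"
    using U(1) openin_subset by blast
  \<comment> \<open>The closing-off, in countably many stages, under adding for each finite
    subfamily \<open>\<F>\<close> all members of the network that meet \<open>\<sigma> \<F>\<close>.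
    These are countably many, as \<open>\<sigma> \<F>\<close> lies in a compact set.\<close>
  define M where "M = rec_nat {} (\<lambda>k M. M \<union> (\<Union>\<F>\<in>{\<F>. finite \<F> \<and> \<F> \<subseteq> M}. {Q \<in> \<P>. Q \<inter> range (\<sigma> \<F>) \<noteq> {}}))"
  have M0: "M 0 = {}" and MSuc: "M (Suc k) = M k \<union> (\<Union>\<F>\<in>{\<F>. finite \<F> \<and> \<F> \<subseteq> M k}. {Q \<in> \<P>. Q \<inter> range (\<sigma> \<F>) \<noteq> {}})" for k
    by (simp_all add: M_def)
  have M: "M k \<subseteq> \<P> \<and> countable (M k)" for k
  proof (induction k)
    case (Suc k)
    have "countable {Q \<in> \<P>. Q \<inter> range (\<sigma> \<F>) \<noteq> {}}" if F: "finite \<F>" "\<F> \<subseteq> M k" for \<F>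
    proof -
      have "\<F> \<subseteq> \<P>"
        using F Suc by blast
      then have "compactin X (insert (snd (p \<F>)) (range (\<sigma> \<F>)))"
        using \<sigma>(1)[OF F(1)] UX by (intro compact_sequence[OF lim(2)[OF F(1)]]) auto
      from countable_meeting[OF this] show ?thesis
        by (rule countable_subset[rotated]) blast
    qed
    moreover have "countable {\<F>. finite \<F> \<and> \<F> \<subseteq> M k}"
      using Suc by (simp add: countable_Collect_finite_subset)
    ultimately have "countable (\<Union>\<F>\<in>{\<F>. finite \<F> \<and> \<F> \<subseteq> M k}. {Q \<in> \<P>. Q \<inter> range (\<sigma> \<F>) \<noteq> {}})"
      by (intro countable_UN) auto
    then show ?case
      unfolding MSuc using Suc by auto
  qed (simp add: M0)
  have incM: "incseq M"
    by (rule incseq_SucI) (simp add: MSuc)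
  define M' where "M' = (\<Union>k. M k)"
  have M': "M' \<subseteq> \<P>" "countable M'"
    unfolding M'_def using M by (auto intro!: countable_UN)
  have closed_M': "Q \<in> M'" if F: "finite \<F>" "\<F> \<subseteq> M'" and Q: "Q \<in> \<P>" "Q \<inter> range (\<sigma> \<F>) \<noteq> {}" for \<F> Q
  proof -
    have "\<exists>k. \<F> \<subseteq> M k"
      using F
    proof (induction \<F> rule: finite_induct)
      case (insert P \<F>)
      then obtain k l where "\<F> \<subseteq> M k" "P \<in> M l"
        unfolding M'_def by blast
      then have "insert P \<F> \<subseteq> M (max k l)"
        using incseqD[OF incM, of k "max k l"] incseqD[OF incM, of l "max k l"] by auto
      then show ?case
        by blast
    qed simp
    then obtain k where "\<F> \<subseteq> M k"
      by blast
    then have "Q \<in> M (Suc k)"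
      unfolding MSuc using F(1) Q by blast
    then show ?thesis
      unfolding M'_def by blast
  qed
  obtain e :: "nat \<Rightarrow> 'a set" where e: "M' \<subseteq> range e"
    using countable_enumeration[OF M'(2)] by blast
  define F where "F = (\<lambda>n. M' \<inter> e ` {..<n})"
  have F: "finite (F n)" "F n \<subseteq> M'" "F n \<subseteq> \<P>" for n
    unfolding F_def using M'(1) by auto
  have "\<exists>L. compactin X L \<and> infinite {n. range (\<sigma> (F n)) \<inter> L \<noteq> {}}"
    by (rule sequences_meet_compact[of "\<lambda>n. snd (p (F n))"]) (use lim[OF F(1,3)] \<sigma>[OF F(1,3)] UX in auto)
  then obtain L where L: "compactin X L" and inf: "infinite {n. range (\<sigma> (F n)) \<inter> L \<noteq> {}}"
    by blast
  define n where "n = enumerate {n. range (\<sigma> (F n)) \<inter> L \<noteq> {}}"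
  have sm: "strict_mono n"
    unfolding n_def using inf by (rule strict_mono_enumerate)
  have "range (\<sigma> (F (n k))) \<inter> L \<noteq> {}" for k
    using enumerate_in_set[OF inf, of k] unfolding n_def by simp
  then have "\<forall>k. \<exists>a. a \<in> range (\<sigma> (F (n k))) \<inter> L"
    by blast
  from choice[OF this] obtain a where a': "\<forall>k. a k \<in> range (\<sigma> (F (n k))) \<inter> L" ..
  have a: "a k \<in> range (\<sigma> (F (n k)))" "a k \<in> L" for k
    using a' by auto
  have aU: "a k \<in> U" for k
    using a(1)[of k] \<sigma>(1)[OF F(1,3)] by auto
  obtain z r where z: "z \<in> L" "strict_mono r" "limitin X (a \<circ> r) z sequentially"
    using sequentially_compact[of L a, OF L a(2)] by blast
  have zU: "z \<in> U"
  proof (cases "z \<in> nonisolated")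
    case False
    then have "openin X {z}"
      using limitin_topspace[OF z(3)] by (simp add: nonisolated_def)
    then obtain k where "(a \<circ> r) k \<in> {z}"
      using z(3) unfolding limitin_sequentially by blast
    then show ?thesis
      using aU[of "r k"] by simp
  qed (use U in blast)
  have "compactin X (insert z (range (a \<circ> r)))"
    by (rule compact_sequence[OF z(3)]) (use aU UX in auto)
  moreover have "insert z (range (a \<circ> r)) \<subseteq> U"
    using aU zU by auto
  ultimately have "\<exists>\<F>. finite \<F> \<and> \<F> \<subseteq> \<P> \<and> insert z (range (a \<circ> r)) \<subseteq> \<Union>\<F> \<and> \<Union>\<F> \<subseteq> U"
    by (rule network_cover[OF _ U(1)])
  then obtain \<F> where \<F>: "finite \<F>" "\<F> \<subseteq> \<P>" "insert z (range (a \<circ> r)) \<subseteq> \<Union>\<F>" "\<Union>\<F> \<subseteq> U"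
    by (elim exE conjE)
  have "\<exists>Q\<in>\<F>. infinite {k. a (r k) \<in> Q}"
  proof (rule ccontr)
    assume "\<not> ?thesis"
    then have "finite (\<Union>Q\<in>\<F>. {k. a (r k) \<in> Q})"
      using \<F>(1) by blast
    moreover have "(\<Union>Q\<in>\<F>. {k. a (r k) \<in> Q}) = UNIV"
      using \<F>(3) by auto
    ultimately show False
      by simp
  qed
  then obtain Q where Q: "Q \<in> \<F>" "infinite {k. a (r k) \<in> Q}"
    by blast
  then obtain k0 where k0: "a (r k0) \<in> Q"
    by (metis (mono_tags, lifting) Collect_empty_eq finite.emptyI)
  \<comment> \<open>\<open>Q\<close> meets one of the sequences \<open>\<sigma> (F n)\<close>, so it
    belongs to \<open>M'\<close> and hence to all \<open>F n\<close> from some \<open>n\<close> on.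
    The sequences of these avoid \<open>Q\<close>, although \<open>Q\<close> contains infinitely
    many of the points \<open>a (r k)\<close>.\<close>
  have "Q \<in> M'"
    by (rule closed_M'[OF F(1,2)]) (use Q(1) \<F>(2) k0 a(1) in blast)+
  then obtain l where l: "Q = e l"
    using e by blast
  obtain k where k: "k > l" "a (r k) \<in> Q"
    using Q(2) unfolding infinite_nat_iff_unbounded by blast
  have "n (r k) > l"
    using strict_mono_imp_increasing[OF sm, of "r k"] strict_mono_imp_increasing[OF z(2), of k] k(1) by linarith
  then have "Q \<in> F (n (r k))"
    unfolding F_def using \<open>Q \<in> M'\<close> l by blast
  moreover have "Q \<subseteq> U"
    using Q(1) \<F>(4) by blast
  ultimately have "\<sigma> (F (n (r k))) m \<notin> Q" for m
    by (rule \<sigma>(3)[OF F(1,3)])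
  then show False
    using a(1)[of "r k"] k(2) by auto
qed

text \<open>As in Mishchenko's lemma, there are only countably many minimal finite subfamilies of the
  \<open>k\<close>-network whose union is, together with the non-isolated points, a neighbourhood of these.\<close>

lemma countable_minimal_families:
  defines "nb \<equiv> \<lambda>\<F>. nonisolated \<subseteq> X interior_of (nonisolated \<union> \<Union>\<F>)"
  shows "countable {\<F>. finite \<F> \<and> \<F> \<subseteq> \<P> \<and> nb \<F> \<and> (\<forall>\<H>. \<H> \<subset> \<F> \<longrightarrow> \<not> nb \<H>)}" (is "countable ?M")
proof -
  have "countable {\<F> \<in> ?M. card \<F> = n}" for n
  proof (rule ccontr)
    assume unc: "uncountable {\<F> \<in> ?M. card \<F> = n}"
    let ?S = "\<lambda>R. {\<F> \<in> ?M. card \<F> = n \<and> R \<subseteq> \<F>}"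
    have bound: "card R \<le> n" if "finite R" "uncountable (?S R)" for R
    proof -
      have "?S R \<noteq> {}"
        using that(2) by (metis countable_empty)
      then obtain \<F> where "finite \<F>" "card \<F> = n" "R \<subseteq> \<F>"
        by auto
      then show ?thesis
        using card_mono[of \<F> R] by simp
    qed
    let ?P = "\<lambda>k. \<exists>R. finite R \<and> uncountable (?S R) \<and> card R = k"
    define big where "big = (\<lambda>R. finite R \<and> uncountable (?S R))"
    have "big {}"
      using unc by (simp add: big_def)
    moreover have "\<forall>R. big R \<longrightarrow> card R < Suc n"
      using bound by (auto simp: big_def less_Suc_eq_le)
    \<comment> \<open>A largest set \<open>R\<close> that is contained in uncountably many of the
      minimal families of size \<open>n\<close>. It is a proper part of one of them, so by
      minimality \<open>nb R\<close> fails and a sequence escapes from \<open>R\<close>.\<close>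
    ultimately obtain R where "big R" and max': "\<forall>R'. big R' \<longrightarrow> card R' \<le> card R"
      using ex_has_greatest_nat[of big "{}" card "Suc n"] by auto
    then have R: "finite R" "uncountable (?S R)"
      by (auto simp: big_def)
    have max: "card R' \<le> card R" if "finite R'" "uncountable (?S R')" for R'
      using max' that by (simp add: big_def)
    have "\<exists>\<F>\<in>?S R. \<F> \<noteq> R"
    proof (rule ccontr)
      assume "\<not> ?thesis"
      then have "?S R \<subseteq> {R}"
        by blast
      then have "countable (?S R)"
        by (rule countable_subset) simp
      then show False
        using R(2) by contradiction
    qed
    then obtain \<F> where F: "\<F> \<in> ?S R" "\<F> \<noteq> R"
      by blast
    then have notR: "\<not> nb R" and RP: "R \<subseteq> \<P>"
      by auto
    have "\<exists>\<sigma> y. (\<forall>m::nat. \<sigma> m \<in> topspace X - (nonisolated \<union> \<Union>R)) \<and> y \<in> nonisolated \<and> limitin X \<sigma> y sequentially"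
    proof (rule escaping_sequence)
      show "nonisolated \<union> \<Union>R \<subseteq> topspace X"
        using network_subset RP by (auto simp: nonisolated_def)
      show "\<not> nonisolated \<subseteq> X interior_of (nonisolated \<union> \<Union>R)"
        using notR by (simp add: nb_def)
    qed (auto simp: nonisolated_def)
    then obtain \<sigma> y where \<sigma>: "\<forall>m::nat. \<sigma> m \<in> topspace X - (nonisolated \<union> \<Union>R)" "y \<in> nonisolated" "limitin X \<sigma> y sequentially"
      by (elim exE conjE)
    let ?Q = "{Q \<in> \<P>. Q \<inter> range \<sigma> \<noteq> {}} - R"
    have "compactin X (insert y (range \<sigma>))"
      by (rule compact_sequence[OF \<sigma>(3)]) (use \<sigma>(1) in blast)
    from countable_meeting[OF this] have cQ: "countable ?Q"
      by (rule countable_subset[rotated]) blast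
    \<comment> \<open>Each of the families that contain \<open>R\<close> must catch the escaping
      sequence, so it has one of the countably many members \<open>Q\<close> outside
      \<open>R\<close> that meet it. By maximality only countably many families contain
      \<open>insert Q R\<close>.\<close>
    have "?S R \<subseteq> (\<Union>Q\<in>?Q. ?S (insert Q R))"
    proof
      fix \<H> assume H: "\<H> \<in> ?S R"
      then have "nb \<H>"
        by blast
      then have "y \<in> X interior_of (nonisolated \<union> \<Union>\<H>)"
        using \<sigma>(2) unfolding nb_def by blast
      then have "\<exists>N. \<forall>n\<ge>N. \<sigma> n \<in> X interior_of (nonisolated \<union> \<Union>\<H>)"
        using \<sigma>(3) unfolding limitin_sequentially by simp
      then obtain m where "\<sigma> m \<in> X interior_of (nonisolated \<union> \<Union>\<H>)"
        by blast
      then have "\<sigma> m \<in> \<Union>\<H>"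
        using interior_of_subset[of X "nonisolated \<union> \<Union>\<H>"] \<sigma>(1) by blast
      then obtain Q where Q: "Q \<in> \<H>" "\<sigma> m \<in> Q"
        by blast
      then have "Q \<in> ?Q"
        using H \<sigma>(1) by blast
      then show "\<H> \<in> (\<Union>Q\<in>?Q. ?S (insert Q R))"
        using H Q(1) by (intro UN_I[of Q]) simp_all
    qed
    moreover have "countable (?S (insert Q R))" if "Q \<in> ?Q" for Q
    proof (rule ccontr)
      assume "uncountable (?S (insert Q R))"
      then have "card (insert Q R) \<le> card R"
        using R(1) by (intro max) auto
      then show False
        using that R(1) by simp
    qed
    then have "countable (\<Union>Q\<in>?Q. ?S (insert Q R))"
      by (intro countable_UN cQ)
    ultimately have "countable (?S R)"
      by (rule countable_subset)
    then show False
      using R(2) by contradiction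
  qed
  then have "countable (\<Union>n. {\<F> \<in> ?M. card \<F> = n})"
    by (intro countable_UN) auto
  moreover have "?M \<subseteq> (\<Union>n. {\<F> \<in> ?M. card \<F> = n})"
    by auto
  ultimately show ?thesis
    by (rule countable_subset[rotated])
qed

text \<open>Every family supplied by \<open>finite_network_neighbourhood\<close> contains a minimal
  one, whose union is at least as small, and there are only countably many minimal families.\<close>

lemma nonisolated_base:
  "\<exists>B :: nat \<Rightarrow> 'a set. (\<forall>n. openin X (B n) \<and> nonisolated \<subseteq> B n) \<and>
    (\<forall>U. openin X U \<longrightarrow> nonisolated \<subseteq> U \<longrightarrow> (\<exists>N. \<forall>n\<ge>N. B n \<subseteq> U))"
proof -
  define nb where "nb = (\<lambda>\<F>. nonisolated \<subseteq> X interior_of (nonisolated \<union> \<Union>\<F>))"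
  let ?M = "{\<F>. finite \<F> \<and> \<F> \<subseteq> \<P> \<and> nb \<F> \<and> (\<forall>\<H>. \<H> \<subset> \<F> \<longrightarrow> \<not> nb \<H>)}"
  have "countable ?M"
    using countable_minimal_families by (simp add: nb_def)
  from countable_enumeration[OF this] obtain e where e: "?M \<subseteq> range (e :: nat \<Rightarrow> 'a set set)" ..
  \<comment> \<open>The enumeration \<open>e\<close> may have values that are not neighbourhood
    families; these get the harmless value \<open>topspace X\<close>.\<close>
  define b where "b = (\<lambda>n. if nb (e n) then X interior_of (nonisolated \<union> \<Union>(e n)) else topspace X)"
  have b: "openin X (b n)" "nonisolated \<subseteq> b n" for n
    by (auto simp: b_def nb_def nonisolated_def)
  have base: "\<exists>n. b n \<subseteq> U" if U: "openin X U" "nonisolated \<subseteq> U" for U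
  proof -
    have "\<exists>\<F>. finite \<F> \<and> \<F> \<subseteq> \<P> \<and> \<Union>\<F> \<subseteq> U \<and> nb \<F>"
      using finite_network_neighbourhood[OF U] by (simp add: nb_def)
    then obtain \<F> where F: "finite \<F>" "\<F> \<subseteq> \<P>" "\<Union>\<F> \<subseteq> U" "nb \<F>"
      by (elim exE conjE)
    have "\<exists>\<H>. \<H> \<subseteq> \<F> \<and> nb \<H> \<and> (\<forall>\<H>'. \<H>' \<subset> \<H> \<longrightarrow> \<not> nb \<H>')"
    proof -
      have "\<F> \<in> {\<H>. \<H> \<subseteq> \<F> \<and> nb \<H>}" "finite {\<H>. \<H> \<subseteq> \<F> \<and> nb \<H>}"
        using F by auto
      from finite_has_minimal2[OF this(2,1)]
      obtain \<H> where H: "\<H> \<in> {\<H>. \<H> \<subseteq> \<F> \<and> nb \<H>}" "\<forall>\<H>'\<in>{\<H>. \<H> \<subseteq> \<F> \<and> nb \<H>}. \<H>' \<le> \<H> \<longrightarrow> \<H> = \<H>'"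
        by (elim bexE conjE)
      then have "\<not> nb \<H>'" if "\<H>' \<subset> \<H>" for \<H>'
        using that by blast
      then show ?thesis
        using H(1) by blast
    qed
    then obtain \<H> where H: "\<H> \<subseteq> \<F>" "nb \<H>" "\<forall>\<H>'. \<H>' \<subset> \<H> \<longrightarrow> \<not> nb \<H>'"
      by (elim exE conjE)
    have "finite \<H>"
      using H(1) F(1) by (rule finite_subset)
    then have "\<H> \<in> ?M"
      using H F(2) by blast
    then have "\<H> \<in> range e"
      by (rule subsetD[OF e])
    then obtain n where n: "\<H> = e n"
      by (rule rangeE)
    have "b n \<subseteq> nonisolated \<union> \<Union>\<H>"
      using H(2) interior_of_subset[of X "nonisolated \<union> \<Union>\<H>"] unfolding b_def n by simp
    also have "\<dots> \<subseteq> U"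
      using U(2) F(3) H(1) by blast
    finally show ?thesis
      by blast
  qed
  have "openin X (\<Inter>k\<le>n. b k)" for n
    using b(1) by (intro openin_Inter) auto
  moreover have "nonisolated \<subseteq> (\<Inter>k\<le>n. b k)" for n
    using b(2) by blast
  moreover have "\<exists>N. \<forall>n\<ge>N. (\<Inter>k\<le>n. b k) \<subseteq> U" if U: "openin X U" "nonisolated \<subseteq> U" for U
  proof -
    obtain N where "b N \<subseteq> U"
      using base[OF U] by blast
    then show ?thesis
      by (intro exI[of _ N]) auto
  qed
  ultimately show ?thesis
    by (intro exI[of _ "\<lambda>n. \<Inter>k\<le>n. b k"]) simp
qed

text \<open>On the compact set \<open>nonisolated\<close> the sets \<open>G n {y}\<close> shrink to
  \<open>y\<close>, and the outer base \<open>B\<close> controls the points off this set.\<close>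

lemma sequential_bases:
  assumes y: "y \<in> topspace X"
  shows "\<exists>B. sequential_base X y B"
proof (cases "y \<in> nonisolated")
  case False
  then have "openin X {y}"
    using y by (simp add: nonisolated_def)
  then have "sequential_base X y (\<lambda>n. {y})"
    by (simp add: sequential_base_def)
  then show ?thesis
    by blast
next
  case True
  obtain B :: "nat \<Rightarrow> 'a set" where B: "\<forall>n. openin X (B n) \<and> nonisolated \<subseteq> B n"
    and base: "\<forall>U. openin X U \<longrightarrow> nonisolated \<subseteq> U \<longrightarrow> (\<exists>N. \<forall>n\<ge>N. B n \<subseteq> U)"
    using nonisolated_base by (elim exE conjE)
  note G = openin_G[OF closedin_sing[OF y]] subset_G[OF closedin_sing[OF y]] G_decreasing[OF closedin_sing[OF y]]
  have "sequential_base X y (\<lambda>n. G n {y} \<inter> B n)"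
    unfolding sequential_base_def
  proof (intro conjI allI impI)
    show "openin X (G n {y} \<inter> B n)" "y \<in> G n {y} \<inter> B n" for n
      using B True G by auto
    fix U assume U: "openin X U" "y \<in> U"
    obtain n where n: "X closure_of G n {y} \<inter> nonisolated \<subseteq> U"
      using closure_G_limit[OF compactin_nonisolated y U] by blast
    have "openin X (U \<union> (topspace X - X closure_of G n {y}))"
      using U(1) by (intro openin_Un openin_diff) auto
    moreover have "nonisolated \<subseteq> U \<union> (topspace X - X closure_of G n {y})"
      using n by (auto simp: nonisolated_def)
    ultimately obtain N where N: "\<forall>n'\<ge>N. B n' \<subseteq> U \<union> (topspace X - X closure_of G n {y})"
      using base by blast
    have "G m {y} \<inter> B m \<subseteq> U" if "m \<ge> max N n" for m
    proof -
      have "G m {y} \<subseteq> G n {y}"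
        using that by (intro G(3)) simp
      also have "\<dots> \<subseteq> X closure_of G n {y}"
        by (rule closure_of_subset[OF openin_subset[OF G(1)]])
      finally show ?thesis
        using N that by fastforce
    qed
    then show "\<exists>N. \<forall>n\<ge>N. G n {y} \<inter> B n \<subseteq> U"
      by blast
  qed
  then show ?thesis
    by blast
qed

lemma k_space_level_3_metric_fan: "k_space (free_abelian_level 3 X A T i)"
proof (rule k_space_level_3)
  show "k_space (prod_topology X (prod_topology X X))"
  proof (rule k_space_if_sequential_bases)
    show "Hausdorff_space (prod_topology X (prod_topology X X))"
      using Hausdorff by (simp add: Hausdorff_space_prod_topology)
    fix w assume "w \<in> topspace (prod_topology X (prod_topology X X))"
    then obtain a b c where w: "w = (a, b, c)" "a \<in> topspace X" "b \<in> topspace X" "c \<in> topspace X"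
      by auto
    obtain Ba Bb Bc where "sequential_base X a Ba" "sequential_base X b Bb" "sequential_base X c Bc"
      using sequential_bases w by metis
    then have "sequential_base (prod_topology X (prod_topology X X)) w (\<lambda>n. Ba n \<times> (Bb n \<times> Bc n))"
      unfolding w(1) by (intro sequential_base_prod)
    then show "\<exists>B. sequential_base (prod_topology X (prod_topology X X)) w B"
      by blast
  qed
  show "tube_property X"
    by (rule tube_property_if_compact_derived[OF tychonoff compactin_nonisolated]) (simp add: nonisolated_def)
  show "topspace X \<noteq> {}"
    using x by blast
qed

end

section \<open>Spaces covered by relatively compact members of the \<open>k\<close>-network\<close>

text \<open>Distinct sets of naturals have only finitely many initial segments in common, so the
  sets of codes of their initial segments, the branches of the binary tree, are almost disjoint.
  Passing to \<open>S0\<close> reduces a set larger than the continuum to one that sets of naturals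
  can index.\<close>

lemma uncountable_almost_disjoint:
  assumes "uncountable S"
  shows "\<exists>S0\<subseteq>S. uncountable S0 \<and> (\<exists>A :: 'b \<Rightarrow> nat set. (\<forall>p\<in>S0. infinite (A p)) \<and>
    (\<forall>p\<in>S0. \<forall>q\<in>S0. p \<noteq> q \<longrightarrow> finite (A p \<inter> A q)))"
proof -
  have unc: "uncountable (UNIV :: nat set set)"
  proof
    assume "countable (UNIV :: nat set set)"
    then have "range (from_nat_into (UNIV :: nat set set)) = UNIV"
      by (intro range_from_nat_into) auto
    then show False
      using Cantors_theorem[of "UNIV :: nat set"] by (metis Pow_UNIV)
  qed
  have "\<exists>S0\<subseteq>S. uncountable S0 \<and> (\<exists>\<phi> :: 'b \<Rightarrow> nat set. inj_on \<phi> S0)"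
  proof (cases "|S| \<le>o |UNIV :: nat set set|")
    case True
    then obtain \<phi> :: "'b \<Rightarrow> nat set" where "inj_on \<phi> S"
      using card_of_ordLeq[of S "UNIV :: nat set set"] by blast
    then show ?thesis
      using assms by blast
  next
    case False
    then have "|UNIV :: nat set set| \<le>o |S|"
      using ordLeq_total[OF card_of_Well_order card_of_Well_order] by blast
    then obtain f :: "nat set \<Rightarrow> 'b" where f: "inj f" "range f \<subseteq> S"
      using card_of_ordLeq[of "UNIV :: nat set set" S] by blast
    have "uncountable (range f)"
      using unc countable_image_inj_on[of f UNIV] f(1) by blast
    moreover have "inj_on (inv_into UNIV f) (range f)"
      by (rule inj_on_inv_into) simp
    ultimately show ?thesis
      using f(2) by blast
  qed
  then obtain S0 and \<phi> :: "'b \<Rightarrow> nat set" where S0: "S0 \<subseteq> S" "uncountable S0" "inj_on \<phi> S0"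
    by blast
  define A where "A = (\<lambda>p. range (\<lambda>n. prod_encode (n, set_encode (\<phi> p \<inter> {..<n}))))"
  have "infinite (A p)" for p
    unfolding A_def by (rule range_inj_infinite) (auto simp: inj_def)
  moreover have "finite (A p \<inter> A q)" if pq: "p \<in> S0" "q \<in> S0" "p \<noteq> q" for p q
  proof -
    have "\<phi> p \<noteq> \<phi> q"
      using S0(3) pq by (auto dest: inj_onD)
    then obtain k where k: "k \<in> \<phi> p \<longleftrightarrow> k \<notin> \<phi> q"
      by blast
    have "A p \<inter> A q \<subseteq> (\<lambda>n. prod_encode (n, set_encode (\<phi> p \<inter> {..<n}))) ` {..k}"
    proof
      fix c assume "c \<in> A p \<inter> A q"
      then obtain m n where c: "c = prod_encode (n, set_encode (\<phi> p \<inter> {..<n}))" "c = prod_encode (m, set_encode (\<phi> q \<inter> {..<m}))"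
        unfolding A_def by blast
      then have "n = m" "set_encode (\<phi> p \<inter> {..<n}) = set_encode (\<phi> q \<inter> {..<n})"
        by auto
      then have "\<phi> p \<inter> {..<n} = \<phi> q \<inter> {..<n}"
        by (simp add: set_encode_eq)
      then have "n \<le> k"
        using k by (metis IntI Int_iff lessThan_iff not_le)
      then show "c \<in> (\<lambda>n. prod_encode (n, set_encode (\<phi> p \<inter> {..<n}))) ` {..k}"
        using c(1) by blast
    qed
    then show ?thesis
      by (rule finite_subset) simp
  qed
  ultimately show ?thesis
    using S0(1,2) by (intro exI[of _ S0] conjI exI[of _ A]) auto
qed

locale kR_compact_network = kR_level_3 X A T i G \<P>
  for X :: "'a topology" and A :: "'g monoid" and T i G \<P> +
  assumes cover: "\<And>K. compactin X K \<Longrightarrow>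
    \<exists>\<F>. finite \<F> \<and> \<F> \<subseteq> {P \<in> \<P>. compactin X (X closure_of P)} \<and> K \<subseteq> \<Union>\<F>"
begin

definition \<C> :: "'a set set" where
  "\<C> = {P \<in> \<P>. compactin X (X closure_of P)}"

lemma cover': "compactin X K \<Longrightarrow> \<exists>\<F>. finite \<F> \<and> \<F> \<subseteq> \<C> \<and> K \<subseteq> \<Union>\<F>"
  using cover by (simp add: \<C>_def)

lemma \<C>: "P \<in> \<C> \<Longrightarrow> P \<in> \<P> \<and> compactin X (X closure_of P) \<and> P \<subseteq> X closure_of P"
  unfolding \<C>_def using closure_of_subset[OF network_subset[of P]] by simp

text \<open>Otherwise uncountably many members of \<open>\<C>\<close> contain sequences \<open>s P\<close> converging to points of \<open>K\<close>, and
  these can be chosen so that a compact set meets only finitely many of them. An almost disjoint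
  family then yields the fan that shows that the square of the sequential fan with \<open>\<omega>\<^sub>1\<close> spines is
  not a \<open>k\<^sub>R\<close>-space.\<close>

lemma countable_closure_meeting:
  assumes K: "compactin X K"
  shows "countable {P \<in> \<C>. X closure_of P \<inter> K \<noteq> {}}"
proof (rule ccontr)
  assume unc: "uncountable {P \<in> \<C>. X closure_of P \<inter> K \<noteq> {}}"
  \<comment> \<open>Only countably many members of \<open>\<C>\<close> meet \<open>K\<close>
    themselves. For those in \<open>S\<close> some point of \<open>K\<close> is the limit of a
    sequence in \<open>P\<close>, which lies outside \<open>K\<close>.\<close>
  define S where "S = {P \<in> \<C>. X closure_of P \<inter> K \<noteq> {} \<and> P \<inter> K = {}}"
  have "uncountable S"
  proof
    assume "countable S"
    then have "countable (S \<union> {P \<in> \<P>. P \<inter> K \<noteq> {}})"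
      using countable_meeting[OF K] by simp
    moreover have "{P \<in> \<C>. X closure_of P \<inter> K \<noteq> {}} \<subseteq> S \<union> {P \<in> \<P>. P \<inter> K \<noteq> {}}"
    proof
      fix P assume "P \<in> {P \<in> \<C>. X closure_of P \<inter> K \<noteq> {}}"
      then show "P \<in> S \<union> {P \<in> \<P>. P \<inter> K \<noteq> {}}"
        unfolding S_def using \<C>[of P] by simp
    qed
    ultimately have "countable {P \<in> \<C>. X closure_of P \<inter> K \<noteq> {}}"
      by (rule countable_subset[rotated])
    then show False
      using unc by contradiction
  qed
  have "\<forall>P\<in>S. \<exists>p. snd p \<in> K \<and> (\<forall>n::nat. fst p n \<in> P) \<and> limitin X (fst p) (snd p) sequentially"
  proof
    fix P assume P: "P \<in> S"
    then obtain z where z: "z \<in> K" "z \<in> X closure_of P"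
      unfolding S_def by blast
    obtain a where "\<forall>n::nat. a n \<in> P" "limitin X a z sequentially"
      using closure_sequence[of "X closure_of P" P z] \<C>[of P] P z(2) unfolding S_def by blast
    then show "\<exists>p. snd p \<in> K \<and> (\<forall>n::nat. fst p n \<in> P) \<and> limitin X (fst p) (snd p) sequentially"
      using z(1) by (intro exI[of _ "(a, z)"]) simp
  qed
  from bchoice[OF this] obtain p where
    p: "\<forall>P\<in>S. snd (p P) \<in> K \<and> (\<forall>n::nat. fst (p P) n \<in> P) \<and> limitin X (fst (p P)) (snd (p P)) sequentially" ..
  define s where "s = (\<lambda>P. fst (p P))"
  define z where "z = (\<lambda>P. snd (p P))"
  have z: "z P \<in> K" and s: "s P n \<in> P" and lim: "limitin X (s P) (z P) sequentially" if "P \<in> S" for P n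
    using p that unfolding s_def z_def by auto
  have sX: "s P n \<in> topspace X" if "P \<in> S" for P n
    using s[OF that, of n] network_subset[of P] \<C>[of P] that unfolding S_def by blast
  \<comment> \<open>No member of \<open>\<C>\<close> may meet the sequences of two different
    elements. As compact sets are covered by finitely many members of \<open>\<C>\<close>, the
    sequences of such a family are compact-finite.\<close>
  define \<Z> where "\<Z> = {\<M>. \<M> \<subseteq> S \<and> (\<forall>Q\<in>\<C>. \<forall>P\<in>\<M>. \<forall>P'\<in>\<M>. Q \<inter> range (s P) \<noteq> {} \<longrightarrow> Q \<inter> range (s P') \<noteq> {} \<longrightarrow> P = P')}"
  have "\<exists>M\<in>\<Z>. \<forall>M'\<in>\<Z>. M \<subseteq> M' \<longrightarrow> M' = M"
  proof (rule subset_Zorn')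
    fix Ch assume ch: "subset.chain \<Z> Ch"
    then have sub: "Ch \<subseteq> \<Z>" and lin: "\<And>M N. M \<in> Ch \<Longrightarrow> N \<in> Ch \<Longrightarrow> M \<subseteq> N \<or> N \<subseteq> M"
      by (auto simp: subset_chain_def)
    have "P = P'" if Q: "Q \<in> \<C>" "P \<in> \<Union>Ch" "P' \<in> \<Union>Ch" "Q \<inter> range (s P) \<noteq> {}" "Q \<inter> range (s P') \<noteq> {}" for Q P P'
    proof -
      obtain M where "M \<in> Ch" "P \<in> M" "P' \<in> M"
        using Q(2,3) lin by blast
      then show ?thesis
        using sub Q unfolding \<Z>_def by blast
    qed
    moreover have "\<Union>Ch \<subseteq> S"
      using sub unfolding \<Z>_def by blast
    ultimately show "\<Union>Ch \<in> \<Z>"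
      unfolding \<Z>_def by blast
  qed
  then obtain \<M> where M: "\<M> \<in> \<Z>" and max: "\<And>M'. M' \<in> \<Z> \<Longrightarrow> \<M> \<subseteq> M' \<Longrightarrow> M' = \<M>"
    by blast
  have MS: "\<M> \<subseteq> S" and once: "\<And>Q P P'. Q \<in> \<C> \<Longrightarrow> P \<in> \<M> \<Longrightarrow> P' \<in> \<M> \<Longrightarrow> Q \<inter> range (s P) \<noteq> {} \<Longrightarrow> Q \<inter> range (s P') \<noteq> {} \<Longrightarrow> P = P'"
    using M unfolding \<Z>_def by blast+
  have "uncountable \<M>"
  proof
    assume cM: "countable \<M>"
    \<comment> \<open>If \<open>\<M>\<close> were countable, so would be the set of members of
      \<open>\<C>\<close> that meet its sequences, and the set of members of \<open>\<P>\<close>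
      that meet the closures of these. Any other element of \<open>S\<close> could then be added to
      \<open>\<M>\<close>.\<close>
    let ?Q = "\<Union>P\<in>\<M>. {Q \<in> \<P>. Q \<inter> insert (z P) (range (s P)) \<noteq> {}} \<inter> \<C>"
    have "countable ?Q"
    proof (intro countable_UN cM countable_Int1)
      fix P assume "P \<in> \<M>"
      then have "P \<in> S"
        using MS by blast
      show "countable {Q \<in> \<P>. Q \<inter> insert (z P) (range (s P)) \<noteq> {}}"
        by (rule countable_meeting[OF compact_sequence[OF lim[OF \<open>P \<in> S\<close>] sX[OF \<open>P \<in> S\<close>]]])
    qed
    then have "countable (\<Union>Q\<in>?Q. {P \<in> \<P>. P \<inter> X closure_of Q \<noteq> {}})"
    proof (rule countable_UN)
      fix Q assume "Q \<in> ?Q"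
      then have "Q \<in> \<C>"
        by blast
      then show "countable {P \<in> \<P>. P \<inter> X closure_of Q \<noteq> {}}"
        using \<C>[of Q] by (intro countable_meeting) simp
    qed
    moreover define R where "R = (\<Union>Q\<in>?Q. {P \<in> \<P>. P \<inter> X closure_of Q \<noteq> {}})"
    ultimately have "countable (\<M> \<union> R)"
      using cM by simp
    then have "\<not> S \<subseteq> \<M> \<union> R"
      using \<open>uncountable S\<close> countable_subset by metis
    then obtain P where P: "P \<in> S" "P \<notin> \<M>" "P \<notin> R"
      by blast
    have new: "Q \<inter> range (s P) = {}" if Q: "Q \<in> \<C>" "P' \<in> \<M>" "Q \<inter> range (s P') \<noteq> {}" for Q P'
    proof -
      have "Q \<in> ?Q"
        using Q \<C>[OF Q(1)] by (intro UN_I[OF Q(2)]) auto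
      moreover have "P \<in> \<P>"
        using \<C>[of P] P(1) unfolding S_def by simp
      ultimately have "P \<inter> X closure_of Q = {}"
        using P(3) unfolding R_def by (metis (mono_tags, lifting) UN_I mem_Collect_eq)
      then show ?thesis
        using s[OF P(1)] \<C>[OF Q(1)] by (auto simp: disjoint_iff)
    qed
    have "P1 = P2" if "Q \<in> \<C>" "P1 \<in> insert P \<M>" "P2 \<in> insert P \<M>" "Q \<inter> range (s P1) \<noteq> {}" "Q \<inter> range (s P2) \<noteq> {}" for Q P1 P2
    proof (cases "P1 \<in> \<M>")
      case True
      show ?thesis
      proof (cases "P2 \<in> \<M>")
        case True
        show ?thesis
          by (rule once[OF that(1) \<open>P1 \<in> \<M>\<close> True that(4,5)])
      next
        case False
        then have "P2 = P"
          using that(3) by simp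
        then show ?thesis
          using new[OF that(1) \<open>P1 \<in> \<M>\<close> that(4)] that(5) by simp
      qed
    next
      case False
      then have P1: "P1 = P"
        using that(2) by simp
      show ?thesis
      proof (cases "P2 \<in> \<M>")
        case True
        show ?thesis
          using new[OF that(1) True that(5)] that(4) P1 by simp
      qed (use that(3) P1 in simp)
    qed
    note same = this
    have "insert P \<M> \<in> \<Z>"
      unfolding \<Z>_def mem_Collect_eq
    proof (intro conjI ballI impI)
      show "insert P \<M> \<subseteq> S"
        using MS P(1) by simp
    qed (rule same)
    then have "insert P \<M> = \<M>"
      by (rule max) blast
    then show False
      using P(2) by blast
  qed
  from uncountable_almost_disjoint[OF this]
  obtain \<M>0 and D :: "'a set \<Rightarrow> nat set" where M0: "\<M>0 \<subseteq> \<M>" "uncountable \<M>0"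
    and D: "\<forall>p\<in>\<M>0. infinite (D p)" "\<forall>p\<in>\<M>0. \<forall>q\<in>\<M>0. p \<noteq> q \<longrightarrow> finite (D p \<inter> D q)"
    by (elim exE conjE)
  have M0S: "\<And>P. P \<in> \<M>0 \<Longrightarrow> P \<in> S"
    using M0(1) MS by blast
  have "compact_finite X \<M>0 (\<lambda>P. range (s P))"
    unfolding compact_finite_def
  proof (intro strip)
    fix L assume "compactin X L"
    from cover'[OF this] obtain \<F> where F: "finite \<F>" "\<F> \<subseteq> \<C>" "L \<subseteq> \<Union>\<F>"
      by (elim exE conjE)
    have "finite {P \<in> \<M>0. Q \<inter> range (s P) \<noteq> {}}" if "Q \<in> \<F>" for Q
    proof (cases "{P \<in> \<M>0. Q \<inter> range (s P) \<noteq> {}} = {}")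
      case False
      then obtain P where "P \<in> \<M>0" "Q \<inter> range (s P) \<noteq> {}"
        by blast
      have "P' = P" if P': "P' \<in> \<M>0" "Q \<inter> range (s P') \<noteq> {}" for P'
        by (rule once[of Q]) (use P' \<open>P \<in> \<M>0\<close> \<open>Q \<inter> range (s P) \<noteq> {}\<close> \<open>Q \<in> \<F>\<close> F(2) M0(1) in \<open>simp_all add: subset_iff\<close>)
      then have "{P \<in> \<M>0. Q \<inter> range (s P) \<noteq> {}} \<subseteq> {P}"
        by blast
      then show ?thesis
        by (rule finite_subset) simp
    next
      case True
      show ?thesis
        unfolding True by simp
    qed
    then have "finite (\<Union>Q\<in>\<F>. {P \<in> \<M>0. Q \<inter> range (s P) \<noteq> {}})"
      using F(1) by blast
    moreover have "{P \<in> \<M>0. range (s P) \<inter> L \<noteq> {}} \<subseteq> (\<Union>Q\<in>\<F>. {P \<in> \<M>0. Q \<inter> range (s P) \<noteq> {}})"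
    proof
      fix P assume "P \<in> {P \<in> \<M>0. range (s P) \<inter> L \<noteq> {}}"
      then obtain n where n: "P \<in> \<M>0" "s P n \<in> L"
        by blast
      then obtain Q where "Q \<in> \<F>" "s P n \<in> Q"
        using F(3) by blast
      then show "P \<in> (\<Union>Q\<in>\<F>. {P \<in> \<M>0. Q \<inter> range (s P) \<noteq> {}})"
        using n(1) by blast
    qed
    ultimately show "finite {P \<in> \<M>0. range (s P) \<inter> L \<noteq> {}}"
      by (rule finite_subset[rotated])
  qed
  then have "\<exists>W. (\<forall>P\<in>\<M>0. \<forall>n. openin X (W P n) \<and> s P n \<in> W P n) \<and> compact_finite X \<M>0 (\<lambda>P. \<Union>n. W P n)"
    by (rule compact_finite_expansion) (rule sX[OF M0S])
  then obtain W where W: "\<forall>P\<in>\<M>0. \<forall>n. openin X (W P n) \<and> s P n \<in> W P n" and Wcf: "compact_finite X \<M>0 (\<lambda>P. \<Union>n. W P n)"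
    by (elim exE conjE)
  \<comment> \<open>The fan is placed at a point of \<open>K\<close> each of whose neighbourhoods
    contains the limits of uncountably many of the sequences.\<close>
  have "\<exists>w\<in>K. \<forall>V. openin X V \<longrightarrow> w \<in> V \<longrightarrow> uncountable {P \<in> \<M>0. z P \<in> V}"
  proof (rule ccontr)
    assume "\<not> ?thesis"
    then have "\<forall>w\<in>K. \<exists>V. openin X V \<and> w \<in> V \<and> countable {P \<in> \<M>0. z P \<in> V}"
      by simp
    from bchoice[OF this] obtain V where V: "\<forall>w\<in>K. openin X (V w) \<and> w \<in> V w \<and> countable {P \<in> \<M>0. z P \<in> V w}" ..
    have "\<exists>J\<subseteq>K. finite J \<and> K \<subseteq> (\<Union>w\<in>J. V w)"
      by (rule compactin_finite_subcover[OF K]) (use V in auto)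
    then obtain J where J: "J \<subseteq> K" "finite J" "K \<subseteq> (\<Union>w\<in>J. V w)"
      by blast
    have "countable (\<Union>w\<in>J. {P \<in> \<M>0. z P \<in> V w})"
      by (rule countable_UN[OF countable_finite[OF J(2)]]) (use J(1) V in auto)
    moreover have "\<M>0 \<subseteq> (\<Union>w\<in>J. {P \<in> \<M>0. z P \<in> V w})"
    proof
      fix P assume P: "P \<in> \<M>0"
      then have "z P \<in> (\<Union>w\<in>J. V w)"
        using J(3) z[OF M0S[OF P]] by blast
      then show "P \<in> (\<Union>w\<in>J. {P \<in> \<M>0. z P \<in> V w})"
        using P by blast
    qed
    ultimately have "countable \<M>0"
      by (rule countable_subset[rotated])
    then show False
      using M0(2) by contradiction
  qed
  then obtain w where w: "w \<in> K" "\<And>V. openin X V \<Longrightarrow> w \<in> V \<Longrightarrow> uncountable {P \<in> \<M>0. z P \<in> V}"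
    by blast
  have wX: "w \<in> topspace X"
    using w(1) compactin_subset_topspace[OF K] by blast
  \<comment> \<open>The words are \<open>s P n + s Q n\<close> with
    \<open>n \<in> D P \<inter> D Q\<close>. A compact set involves only finitely many
    \<open>P\<close> and \<open>Q\<close>, and each pair contributes finitely many \<open>n\<close>
    because the sets \<open>D P\<close> are almost disjoint.\<close>
  let ?I = "{(P, Q, n). P \<in> \<M>0 \<and> Q \<in> \<M>0 \<and> P \<noteq> Q \<and> n \<in> D P \<inter> D Q}"
  show False
  proof (rule no_sum_fan[of ?I "\<lambda>(P, Q, n). s P n" "\<lambda>(P, Q, n). s Q n" w w "\<lambda>(P, Q, n). W P n" "\<lambda>(P, Q, n). W Q n"])
    fix l assume "l \<in> ?I"
    then obtain P Q n where l: "l = (P, Q, n)" "P \<in> \<M>0" "Q \<in> \<M>0"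
      by blast
    show "(case l of (P, Q, n) \<Rightarrow> s P n) \<in> topspace X \<and> (case l of (P, Q, n) \<Rightarrow> s Q n) \<in> topspace X"
      using l sX[OF M0S] by simp
    have "s Q n \<in> Q" "Q \<inter> K = {}"
      using s[OF M0S[OF l(3)]] M0S[OF l(3)] by (auto simp: S_def)
    then show "(case l of (P, Q, n) \<Rightarrow> s Q n) \<noteq> w \<and> (case l of (P, Q, n) \<Rightarrow> s Q n) \<noteq> w"
      using w(1) l by auto
    show "openin X (case l of (P, Q, n) \<Rightarrow> W P n) \<and> (case l of (P, Q, n) \<Rightarrow> s P n) \<in> (case l of (P, Q, n) \<Rightarrow> W P n)"
      "openin X (case l of (P, Q, n) \<Rightarrow> W Q n) \<and> (case l of (P, Q, n) \<Rightarrow> s Q n) \<in> (case l of (P, Q, n) \<Rightarrow> W Q n)"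
      using W l by auto
  next
    fix L assume L: "compactin X L"
    let ?J = "{P \<in> \<M>0. (\<Union>n. W P n) \<inter> L \<noteq> {}}"
    have "finite ?J"
      by (rule compact_finiteD[OF Wcf L])
    then have "finite (\<Union>P\<in>?J. \<Union>Q\<in>?J - {P}. (\<lambda>n. (P, Q, n)) ` (D P \<inter> D Q))"
      using D(2) by auto
    then show "finite {l \<in> ?I. (case l of (P, Q, n) \<Rightarrow> W P n) \<inter> L \<noteq> {} \<and> (case l of (P, Q, n) \<Rightarrow> W Q n) \<inter> L \<noteq> {}}"
    proof (rule finite_subset[rotated], intro subsetI)
      fix l assume "l \<in> {l \<in> ?I. (case l of (P, Q, n) \<Rightarrow> W P n) \<inter> L \<noteq> {} \<and> (case l of (P, Q, n) \<Rightarrow> W Q n) \<inter> L \<noteq> {}}"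
      then obtain P Q n where l: "l = (P, Q, n)" "P \<in> \<M>0" "Q \<in> \<M>0" "P \<noteq> Q" "n \<in> D P \<inter> D Q" "W P n \<inter> L \<noteq> {}" "W Q n \<inter> L \<noteq> {}"
        by auto
      then have "P \<in> ?J" "Q \<in> ?J - {P}"
        by blast+
      then show "l \<in> (\<Union>P\<in>?J. \<Union>Q\<in>?J - {P}. (\<lambda>n. (P, Q, n)) ` (D P \<inter> D Q))"
        using l(1,5) by blast
    qed
  next
    fix O1 O2 assume O: "openin X O1" "w \<in> O1" "openin X O2" "w \<in> O2"
    let ?V = "O1 \<inter> O2"
    have "uncountable {P \<in> \<M>0. z P \<in> ?V}"
      by (rule w(2)) (use O in auto)
    moreover have "{P \<in> \<M>0. z P \<in> ?V} \<subseteq> (\<Union>k. {P \<in> \<M>0. \<forall>n\<ge>k. s P n \<in> ?V})"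
    proof
      fix P assume P: "P \<in> {P \<in> \<M>0. z P \<in> ?V}"
      then have P': "P \<in> \<M>0" "z P \<in> ?V"
        by simp_all
      have "openin X ?V"
        using O by blast
      then have "\<exists>N. \<forall>n\<ge>N. s P n \<in> ?V"
        by (intro lim[OF M0S[OF P'(1)], unfolded limitin_sequentially, THEN conjunct2, THEN spec, THEN mp] conjI P'(2))
      then show "P \<in> (\<Union>k. {P \<in> \<M>0. \<forall>n\<ge>k. s P n \<in> ?V})"
        using P by blast
    qed
    ultimately have "uncountable (\<Union>k. {P \<in> \<M>0. \<forall>n\<ge>k. s P n \<in> ?V})"
      using countable_subset[of "{P \<in> \<M>0. z P \<in> ?V}"] by blast
    then have "\<exists>k. uncountable {P \<in> \<M>0. \<forall>n\<ge>k. s P n \<in> ?V}"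
      using countable_UN[of UNIV "\<lambda>k. {P \<in> \<M>0. \<forall>n\<ge>k. s P n \<in> ?V}"] by auto
    then obtain k where k: "uncountable {P \<in> \<M>0. \<forall>n\<ge>k. s P n \<in> ?V}" (is "uncountable ?N") ..
    \<comment> \<open>Otherwise the parts of the sets \<open>D P\<close> from \<open>k\<close> on
      would be disjoint and non-empty, and choosing an element of each would embed the uncountable
      set \<open>?N\<close> into the naturals.\<close>
    have "\<exists>P\<in>?N. \<exists>Q\<in>?N. P \<noteq> Q \<and> (\<exists>n\<ge>k. n \<in> D P \<inter> D Q)"
    proof (rule ccontr)
      assume neg: "\<not> ?thesis"
      have "\<forall>P\<in>?N. \<exists>n. n \<ge> k \<and> n \<in> D P"
      proof
        fix P assume "P \<in> ?N"
        then have "infinite (D P)"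
          using D(1) by simp
        then show "\<exists>n. n \<ge> k \<and> n \<in> D P"
          unfolding infinite_nat_iff_unbounded_le by simp
      qed
      from bchoice[OF this] obtain f where "\<forall>P\<in>?N. f P \<ge> k \<and> f P \<in> D P" ..
      then have f: "f P \<ge> k \<and> f P \<in> D P" if "P \<in> ?N" for P
        using that by (rule bspec)
      have "inj_on f ?N"
      proof (rule inj_onI)
        fix P Q assume PQ: "P \<in> ?N" "Q \<in> ?N" "f P = f Q"
        then have "f P \<ge> k" "f P \<in> D P \<inter> D Q"
          using f[OF PQ(1)] f[OF PQ(2)] by auto
        then have "\<exists>n\<ge>k. n \<in> D P \<inter> D Q"
          by blast
        then show "P = Q"
          using neg PQ(1,2) by (metis (no_types, lifting))
      qed
      then show False
        using k countableI[of f ?N] by blast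
    qed
    then obtain P Q n where "P \<in> ?N" "Q \<in> ?N" "P \<noteq> Q" "n \<ge> k" "n \<in> D P \<inter> D Q"
      by (elim bexE exE conjE)
    then show "\<exists>l\<in>?I. (case l of (P, Q, n) \<Rightarrow> s P n) \<in> O1 \<and> (case l of (P, Q, n) \<Rightarrow> s Q n) \<in> O2"
      by (intro bexI[of _ "(P, Q, n)"]) auto
  qed (use wX in auto)
qed

end

lemma (in stratified_k_space) k_omega_setI:
  assumes P: "openin X P" "\<And>n. compactin X (K n)" "incseq K" "P = (\<Union>n. K n)"
    and absorb: "\<And>L. compactin X L \<Longrightarrow> \<exists>m. L \<inter> P \<subseteq> K m"
  shows "k_omega_set X P K"
  unfolding k_omega_set_def
proof (intro conjI allI impI P)
  fix U assume U: "U \<subseteq> P" "\<forall>n. openin (subtopology X (K n)) (U \<inter> K n)"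
  have UX: "U \<subseteq> topspace X"
    using U(1) openin_subset[OF P(1)] by blast
  have "closedin X (topspace X - U)"
  proof (rule k_closedI)
    fix L assume L: "compactin X L"
    obtain m where m: "L \<inter> P \<subseteq> K m"
      using absorb[OF L] by (elim exE)
    obtain Q where Q: "openin X Q" "U \<inter> K m = Q \<inter> K m"
      using U(2)[THEN spec, of m] unfolding openin_subtopology by (elim exE conjE)
    have "L \<inter> (topspace X - U) = L \<inter> (topspace X - (Q \<inter> P))"
      using m Q(2) U(1) compactin_subset_topspace[OF L] by blast
    moreover have "closedin X (L \<inter> (topspace X - (Q \<inter> P)))"
      by (intro closedin_Int closedin_compact[OF L] closedin_diff closedin_topspace openin_Int Q(1) P(1))
    ultimately show "closedin X (L \<inter> (topspace X - U))"
      by simp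
  qed simp
  then show "openin X U"
    using UX by (simp add: openin_closedin_eq)
qed

section \<open>The decomposition into open k_omega-subspaces\<close>

context kR_compact_network
begin

text \<open>The graph of intersecting closures. Its connected components are the sets
  \<open>chain_class P\<close>, and the saturated families are the unions of components.\<close>

definition link :: "('a set \<times> 'a set) set" where
  "link = {(P, Q). P \<in> \<C> \<and> Q \<in> \<C> \<and> X closure_of P \<inter> X closure_of Q \<noteq> {}}"

definition saturated :: "'a set set \<Rightarrow> bool" where
  "saturated d \<longleftrightarrow> d \<subseteq> \<C> \<and> link `` d \<subseteq> d"

definition carrier_of :: "'a set set \<Rightarrow> 'a set" where
  "carrier_of d = (\<Union>P\<in>d. X closure_of P)"

definition chain_class :: "'a set \<Rightarrow> 'a set set" where
  "chain_class P = link\<^sup>* `` {P}"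

lemma sym_link: "sym link"
  by (auto simp: sym_def link_def)

lemma saturated_class: "P \<in> \<C> \<Longrightarrow> saturated (chain_class P)"
proof -
  assume P: "P \<in> \<C>"
  have "Q \<in> \<C>" if "(P, Q) \<in> link\<^sup>*" for Q
    using that P by (induction rule: rtrancl_induct) (auto simp: link_def)
  then show ?thesis
    by (auto simp: saturated_def chain_class_def intro: rtrancl_into_rtrancl)
qed

lemma chain_class_self: "P \<in> chain_class P"
  by (simp add: chain_class_def)

text \<open>Each closure is compact, so by \<open>countable_closure_meeting\<close> every member has
  countably many neighbours in the graph, and a component is exhausted by the paths of finite
  length.\<close>

lemma countable_class: "countable (chain_class P)"
proof -
  have step: "countable (link `` d)" if "countable d" for d
  proof -
    have "link `` d \<subseteq> (\<Union>Q\<in>d \<inter> \<C>. {P \<in> \<C>. X closure_of P \<inter> X closure_of Q \<noteq> {}})"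
      by (auto simp: link_def)
    moreover have "countable (\<Union>Q\<in>d \<inter> \<C>. {P \<in> \<C>. X closure_of P \<inter> X closure_of Q \<noteq> {}})"
      by (rule countable_UN[OF countable_Int1[OF that]]) (intro countable_closure_meeting, simp add: \<C>)
    ultimately show ?thesis
      by (rule countable_subset)
  qed
  have "countable ((link ^^ n) `` {P})" for n
  proof (induction n)
    case (Suc n)
    have "(link ^^ Suc n) `` {P} = link `` ((link ^^ n) `` {P})"
      by auto
    then show ?case
      using step[OF Suc] by simp
  qed simp
  then have "countable (\<Union>n. (link ^^ n) `` {P})"
    by (intro countable_UN) auto
  moreover have "chain_class P = (\<Union>n. (link ^^ n) `` {P})"
    by (auto simp: chain_class_def rtrancl_power)
  ultimately show ?thesis
    by simp
qed

lemma chain_class_eq: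
  assumes "P \<in> chain_class Q"
  shows "chain_class P = chain_class Q"
proof -
  have QP: "(Q, P) \<in> link\<^sup>*"
    using assms by (simp add: chain_class_def)
  have "sym (link\<^sup>*)"
    by (rule sym_rtrancl[OF sym_link])
  then have "(P, Q) \<in> link\<^sup>*"
    using QP by (rule symD)
  then show ?thesis
    using QP by (auto simp: chain_class_def intro: rtrancl_trans)
qed

lemma saturated_meet:
  assumes "saturated d" "P \<in> \<C>" "y \<in> X closure_of P" "y \<in> carrier_of d"
  shows "P \<in> d"
proof -
  obtain Q where Q: "Q \<in> d" "y \<in> X closure_of Q"
    using assms(4) by (auto simp: carrier_of_def)
  then have "(Q, P) \<in> link"
    using assms(1-3) by (auto simp: link_def saturated_def)
  then show ?thesis
    using Q(1) assms(1) by (auto simp: saturated_def)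
qed

lemma carrier_subset: "carrier_of d \<subseteq> topspace X"
  unfolding carrier_of_def using closure_of_subset_topspace by fastforce

lemma mem_\<C>:
  assumes "x \<in> topspace X"
  shows "\<exists>P\<in>\<C>. x \<in> X closure_of P"
proof -
  have "compactin X {x}"
    using assms by simp
  from cover'[OF this] obtain \<F> where F: "finite \<F>" "\<F> \<subseteq> \<C>" "{x} \<subseteq> \<Union>\<F>"
    by (elim exE conjE)
  then obtain P where "P \<in> \<F>" "x \<in> P"
    by blast
  then show ?thesis
    using F(2) \<C>[of P] by (intro bexI[of _ P]) auto
qed

text \<open>Finitely many members of \<open>\<C>\<close> cover \<open>L\<close>, and by
  \<open>saturated_meet\<close> only those in \<open>d\<close> can contain a point of
  \<open>carrier_of d\<close>.\<close>

lemma compact_within_saturated: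
  assumes d: "saturated d" and L: "compactin X L"
  shows "\<exists>\<F>. finite \<F> \<and> \<F> \<subseteq> d \<and> L \<inter> carrier_of d = L \<inter> (\<Union>P\<in>\<F>. X closure_of P)"
proof -
  from cover'[OF L] obtain \<F> where F: "finite \<F>" "\<F> \<subseteq> \<C>" "L \<subseteq> \<Union>\<F>"
    by (elim exE conjE)
  have "y \<in> (\<Union>P\<in>\<F> \<inter> d. X closure_of P)" if y: "y \<in> L" "y \<in> carrier_of d" for y
  proof -
    obtain P where P: "P \<in> \<F>" "y \<in> P"
      using F(3) y(1) by blast
    then have "P \<in> \<C>" "y \<in> X closure_of P"
      using F(2) \<C>[of P] by auto
    moreover then have "P \<in> d"
      using saturated_meet[OF d] y(2) by blast
    ultimately show ?thesis
      using P(1) by blast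
  qed
  moreover have "(\<Union>P\<in>\<F> \<inter> d. X closure_of P) \<subseteq> carrier_of d"
    unfolding carrier_of_def by (rule UN_mono) auto
  ultimately have "L \<inter> carrier_of d = L \<inter> (\<Union>P\<in>\<F> \<inter> d. X closure_of P)"
    by (intro equalityI subsetI) auto
  then show ?thesis
    using F(1) by (intro exI[of _ "\<F> \<inter> d"] conjI) simp_all
qed

lemma closedin_carrier:
  assumes d: "saturated d"
  shows "closedin X (carrier_of d)"
proof (rule k_closedI[OF carrier_subset])
  fix L assume L: "compactin X L"
  from compact_within_saturated[OF d L]
  obtain \<F> where F: "finite \<F>" "\<F> \<subseteq> d" "L \<inter> carrier_of d = L \<inter> (\<Union>P\<in>\<F>. X closure_of P)"
    by (elim exE conjE)
  have "closedin X (\<Union>P\<in>\<F>. X closure_of P)"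
    using F(1) by (intro closedin_Union) auto
  then show "closedin X (L \<inter> carrier_of d)"
    unfolding F(3) by (rule closedin_Int[OF closedin_compact[OF L]])
qed

text \<open>The family \<open>\<C> - d\<close> is saturated too, because \<open>link\<close> is
  symmetric; its carrier is closed and is the complement of that of \<open>d\<close>.\<close>

lemma openin_carrier:
  assumes d: "saturated d"
  shows "openin X (carrier_of d)"
proof -
  have "link `` (\<C> - d) \<subseteq> \<C> - d"
  proof
    fix Q assume "Q \<in> link `` (\<C> - d)"
    then obtain P where P: "(P, Q) \<in> link" "P \<notin> d"
      by blast
    then have "(Q, P) \<in> link" "Q \<in> \<C>"
      by (auto simp: link_def)
    then show "Q \<in> \<C> - d"
      using P(2) d by (auto simp: saturated_def)
  qed
  then have d': "saturated (\<C> - d)"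
    by (simp add: saturated_def)
  have "topspace X - carrier_of (\<C> - d) = carrier_of d"
  proof (intro equalityI subsetI)
    fix x assume x: "x \<in> topspace X - carrier_of (\<C> - d)"
    then obtain P where "P \<in> \<C>" "x \<in> X closure_of P"
      using mem_\<C> by blast
    then show "x \<in> carrier_of d"
      using x by (auto simp: carrier_of_def)
  next
    fix x assume x: "x \<in> carrier_of d"
    then obtain P where P: "P \<in> d" "x \<in> X closure_of P"
      by (auto simp: carrier_of_def)
    then have "P \<in> \<C>"
      using d by (auto simp: saturated_def)
    then have "x \<notin> carrier_of (\<C> - d)"
      using saturated_meet[OF d' _ P(2)] P(1) by blast
    then show "x \<in> topspace X - carrier_of (\<C> - d)"
      using x carrier_subset by blast
  qed
  then show ?thesis
    using closedin_carrier[OF d'] by (metis openin_diff openin_topspace)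
qed

definition exhaustion :: "'a set set \<Rightarrow> nat \<Rightarrow> 'a set" where
  "exhaustion d n = (\<Union>k\<le>n. X closure_of (from_nat_into d k))"

lemma exhaustion_absorbs:
  assumes d: "saturated d" "countable d" "d \<noteq> {}" and L: "compactin X L"
  shows "\<exists>m. L \<inter> carrier_of d \<subseteq> exhaustion d m"
proof -
  have r: "range (from_nat_into d) = d"
    by (rule range_from_nat_into[OF d(3,2)])
  from compact_within_saturated[OF d(1) L]
  obtain \<F> where F: "finite \<F>" "\<F> \<subseteq> d" "L \<inter> carrier_of d = L \<inter> (\<Union>P\<in>\<F>. X closure_of P)"
    by (elim exE conjE)
  have "\<forall>P\<in>\<F>. \<exists>k. P = from_nat_into d k"
    using F(2) r by blast
  from bchoice[OF this] obtain f where f: "\<forall>P\<in>\<F>. P = from_nat_into d (f P)" ..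
  have "finite (f ` \<F>)"
    using F(1) by simp
  then obtain m where m: "\<forall>k\<in>f ` \<F>. k \<le> m"
    unfolding finite_nat_set_iff_bounded_le ..
  have "(\<Union>P\<in>\<F>. X closure_of P) \<subseteq> exhaustion d m"
    unfolding exhaustion_def
  proof (rule UN_least)
    fix P assume P: "P \<in> \<F>"
    then have "f P \<in> {..m}" "P = from_nat_into d (f P)"
      using m f by auto
    then show "X closure_of P \<subseteq> (\<Union>k\<le>m. X closure_of (from_nat_into d k))"
      by (metis UN_upper)
  qed
  then show "\<exists>m. L \<inter> carrier_of d \<subseteq> exhaustion d m"
    unfolding F(3) by (intro exI[of _ m]) blast
qed

lemma k_omega_carrier:
  assumes d: "saturated d" "countable d" "d \<noteq> {}"
  shows "k_omega_set X (carrier_of d) (exhaustion d)"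
proof (rule k_omega_setI)
  have r: "range (from_nat_into d) = d"
    by (rule range_from_nat_into[OF d(3,2)])
  have in_d: "from_nat_into d k \<in> d" for k
    by (rule from_nat_into[OF d(3)])
  show "openin X (carrier_of d)"
    by (rule openin_carrier[OF d(1)])
  show "compactin X (exhaustion d n)" for n
    unfolding exhaustion_def
  proof (rule compactin_Union)
    fix S assume "S \<in> (\<lambda>k. X closure_of from_nat_into d k) ` {..n}"
    then obtain k where "S = X closure_of from_nat_into d k"
      by blast
    moreover have "from_nat_into d k \<in> \<C>"
      using in_d[of k] d(1) by (auto simp: saturated_def)
    ultimately show "compactin X S"
      using \<C> by blast
  qed simp
  show "incseq (exhaustion d)"
    unfolding exhaustion_def by (intro incseq_SucI UN_mono) auto
  have *: "X closure_of P \<subseteq> (\<Union>n. exhaustion d n)" if "P \<in> d" for P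
  proof -
    have "P \<in> range (from_nat_into d)"
      unfolding r by (rule that)
    then obtain k where "P = from_nat_into d k"
      by (rule imageE)
    then have "X closure_of P \<subseteq> exhaustion d k"
      by (auto simp: exhaustion_def)
    then show ?thesis
      by blast
  qed
  have "exhaustion d n \<subseteq> carrier_of d" for n
    unfolding exhaustion_def carrier_of_def using in_d by (intro UN_least) blast
  moreover have "carrier_of d \<subseteq> (\<Union>n. exhaustion d n)"
    unfolding carrier_of_def by (rule UN_least[OF *])
  ultimately show "carrier_of d = (\<Union>n. exhaustion d n)"
    by (intro equalityI UN_least)
  show "\<exists>m. L \<inter> carrier_of d \<subseteq> exhaustion d m" if "compactin X L" for L
    by (rule exhaustion_absorbs[OF d that])
qed

lemma k_omega_class: "P \<in> \<C> \<Longrightarrow> k_omega_set X (carrier_of (chain_class P)) (exhaustion (chain_class P))"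
  using chain_class_self[of P] by (intro k_omega_carrier saturated_class countable_class) auto

lemma carrier_class_disjoint:
  assumes "c \<in> chain_class ` \<C>" "d \<in> chain_class ` \<C>" "c \<noteq> d"
  shows "carrier_of c \<inter> carrier_of d = {}"
proof (rule ccontr)
  assume "carrier_of c \<inter> carrier_of d \<noteq> {}"
  then obtain y where y: "y \<in> carrier_of c" "y \<in> carrier_of d"
    by blast
  obtain P Q where PQ: "P \<in> \<C>" "c = chain_class P" "Q \<in> \<C>" "d = chain_class Q"
    using assms(1,2) by blast
  obtain R where R: "R \<in> c" "y \<in> X closure_of R"
    using y(1) by (auto simp: carrier_of_def)
  have "R \<in> \<C>"
    using R(1) saturated_class[OF PQ(1)] PQ(2) by (auto simp: saturated_def)
  then have "R \<in> d"
    using saturated_meet[OF saturated_class[OF PQ(3)] _ R(2)] y(2) PQ(4) by simp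
  then show False
    using R(1) chain_class_eq[of R P] chain_class_eq[of R Q] PQ assms(3) by simp
qed

lemma refinable: "refinable X"
proof (rule refinable_if_sum_of_sigma_compact[OF tychonoff, of "chain_class ` \<C>" carrier_of exhaustion])
  show "openin X (carrier_of c)" if "c \<in> chain_class ` \<C>" for c
    using that saturated_class openin_carrier by blast
  show "topspace X = (\<Union>c\<in>chain_class ` \<C>. carrier_of c)"
  proof (intro equalityI subsetI)
    fix x assume "x \<in> topspace X"
    then obtain P where "P \<in> \<C>" "x \<in> X closure_of P"
      using mem_\<C> by blast
    then have "x \<in> carrier_of (chain_class P)" "chain_class P \<in> chain_class ` \<C>"
      using chain_class_self by (auto simp: carrier_of_def)
    then show "x \<in> (\<Union>c\<in>chain_class ` \<C>. carrier_of c)"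
      by blast
  qed (use carrier_subset in blast)
  show "carrier_of c \<inter> carrier_of d = {}" if "c \<in> chain_class ` \<C>" "d \<in> chain_class ` \<C>" "c \<noteq> d" for c d
    by (rule carrier_class_disjoint[OF that])
  show "compactin X (exhaustion c n)" "carrier_of c \<subseteq> (\<Union>n. exhaustion c n)" if c: "c \<in> chain_class ` \<C>" for c n
  proof -
    obtain P where P: "P \<in> \<C>" "c = chain_class P"
      using c by blast
    show "compactin X (exhaustion c n)" "carrier_of c \<subseteq> (\<Union>n. exhaustion c n)"
      using k_omega_setD(2,4)[OF k_omega_class[OF P(1)]] unfolding P(2) by simp_all
  qed
qed

lemma k_space_cube: "k_space (prod_topology X (prod_topology X X))"
proof (rule k_space_if_k_omega_sets)
  fix w assume "w \<in> topspace (prod_topology X (prod_topology X X))"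
  then obtain a b c where w: "w = (a, b, c)" "a \<in> topspace X" "b \<in> topspace X" "c \<in> topspace X"
    by auto
  obtain P where P: "P \<in> \<C>" "a \<in> X closure_of P"
    using mem_\<C>[OF w(2)] by blast
  obtain Q where Q: "Q \<in> \<C>" "b \<in> X closure_of Q"
    using mem_\<C>[OF w(3)] by blast
  obtain R where R: "R \<in> \<C>" "c \<in> X closure_of R"
    using mem_\<C>[OF w(4)] by blast
  \<comment> \<open>The coordinates may lie in different summands, so the three classes are united;
    the union is still saturated and countable.\<close>
  let ?d = "chain_class P \<union> chain_class Q \<union> chain_class R"
  have "saturated ?d"
    using saturated_class[OF P(1)] saturated_class[OF Q(1)] saturated_class[OF R(1)] by (auto simp: saturated_def)
  moreover have "countable ?d"
    using countable_class by simp
  moreover have "?d \<noteq> {}"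
    using chain_class_self by blast
  ultimately have k: "k_omega_set X (carrier_of ?d) (exhaustion ?d)"
    by (rule k_omega_carrier)
  have reg2: "regular_space (prod_topology X X)" and haus2: "Hausdorff_space (prod_topology X X)"
    using regular Hausdorff by (simp_all add: regular_space_prod_topology Hausdorff_space_prod_topology)
  have "k_omega_set (prod_topology X (prod_topology X X)) (carrier_of ?d \<times> (carrier_of ?d \<times> carrier_of ?d))
      (\<lambda>n. exhaustion ?d n \<times> (exhaustion ?d n \<times> exhaustion ?d n))"
    by (rule k_omega_set_prod[OF regular reg2 haus2 k k_omega_set_prod[OF regular regular Hausdorff k k]])
  moreover have "a \<in> carrier_of ?d" "b \<in> carrier_of ?d" "c \<in> carrier_of ?d"
    using P Q R chain_class_self by (auto simp: carrier_of_def)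
  then have "w \<in> carrier_of ?d \<times> (carrier_of ?d \<times> carrier_of ?d)"
    by (simp add: w(1))
  ultimately show "\<exists>P K. w \<in> P \<and> k_omega_set (prod_topology X (prod_topology X X)) P K"
    by (intro exI conjI)
qed

text \<open>This is the fan that shows that, under \<open>\<bb> = \<omega>\<^sub>1\<close>, the product of the sequential fans with
  countably many and with \<open>\<omega>\<^sub>1\<close> spines is not a \<open>k\<^sub>R\<close>-space. The sets \<open>e n\<close> take the place of the
  countably many spines.\<close>

lemma countable_nonisolated_classes:
  assumes b: "bounding_number =o cardSuc natLeq" and x0: "x0 \<in> topspace X"
    and nc: "\<And>U L. openin X U \<Longrightarrow> compactin X L \<Longrightarrow> x0 \<in> U \<Longrightarrow> \<not> U \<subseteq> L"
  shows "countable {c \<in> chain_class ` \<C>. carrier_of c \<inter> nonisolated \<noteq> {}}" (is "countable ?B")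
proof (rule ccontr)
  assume unc: "uncountable ?B"
  obtain P0 where P0: "P0 \<in> \<C>" "x0 \<in> X closure_of P0"
    using mem_\<C>[OF x0] by blast
  define d0 where "d0 = chain_class P0"
  have d0: "d0 \<in> chain_class ` \<C>" "x0 \<in> carrier_of d0"
    using P0 chain_class_self by (auto simp: d0_def carrier_of_def)
  have k: "k_omega_set X (carrier_of d0) (exhaustion d0)"
    unfolding d0_def by (rule k_omega_class[OF P0(1)])
  define B where "B = ?B - {d0}"
  have Bunc: "uncountable B"
    unfolding B_def using unc uncountable_minus_countable by simp
  \<comment> \<open>As \<open>x0\<close> has no compact neighbourhood, it is in the closure of the
    part of its summand that lies outside the \<open>n\<close>-th compact set of the exhaustion.
    Countable tightness allows this part to be replaced by a countable set, enumerated as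
    \<open>e n\<close>.\<close>
  have "\<forall>n. \<exists>E. E \<subseteq> carrier_of d0 - exhaustion d0 n \<and> countable E \<and> x0 \<in> X closure_of E"
  proof
    fix n
    have "x0 \<in> X closure_of (carrier_of d0 - exhaustion d0 n)"
    proof (rule ccontr)
      assume "x0 \<notin> X closure_of (carrier_of d0 - exhaustion d0 n)"
      then obtain U where U: "openin X U" "x0 \<in> U" "U \<inter> (carrier_of d0 - exhaustion d0 n) = {}"
        using x0 by (auto simp: in_closure_of)
      have "openin X (U \<inter> carrier_of d0)" "x0 \<in> U \<inter> carrier_of d0"
        using U(1,2) k_omega_setD(1)[OF k] d0(2) by auto
      moreover have "U \<inter> carrier_of d0 \<subseteq> exhaustion d0 n"
        using U(3) by blast
      ultimately show False
        using nc[OF _ k_omega_setD(2)[OF k]] by blast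
    qed
    moreover have "carrier_of d0 - exhaustion d0 n \<subseteq> topspace X"
      using carrier_subset by blast
    ultimately show "\<exists>E. E \<subseteq> carrier_of d0 - exhaustion d0 n \<and> countable E \<and> x0 \<in> X closure_of E"
      using countable_tightness[of "carrier_of d0 - exhaustion d0 n" x0] by simp
  qed
  from choice[OF this] obtain E where
    E': "\<forall>n. E n \<subseteq> carrier_of d0 - exhaustion d0 n \<and> countable (E n) \<and> x0 \<in> X closure_of (E n)" ..
  have E: "E n \<subseteq> carrier_of d0 - exhaustion d0 n" "countable (E n)" "x0 \<in> X closure_of (E n)" for n
    using E' by simp_all
  have Ene: "E n \<noteq> {}" for n
    using E(3)[of n] by auto
  define e where "e = (\<lambda>n. from_nat_into (E n))"
  have re: "range (e n) = E n" for n
    unfolding e_def by (rule range_from_nat_into[OF Ene E(2)])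
  have e_d0: "e n m \<in> carrier_of d0" and eX: "e n m \<in> topspace X" for n m
  proof -
    have "e n m \<in> E n"
      using re[of n] by blast
    then show "e n m \<in> carrier_of d0"
      using E(1)[of n] by blast
    then show "e n m \<in> topspace X"
      using carrier_subset by blast
  qed
  have "compact_finite X UNIV (\<lambda>n. range (e n))"
    unfolding compact_finite_def
  proof (intro strip)
    fix L assume L: "compactin X L"
    have "\<exists>m. L \<inter> carrier_of d0 \<subseteq> exhaustion d0 m"
      using chain_class_self[of P0] unfolding d0_def by (intro exhaustion_absorbs saturated_class countable_class P0(1) L) auto
    then obtain m where m: "L \<inter> carrier_of d0 \<subseteq> exhaustion d0 m"
      by (elim exE)
    have "n < m" if "range (e n) \<inter> L \<noteq> {}" for n
    proof (rule ccontr)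
      assume "\<not> n < m"
      then have "exhaustion d0 m \<subseteq> exhaustion d0 n"
        using incseqD[OF k_omega_setD(3)[OF k], of m n] by simp
      then show False
        using that re[of n] E(1)[of n] m by blast
    qed
    then have "{n \<in> UNIV. range (e n) \<inter> L \<noteq> {}} \<subseteq> {..<m}"
      by blast
    then show "finite {n \<in> UNIV. range (e n) \<inter> L \<noteq> {}}"
      by (rule finite_subset) simp
  qed
  then have "\<exists>W. (\<forall>n\<in>UNIV. \<forall>m. openin X (W n m) \<and> e n m \<in> W n m) \<and> compact_finite X UNIV (\<lambda>n. \<Union>m. W n m)"
    by (rule compact_finite_expansion) (rule eX)
  then obtain W where W: "\<forall>n\<in>UNIV. \<forall>m. openin X (W n m) \<and> e n m \<in> W n m" and Wcf: "compact_finite X UNIV (\<lambda>n. \<Union>m. W n m)"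
    by (elim exE conjE)
  obtain H where H: "unbounded_family H" "bounding_number = |H|"
    using bounding_number_attained by (elim exE conjE)
  \<comment> \<open>By the assumption on the bounding number, \<open>H\<close> has the cardinality
    of the first uncountable cardinal. So the uncountable set \<open>B\<close> can be mapped onto
    \<open>H\<close>.\<close>
  have "\<not> |B| \<le>o natLeq"
  proof
    assume "|B| \<le>o natLeq"
    then have "|B| \<le>o |UNIV :: nat set|"
      using ordLeq_ordIso_trans ordIso_symmetric card_of_nat by blast
    then obtain j :: "_ \<Rightarrow> nat" where "inj_on j B"
      using card_of_ordLeq[of B "UNIV :: nat set"] by blast
    then show False
      using Bunc by (auto simp: countable_def)
  qed
  then have "natLeq <o |B|"
    using not_ordLeq_iff_ordLess[OF natLeq_Well_order card_of_Well_order] by blast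
  then have "cardSuc natLeq \<le>o |B|"
    using cardSuc_least[OF natLeq_Card_order card_of_Card_order] by blast
  then have "|H| \<le>o |B|"
    using b H(2) ordIso_ordLeq_trans by metis
  moreover have "H \<noteq> {}"
    using H(1) by (auto simp: unbounded_family_def)
  ultimately obtain f where f: "f ` B = H"
    using card_of_ordLeq2[of H B] by blast
  have "\<forall>c\<in>B. \<exists>p. snd p \<in> carrier_of c \<and> snd p \<in> topspace X \<and>
    (\<forall>n::nat. fst p n \<in> topspace X \<and> fst p n \<noteq> snd p) \<and> limitin X (fst p) (snd p) sequentially"
  proof
    fix c assume "c \<in> B"
    then obtain y where y: "y \<in> carrier_of c" "y \<in> nonisolated"
      by (auto simp: B_def)
    then have "y \<in> topspace X" "\<not> openin X {y}"
      by (auto simp: nonisolated_def)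
    from non_isolated_limit[OF this] obtain a where "\<forall>n::nat. a n \<in> topspace X \<and> a n \<noteq> y" "limitin X a y sequentially"
      by (elim exE conjE)
    then show "\<exists>p. snd p \<in> carrier_of c \<and> snd p \<in> topspace X \<and>
      (\<forall>n::nat. fst p n \<in> topspace X \<and> fst p n \<noteq> snd p) \<and> limitin X (fst p) (snd p) sequentially"
      using y(1) \<open>y \<in> topspace X\<close> by (intro exI[of _ "(a, y)"]) simp
  qed
  from bchoice[OF this] obtain p where p: "\<forall>c\<in>B. snd (p c) \<in> carrier_of c \<and> snd (p c) \<in> topspace X \<and>
    (\<forall>n::nat. fst (p c) n \<in> topspace X \<and> fst (p c) n \<noteq> snd (p c)) \<and> limitin X (fst (p c)) (snd (p c)) sequentially" ..
  define s where "s = (\<lambda>c. fst (p c))"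
  define y where "y = (\<lambda>c. snd (p c))"
  have y: "y c \<in> carrier_of c" "y c \<in> topspace X" and s: "s c n \<in> topspace X" "s c n \<noteq> y c"
    and lim: "limitin X (s c) (y c) sequentially" if "c \<in> B" for c n
    using p that unfolding s_def y_def by simp_all
  have BC: "c \<in> chain_class ` \<C>" "c \<noteq> d0" if "c \<in> B" for c
    using that by (auto simp: B_def)
  have openc: "openin X (carrier_of c)" if "c \<in> B" for c
    using BC(1)[OF that] saturated_class openin_carrier by blast
  \<comment> \<open>The words are \<open>e n m + s c n - y c\<close> with
    \<open>m \<le> f c n\<close>. A compact set meets finitely many summands and, for finitely many
    \<open>n\<close> only, some set \<open>W n m\<close>; for each pair of these \<open>m\<close> is
    bounded by \<open>f c n\<close>.\<close>
  let ?I = "{(c, n, m). c \<in> B \<and> m \<le> f c n}"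
  show False
  proof (rule no_difference_fan[of ?I "\<lambda>(c, n, m). e n m" "\<lambda>(c, n, m). s c n" "\<lambda>(c, n, m). y c" x0 "\<lambda>(c, n, m). W n m" "\<lambda>(c, n, m). carrier_of c"])
    fix l assume "l \<in> ?I"
    then obtain c n m where l: "l = (c, n, m)" "c \<in> B"
      by blast
    have "e n m \<noteq> y c"
      using carrier_class_disjoint[OF BC(1)[OF l(2)] d0(1) BC(2)[OF l(2)]] y(1)[OF l(2)] e_d0[of n m] by auto
    then show "(case l of (c, n, m) \<Rightarrow> e n m) \<noteq> (case l of (c, n, m) \<Rightarrow> y c) \<and> (case l of (c, n, m) \<Rightarrow> s c n) \<noteq> (case l of (c, n, m) \<Rightarrow> y c)"
      using s(2)[OF l(2)] l(1) by simp
    show "(case l of (c, n, m) \<Rightarrow> e n m) \<in> topspace X \<and> (case l of (c, n, m) \<Rightarrow> s c n) \<in> topspace X \<and> (case l of (c, n, m) \<Rightarrow> y c) \<in> topspace X"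
      using eX s(1)[OF l(2)] y(2)[OF l(2)] l(1) by simp
    show "openin X (case l of (c, n, m) \<Rightarrow> W n m) \<and> (case l of (c, n, m) \<Rightarrow> e n m) \<in> (case l of (c, n, m) \<Rightarrow> W n m)"
      using W l(1) by simp
    show "openin X (case l of (c, n, m) \<Rightarrow> carrier_of c) \<and> (case l of (c, n, m) \<Rightarrow> y c) \<in> (case l of (c, n, m) \<Rightarrow> carrier_of c)"
      using openc[OF l(2)] y(1)[OF l(2)] l(1) by simp
  next
    fix L assume L: "compactin X L"
    from cover'[OF L] obtain \<F> where F: "finite \<F>" "\<F> \<subseteq> \<C>" "L \<subseteq> \<Union>\<F>"
      by (elim exE conjE)
    have fc: "finite (chain_class ` \<F>)"
      using F(1) by simp
    have fn: "finite {n \<in> UNIV. (\<Union>m. W n m) \<inter> L \<noteq> {}}" (is "finite ?N")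
      by (rule compact_finiteD[OF Wcf L])
    have "finite (\<Union>c\<in>chain_class ` \<F>. \<Union>n\<in>?N. (\<lambda>m. (c, n, m)) ` {..f c n})"
      using fc fn by blast
    then show "finite {l \<in> ?I. (case l of (c, n, m) \<Rightarrow> W n m) \<inter> L \<noteq> {} \<and> (case l of (c, n, m) \<Rightarrow> carrier_of c) \<inter> L \<noteq> {}}"
    proof (rule finite_subset[rotated], intro subsetI)
      fix l assume "l \<in> {l \<in> ?I. (case l of (c, n, m) \<Rightarrow> W n m) \<inter> L \<noteq> {} \<and> (case l of (c, n, m) \<Rightarrow> carrier_of c) \<inter> L \<noteq> {}}"
      then obtain c n m where l: "l = (c, n, m)" "c \<in> B" "m \<le> f c n" "W n m \<inter> L \<noteq> {}" "carrier_of c \<inter> L \<noteq> {}"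
        by auto
      then obtain v where v: "v \<in> carrier_of c" "v \<in> L"
        by blast
      then obtain P where P: "P \<in> \<F>" "v \<in> P"
        using F(3) by blast
      then have PC: "P \<in> \<C>" "v \<in> X closure_of P"
        using F(2) \<C>[of P] by auto
      obtain P' where P': "P' \<in> \<C>" "c = chain_class P'"
        using BC(1)[OF l(2)] by blast
      have "P \<in> c"
        using saturated_meet[OF saturated_class[OF P'(1)] PC] v(1) P'(2) by simp
      then have "c \<in> chain_class ` \<F>"
        using chain_class_eq[of P P'] P'(2) P(1) by blast
      moreover have "n \<in> ?N"
        using l(4) by blast
      ultimately show "l \<in> (\<Union>c\<in>chain_class ` \<F>. \<Union>n\<in>?N. (\<lambda>m. (c, n, m)) ` {..f c n})"
        using l(1,3) by (intro UN_I[of c] UN_I[of n] image_eqI[of _ _ m]) simp_all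
    qed
  next
    fix Q M assume Q: "openin X Q" "x0 \<in> Q" and M: "openin T M" "\<one>\<^bsub>A\<^esub> \<in> M"
    have "\<forall>n. \<exists>m. e n m \<in> Q"
    proof
      fix n
      obtain v where v: "v \<in> E n" "v \<in> Q"
        using E(3)[of n] Q unfolding in_closure_of by blast
      then show "\<exists>m. e n m \<in> Q"
        using re[of n] by (metis rangeE)
    qed
    \<comment> \<open>\<open>g\<close> records where \<open>Q\<close> meets each of the sets
      \<open>E n\<close>. Since \<open>H\<close> is unbounded, some \<open>c\<close> has
      \<open>g n < f c n\<close> for infinitely many \<open>n\<close>, hence for one that is late
      enough for the difference of \<open>s c n\<close> and \<open>y c\<close> to be near 0.\<close>
    from choice[OF this] obtain g where g: "\<forall>n. e n (g n) \<in> Q" ..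
    obtain h where h: "h \<in> H" "\<not> (\<forall>\<^sub>\<infinity>n. h n \<le> g n)"
      using H(1) unfolding unbounded_family_def by blast
    obtain c where c: "c \<in> B" "h = f c"
      using h(1) f by blast
    obtain N where N: "\<forall>n\<ge>N. ev (letter 1 (s c n) + letter (-1) (y c)) \<in> M"
      using small_difference[OF M lim[OF c(1)]] by (elim exE)
    obtain n where n: "n > N" "\<not> h n \<le> g n"
      using h(2) unfolding MOST_nat by blast
    then show "\<exists>l\<in>?I. (case l of (c, n, m) \<Rightarrow> e n m) \<in> Q \<and>
      ev (letter 1 (case l of (c, n, m) \<Rightarrow> s c n) + letter (-1) (case l of (c, n, m) \<Rightarrow> y c)) \<in> M"
      using c g N by (intro bexI[of _ "(c, n, g n)"]) auto
  qed (rule x0)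
qed

lemma k_space_level_3_compact_network:
  assumes b: "bounding_number =o cardSuc natLeq" and ne: "topspace X \<noteq> {}"
  shows "k_space (free_abelian_level 3 X A T i)"
proof (rule k_space_level_3[OF k_space_cube _ ne])
  show "tube_property X"
  proof (cases "locally_compact_space X")
    case True
    then show ?thesis
      by (rule tube_property_if_locally_compact[OF refinable regular])
  next
    case False
    then obtain x0 where x0: "x0 \<in> topspace X" "\<And>U L. openin X U \<Longrightarrow> compactin X L \<Longrightarrow> x0 \<in> U \<Longrightarrow> \<not> U \<subseteq> L"
      unfolding locally_compact_space_def by blast
    let ?B = "{c \<in> chain_class ` \<C>. carrier_of c \<inter> nonisolated \<noteq> {}}"
    have cB: "countable ?B"
      by (rule countable_nonisolated_classes[OF b x0])
    obtain P0 where P0: "P0 \<in> \<C>"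
      using mem_\<C>[OF x0(1)] by blast
    \<comment> \<open>All summands with a non-isolated point are merged into one open set with a
      compact exhaustion; \<open>chain_class P0\<close> ensures that the family is
      non-empty.\<close>
    let ?d = "chain_class P0 \<union> \<Union>?B"
    have "saturated d" if "d \<in> ?B" for d
      using that saturated_class by blast
    then have "saturated ?d"
      using saturated_class[OF P0] unfolding saturated_def by blast
    moreover have "countable (\<Union>d\<in>?B. id d)"
      using cB countable_class by (intro countable_UN) auto
    then have "countable ?d"
      using countable_class by simp
    moreover have "?d \<noteq> {}"
      using chain_class_self by blast
    ultimately have k: "k_omega_set X (carrier_of ?d) (exhaustion ?d)"
      by (rule k_omega_carrier)
    show ?thesis
    proof (rule tube_property_if_k_omega_and_isolated[OF refinable regular Hausdorff k])
      fix x assume x: "x \<in> topspace X - carrier_of ?d"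
      obtain P where P: "P \<in> \<C>" "x \<in> X closure_of P"
        using mem_\<C>[of x] x by blast
      have xP: "x \<in> carrier_of (chain_class P)"
        using P chain_class_self by (auto simp: carrier_of_def)
      show "openin X {x}"
      proof (rule ccontr)
        assume "\<not> openin X {x}"
        then have "x \<in> nonisolated"
          using x by (simp add: nonisolated_def)
        then have "chain_class P \<in> ?B"
          using xP P(1) by blast
        then have "carrier_of (chain_class P) \<subseteq> carrier_of ?d"
          unfolding carrier_of_def[of "chain_class P"] carrier_of_def[of ?d] by (intro UN_mono) blast+
        then have "x \<in> carrier_of ?d"
          using xP by blast
        then show False
          using x by blast
      qed
    qed
  qed
qed

end

theorem theorem4p14:
  fixes X :: "'a topology" and A :: "'g monoid" and T :: "'g topology" and i :: "'a \<Rightarrow> 'g"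
  assumes b_eq_omega1: "bounding_number =o cardSuc natLeq"
    and X: "tychonoff_space X" "topspace X \<noteq> {}"
    and "stratifiable_space X"
    and "k_space X"
    and "\<exists>\<P>. k_network X \<P> \<and> compact_countable X \<P>"
    and A: "free_abelian_topological_group X A T i"
    and "kR_space (free_abelian_level 3 X A T i)"
  shows "k_space (free_abelian_level 3 X A T i)"
proof -
  obtain G where "stratified_k_space X G"
    using stratified_k_space_if_stratifiable[OF X(1) \<open>stratifiable_space X\<close> \<open>k_space X\<close>] ..
  obtain \<P> where "k_network X \<P>" "compact_countable X \<P>"
    using \<open>\<exists>\<P>. k_network X \<P> \<and> compact_countable X \<P>\<close> by (elim exE conjE)
  interpret stratified_k_space X G
    by fact
  interpret kR_level_3 X A T i G \<P>
    by unfold_locales fact+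
  show ?thesis
  proof (cases "\<forall>K. compactin X K \<longrightarrow> (\<exists>\<F>. finite \<F> \<and> \<F> \<subseteq> {P \<in> \<P>. compactin X (X closure_of P)} \<and> K \<subseteq> \<Union>\<F>)")
    case True
    interpret kR_compact_network X A T i G \<P>
      by unfold_locales (use True in blast)
    show ?thesis
      by (rule k_space_level_3_compact_network[OF b_eq_omega1 X(2)])
  next
    case False
    then obtain K where K: "compactin X K"
      "\<not> (\<exists>\<F>. finite \<F> \<and> \<F> \<subseteq> {P \<in> \<P>. compactin X (X closure_of P)} \<and> K \<subseteq> \<Union>\<F>)"
      unfolding not_all not_imp by (elim exE conjE)
    from discrete_sets_at_point[OF K] obtain x and D :: "nat \<Rightarrow> nat \<Rightarrow> 'a" where
      D: "x \<in> topspace X \<and> (\<forall>j m. D j m \<in> topspace X) \<and> (\<forall>j. compact_finite X UNIV (\<lambda>m. {D j m})) \<and>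
        (\<forall>U. openin X U \<longrightarrow> x \<in> U \<longrightarrow> (\<exists>j. range (D j) \<subseteq> U))"
      by (elim exE)
    interpret kR_discrete_fan X A T i G \<P> x D
      by unfold_locales (use D in simp_all)
    show ?thesis
      by (rule k_space_level_3_metric_fan)
  qed
qed

end
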